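(* Let $(M^2,g)$ be an oriented Riemannian surface with Levi-Civita connection $\overline\nabla$, Gauss curvature $K_g$ and area form $\mathrm dA_g$. Let $\gamma$ be a curved polygon on $M^2$, positively oriented as the boundary of an open set $D$ with compact closure, with inward-pointing unit normal $N$ and exterior angles $\epsilon_i$. Let $\kappa_N=g(\overline\nabla_{\dot\gamma}\dot\gamma,N)$ be the signed curvature of $\gamma$, and let $B_i$ be a $1$-form on $M^2$. Then $$\int_D\big(K_g-\mathrm d^*_g(B_i)\big)\,\mathrm dA_g+\int_\gamma\big(\kappa_N+B_i(N)\big)\,\mathrm ds+\sum_i\epsilon_i=2\pi .$$ Moreover, if $\nabla'=\overline\nabla-B_i{}^k{}_j$ is a metric connection on $TM^2$, i.e. $B_{ikj}=g_{km}B_i{}^m{}_j$ satisfies $B_{ikj}=-B_{ijk}$, and $B_i=B_k{}^k{}_i=B_{kki}$, then $$\big(K_g-\mathrm d^*_g(B_i)\big)\,\mathrm dA_g=\mathrm{Pf}(\Omega_{\nabla'})\qquad\text{and}\qquad \kappa_N+B_i(N)=g(\nabla'_{\dot\gamma}\dot\gamma,N).$$ If $\nabla=\overline\nabla-D_i{}^k{}_j$ is a general connection on $TM^2$, then the associated connection $\nabla^g:=\nabla+\tfrac12 g^{-1}\nabla g=\overline\nabla-\tfrac12\big(D_i{}^k{}_j-g^{kl}D_i{}^m{}_l\,g_{mj}\big)$ is a metric connection, and, with $B_i{}^k{}_j=\tfrac12\big(D_i{}^k{}_j-g^{kl}D_i{}^m{}_l\,g_{mj}\big)$ and $B_i=B_k{}^k{}_i$,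 one has $$\int_D\big(K_g-\mathrm d^*_g(B_i)\big)\,\mathrm dA_g+\int_\gamma\big(\kappa_N+B_i(N)\big)\,\mathrm ds+\sum_i\epsilon_i=2\pi ,$$ $$\big(K_g-\mathrm d^*_g(B_i)\big)\,\mathrm dA_g=\mathrm{Pf}(\Omega_{\nabla^g})\qquad\text{and}\qquad \kappa_N+B_i(N)=g(\nabla^g_{\dot\gamma}\dot\gamma,N).$$
   Context: Conventions. A curved polygon on $M^2$ (terminology of Lee's "Riemannian Manifolds") is a unit-speed piecewise smooth simple closed curve $\gamma$, with no exterior angle equal to $\pm\pi$, that is the boundary of an open set $D\subset M$ with compact closure, such that some coordinate chart contains both $\gamma$ and $D$ and maps $\gamma$ to a simple closed curve in the plane bounding the image of $D$. The exterior angles $\epsilon_i\in(-\pi,\pi)$ are the oriented angles from the incoming to the outgoing tangent vectors at the vertices. $N$ is the unit normal along the smooth parts of $\gamma$ such that $(\dot\gamma,N)$ is an oriented orthonormal basis, so $N$ points into $D$. $\mathrm ds$ is arc length. $\mathrm d^*_g$ is the formal $L^2$-adjoint of $\mathrm d$; on $1$-forms $\mathrm d^*_g\psi=-\overline\nabla_i\psi_i$ (minus the divergence). $B_i(N)$ is the $1$-form $B_i$ evaluated on $N$. In difference tensors such as $B_i{}^k{}_j$, the index $i$ is the direction of differentiation: $\nabla'_XY=\overline\nabla_XY-B_XY$, where $B_XY$ has components $X^iB_i{}^k{}_jY^j$. Repeated lower indices are contracted with the inverse metric. $(g^{-1}\nabla g)_i{}^k{}_j=g^{kl}\nabla_i g_{lj}$.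 $\Omega_{\nabla'}=\mathrm d\omega'+\omega'\wedge\omega'$ is the curvature of $\nabla'$, where $\nabla'E_\beta=\omega'^\alpha{}_\beta E_\alpha$; in a local oriented $g$-orthonormal frame $\mathrm{Pf}(\Theta)=\tfrac12(\Theta^1{}_2-\Theta^2{}_1)$ for an $\mathrm{End}(TM^2)$-valued $2$-form $\Theta$. *)

theory Defs
  imports "HOL-Analysis.Analysis"
begin

section \<open>Smooth maps\<close>

primrec Ck_on :: "nat \<Rightarrow> 'a::real_normed_vector set \<Rightarrow> ('a \<Rightarrow> 'b::real_normed_vector) \<Rightarrow> bool" where
  "Ck_on 0 S f \<longleftrightarrow> continuous_on S f"
| "Ck_on (Suc n) S f \<longleftrightarrow>
     (\<forall>x\<in>S. f differentiable (at x)) \<and> (\<forall>v. Ck_on n S (\<lambda>x. frechet_derivative f (at x) v))"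

text \<open>Meant for open \<open>S\<close> only, since derivatives are taken in the full space.\<close>
definition smooth_on :: "'a::real_normed_vector set \<Rightarrow> ('a \<Rightarrow> 'b::real_normed_vector) \<Rightarrow> bool" where
  "smooth_on S f \<longleftrightarrow> (\<forall>n. Ck_on n S f)"

text \<open>Smoothness on a compact interval: existence of a smooth extension to an open
  neighbourhood.\<close>
definition smooth_on_interval :: "real \<Rightarrow> real \<Rightarrow> (real \<Rightarrow> real^2) \<Rightarrow> bool" where
  "smooth_on_interval a b f \<longleftrightarrow>
     (\<exists>J h. open J \<and> {a..b} \<subseteq> J \<and> smooth_on J h \<and> (\<forall>t\<in>{a..b}. h t = f t))"

definition pd :: "2 \<Rightarrow> (real^2 \<Rightarrow> real) \<Rightarrow> real^2 \<Rightarrow> real" where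
  "pd i f x = frechet_derivative f (at x) (axis i 1)"


section \<open>Oriented smooth surfaces\<close>

datatype 'a chart = Chart (cdom: "'a set") (cmap: "'a \<Rightarrow> real^2")

definition coords :: "'a chart \<Rightarrow> (real^2) set" where
  "coords c = cmap c ` cdom c"

definition is_chart :: "'a::topological_space chart \<Rightarrow> bool" where
  "is_chart c \<longleftrightarrow> open (cdom c) \<and> open (coords c) \<and>
     homeomorphism (cdom c) (coords c) (cmap c) (inv_into (cdom c) (cmap c))"

definition overlap :: "'a chart \<Rightarrow> 'a chart \<Rightarrow> (real^2) set" where
  "overlap c c' = cmap c ` (cdom c \<inter> cdom c')"

definition transition :: "'a chart \<Rightarrow> 'a chart \<Rightarrow> real^2 \<Rightarrow> real^2" where
  "transition c c' = cmap c' \<circ> inv_into (cdom c) (cmap c)"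

definition compatible :: "'a chart \<Rightarrow> 'a chart \<Rightarrow> bool" where
  "compatible c c' \<longleftrightarrow>
     smooth_on (overlap c c') (transition c c') \<and> smooth_on (overlap c' c) (transition c' c)"

text \<open>The entry \<open>$ a $ i\<close> is the partial derivative of the \<open>a\<close>-th coordinate of \<open>c'\<close> with
  respect to the \<open>i\<close>-th coordinate of \<open>c\<close>.\<close>
definition jacobian :: "'a chart \<Rightarrow> 'a chart \<Rightarrow> real^2 \<Rightarrow> real^2^2" where
  "jacobian c c' x = matrix (frechet_derivative (transition c c') (at x))"

definition carrier :: "'a chart set \<Rightarrow> 'a set" where
  "carrier A = (\<Union>c\<in>A. cdom c)"

text \<open>A smooth structure on \<open>carrier A\<close> is a maximal smooth atlas, so that ``some coordinate chart''
  ranges over all charts of the surface, whatever their orientation. The Hausdorff and second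
  countability axioms come from the type class of the ambient type.\<close>
definition smooth_structure :: "'a::{t2_space,second_countable_topology} chart set \<Rightarrow> bool" where
  "smooth_structure A \<longleftrightarrow>
     (\<forall>c\<in>A. is_chart c) \<and>
     (\<forall>c\<in>A. \<forall>c'\<in>A. compatible c c') \<and>
     (\<forall>c. is_chart c \<and> cdom c \<subseteq> carrier A \<and> (\<forall>c'\<in>A. compatible c c') \<longrightarrow> c \<in> A)"

text \<open>An orientation is recorded by the locally constant sign \<open>\<sigma> c x\<close>, which is \<open>1\<close> where the
  coordinate basis of \<open>c\<close> is positively oriented and \<open>-1\<close> elsewhere.\<close>
definition orientation :: "'a chart set \<Rightarrow> ('a chart \<Rightarrow> real^2 \<Rightarrow> real) \<Rightarrow> bool" where
  "orientation A \<sigma> \<longleftrightarrow>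
     (\<forall>c\<in>A. continuous_on (coords c) (\<sigma> c) \<and> (\<forall>x\<in>coords c. \<sigma> c x \<in> {1, -1})) \<and>
     (\<forall>c\<in>A. \<forall>c'\<in>A. \<forall>x\<in>overlap c c'.
        \<sigma> c x = sgn (det (jacobian c c' x)) * \<sigma> c' (transition c c' x))"

definition oriented_surface ::
    "'a::{t2_space,second_countable_topology} chart set \<Rightarrow> ('a chart \<Rightarrow> real^2 \<Rightarrow> real) \<Rightarrow> bool" where
  "oriented_surface A \<sigma> \<longleftrightarrow> smooth_structure A \<and> orientation A \<sigma>"


section \<open>Tensor fields and connections\<close>

text \<open>Tensor fields are families of component functions, one for each chart \<open>c\<close>, defined on
  \<open>coords c\<close> and related by the transformation laws on overlaps. Values outside \<open>coords c\<close> are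
  irrelevant.\<close>

type_synonym 'a covector_field = "'a chart \<Rightarrow> real^2 \<Rightarrow> real^2"
type_synonym 'a metric_field = "'a chart \<Rightarrow> real^2 \<Rightarrow> real^2^2"

text \<open>Christoffel symbols and difference tensors: \<open>T c x $ i $ k $ j\<close> stands for
  \<open>T\<^sub>i\<^sup>k\<^sub>j\<close>, where \<open>i\<close> is the direction of differentiation.\<close>
type_synonym 'a connection_field = "'a chart \<Rightarrow> real^2 \<Rightarrow> real^2^2^2"

text \<open>A 2-form is given by its value on the pair of coordinate vector fields
  \<open>(\<partial>\<^sub>1, \<partial>\<^sub>2)\<close>.\<close>
type_synonym 'a two_form = "'a chart \<Rightarrow> real^2 \<Rightarrow> real"

definition one_form :: "'a chart set \<Rightarrow> 'a covector_field \<Rightarrow> bool" where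
  "one_form A \<psi> \<longleftrightarrow>
     (\<forall>c\<in>A. smooth_on (coords c) (\<psi> c)) \<and>
     (\<forall>c\<in>A. \<forall>c'\<in>A. \<forall>x\<in>overlap c c'. \<forall>i.
        \<psi> c x $ i = (\<Sum>a\<in>UNIV. jacobian c c' x $ a $ i * \<psi> c' (transition c c' x) $ a))"

definition riemannian_metric :: "'a chart set \<Rightarrow> 'a metric_field \<Rightarrow> bool" where
  "riemannian_metric A g \<longleftrightarrow>
     (\<forall>c\<in>A. smooth_on (coords c) (g c)) \<and>
     (\<forall>c\<in>A. \<forall>x\<in>coords c. transpose (g c x) = g c x \<and> (\<forall>v. v \<noteq> 0 \<longrightarrow> v \<bullet> (g c x *v v) > 0)) \<and>
     (\<forall>c\<in>A. \<forall>c'\<in>A. \<forall>x\<in>overlap c c'. \<forall>i j.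
        g c x $ i $ j = (\<Sum>a\<in>UNIV. \<Sum>b\<in>UNIV. jacobian c c' x $ a $ i * jacobian c c' x $ b $ j
                            * g c' (transition c c' x) $ a $ b))"

text \<open>The inhomogeneous term in the transformation law of the Christoffel symbols is the second
  derivative of the transition map.\<close>
definition is_connection :: "'a chart set \<Rightarrow> 'a connection_field \<Rightarrow> bool" where
  "is_connection A \<Gamma> \<longleftrightarrow>
     (\<forall>c\<in>A. smooth_on (coords c) (\<Gamma> c)) \<and>
     (\<forall>c\<in>A. \<forall>c'\<in>A. \<forall>x\<in>overlap c c'. \<forall>i j m.
        (\<Sum>k\<in>UNIV. jacobian c c' x $ m $ k * \<Gamma> c x $ i $ k $ j) =
          pd i (\<lambda>y. jacobian c c' y $ m $ j) x +
          (\<Sum>a\<in>UNIV. \<Sum>b\<in>UNIV. jacobian c c' x $ a $ i * jacobian c c' x $ b $ j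
              * \<Gamma> c' (transition c c' x) $ a $ m $ b))"

text \<open>\<open>cov_metric g \<Gamma> c x i l j\<close> is \<open>\<nabla>\<^sub>i g\<^sub>l\<^sub>j\<close>.\<close>
definition cov_metric ::
    "'a metric_field \<Rightarrow> 'a connection_field \<Rightarrow> 'a chart \<Rightarrow> real^2 \<Rightarrow> 2 \<Rightarrow> 2 \<Rightarrow> 2 \<Rightarrow> real" where
  "cov_metric g \<Gamma> c x i l j =
     pd i (\<lambda>y. g c y $ l $ j) x
     - (\<Sum>m\<in>UNIV. \<Gamma> c x $ i $ m $ l * g c x $ m $ j)
     - (\<Sum>m\<in>UNIV. \<Gamma> c x $ i $ m $ j * g c x $ l $ m)"

definition metric_connection :: "'a chart set \<Rightarrow> 'a metric_field \<Rightarrow> 'a connection_field \<Rightarrow> bool" where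
  "metric_connection A g \<Gamma> \<longleftrightarrow>
     is_connection A \<Gamma> \<and> (\<forall>c\<in>A. \<forall>x\<in>coords c. \<forall>i l j. cov_metric g \<Gamma> c x i l j = 0)"

definition levi_civita :: "'a chart set \<Rightarrow> 'a metric_field \<Rightarrow> 'a connection_field \<Rightarrow> bool" where
  "levi_civita A g \<Gamma> \<longleftrightarrow>
     metric_connection A g \<Gamma> \<and>
     (\<forall>c\<in>A. \<forall>x\<in>coords c. \<forall>i k j. \<Gamma> c x $ i $ k $ j = \<Gamma> c x $ j $ k $ i)"

text \<open>\<open>connection_minus A \<Gamma> \<Gamma>' T\<close> says that \<open>\<Gamma>' = \<Gamma> - T\<close> on the surface.\<close>
definition connection_minus ::
    "'a chart set \<Rightarrow> 'a connection_field \<Rightarrow> 'a connection_field \<Rightarrow> 'a connection_field \<Rightarrow> bool" where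
  "connection_minus A \<Gamma> \<Gamma>' T \<longleftrightarrow> (\<forall>c\<in>A. \<forall>x\<in>coords c. \<Gamma>' c x = \<Gamma> c x - T c x)"

text \<open>\<open>T\<^sub>i\<^sub>k\<^sub>j = g\<^sub>k\<^sub>m T\<^sub>i\<^sup>m\<^sub>j\<close>\<close>
definition lower :: "'a metric_field \<Rightarrow> 'a connection_field \<Rightarrow> 'a connection_field" where
  "lower g T c x = (\<chi> i k j. \<Sum>m\<in>UNIV. g c x $ k $ m * T c x $ i $ m $ j)"

definition skew :: "'a chart set \<Rightarrow> 'a metric_field \<Rightarrow> 'a connection_field \<Rightarrow> bool" where
  "skew A g T \<longleftrightarrow>
     (\<forall>c\<in>A. \<forall>x\<in>coords c. \<forall>i k j. lower g T c x $ i $ k $ j = - lower g T c x $ i $ j $ k)"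

text \<open>\<open>T\<^sub>k\<^sup>k\<^sub>i\<close>\<close>
definition contraction :: "'a connection_field \<Rightarrow> 'a covector_field" where
  "contraction T c x = (\<chi> i. \<Sum>k\<in>UNIV. T c x $ k $ k $ i)"

text \<open>\<open>\<nabla> + (1/2) g\<^sup>-\<^sup>1\<nabla>g\<close>\<close>
definition assoc_connection :: "'a metric_field \<Rightarrow> 'a connection_field \<Rightarrow> 'a connection_field" where
  "assoc_connection g \<Gamma> c x =
     (\<chi> i k j. \<Gamma> c x $ i $ k $ j
        + 1/2 * (\<Sum>l\<in>UNIV. matrix_inv (g c x) $ k $ l * cov_metric g \<Gamma> c x i l j))"

text \<open>\<open>(1/2) (D\<^sub>i\<^sup>k\<^sub>j - g\<^sup>k\<^sup>l D\<^sub>i\<^sup>m\<^sub>l g\<^sub>m\<^sub>j)\<close>\<close>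
definition skew_part :: "'a metric_field \<Rightarrow> 'a connection_field \<Rightarrow> 'a connection_field" where
  "skew_part g D c x =
     (\<chi> i k j. 1/2 * (D c x $ i $ k $ j
        - (\<Sum>l\<in>UNIV. \<Sum>m\<in>UNIV. matrix_inv (g c x) $ k $ l * D c x $ i $ m $ l * g c x $ m $ j)))"


section \<open>Metric notions at a point\<close>

definition ginner :: "'a metric_field \<Rightarrow> 'a chart \<Rightarrow> real^2 \<Rightarrow> real^2 \<Rightarrow> real^2 \<Rightarrow> real" where
  "ginner g c x v w = v \<bullet> (g c x *v w)"

definition oriented_det :: "('a chart \<Rightarrow> real^2 \<Rightarrow> real) \<Rightarrow> 'a chart \<Rightarrow> real^2 \<Rightarrow> real^2 \<Rightarrow> real^2 \<Rightarrow> real" where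
  "oriented_det \<sigma> c x v w = \<sigma> c x * det (vector [v, w] :: real^2^2)"

definition oriented_orthonormal ::
    "('a chart \<Rightarrow> real^2 \<Rightarrow> real) \<Rightarrow> 'a metric_field \<Rightarrow> 'a chart \<Rightarrow> real^2 \<Rightarrow> real^2 \<Rightarrow> real^2 \<Rightarrow> bool" where
  "oriented_orthonormal \<sigma> g c x v w \<longleftrightarrow>
     ginner g c x v v = 1 \<and> ginner g c x w w = 1 \<and> ginner g c x v w = 0 \<and> oriented_det \<sigma> c x v w > 0"

text \<open>The oriented angle from \<open>v\<close> to \<open>w\<close>, in the interval from \<open>-\<pi>\<close> (excluded) to \<open>\<pi>\<close>
  (included); the value \<open>\<pi>\<close> occurs exactly for opposite vectors.\<close>
definition oriented_angle ::
    "('a chart \<Rightarrow> real^2 \<Rightarrow> real) \<Rightarrow> 'a metric_field \<Rightarrow> 'a chart \<Rightarrow> real^2 \<Rightarrow> real^2 \<Rightarrow> real^2 \<Rightarrow> real" where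
  "oriented_angle \<sigma> g c x v w =
     (if oriented_det \<sigma> c x v w \<ge> 0 then 1 else -1) *
     arccos (ginner g c x v w / (sqrt (ginner g c x v v) * sqrt (ginner g c x w w)))"

definition area_form :: "('a chart \<Rightarrow> real^2 \<Rightarrow> real) \<Rightarrow> 'a metric_field \<Rightarrow> 'a two_form" where
  "area_form \<sigma> g c x = \<sigma> c x * sqrt (det (g c x))"

text \<open>The integral of a 2-form over a subset of a chart domain; the sign accounts for charts
  that reverse the orientation.\<close>
definition form_integral ::
    "('a chart \<Rightarrow> real^2 \<Rightarrow> real) \<Rightarrow> 'a chart \<Rightarrow> 'a set \<Rightarrow> 'a two_form \<Rightarrow> real" where
  "form_integral \<sigma> c D w = integral (cmap c ` D) (\<lambda>x. \<sigma> c x * w c x)"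


section \<open>Curvature\<close>

text \<open>\<open>riemann \<Gamma> c x i j l k\<close> is the \<open>k\<close>-th component of
  \<open>R(\<partial>\<^sub>i, \<partial>\<^sub>j) \<partial>\<^sub>l\<close>, where \<open>R(X,Y) = [\<nabla>\<^sub>X, \<nabla>\<^sub>Y] - \<nabla>\<close> in direction \<open>[X,Y]\<close>.\<close>
definition riemann ::
    "'a connection_field \<Rightarrow> 'a chart \<Rightarrow> real^2 \<Rightarrow> 2 \<Rightarrow> 2 \<Rightarrow> 2 \<Rightarrow> 2 \<Rightarrow> real" where
  "riemann \<Gamma> c x i j l k =
     pd i (\<lambda>y. \<Gamma> c y $ j $ k $ l) x - pd j (\<lambda>y. \<Gamma> c y $ i $ k $ l) x
     + (\<Sum>m\<in>UNIV. \<Gamma> c x $ i $ k $ m * \<Gamma> c x $ j $ m $ l - \<Gamma> c x $ j $ k $ m * \<Gamma> c x $ i $ m $ l)"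

text \<open>\<open>K = g(R(\<partial>\<^sub>1,\<partial>\<^sub>2)\<partial>\<^sub>2, \<partial>\<^sub>1) / det g\<close>, where \<open>\<Gamma>\<close> is the Levi-Civita connection.\<close>
definition gauss_curvature ::
    "'a metric_field \<Rightarrow> 'a connection_field \<Rightarrow> 'a chart \<Rightarrow> real^2 \<Rightarrow> real" where
  "gauss_curvature g \<Gamma> c x =
     (\<Sum>k\<in>UNIV. riemann \<Gamma> c x 1 2 2 k * g c x $ k $ 1) / det (g c x)"

text \<open>On 1-forms the formal adjoint of the exterior derivative is minus the divergence; \<open>\<Gamma>\<close> is the
  Levi-Civita connection.\<close>
definition codiff ::
    "'a metric_field \<Rightarrow> 'a connection_field \<Rightarrow> 'a covector_field \<Rightarrow> 'a chart \<Rightarrow> real^2 \<Rightarrow> real" where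
  "codiff g \<Gamma> \<psi> c x =
     - (\<Sum>i\<in>UNIV. \<Sum>j\<in>UNIV. matrix_inv (g c x) $ i $ j *
          (pd i (\<lambda>y. \<psi> c y $ j) x - (\<Sum>k\<in>UNIV. \<Gamma> c x $ i $ k $ j * \<psi> c x $ k)))"

text \<open>A frame is given by \<open>E x $ \<beta>\<close>, the coordinate vector of \<open>E\<^sub>\<beta>\<close> at \<open>x\<close>.\<close>
definition oriented_frame ::
    "('a chart \<Rightarrow> real^2 \<Rightarrow> real) \<Rightarrow> 'a metric_field \<Rightarrow> 'a chart \<Rightarrow> (real^2) set \<Rightarrow> (real^2 \<Rightarrow> real^2^2) \<Rightarrow> bool" where
  "oriented_frame \<sigma> g c V E \<longleftrightarrow>
     open V \<and> V \<subseteq> coords c \<and> smooth_on V E \<and>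
     (\<forall>x\<in>V. oriented_orthonormal \<sigma> g c x (E x $ 1) (E x $ 2))"

definition cov_deriv ::
    "'a connection_field \<Rightarrow> 'a chart \<Rightarrow> 2 \<Rightarrow> (real^2 \<Rightarrow> real^2) \<Rightarrow> real^2 \<Rightarrow> real^2" where
  "cov_deriv \<Gamma> c i Y x = (\<chi> k. pd i (\<lambda>y. Y y $ k) x + (\<Sum>j\<in>UNIV. \<Gamma> c x $ i $ k $ j * Y x $ j))"

text \<open>\<open>\<omega> x $ i $ \<alpha> $ \<beta>\<close> is the value of the connection 1-form
  \<open>\<omega>\<^sup>\<alpha>\<^sub>\<beta>\<close> on \<open>\<partial>\<^sub>i\<close>; it is determined on \<open>V\<close> by
  \<open>\<nabla>E\<^sub>\<beta> = \<omega>\<^sup>\<alpha>\<^sub>\<beta> E\<^sub>\<alpha>\<close>.\<close>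
definition connection_form ::
    "'a connection_field \<Rightarrow> 'a chart \<Rightarrow> (real^2) set \<Rightarrow> (real^2 \<Rightarrow> real^2^2) \<Rightarrow> (real^2 \<Rightarrow> real^2^2^2) \<Rightarrow> bool" where
  "connection_form \<Gamma> c V E \<omega> \<longleftrightarrow>
     (\<forall>x\<in>V. \<forall>i \<beta>. cov_deriv \<Gamma> c i (\<lambda>y. E y $ \<beta>) x = (\<Sum>\<alpha>\<in>UNIV. \<omega> x $ i $ \<alpha> $ \<beta> *\<^sub>R E x $ \<alpha>))"

text \<open>The value of \<open>d\<omega> + \<omega> \<and> \<omega>\<close> on \<open>(\<partial>\<^sub>1, \<partial>\<^sub>2)\<close>.\<close>
definition curvature_form :: "(real^2 \<Rightarrow> real^2^2^2) \<Rightarrow> real^2 \<Rightarrow> real^2^2" where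
  "curvature_form \<omega> x =
     (\<chi> \<alpha> \<beta>. pd 1 (\<lambda>y. \<omega> y $ 2 $ \<alpha> $ \<beta>) x - pd 2 (\<lambda>y. \<omega> y $ 1 $ \<alpha> $ \<beta>) x
        + (\<Sum>\<gamma>\<in>UNIV. \<omega> x $ 1 $ \<alpha> $ \<gamma> * \<omega> x $ 2 $ \<gamma> $ \<beta> - \<omega> x $ 2 $ \<alpha> $ \<gamma> * \<omega> x $ 1 $ \<gamma> $ \<beta>))"

definition Pf :: "real^2^2 \<Rightarrow> real" where
  "Pf \<Theta> = 1/2 * (\<Theta> $ 1 $ 2 - \<Theta> $ 2 $ 1)"

text \<open>The 2-form \<open>w\<close> is \<open>Pf(\<Omega>)\<close> for the connection \<open>\<Gamma>\<close>, computed in any local oriented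
  orthonormal frame. Such frames exist on all of \<open>coords c\<close>, by the Gram-Schmidt process.\<close>
definition is_pfaffian_curvature ::
    "'a chart set \<Rightarrow> ('a chart \<Rightarrow> real^2 \<Rightarrow> real) \<Rightarrow> 'a metric_field \<Rightarrow> 'a connection_field \<Rightarrow> 'a two_form \<Rightarrow> bool" where
  "is_pfaffian_curvature A \<sigma> g \<Gamma> w \<longleftrightarrow>
     (\<forall>c\<in>A. \<forall>V E \<omega>. oriented_frame \<sigma> g c V E \<and> connection_form \<Gamma> c V E \<omega> \<longrightarrow>
        (\<forall>x\<in>V. w c x = Pf (curvature_form \<omega> x)))"


section \<open>Curved polygons\<close>

text \<open>A curve is \<open>\<gamma>\<close>, subdivided at \<open>\<tau> 0 < \<dots> < \<tau> n\<close>, with \<open>n\<close> smooth pieces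
  \<open>i < n\<close> on \<open>{\<tau> i..\<tau> (Suc i)}\<close>. Velocity and acceleration are taken piece by piece, and are
  one-sided at the end points of a piece.\<close>

definition vel :: "'a chart \<Rightarrow> (real \<Rightarrow> 'a) \<Rightarrow> (nat \<Rightarrow> real) \<Rightarrow> nat \<Rightarrow> real \<Rightarrow> real^2" where
  "vel c \<gamma> \<tau> i t = vector_derivative (\<lambda>s. cmap c (\<gamma> s)) (at t within {\<tau> i..\<tau> (Suc i)})"

text \<open>\<open>\<nabla>\<close> of the velocity field along the curve, in the direction of the velocity.\<close>
definition cov_accel ::
    "'a connection_field \<Rightarrow> 'a chart \<Rightarrow> (real \<Rightarrow> 'a) \<Rightarrow> (nat \<Rightarrow> real) \<Rightarrow> nat \<Rightarrow> real \<Rightarrow> real^2" where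
  "cov_accel \<Gamma> c \<gamma> \<tau> i t =
     (\<chi> k. vector_derivative (vel c \<gamma> \<tau> i) (at t within {\<tau> i..\<tau> (Suc i)}) $ k
        + (\<Sum>p\<in>UNIV. \<Sum>q\<in>UNIV. \<Gamma> c (cmap c (\<gamma> t)) $ p $ k $ q * vel c \<gamma> \<tau> i t $ p * vel c \<gamma> \<tau> i t $ q))"

text \<open>The angle at the vertex \<open>\<gamma> (\<tau> (Suc i))\<close>; the last vertex, where the curve closes up,
  lies between the last and the first piece.\<close>
definition exterior_angle ::
    "('a chart \<Rightarrow> real^2 \<Rightarrow> real) \<Rightarrow> 'a metric_field \<Rightarrow> 'a chart \<Rightarrow> (real \<Rightarrow> 'a) \<Rightarrow> nat \<Rightarrow> (nat \<Rightarrow> real) \<Rightarrow> nat \<Rightarrow> real" where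
  "exterior_angle \<sigma> g c \<gamma> n \<tau> i =
     (let i' = Suc i mod n in
      oriented_angle \<sigma> g c (cmap c (\<gamma> (\<tau> (Suc i)))) (vel c \<gamma> \<tau> i (\<tau> (Suc i))) (vel c \<gamma> \<tau> i' (\<tau> i')))"

text \<open>\<open>c\<close> is the coordinate chart that contains the polygon and its interior.\<close>
definition curved_polygon ::
    "'a::topological_space chart set \<Rightarrow> ('a chart \<Rightarrow> real^2 \<Rightarrow> real) \<Rightarrow> 'a metric_field \<Rightarrow> 'a chart \<Rightarrow>
     (real \<Rightarrow> 'a) \<Rightarrow> nat \<Rightarrow> (nat \<Rightarrow> real) \<Rightarrow> 'a set \<Rightarrow> bool" where
  "curved_polygon A \<sigma> g c \<gamma> n \<tau> D \<longleftrightarrow>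
     0 < n \<and> (\<forall>i<n. \<tau> i < \<tau> (Suc i)) \<and>
     inj_on \<gamma> {\<tau> 0..<\<tau> n} \<and> \<gamma> (\<tau> n) = \<gamma> (\<tau> 0) \<and>
     c \<in> A \<and> \<gamma> ` {\<tau> 0..\<tau> n} \<subseteq> cdom c \<and> D \<subseteq> cdom c \<and>
     (\<forall>i<n. smooth_on_interval (\<tau> i) (\<tau> (Suc i)) (\<lambda>t. cmap c (\<gamma> t))) \<and>
     (\<forall>i<n. \<forall>t\<in>{\<tau> i..\<tau> (Suc i)}.
        ginner g c (cmap c (\<gamma> t)) (vel c \<gamma> \<tau> i t) (vel c \<gamma> \<tau> i t) = 1) \<and>
     (\<forall>i<n. exterior_angle \<sigma> g c \<gamma> n \<tau> i \<noteq> pi \<and> exterior_angle \<sigma> g c \<gamma> n \<tau> i \<noteq> - pi) \<and>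
     open D \<and> compact (closure D) \<and> frontier D = \<gamma> ` {\<tau> 0..\<tau> n} \<and>
     cmap c ` D = inside (cmap c ` \<gamma> ` {\<tau> 0..\<tau> n})"

definition unit_normal ::
    "('a chart \<Rightarrow> real^2 \<Rightarrow> real) \<Rightarrow> 'a metric_field \<Rightarrow> 'a chart \<Rightarrow> (real \<Rightarrow> 'a) \<Rightarrow> nat \<Rightarrow> (nat \<Rightarrow> real) \<Rightarrow>
     (nat \<Rightarrow> real \<Rightarrow> real^2) \<Rightarrow> bool" where
  "unit_normal \<sigma> g c \<gamma> n \<tau> N \<longleftrightarrow>
     (\<forall>i<n. \<forall>t\<in>{\<tau> i..\<tau> (Suc i)}. oriented_orthonormal \<sigma> g c (cmap c (\<gamma> t)) (vel c \<gamma> \<tau> i t) (N i t))"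

definition inward_pointing ::
    "'a chart \<Rightarrow> (real \<Rightarrow> 'a) \<Rightarrow> nat \<Rightarrow> (nat \<Rightarrow> real) \<Rightarrow> 'a set \<Rightarrow> (nat \<Rightarrow> real \<Rightarrow> real^2) \<Rightarrow> bool" where
  "inward_pointing c \<gamma> n \<tau> D N \<longleftrightarrow>
     (\<forall>i<n. \<forall>t\<in>{\<tau> i<..<\<tau> (Suc i)}.
        \<forall>\<^sub>F h in at_right 0. cmap c (\<gamma> t) + h *\<^sub>R N i t \<in> cmap c ` D)"

text \<open>Positive orientation of \<open>\<gamma>\<close> as the boundary of \<open>D\<close> means that the unit normal \<open>N\<close> for which
  (velocity, \<open>N\<close>) is an oriented basis points into \<open>D\<close>.\<close>
definition positively_oriented_polygon ::
    "'a::topological_space chart set \<Rightarrow> ('a chart \<Rightarrow> real^2 \<Rightarrow> real) \<Rightarrow> 'a metric_field \<Rightarrow> 'a chart \<Rightarrow>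
     (real \<Rightarrow> 'a) \<Rightarrow> nat \<Rightarrow> (nat \<Rightarrow> real) \<Rightarrow> 'a set \<Rightarrow> (nat \<Rightarrow> real \<Rightarrow> real^2) \<Rightarrow> bool" where
  "positively_oriented_polygon A \<sigma> g c \<gamma> n \<tau> D N \<longleftrightarrow>
     curved_polygon A \<sigma> g c \<gamma> n \<tau> D \<and> unit_normal \<sigma> g c \<gamma> n \<tau> N \<and> inward_pointing c \<gamma> n \<tau> D N"

text \<open>\<open>g(\<nabla>\<gamma>', N)\<close> with \<open>\<nabla>\<close> in direction \<open>\<gamma>'\<close>. For the Levi-Civita connection this is the
  signed curvature.\<close>
definition normal_accel ::
    "'a metric_field \<Rightarrow> 'a connection_field \<Rightarrow> 'a chart \<Rightarrow> (real \<Rightarrow> 'a) \<Rightarrow> (nat \<Rightarrow> real) \<Rightarrow>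
     (nat \<Rightarrow> real \<Rightarrow> real^2) \<Rightarrow> nat \<Rightarrow> real \<Rightarrow> real" where
  "normal_accel g \<Gamma> c \<gamma> \<tau> N i t = ginner g c (cmap c (\<gamma> t)) (cov_accel \<Gamma> c \<gamma> \<tau> i t) (N i t)"

text \<open>\<open>(K - d\<^sup>* B) dA\<close>\<close>
definition interior_form ::
    "('a chart \<Rightarrow> real^2 \<Rightarrow> real) \<Rightarrow> 'a metric_field \<Rightarrow> 'a connection_field \<Rightarrow> 'a covector_field \<Rightarrow> 'a two_form" where
  "interior_form \<sigma> g LC B c x = (gauss_curvature g LC c x - codiff g LC B c x) * area_form \<sigma> g c x"

text \<open>\<open>\<kappa>\<^sub>N + B(N)\<close>\<close>
definition boundary_term ::
    "'a metric_field \<Rightarrow> 'a connection_field \<Rightarrow> 'a covector_field \<Rightarrow> 'a chart \<Rightarrow> (real \<Rightarrow> 'a) \<Rightarrow>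
     (nat \<Rightarrow> real) \<Rightarrow> (nat \<Rightarrow> real \<Rightarrow> real^2) \<Rightarrow> nat \<Rightarrow> real \<Rightarrow> real" where
  "boundary_term g LC B c \<gamma> \<tau> N i t =
     normal_accel g LC c \<gamma> \<tau> N i t + B c (cmap c (\<gamma> t)) \<bullet> N i t"

text \<open>Since \<open>\<gamma>\<close> has unit speed, integration with respect to arc length is integration in the
  parameter.\<close>
definition arclength_integral :: "nat \<Rightarrow> (nat \<Rightarrow> real) \<Rightarrow> (nat \<Rightarrow> real \<Rightarrow> real) \<Rightarrow> real" where
  "arclength_integral n \<tau> f = (\<Sum>i<n. integral {\<tau> i..\<tau> (Suc i)} (f i))"

end

theory Submission
  imports Defs "HOL-Complex_Analysis.Winding_Numbers" "HOL-Probability.Sinc_Integral"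
begin

text \<open>Everything happens in the chart \<open>c\<close> that contains the polygon. There the Gram-Schmidt process
  gives an oriented orthonormal frame \<open>E\<^sub>1, E\<^sub>2\<close>, and the Levi-Civita connection becomes a single
  1-form \<open>w\<close> with \<open>\<nabla>E\<^sub>2 = w E\<^sub>1\<close> and \<open>\<nabla>E\<^sub>1 = - w E\<^sub>2\<close>. The 1-form \<open>B\<close> is turned into the 1-form \<open>\<beta>\<close>
  with \<open>\<beta>(v) = B(N)\<close> for every oriented orthonormal pair \<open>v, N\<close>. For \<open>\<eta> = w - \<beta>\<close> three facts
  hold, and together they are the Gauss-Bonnet formula.

  \<^item> In the interior, \<open>d\<eta> = (K - d\<^sup>* B) dA\<close>: the curvature of a surface is the exterior derivative
    of its connection form (\<open>gauss_curvature_frame\<close>), and \<open>d\<beta> = d\<^sup>* B dA\<close> (\<open>codiff_frame\<close>).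
  \<^item> On the boundary, if \<open>\<theta>\<close> is the angle from \<open>E\<^sub>1\<close> to the velocity, then \<open>\<theta>' = \<kappa>\<^sub>N + w(\<gamma>')\<close>
    (\<open>angular_speed\<close>), so that \<open>\<kappa>\<^sub>N + B(N) = \<theta>' - \<eta>(\<gamma>')\<close>.
  \<^item> The velocity turns once: the total change of \<open>\<theta>\<close> along the smooth pieces, together with the
    exterior angles, is \<open>2\<pi>\<close> (\<open>umlaufsatz\<close>).

  Green's formula (\<open>green\<close>) makes the integral of \<open>d\<eta>\<close> over \<open>D\<close> cancel against the integral of
  \<open>\<eta>\<close> along \<open>\<gamma>\<close>, and \<open>2\<pi>\<close> is what remains (\<open>gauss_bonnet\<close>).

  The Umlaufsatz is proved by Hopf's method. The secants \<open>z t - z s\<close> of a simple loop vanish nowhere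
  on a convex set of parameter pairs and therefore have a continuous logarithm; near the diagonal
  it records the direction of the velocity, and a local computation at each vertex
  (\<open>log_turn_at_corner\<close>) produces the exterior angle. A frame changes the secants by matrices without
  negative eigenvalues, which does not affect the monodromy of the logarithm (\<open>framed_log\<close>). That
  this monodromy is \<open>\<pi> \<i>\<close>, rather than another odd multiple, follows from the
  winding numbers on the two sides of the curve (\<open>winding_number_beside_curve\<close>).

  Green's formula is proved for the whole domain at once, without cutting it into simple pieces. The
  indicator function of the interior is a winding number, hence an integral along the curve of the
  kernel \<open>(x, y) / (x\<^sup>2 + y\<^sup>2)\<close>; after Fubini, everything reduces to the fact that integrating
  the radial derivative of \<open>f\<close> against this kernel gives \<open>- 2\<pi>\<close> times the value of \<open>f\<close> at the origin
  (\<open>integral_radial_derivative\<close>, \<open>winding_flux_arc\<close>).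

  For a metric connection \<open>\<nabla>'\<close>, equal to the Levi-Civita connection minus \<open>T\<close>, the tensor \<open>T\<close> is
  skew. In dimension two a skew \<open>T\<close> is determined by its contraction \<open>B\<close> (\<open>skew_contraction\<close>), in
  such a way that \<open>\<eta>\<close> is the connection form of \<open>\<nabla>'\<close>. Hence \<open>Pf(\<Omega>)\<close> is \<open>d\<eta>\<close> (\<open>Pf_torsion\<close>), and the
  boundary terms agree pointwise (\<open>skew_normal_component\<close>). Finally, the connection associated with
  a general connection differs from the Levi-Civita connection by the skew part of a tensor, which
  is again a tensor (\<open>skew_part_tensor\<close>), so it is a connection to which the above applies.\<close>


section \<open>Continuous logarithms\<close>

text \<open>The difference of the two logarithms takes values in a translate of \<open>2\<pi>\<i>\<int>\<close>, which is discrete.\<close>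
lemma continuous_logs_differ_by_constant:
  fixes f g :: "'a::topological_space \<Rightarrow> complex"
  assumes X: "connected X" and f: "continuous_on X f" and g: "continuous_on X g"
    and eq: "\<And>x. x \<in> X \<Longrightarrow> exp (f x) = w * exp (g x)" and w: "w \<noteq> 0"
  obtains c where "exp c = w" "\<And>x. x \<in> X \<Longrightarrow> f x = g x + c"
proof (cases "X = {}")
  case True
  then show ?thesis using that[of "Ln w"] w by auto
next
  case False
  then obtain x0 where x0: "x0 \<in> X" by auto
  have e1: "exp (f x - g x) = w" if "x \<in> X" for x
    using eq[OF that] by (simp add: exp_diff)
  have "(\<lambda>x. f x - g x) constant_on X"
  proof (rule continuous_discrete_range_constant[OF X])
    show "continuous_on X (\<lambda>x. f x - g x)" by (intro continuous_intros f g)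
    fix x assume x: "x \<in> X"
    have "2 * pi \<le> norm ((f y - g y) - (f x - g x))"
      if y: "y \<in> X" "f y - g y \<noteq> f x - g x" for y
    proof -
      have "exp (f y - g y) = exp (f x - g x)" using e1[OF y(1)] e1[OF x] by simp
      then obtain m :: int where m: "f y - g y = f x - g x + 2 * of_int m * pi * \<i>"
        unfolding exp_eq by auto
      with y(2) have "m \<noteq> 0" by auto
      then have m1: "1 \<le> \<bar>real_of_int m\<bar>" by linarith
      have "(f y - g y) - (f x - g x) = complex_of_real (2 * pi * m) * \<i>" using m by simp
      then have "norm ((f y - g y) - (f x - g x)) = 2 * pi * \<bar>real_of_int m\<bar>"
        by (simp only: norm_mult norm_ii norm_of_real) (simp add: abs_mult)
      then show ?thesis using mult_left_mono[OF m1, of "2*pi"] by simp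
    qed
    then show "\<exists>e>0. \<forall>y. y \<in> X \<and> f y - g y \<noteq> f x - g x \<longrightarrow> e \<le> norm ((f y - g y) - (f x - g x))"
      by (intro exI[of _ "2*pi"]) auto
  qed
  then obtain c where c: "\<And>x. x \<in> X \<Longrightarrow> f x - g x = c" unfolding constant_on_def by blast
  show ?thesis
  proof (rule that)
    show "exp c = w" using e1[OF x0] c[OF x0] by simp
    show "f x = g x + c" if "x \<in> X" for x using c[OF that] by (simp add: algebra_simps)
  qed
qed

lemma Im_Ln_scale: "0 < r \<Longrightarrow> z \<noteq> 0 \<Longrightarrow> Im (Ln (complex_of_real r * z)) = Im (Ln z)"
  by (simp add: Ln_times_of_real)

text \<open>Since \<open>p\<close> and \<open>q\<close> are not opposite, near the origin all values of the linear combination lie in the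
  open half plane around the bisector of \<open>p\<close> and \<open>q\<close>, where the logarithm is a principal branch up
  to a constant. This one lemma computes the exterior angles at the vertices and the jump of the
  winding number across the curve.\<close>
lemma log_turn_at_corner:
  fixes P Q :: "real \<times> real \<Rightarrow> complex" and L :: "real \<times> real \<Rightarrow> complex"
  assumes h: "0 < h" and B: "B = {0..h} \<times> {0..h}"
    and P: "continuous (at (0,0) within B) P" and Q: "continuous (at (0,0) within B) Q"
    and L: "continuous_on (B - {(0,0)}) L"
    and eq: "\<And>\<alpha> \<beta>. (\<alpha>, \<beta>) \<in> B \<Longrightarrow> (\<alpha>, \<beta>) \<noteq> (0,0) \<Longrightarrow> exp (L (\<alpha>, \<beta>)) = of_real \<alpha> * P (\<alpha>, \<beta>) + of_real \<beta> * Q (\<alpha>, \<beta>)"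
    and P0: "P (0,0) = p" "p \<noteq> 0" and Q0: "Q (0,0) = q" and w: "q / p \<notin> \<real>\<^sub>\<le>\<^sub>0"
    and l1: "((\<lambda>\<alpha>. Im (L (\<alpha>, 0))) \<longlongrightarrow> l1) (at_right 0)"
    and l2: "((\<lambda>\<beta>. Im (L (0, \<beta>))) \<longlongrightarrow> l2) (at_right 0)"
  shows "l2 - l1 = Im (Ln (q / p))"
proof -
  define w where "w = q / p"
  have w0: "w \<noteq> 0" using w w_def by auto
  have q: "q = p * w" using P0 by (simp add: w_def)
  have pos: "0 < Re (exp (Ln w / 2))" "0 < Re (exp (- (Ln w / 2)))"
  proof -
    have "\<bar>Im (Ln w)\<bar> < pi" using w w_def
      by (metis Im_Ln_less_pi Im_Ln_le_pi abs_less_iff complex_nonpos_Reals_iff minus_less_iff mpi_less_Im_Ln w0 Im_Ln_eq_pi less_le)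
    then have "0 < cos (Im (Ln w) / 2)" by (intro cos_gt_zero_pi) auto
    then show "0 < Re (exp (Ln w / 2))" "0 < Re (exp (- (Ln w / 2)))"
      by (auto simp: Re_exp)
  qed
  \<comment> \<open>the bisector: \<open>p / u\<close> and \<open>q / u\<close> are conjugate up to positive factors and have positive real part\<close>
  define u where "u = p * exp (Ln w / 2)"
  have u0: "u \<noteq> 0" using P0 by (simp add: u_def)
  have pu: "p / u = exp (- (Ln w / 2))" using P0 by (simp add: u_def exp_minus field_simps)
  have qu: "q / u = exp (Ln w / 2)"
    using P0 w0 by (simp add: u_def q field_simps flip: exp_add)
  have cont: "continuous (at (0,0) within B) (\<lambda>x. Re (P x / u))" "continuous (at (0,0) within B) (\<lambda>x. Re (Q x / u))"
    using P Q u0 unfolding continuous_within by (auto intro!: tendsto_intros)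
  have "\<forall>\<^sub>F x in at (0,0) within B. 0 < Re (P x / u) \<and> 0 < Re (Q x / u)"
    using order_tendstoD(1)[OF cont(1)[unfolded continuous_within], of 0]
      order_tendstoD(1)[OF cont(2)[unfolded continuous_within], of 0] P0 Q0 pu qu pos
    by (simp add: eventually_conj)
  then obtain d where d: "0 < d" and dpos: "\<And>x. x \<in> B \<Longrightarrow> x \<noteq> (0,0) \<Longrightarrow> dist x (0,0) < d \<Longrightarrow> 0 < Re (P x / u) \<and> 0 < Re (Q x / u)"
    unfolding eventually_at by auto
  define e where "e = min h (d/3)"
  have e: "0 < e" "e \<le> h" using h d by (auto simp: e_def)
  \<comment> \<open>on this convex part of the corner, \<open>exp \<circ> L\<close> stays in the half plane of \<open>u\<close>\<close>
  define C where "C = {0..e} \<times> {0..e} \<inter> {x :: real \<times> real. 0 < fst x + snd x}"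
  have CB: "C \<subseteq> B - {(0,0)}" using e by (auto simp: C_def B)
  have Cpos: "0 < Re (P x / u) \<and> 0 < Re (Q x / u)" if "x \<in> C" for x
  proof (rule dpos)
    show "x \<in> B" "x \<noteq> (0,0)" using that CB by auto
    obtain a b where ab: "x = (a,b)" by fastforce
    then have ab2: "0 \<le> a" "a \<le> e" "0 \<le> b" "b \<le> e" using that by (auto simp: C_def)
    have "dist x (0,0) \<le> \<bar>a\<bar> + \<bar>b\<bar>" by (simp add: ab dist_prod_def dist_real_def sqrt_sum_squares_le_sum_abs)
    also have "\<dots> < d" using ab2 d by (auto simp: e_def)
    finally show "dist x (0,0) < d" .
  qed
  have "convex C" unfolding C_def
  proof (intro convex_Int convex_Times)
    have "{x :: real \<times> real. 0 < fst x + snd x} = {x. (1,1) \<bullet> x > 0}" by (auto simp: inner_prod_def)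
    then show "convex {x :: real \<times> real. 0 < fst x + snd x}" by (simp add: convex_halfspace_gt)
  qed auto
  then have conn: "connected C" by (rule convex_connected)
  define f where "f = (\<lambda>x. exp (L x) / u)"
  have contL: "continuous_on C L" using L CB continuous_on_subset by blast
  have fpos: "0 < Re (f x)" if x: "x \<in> C" for x
  proof -
    obtain a b where ab: "x = (a,b)" by fastforce
    then have ab2: "0 \<le> a" "0 \<le> b" "0 < a + b" using that by (auto simp: C_def)
    have "exp (L x) = of_real a * P x + of_real b * Q x"
      using eq[of a b] CB x ab by auto
    then have "f x = of_real a * (P x / u) + of_real b * (Q x / u)" by (simp add: f_def add_divide_distrib)
    then have *: "Re (f x) = a * Re (P x / u) + b * Re (Q x / u)"
      by (simp del: times_divide_eq_right)
    have "a > 0 \<or> b > 0" using ab2 by linarith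
    then show ?thesis using Cpos[OF x] ab2 unfolding *
      by (auto intro: add_pos_nonneg add_nonneg_pos)
  qed
  have fcont: "continuous_on C (\<lambda>x. Ln (f x))"
    using fpos u0 unfolding f_def
    by (intro continuous_intros contL) (auto simp: complex_nonpos_Reals_iff not_le)
  have fexp: "exp (L x) = u * exp (Ln (f x))" if "x \<in> C" for x
    using fpos[OF that] u0 by (subst exp_Ln) (auto simp: f_def)
  obtain c where c: "exp c = u" "\<And>x. x \<in> C \<Longrightarrow> L x = Ln (f x) + c"
    using continuous_logs_differ_by_constant[OF conn contL fcont fexp u0] by metis
  have lim: "((\<lambda>x. Im (Ln (R x / u)) + Im c) \<longlongrightarrow> Im (Ln (R (0,0) / u)) + Im c) (at (0,0) within B)"
    if R: "continuous (at (0,0) within B) R" "0 < Re (R (0,0) / u)" for R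
    using R(1) u0 R(2) unfolding continuous_within
    by (intro tendsto_intros) (auto simp: complex_nonpos_Reals_iff not_le)
  have axis1: "filterlim (\<lambda>\<alpha>::real. (\<alpha>, 0::real)) (at (0,0) within B) (at_right 0)"
    unfolding filterlim_at
    by (auto intro!: tendsto_eq_intros eventually_at_rightI[of 0 h] simp: B h less_imp_le zero_prod_def)
  have axis2: "filterlim (\<lambda>\<beta>::real. (0::real, \<beta>)) (at (0,0) within B) (at_right 0)"
    unfolding filterlim_at
    by (auto intro!: tendsto_eq_intros eventually_at_rightI[of 0 h] simp: B h less_imp_le zero_prod_def)
  have L1: "Im (L (\<alpha>, 0)) = Im (Ln (P (\<alpha>, 0) / u)) + Im c" if "0 < \<alpha>" "\<alpha> < e" for \<alpha>
  proof -
    have x: "(\<alpha>, 0) \<in> C" using that by (auto simp: C_def)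
    have "f (\<alpha>, 0) = of_real \<alpha> * (P (\<alpha>, 0) / u)" using eq[of \<alpha> 0] x CB by (auto simp: f_def)
    then have "Im (Ln (f (\<alpha>,0))) = Im (Ln (P (\<alpha>, 0) / u))"
      using that Cpos[OF x] by (metis Im_Ln_scale less_irrefl zero_complex.simps(1))
    then show ?thesis using c(2)[OF x] by simp
  qed
  have L2: "Im (L (0, \<beta>)) = Im (Ln (Q (0, \<beta>) / u)) + Im c" if "0 < \<beta>" "\<beta> < e" for \<beta>
  proof -
    have x: "(0, \<beta>) \<in> C" using that by (auto simp: C_def)
    have "f (0, \<beta>) = of_real \<beta> * (Q (0, \<beta>) / u)" using eq[of 0 \<beta>] x CB by (auto simp: f_def)
    then have "Im (Ln (f (0,\<beta>))) = Im (Ln (Q (0, \<beta>) / u))"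
      using that Cpos[OF x] by (metis Im_Ln_scale less_irrefl zero_complex.simps(1))
    then show ?thesis using c(2)[OF x] by simp
  qed
  have ev: "\<forall>\<^sub>F \<alpha> in at_right (0::real). 0 < \<alpha> \<and> \<alpha> < e"
    using e by (auto intro!: eventually_at_rightI[of 0 e])
  have "((\<lambda>\<alpha>. Im (L (\<alpha>, 0))) \<longlongrightarrow> Im (Ln (p / u)) + Im c) (at_right 0)"
    using filterlim_compose[OF lim[OF P] axis1] P0 pu pos
    by (subst tendsto_cong[OF eventually_mono[OF ev]]) (auto simp: L1)
  then have l1': "l1 = Im (Ln (p / u)) + Im c"
    using l1 tendsto_unique trivial_limit_at_right_real by blast
  have "((\<lambda>\<beta>. Im (L (0, \<beta>))) \<longlongrightarrow> Im (Ln (q / u)) + Im c) (at_right 0)"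
    using filterlim_compose[OF lim[OF Q] axis2] Q0 qu pos
    by (subst tendsto_cong[OF eventually_mono[OF ev]]) (auto simp: L2)
  then have l2': "l2 = Im (Ln (q / u)) + Im c"
    using l2 tendsto_unique trivial_limit_at_right_real by blast
  have b: "- pi < Im (Ln w)" "Im (Ln w) \<le> pi" using w0 mpi_less_Im_Ln Im_Ln_le_pi by auto
  have "Ln (q / u) = Ln w / 2" unfolding qu using b by (intro Ln_exp) auto
  then have "Im (Ln (q / u)) = Im (Ln w) / 2" by (simp only: Im_divide_numeral)
  moreover have "Ln (p / u) = - (Ln w / 2)" unfolding pu using b by (intro Ln_exp) auto
  then have "Im (Ln (p / u)) = - Im (Ln w) / 2" by (simp only: Im_divide_numeral uminus_complex.sel)
  ultimately show ?thesis using l1' l2' by (simp add: w_def)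
qed


section \<open>Loops with corners and their secants\<close>

text \<open>The components of a tangent vector with respect to a Gram-Schmidt frame: a real linear map with
  upper triangular matrix, with \<open>p\<close> and \<open>r\<close> positive when the frame is positively oriented.\<close>
definition shear :: "real \<Rightarrow> real \<Rightarrow> real \<Rightarrow> complex \<Rightarrow> complex" where
  "shear p q r w = Complex (p * Re w + q * Im w) (r * Im w)"

lemma shear_alt: "shear p q r w = of_real p * of_real (Re w) + of_real q * of_real (Im w) + \<i> * of_real r * of_real (Im w)"
  by (simp add: shear_def complex_eq_iff)

lemma shear_add: "shear p q r (w + w') = shear p q r w + shear p q r w'"
  by (simp add: shear_def complex_eq_iff algebra_simps)

lemma shear_scale: "shear p q r (of_real x * w) = of_real x * shear p q r w"
  by (simp add: shear_def complex_eq_iff algebra_simps)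

lemma shear_minus: "shear p q r (- w) = - shear p q r w"
  by (simp add: shear_def complex_eq_iff)

text \<open>A vector mapped to a nonpositive multiple of itself would be an eigenvector, but the eigenvalues are
  the positive numbers \<open>p\<close> and \<open>r\<close>. This is what makes the choice of frame irrelevant for the total
  rotation.\<close>
lemma shear_quotient_not_nonpos:
  assumes "0 < p" "0 < r" "w \<noteq> 0"
  shows "shear p q r w / w \<notin> \<real>\<^sub>\<le>\<^sub>0"
proof
  assume "shear p q r w / w \<in> \<real>\<^sub>\<le>\<^sub>0"
  then obtain c where c: "c \<le> 0" "shear p q r w / w = of_real c"
    by (auto elim!: nonpos_Reals_cases)
  then have eq: "shear p q r w = of_real c * w" using assms by (simp add: field_simps)
  then have "r * Im w = c * Im w" by (simp add: shear_def complex_eq_iff)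
  then have "Im w = 0" using c(1) assms by (metis mult_cancel_right not_less)
  moreover from this have "p * Re w = c * Re w" using eq by (simp add: shear_def complex_eq_iff)
  then have "Re w = 0" using c(1) assms by (metis mult_cancel_right not_less)
  ultimately show False using assms by (simp add: complex_eq_iff)
qed

lemma shear_nonzero:
  assumes "0 < p" "0 < r" "w \<noteq> 0"
  shows "shear p q r w \<noteq> 0"
  using shear_quotient_not_nonpos[OF assms, of q] by auto

lemma continuous_on_shear [continuous_intros]:
  assumes "continuous_on S p" "continuous_on S q" "continuous_on S r" "continuous_on S w"
  shows "continuous_on S (\<lambda>x. shear (p x) (q x) (r x) (w x))"
  unfolding shear_alt by (intro continuous_intros assms)

text \<open>A simple loop with \<open>n\<close> pieces of class \<open>C\<^sup>1\<close>. The velocity \<open>v i\<close> belongs to the \<open>i\<close>-th piece and is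
  one-sided at its ends, so that the loop may have a corner at every \<open>\<tau> i\<close>.\<close>
locale cornered_loop =
  fixes z :: "real \<Rightarrow> complex" and v :: "nat \<Rightarrow> real \<Rightarrow> complex" and n :: nat and \<tau> :: "nat \<Rightarrow> real"
  assumes n_pos: "0 < n"
    and \<tau>_less: "\<And>i. i < n \<Longrightarrow> \<tau> i < \<tau> (Suc i)"
    and inj: "inj_on z {\<tau> 0..<\<tau> n}"
    and closed: "z (\<tau> n) = z (\<tau> 0)"
    and deriv: "\<And>i t. i < n \<Longrightarrow> t \<in> {\<tau> i..\<tau> (Suc i)} \<Longrightarrow>
                   (z has_vector_derivative v i t) (at t within {\<tau> i..\<tau> (Suc i)})"
    and cont_v: "\<And>i. i < n \<Longrightarrow> continuous_on {\<tau> i..\<tau> (Suc i)} (v i)"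
    and v_nz: "\<And>i t. i < n \<Longrightarrow> t \<in> {\<tau> i..\<tau> (Suc i)} \<Longrightarrow> v i t \<noteq> 0"
begin

abbreviation "a \<equiv> \<tau> 0"
abbreviation "b \<equiv> \<tau> n"

lemma \<tau>_mono: "i \<le> j \<Longrightarrow> j \<le> n \<Longrightarrow> \<tau> i \<le> \<tau> j"
proof (induction j)
  case (Suc j)
  show ?case
  proof (cases "i = Suc j")
    case False
    then have "\<tau> i \<le> \<tau> j" using Suc by simp
    also have "\<dots> < \<tau> (Suc j)" using \<tau>_less[of j] Suc by simp
    finally show ?thesis by simp
  qed simp
qed simp

lemma piece_subset: "i < n \<Longrightarrow> {\<tau> i..\<tau> (Suc i)} \<subseteq> {a..b}"
  using \<tau>_mono[of 0 i] \<tau>_mono[of "Suc i" n] by auto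

lemma a_less_b: "a < b"
  using \<tau>_less[of 0] \<tau>_mono[of 1 n] n_pos by auto

lemma cont_z: "continuous_on {a..b} z"
proof -
  have "m \<le> n \<Longrightarrow> continuous_on {a..\<tau> m} z" for m
  proof (induction m)
    case (Suc m)
    have "continuous_on {\<tau> m..\<tau> (Suc m)} z"
      using deriv[of m] Suc.prems by (intro continuous_on_vector_derivative) auto
    then have "continuous_on ({a..\<tau> m} \<union> {\<tau> m..\<tau> (Suc m)}) z"
      using Suc by (intro continuous_on_closed_Un) auto
    moreover have "{a..\<tau> m} \<union> {\<tau> m..\<tau> (Suc m)} = {a..\<tau> (Suc m)}"
      using \<tau>_mono[of 0 m] \<tau>_less[of m] Suc.prems by auto
    ultimately show ?case by simp
  qed simp
  then show ?thesis by simp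
qed

text \<open>Hopf's triangle of parameter pairs, without the places where the secant vanishes: the diagonal and
  the pair of the two end points.\<close>
definition secant_domain :: "(real \<times> real) set" where
  "secant_domain = {(s,t). a \<le> s \<and> s < t \<and> t \<le> b \<and> t - s < b - a}"

lemma convex_halfplane2: "convex {x :: real \<times> real. c * fst x + d * snd x \<le> e}"
proof -
  have "{x :: real \<times> real. c * fst x + d * snd x \<le> e} = {x. (c,d) \<bullet> x \<le> e}"
    by (auto simp: inner_prod_def)
  then show ?thesis by (simp add: convex_halfspace_le)
qed

lemma convex_halfplane2_strict: "convex {x :: real \<times> real. c * fst x + d * snd x < e}"
proof -
  have "{x :: real \<times> real. c * fst x + d * snd x < e} = {x. (c,d) \<bullet> x < e}"
    by (auto simp: inner_prod_def)
  then show ?thesis by (simp add: convex_halfspace_lt)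
qed

lemma convex_secant_domain: "convex secant_domain"
proof -
  have "secant_domain = {x. (-1) * fst x + 0 * snd x \<le> - a} \<inter> {x. 1 * fst x + (-1) * snd x < 0} \<inter>
       {x. 0 * fst x + 1 * snd x \<le> b} \<inter> {x. (-1) * fst x + 1 * snd x < b - a}"
    by (auto simp: secant_domain_def)
  then show ?thesis
    by (simp only:) (intro convex_Int convex_halfplane2 convex_halfplane2_strict)
qed

lemma z_neq: "(s,t) \<in> secant_domain \<Longrightarrow> z t \<noteq> z s"
proof
  assume st: "(s,t) \<in> secant_domain" and eq: "z t = z s"
  show False
  proof (cases "t = b")
    case True
    then have "s = a" using st eq closed inj_onD[OF inj, of s a] by (auto simp: secant_domain_def)
    then show False using st True by (auto simp: secant_domain_def)
  next
    case False
    then show False using st eq inj_onD[OF inj, of s t] by (auto simp: secant_domain_def)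
  qed
qed

text \<open>The secant divided by the length of the parameter interval, in a form that is continuous up to the
  diagonal, where it is the velocity.\<close>
definition mean_velocity :: "nat \<Rightarrow> real \<times> real \<Rightarrow> complex" where
  "mean_velocity i = (\<lambda>(s,t). integral {0..1} (\<lambda>x. v i (s + x * (t - s))))"

definition triangle :: "nat \<Rightarrow> (real \<times> real) set" where
  "triangle i = {(s,t). \<tau> i \<le> s \<and> s \<le> t \<and> t \<le> \<tau> (Suc i)}"

lemma between_param:
  fixes s t :: real
  assumes "c \<le> s" "s \<le> t" "t \<le> d" "0 \<le> x" "x \<le> 1"
  shows "c \<le> s + x * (t - s)" "s + x * (t - s) \<le> d"
proof -
  define m where "m = x * (t - s)"
  have "0 \<le> m" "m \<le> t - s"
    using assms unfolding m_def by (auto intro: mult_left_le_one_le)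
  then show "c \<le> s + x * (t - s)" "s + x * (t - s) \<le> d" using assms unfolding m_def[symmetric] by linarith+
qed

lemma mean_velocity_continuous: "i < n \<Longrightarrow> continuous_on (triangle i) (mean_velocity i)"
proof -
  assume i: "i < n"
  have "continuous_on (triangle i \<times> cbox 0 1) (\<lambda>(y, x). v i (fst y + x * (snd y - fst y)))"
    unfolding split_def
    by (rule continuous_on_compose2[OF cont_v[OF i]])
      (auto intro!: continuous_intros simp: triangle_def between_param)
  from integral_continuous_on_param[OF this]
  have "continuous_on (triangle i) (\<lambda>y. integral {0..1} (\<lambda>x. v i (fst y + x * (snd y - fst y))))"
    by simp
  then show ?thesis by (simp add: mean_velocity_def split_def)
qed

lemma mean_velocity_diag: "mean_velocity i (t,t) = v i t"
  by (simp add: mean_velocity_def)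

lemma secant_eq_mean_velocity:
  assumes "i < n" "(s,t) \<in> triangle i"
  shows "z t - z s = of_real (t - s) * mean_velocity i (s,t)"
proof -
  have st: "\<tau> i \<le> s" "s \<le> t" "t \<le> \<tau> (Suc i)" using assms by (auto simp: triangle_def)
  have "((\<lambda>x. (t - s) *\<^sub>R v i (s + x * (t - s))) has_integral (z (s + 1 * (t - s)) - z (s + 0 * (t - s)))) {0..1}"
  proof (rule fundamental_theorem_of_calculus)
    fix x :: real assume x: "x \<in> {0..1}"
    have in_piece: "s + y * (t - s) \<in> {\<tau> i..\<tau> (Suc i)}" if "y \<in> {0..1}" for y
      using between_param[OF st, of y] that by auto
    have "(z has_vector_derivative v i (s + x * (t - s))) (at (s + x * (t - s)) within (\<lambda>x. s + x * (t - s)) ` {0..1})"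
      by (rule has_vector_derivative_within_subset[OF deriv[OF assms(1) in_piece[OF x]]]) (use in_piece in blast)
    moreover have "((\<lambda>x. s + x * (t - s)) has_vector_derivative (t - s)) (at x within {0..1})"
      by (auto intro!: derivative_eq_intros)
    ultimately show "((\<lambda>x. z (s + x * (t - s))) has_vector_derivative (t - s) *\<^sub>R v i (s + x * (t - s))) (at x within {0..1})"
      using vector_diff_chain_within[of "\<lambda>x. s + x * (t - s)" "t - s" x "{0..1}" z "v i (s + x * (t - s))"]
      by (simp only: o_def)
  qed simp
  from integral_unique[OF this]
  have "z t - z s = integral {0..1} (\<lambda>x. (t - s) *\<^sub>R v i (s + x * (t - s)))"
    by simp
  then show ?thesis by (simp add: mean_velocity_def scaleR_conv_of_real)
qed

lemma first_log_exists:
  obtains L0 where "continuous_on secant_domain L0" "\<And>s t. (s,t) \<in> secant_domain \<Longrightarrow> exp (L0 (s,t)) = z t - z s"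
proof -
  have c: "continuous_on secant_domain (\<lambda>x. z (snd x) - z (fst x))"
    by (intro continuous_intros continuous_on_compose2[OF cont_z]) (auto simp: secant_domain_def)
  obtain g where "continuous_on secant_domain g" "\<And>x. x \<in> secant_domain \<Longrightarrow> z (snd x) - z (fst x) = exp (g x)"
    by (rule continuous_logarithm_on_contractible[OF c convex_imp_contractible[OF convex_secant_domain]])
      (use z_neq in auto)
  then show ?thesis by (intro that[of g]) (auto simp flip: prod.case_eq_if)
qed

text \<open>Since the loop is closed, the secant from \<open>s\<close> to the end is the negative of the secant from the
  start to \<open>s\<close>. The imaginary part of the constant \<open>k\<close> will turn out to be half
  the total rotation of the velocity.\<close>
lemma antisymmetric_log:
  fixes L :: "real \<times> real \<Rightarrow> complex"
  assumes "continuous_on secant_domain L" and "\<And>s. s \<in> {a<..<b} \<Longrightarrow> exp (L (s,b)) = - exp (L (a,s))"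
  obtains k where "exp k = -1" "\<And>s. s \<in> {a<..<b} \<Longrightarrow> L (s,b) = L (a,s) + k"
proof -
  have c: "continuous_on {a<..<b} (\<lambda>s. L (s,b))" "continuous_on {a<..<b} (\<lambda>s. L (a,s))"
    by (rule continuous_on_compose2[OF assms(1)]; auto simp: secant_domain_def intro!: continuous_intros)+
  obtain k where "exp k = -1" "\<And>s. s \<in> {a<..<b} \<Longrightarrow> L (s,b) = L (a,s) + k"
    by (rule continuous_logs_differ_by_constant[OF _ c, of "-1"]) (use assms(2) in auto)
  then show ?thesis by (rule that)
qed

end


section \<open>Rotation of the velocity in a moving frame\<close>

text \<open>A frame along the loop, given by the shears that compute components in it.\<close>
locale framed_loop = cornered_loop +
  fixes p q r :: "real \<Rightarrow> real"
  assumes cont_pqr: "continuous_on {\<tau> 0..\<tau> n} p" "continuous_on {\<tau> 0..\<tau> n} q" "continuous_on {\<tau> 0..\<tau> n} r"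
    and p_pos: "\<And>t. t \<in> {\<tau> 0..\<tau> n} \<Longrightarrow> 0 < p t" and r_pos: "\<And>t. t \<in> {\<tau> 0..\<tau> n} \<Longrightarrow> 0 < r t"
    and frame_closed: "p (\<tau> n) = p (\<tau> 0)" "q (\<tau> n) = q (\<tau> 0)" "r (\<tau> n) = r (\<tau> 0)"
begin

definition in_frame :: "real \<Rightarrow> complex \<Rightarrow> complex" where
  "in_frame t = shear (p t) (q t) (r t)"

text \<open>The average of the frames at \<open>s\<close> and \<open>t\<close>. It is symmetric in \<open>s\<close> and \<open>t\<close>, so that framed secants are
  antisymmetric like the secants themselves, and it is the frame itself on the diagonal.\<close>
definition mean_frame :: "real \<Rightarrow> real \<Rightarrow> complex \<Rightarrow> complex" where
  "mean_frame s t = shear ((p s + p t) / 2) ((q s + q t) / 2) ((r s + r t) / 2)"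

definition framed_secant :: "real \<times> real \<Rightarrow> complex" where
  "framed_secant = (\<lambda>(s,t). mean_frame s t (z t - z s))"

lemma mean_frame_add: "mean_frame s t (w + w') = mean_frame s t w + mean_frame s t w'" by (simp add: mean_frame_def shear_add)
lemma mean_frame_minus: "mean_frame s t (- w) = - mean_frame s t w" by (simp add: mean_frame_def shear_minus)
lemma mean_frame_scale: "mean_frame s t (of_real x * w) = of_real x * mean_frame s t w" by (simp add: mean_frame_def shear_scale)
lemma mean_frame_diag: "mean_frame t t w = in_frame t w" by (simp add: mean_frame_def in_frame_def)
lemma mean_frame_ends: "mean_frame a b w = in_frame a w" by (simp add: mean_frame_def in_frame_def frame_closed)
lemma in_frame_ends: "in_frame b w = in_frame a w" by (simp add: in_frame_def frame_closed)

lemma mean_frame_nonzero: "s \<in> {a..b} \<Longrightarrow> t \<in> {a..b} \<Longrightarrow> w \<noteq> 0 \<Longrightarrow> mean_frame s t w \<noteq> 0"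
  unfolding mean_frame_def using p_pos[of s] p_pos[of t] r_pos[of s] r_pos[of t]
  by (intro shear_nonzero) auto

lemma framed_secant_nonzero: "x \<in> secant_domain \<Longrightarrow> framed_secant x \<noteq> 0"
proof -
  assume x: "x \<in> secant_domain"
  obtain s t where st: "x = (s,t)" by fastforce
  have "z t - z s \<noteq> 0" using z_neq x st by auto
  then have "mean_frame s t (z t - z s) \<noteq> 0" using x by (intro mean_frame_nonzero) (auto simp: st secant_domain_def)
  then show ?thesis by (simp add: framed_secant_def st)
qed

lemma cont_mean_frame:
  assumes "continuous_on S f" "continuous_on S g" "continuous_on S w" "f ` S \<subseteq> {a..b}" "g ` S \<subseteq> {a..b}"
  shows "continuous_on S (\<lambda>x. mean_frame (f x) (g x) (w x))"
  unfolding mean_frame_def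
  by (intro continuous_intros assms continuous_on_compose2[OF cont_pqr(1)]
      continuous_on_compose2[OF cont_pqr(2)] continuous_on_compose2[OF cont_pqr(3)]) auto

text \<open>The quotient of a framed secant by the secant avoids the nonpositive real axis, so its principal
  logarithm can be added to the logarithm of the secants. The quotient takes equal values at \<open>(a, s)\<close>
  and \<open>(s, b)\<close>, so the monodromy is the same with and without the frame.\<close>
lemma framed_log:
  assumes L0: "continuous_on secant_domain L0" "\<And>s t. (s,t) \<in> secant_domain \<Longrightarrow> exp (L0 (s,t)) = z t - z s"
  obtains L where "continuous_on secant_domain L" "\<And>x. x \<in> secant_domain \<Longrightarrow> exp (L x) = framed_secant x"
    "\<And>s. s \<in> {a<..<b} \<Longrightarrow> L (s,b) - L (a,s) = L0 (s,b) - L0 (a,s)"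
proof
  define R where "R = (\<lambda>(s,t). mean_frame s t (z t - z s) / (z t - z s))"
  have R: "R x \<notin> \<real>\<^sub>\<le>\<^sub>0" if "x \<in> secant_domain" for x
  proof -
    obtain s t where st: "x = (s,t)" by fastforce
    have "z t - z s \<noteq> 0" using z_neq that st by auto
    then show ?thesis using that p_pos[of s] p_pos[of t] r_pos[of s] r_pos[of t]
      unfolding R_def mean_frame_def st prod.case
      by (intro shear_quotient_not_nonpos) (auto simp: secant_domain_def)
  qed
  have Rc: "continuous_on secant_domain R"
    unfolding R_def split_def
    by (intro cont_mean_frame continuous_intros continuous_on_compose2[OF cont_z]) (use z_neq in \<open>auto simp: secant_domain_def\<close>)
  show "continuous_on secant_domain (\<lambda>x. L0 x + Ln (R x))"
    by (intro continuous_intros L0 Rc R)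
  show "exp (L0 x + Ln (R x)) = framed_secant x" if "x \<in> secant_domain" for x
  proof -
    obtain s t where st: "x = (s,t)" by fastforce
    have "z t - z s \<noteq> 0" using z_neq that st by auto
    moreover have "R x \<noteq> 0" using R[OF that] by auto
    ultimately show ?thesis using L0(2)[of s t] that by (simp add: exp_add st R_def framed_secant_def)
  qed
  show "L0 (s,b) + Ln (R (s,b)) - (L0 (a,s) + Ln (R (a,s))) = L0 (s,b) - L0 (a,s)" if "s \<in> {a<..<b}" for s
  proof -
    have "R (s,b) = mean_frame a s (- (z s - z a)) / - (z s - z a)"
      by (simp add: R_def mean_frame_def frame_closed closed add.commute)
    also have "\<dots> = R (a,s)" unfolding mean_frame_minus minus_divide_divide by (simp add: R_def)
    finally show ?thesis by simp
  qed
qed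

text \<open>The condition \<open>t - s < b - a\<close> excludes only the pair of the two end points of a loop with a single
  piece.\<close>
definition proper_triangle :: "nat \<Rightarrow> (real \<times> real) set" where
  "proper_triangle i = {(s,t). \<tau> i \<le> s \<and> s \<le> t \<and> t \<le> \<tau> (Suc i) \<and> t - s < b - a}"

lemma convex_proper_triangle: "convex (proper_triangle i)" and convex_proper_triangle_off_diagonal: "convex (proper_triangle i \<inter> {x. fst x < snd x})"
proof -
  have eq: "proper_triangle i = {x. (-1) * fst x + 0 * snd x \<le> - \<tau> i} \<inter> {x. 1 * fst x + (-1) * snd x \<le> 0} \<inter>
       {x. 0 * fst x + 1 * snd x \<le> \<tau> (Suc i)} \<inter> {x. (-1) * fst x + 1 * snd x < b - a}"
    by (auto simp: proper_triangle_def)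
  show "convex (proper_triangle i)" unfolding eq
    by (intro convex_Int convex_halfplane2 convex_halfplane2_strict)
  moreover have "{x :: real \<times> real. fst x < snd x} = {x. 1 * fst x + (-1) * snd x < 0}" by auto
  ultimately show "convex (proper_triangle i \<inter> {x. fst x < snd x})"
    by (metis convex_Int convex_halfplane2_strict)
qed

lemma proper_triangleD: "i < n \<Longrightarrow> (s,t) \<in> proper_triangle i \<Longrightarrow> (s,t) \<in> triangle i \<and> s \<in> {a..b} \<and> t \<in> {a..b} \<and> (s < t \<longrightarrow> (s,t) \<in> secant_domain)"
  using piece_subset[of i] by (auto simp: proper_triangle_def triangle_def secant_domain_def)

definition framed_mean :: "nat \<Rightarrow> real \<times> real \<Rightarrow> complex" where
  "framed_mean i = (\<lambda>(s,t). mean_frame s t (mean_velocity i (s,t)))"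

lemma framed_secant_factor: "i < n \<Longrightarrow> (s,t) \<in> triangle i \<Longrightarrow> framed_secant (s,t) = of_real (t - s) * framed_mean i (s,t)"
  by (simp add: framed_secant_def framed_mean_def secant_eq_mean_velocity mean_frame_scale del: of_real_diff)

lemma framed_mean_nonzero: "i < n \<Longrightarrow> x \<in> proper_triangle i \<Longrightarrow> framed_mean i x \<noteq> 0"
proof -
  assume i: "i < n" and x: "x \<in> proper_triangle i"
  obtain s t where st: "x = (s,t)" by fastforce
  note st' = proper_triangleD[OF i x[unfolded st]]
  show ?thesis
  proof (cases "s < t")
    case True
    then show ?thesis using framed_secant_nonzero[of "(s,t)"] framed_secant_factor[OF i, of s t] st st' by auto
  next
    case False
    then have "s = t" using x by (auto simp: st proper_triangle_def)
    then have "mean_frame s s (v i s) \<noteq> 0"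
      using v_nz[OF i, of s] st' x by (intro mean_frame_nonzero) (auto simp: st proper_triangle_def)
    then show ?thesis by (simp add: framed_mean_def mean_velocity_diag st \<open>s = t\<close>)
  qed
qed

lemma cont_framed_mean:
  assumes i: "i < n"
  shows "continuous_on (proper_triangle i) (framed_mean i)"
proof -
  have "continuous_on (proper_triangle i) (\<lambda>x. mean_velocity i (fst x, snd x))"
    using proper_triangleD[OF i] by (auto intro: continuous_on_subset[OF mean_velocity_continuous[OF i]])
  then show ?thesis
    unfolding framed_mean_def split_def
    using proper_triangleD[OF i] by (intro cont_mean_frame continuous_intros) fastforce+
qed

text \<open>Off the diagonal a framed secant is a positive multiple of the framed mean velocity, and the latter
  has a logarithm up to the diagonal. Thus the argument of the secants extends to the diagonal of
  each piece and is there the argument of the velocity.\<close>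
lemma piece_log:
  assumes L: "continuous_on secant_domain L" "\<And>x. x \<in> secant_domain \<Longrightarrow> exp (L x) = framed_secant x" and i: "i < n"
  shows "\<exists>\<psi>. continuous_on (proper_triangle i) \<psi> \<and> (\<forall>x\<in>proper_triangle i. exp (\<psi> x) = framed_mean i x) \<and>
           (\<forall>s t. (s,t) \<in> proper_triangle i \<and> s < t \<longrightarrow> Im (L (s,t)) = Im (\<psi> (s,t)))"
proof -
  obtain g where g: "continuous_on (proper_triangle i) g" "\<And>x. x \<in> proper_triangle i \<Longrightarrow> framed_mean i x = exp (g x)"
    by (rule continuous_logarithm_on_contractible[OF cont_framed_mean[OF i] convex_imp_contractible[OF convex_proper_triangle]])
      (use framed_mean_nonzero[OF i] in auto)
  let ?O = "proper_triangle i \<inter> {x. fst x < snd x}"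
  have OX: "?O \<subseteq> secant_domain" using proper_triangleD[OF i] by auto
  have conn: "connected ?O" by (rule convex_connected[OF convex_proper_triangle_off_diagonal])
  have cL: "continuous_on ?O L" using L(1) OX continuous_on_subset by blast
  have cg: "continuous_on ?O (\<lambda>x. g x + of_real (ln (snd x - fst x)))"
    by (intro continuous_intros continuous_on_subset[OF g(1)]) auto
  have e: "exp (L x) = 1 * exp (g x + of_real (ln (snd x - fst x)))" if x: "x \<in> ?O" for x
  proof -
    obtain s t where st: "x = (s,t)" by fastforce
    have "exp (L x) = of_real (t - s) * exp (g x)"
      using L(2)[of x] framed_secant_factor[OF i, of s t] proper_triangleD[OF i, of s t] x OX g(2)[of x] by (auto simp: st)
    moreover have "exp (complex_of_real (ln (t - s))) = of_real (t - s)"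
      using x st by (subst exp_of_real) auto
    ultimately show ?thesis by (simp add: exp_add st)
  qed
  obtain c where c: "exp c = 1" "\<And>x. x \<in> ?O \<Longrightarrow> L x = g x + of_real (ln (snd x - fst x)) + c"
    by (rule continuous_logs_differ_by_constant[OF conn cL cg e]) auto
  show ?thesis
  proof (intro exI[of _ "\<lambda>x. g x + c"] conjI allI impI ballI)
    show "continuous_on (proper_triangle i) (\<lambda>x. g x + c)" by (intro continuous_intros g)
    show "exp (g x + c) = framed_mean i x" if "x \<in> proper_triangle i" for x using g(2)[OF that] c by (simp add: exp_add)
    show "Im (L (s,t)) = Im (g (s,t) + c)" if "(s,t) \<in> proper_triangle i \<and> s < t" for s t
      using c(2)[of "(s,t)"] that by simp
  qed
qed

lemma tendsto_into:
  assumes c: "continuous_on S f" and x: "x \<in> S" and lim: "(g \<longlongrightarrow> x) F" and ev: "\<forall>\<^sub>F y in F. g y \<in> S"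
  shows "((\<lambda>y. f (g y)) \<longlongrightarrow> f x) F"
  by (rule continuous_on_tendsto_compose[OF c lim x ev])

lemma piece_limits:
  assumes i: "i < n" and \<psi>: "continuous_on (proper_triangle i) \<psi>"
    and L\<psi>: "\<And>s t. (s,t) \<in> proper_triangle i \<Longrightarrow> s < t \<Longrightarrow> Im (L (s,t)) = Im (\<psi> (s,t))"
    and u: "u \<in> {\<tau> i..\<tau> (Suc i)}"
  shows "u < \<tau> (Suc i) \<Longrightarrow> ((\<lambda>\<beta>. Im (L (u, u + \<beta>))) \<longlongrightarrow> Im (\<psi> (u,u))) (at_right 0)"
    and "\<tau> i < u \<Longrightarrow> ((\<lambda>\<alpha>. Im (L (u - \<alpha>, u))) \<longlongrightarrow> Im (\<psi> (u,u))) (at_right 0)"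
proof -
  have uu: "(u,u) \<in> proper_triangle i" using u a_less_b by (auto simp: proper_triangle_def)
  define m where "m = b - a"
  have m: "m > 0" using a_less_b by (simp add: m_def)
  show "((\<lambda>\<beta>. Im (L (u, u + \<beta>))) \<longlongrightarrow> Im (\<psi> (u,u))) (at_right 0)" if "u < \<tau> (Suc i)"
  proof -
    have ev: "\<forall>\<^sub>F \<beta> in at_right 0. (u, u + \<beta>) \<in> proper_triangle i \<and> 0 < \<beta>"
      using that u m by (intro eventually_at_rightI[of 0 "min m (\<tau> (Suc i) - u)"]) (auto simp: proper_triangle_def m_def)
    have "((\<lambda>\<beta>. Im (\<psi> (u, u + \<beta>))) \<longlongrightarrow> Im (\<psi> (u,u))) (at_right 0)"
      by (intro tendsto_Im tendsto_into[OF \<psi> uu]) (auto intro!: tendsto_eq_intros eventually_mono[OF ev])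
    then show ?thesis
      by (rule Lim_transform_eventually) (auto intro!: eventually_mono[OF ev] simp: L\<psi>)
  qed
  show "((\<lambda>\<alpha>. Im (L (u - \<alpha>, u))) \<longlongrightarrow> Im (\<psi> (u,u))) (at_right 0)" if "\<tau> i < u"
  proof -
    have ev: "\<forall>\<^sub>F \<alpha> in at_right 0. (u - \<alpha>, u) \<in> proper_triangle i \<and> 0 < \<alpha>"
      using that u m by (intro eventually_at_rightI[of 0 "min m (u - \<tau> i)"]) (auto simp: proper_triangle_def m_def)
    have "((\<lambda>\<alpha>. Im (\<psi> (u - \<alpha>, u))) \<longlongrightarrow> Im (\<psi> (u,u))) (at_right 0)"
      by (intro tendsto_Im tendsto_into[OF \<psi> uu]) (auto intro!: tendsto_eq_intros eventually_mono[OF ev])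
    then show ?thesis
      by (rule Lim_transform_eventually) (auto intro!: eventually_mono[OF ev] simp: L\<psi>)
  qed
qed

text \<open>The quotient of the outgoing by the incoming velocity at a vertex, in the frame there; its argument
  is the exterior angle. The last vertex is followed by piece \<open>0\<close>.\<close>
definition turn :: "nat \<Rightarrow> complex" where
  "turn i = in_frame (\<tau> (Suc i)) (v (Suc i mod n) (\<tau> (Suc i mod n))) / in_frame (\<tau> (Suc i)) (v i (\<tau> (Suc i)))"

text \<open>On every piece, the angle of the velocity is the argument of the secants, extended to the diagonal.
  At the vertices between two pieces, \<open>log_turn_at_corner\<close> compares the extensions from the two sides.
  At the last vertex the secants near the end meet those near the start with the opposite sign,
  which is where \<open>k\<close> enters.\<close>
lemma rotation:
  assumes L: "continuous_on secant_domain L" "\<And>x. x \<in> secant_domain \<Longrightarrow> exp (L x) = framed_secant x"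
    and k: "\<And>s. s \<in> {a<..<b} \<Longrightarrow> L (s,b) = L (a,s) + k"
    and no_cusp: "\<And>i. i < n \<Longrightarrow> turn i \<notin> \<real>\<^sub>\<le>\<^sub>0"
  obtains \<theta> where "\<And>i. i < n \<Longrightarrow> continuous_on {\<tau> i..\<tau> (Suc i)} (\<theta> i)"
    and "\<And>i t. i < n \<Longrightarrow> t \<in> {\<tau> i..\<tau> (Suc i)} \<Longrightarrow> in_frame t (v i t) = of_real (cmod (in_frame t (v i t))) * cis (\<theta> i t)"
    and "(\<Sum>i<n. \<theta> i (\<tau> (Suc i)) - \<theta> i (\<tau> i)) + (\<Sum>i<n. Im (Ln (turn i))) = 2 * Im k"
proof -
  obtain \<psi> where \<psi>: "\<And>i. i < n \<Longrightarrow> continuous_on (proper_triangle i) (\<psi> i)"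
    "\<And>i x. i < n \<Longrightarrow> x \<in> proper_triangle i \<Longrightarrow> exp (\<psi> i x) = framed_mean i x"
    "\<And>i s t. i < n \<Longrightarrow> (s,t) \<in> proper_triangle i \<Longrightarrow> s < t \<Longrightarrow> Im (L (s,t)) = Im (\<psi> i (s,t))"
    using piece_log[OF L] by metis
  define \<theta> where "\<theta> i t = Im (\<psi> i (t,t))" for i t
  have diag: "(t,t) \<in> proper_triangle i" if "t \<in> {\<tau> i..\<tau> (Suc i)}" for i t
    using that a_less_b by (auto simp: proper_triangle_def)
  have \<theta>_cont: "continuous_on {\<tau> i..\<tau> (Suc i)} (\<theta> i)" if "i < n" for i
    unfolding \<theta>_def by (intro continuous_intros continuous_on_compose2[OF \<psi>(1)[OF that]]) (use diag in auto)
  have \<theta>_cis: "in_frame t (v i t) = of_real (cmod (in_frame t (v i t))) * cis (\<theta> i t)"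
    if "i < n" "t \<in> {\<tau> i..\<tau> (Suc i)}" for i t
  proof -
    have "in_frame t (v i t) = exp (\<psi> i (t,t))"
      using \<psi>(2)[OF that(1) diag[OF that(2)]] by (simp add: framed_mean_def mean_frame_diag mean_velocity_diag)
    then show ?thesis by (simp add: \<theta>_def exp_eq_polar norm_mult)
  qed
  have lim_start: "((\<lambda>\<beta>. Im (L (\<tau> i, \<tau> i + \<beta>))) \<longlongrightarrow> \<theta> i (\<tau> i)) (at_right 0)" if "i < n" for i
    unfolding \<theta>_def
    by (rule piece_limits(1)[OF that \<psi>(1)[OF that] \<psi>(3)[OF that]]) (use \<tau>_less[OF that] in auto)
  have lim_end: "((\<lambda>\<alpha>. Im (L (\<tau> (Suc i) - \<alpha>, \<tau> (Suc i)))) \<longlongrightarrow> \<theta> i (\<tau> (Suc i))) (at_right 0)" if "i < n" for i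
    unfolding \<theta>_def
    by (rule piece_limits(2)[OF that \<psi>(1)[OF that] \<psi>(3)[OF that]]) (use \<tau>_less[OF that] in auto)
  \<comment> \<open>the corner is the pair \<open>(u, u)\<close>: the secant from \<open>u - \<alpha>\<close> to \<open>u + \<beta>\<close> is split at the vertex\<close>
  have inner: "\<theta> (Suc i) (\<tau> (Suc i)) - \<theta> i (\<tau> (Suc i)) = Im (Ln (turn i))" if i: "Suc i < n" for i
  proof -
    define u where "u = \<tau> (Suc i)"
    define h where "h = min (u - \<tau> i) (\<tau> (Suc (Suc i)) - u) / 2"
    have i': "i < n" using i by simp
    have h: "0 < h" using \<tau>_less[OF i'] \<tau>_less[OF i] by (auto simp: h_def u_def)
    have "2 * h \<le> u - \<tau> i" "2 * h \<le> \<tau> (Suc (Suc i)) - u" by (simp_all add: h_def)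
    then have hh: "\<tau> i < u - h" "u + h < \<tau> (Suc (Suc i))" using h by linarith+
    have ab: "a \<le> \<tau> i" "\<tau> (Suc (Suc i)) \<le> b" using \<tau>_mono[of 0 i] \<tau>_mono[of "Suc (Suc i)" n] i by auto
    define B where "B = {0..h} \<times> {0..h}"
    define f1 where "f1 = (\<lambda>x::real \<times> real. mean_frame (u - fst x) (u + snd x) (mean_velocity i (u - fst x, u)))"
    define f2 where "f2 = (\<lambda>x::real \<times> real. mean_frame (u - fst x) (u + snd x) (mean_velocity (Suc i) (u, u + snd x)))"
    have B0: "(0,0) \<in> B" using h by (simp add: B_def)
    have Tin: "(u - fst x, u) \<in> triangle i" "(u, u + snd x) \<in> triangle (Suc i)" if "x \<in> B" for x
      using that hh by (auto simp: B_def triangle_def u_def)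
    have Xin: "(u - fst x, u + snd x) \<in> secant_domain" if "x \<in> B" "x \<noteq> (0,0)" for x
      using that hh ab by (cases x) (auto simp: B_def secant_domain_def)
    have "continuous_on B f1" unfolding f1_def
      by (intro cont_mean_frame continuous_intros continuous_on_compose2[OF mean_velocity_continuous[OF i']])
        (use Tin hh ab in \<open>auto simp: B_def\<close>)
    then have c1: "continuous (at (0,0) within B) f1" using B0 by (simp add: continuous_on_eq_continuous_within)
    have "continuous_on B f2" unfolding f2_def
      by (intro cont_mean_frame continuous_intros continuous_on_compose2[OF mean_velocity_continuous[OF i]])
        (use Tin hh ab in \<open>auto simp: B_def\<close>)
    then have c2: "continuous (at (0,0) within B) f2" using B0 by (simp add: continuous_on_eq_continuous_within)
    have cL: "continuous_on (B - {(0,0)}) (\<lambda>x. L (u - fst x, u + snd x))"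
      by (intro continuous_on_compose2[OF L(1)] continuous_intros) (use Xin in auto)
    have e: "exp (L (u - fst (\<alpha>,\<beta>), u + snd (\<alpha>,\<beta>))) = of_real \<alpha> * f1 (\<alpha>,\<beta>) + of_real \<beta> * f2 (\<alpha>,\<beta>)"
      if x: "(\<alpha>,\<beta>) \<in> B" "(\<alpha>,\<beta>) \<noteq> (0,0)" for \<alpha> \<beta>
    proof -
      have "z (u + \<beta>) - z (u - \<alpha>) = (z u - z (u - \<alpha>)) + (z (u + \<beta>) - z u)" by simp
      also have "\<dots> = of_real \<alpha> * mean_velocity i (u - \<alpha>, u) + of_real \<beta> * mean_velocity (Suc i) (u, u + \<beta>)"
        using secant_eq_mean_velocity[OF i' Tin(1)[OF x(1)]] secant_eq_mean_velocity[OF i Tin(2)[OF x(1)]] by simp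
      finally show ?thesis
        using L(2)[OF Xin[OF x]] by (simp add: framed_secant_def f1_def f2_def mean_frame_add mean_frame_scale)
    qed
    have vp: "v i u \<noteq> 0" using v_nz[OF i', of u] \<tau>_less[OF i'] by (simp add: u_def)
    have uab: "u \<in> {a..b}" using hh ab h by auto
    have "Im (Ln (in_frame u (v (Suc i) u) / in_frame u (v i u))) = \<theta> (Suc i) u - \<theta> i u"
    proof (rule log_turn_at_corner[OF h B_def c1 c2 cL e, symmetric])
      show "f1 (0,0) = in_frame u (v i u)" "f2 (0,0) = in_frame u (v (Suc i) u)"
        by (auto simp: f1_def f2_def mean_frame_diag mean_velocity_diag)
      show "in_frame u (v i u) \<noteq> 0" using mean_frame_nonzero[OF uab uab vp] by (simp add: mean_frame_diag)
      show "in_frame u (v (Suc i) u) / in_frame u (v i u) \<notin> \<real>\<^sub>\<le>\<^sub>0"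
        using no_cusp[OF i'] i by (simp add: turn_def u_def)
      show "((\<lambda>\<alpha>. Im (L (u - fst (\<alpha>, 0::real), u + snd (\<alpha>, 0::real)))) \<longlongrightarrow> \<theta> i u) (at_right 0)"
        using lim_end[OF i'] by (simp add: u_def)
      show "((\<lambda>\<beta>. Im (L (u - fst (0::real, \<beta>), u + snd (0::real, \<beta>)))) \<longlongrightarrow> \<theta> (Suc i) u) (at_right 0)"
        using lim_start[OF i] by (simp add: u_def)
    qed
    then show ?thesis using i by (simp add: turn_def u_def)
  qed
  obtain m where m: "n = Suc m" using n_pos gr0_implies_Suc by blast
  \<comment> \<open>the corner is the pair \<open>(a, b)\<close>; the sign of the secant is absorbed by adding \<open>\<i> \<pi>\<close> to the
    logarithm\<close>
  have outer: "\<theta> 0 a - \<theta> m b + 2 * Im k = Im (Ln (turn m))"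
  proof -
    have m0: "m < n" "0 < n" using m by auto
    have bm: "b = \<tau> (Suc m)" by (simp add: m)
    have "Suc m mod n = 0" by (simp add: m)
    then have turn_m: "turn m = in_frame a (v 0 a) / in_frame a (v m b)"
      by (simp add: turn_def in_frame_ends flip: bm)
    define h where "h = min (\<tau> 1 - a) (b - \<tau> m) / 3"
    have h: "0 < h" using \<tau>_less[OF m0(1)] \<tau>_less[OF m0(2)] by (auto simp: h_def bm)
    have h3: "3 * h \<le> \<tau> 1 - a" "3 * h \<le> b - \<tau> m" by (simp_all add: h_def)
    then have hh: "a + h < \<tau> 1" "\<tau> m < b - h" using h by linarith+
    have ab: "a \<le> \<tau> m" "\<tau> 1 \<le> b" using \<tau>_mono[of 0 m] \<tau>_mono[of 1 n] m by auto
    have h2: "2 * h < b - a" using h h3 ab by linarith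
    define B where "B = {0..h} \<times> {0..h}"
    define f1 where "f1 = (\<lambda>x::real \<times> real. mean_frame (a + snd x) (b - fst x) (mean_velocity m (b - fst x, b)))"
    define f2 where "f2 = (\<lambda>x::real \<times> real. mean_frame (a + snd x) (b - fst x) (mean_velocity 0 (a, a + snd x)))"
    have B0: "(0,0) \<in> B" using h by (simp add: B_def)
    have Tin: "(b - fst x, b) \<in> triangle m" "(a, a + snd x) \<in> triangle 0" if "x \<in> B" for x
      using that hh by (auto simp: B_def triangle_def bm)
    have Xin: "(a + snd x, b - fst x) \<in> secant_domain" if "x \<in> B" "x \<noteq> (0,0)" for x
      using that hh ab h2 by (cases x) (auto simp: B_def secant_domain_def)
    have "continuous_on B f1" unfolding f1_def
      by (intro cont_mean_frame continuous_intros continuous_on_compose2[OF mean_velocity_continuous[OF m0(1)]])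
        (use Tin hh ab in \<open>auto simp: B_def\<close>)
    then have c1: "continuous (at (0,0) within B) f1" using B0 by (simp add: continuous_on_eq_continuous_within)
    have "continuous_on B f2" unfolding f2_def
      by (intro cont_mean_frame continuous_intros continuous_on_compose2[OF mean_velocity_continuous[OF m0(2)]])
        (use Tin hh ab in \<open>auto simp: B_def\<close>)
    then have c2: "continuous (at (0,0) within B) f2" using B0 by (simp add: continuous_on_eq_continuous_within)
    have cL: "continuous_on (B - {(0,0)}) (\<lambda>x. L (a + snd x, b - fst x) + \<i> * pi)"
      by (intro continuous_intros continuous_on_compose2[OF L(1)]) (use Xin in auto)
    have e: "exp (L (a + snd (\<alpha>,\<beta>), b - fst (\<alpha>,\<beta>)) + \<i> * pi) = of_real \<alpha> * f1 (\<alpha>,\<beta>) + of_real \<beta> * f2 (\<alpha>,\<beta>)"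
      if x: "(\<alpha>,\<beta>) \<in> B" "(\<alpha>,\<beta>) \<noteq> (0,0)" for \<alpha> \<beta>
    proof -
      have "- (z (b - \<alpha>) - z (a + \<beta>)) = (z b - z (b - \<alpha>)) + (z (a + \<beta>) - z a)" by (simp add: closed)
      also have "\<dots> = of_real \<alpha> * mean_velocity m (b - \<alpha>, b) + of_real \<beta> * mean_velocity 0 (a, a + \<beta>)"
        using secant_eq_mean_velocity[OF m0(1) Tin(1)[OF x(1)]] secant_eq_mean_velocity[OF m0(2) Tin(2)[OF x(1)]] by simp
      finally have "mean_frame (a + \<beta>) (b - \<alpha>) (- (z (b - \<alpha>) - z (a + \<beta>))) = of_real \<alpha> * f1 (\<alpha>,\<beta>) + of_real \<beta> * f2 (\<alpha>,\<beta>)"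
        by (simp only: f1_def f2_def mean_frame_add mean_frame_scale fst_conv snd_conv)
      then show ?thesis
        using L(2)[OF Xin[OF x]] by (simp add: framed_secant_def exp_add mean_frame_minus mult.commute[of \<i>] del: minus_diff_eq)
    qed
    have vp: "v m b \<noteq> 0" using v_nz[OF m0(1), of b] \<tau>_less[OF m0(1)] by (simp add: bm)
    have uab: "a \<in> {a..b}" "b \<in> {a..b}" using a_less_b by auto
    have "Im (Ln (in_frame a (v 0 a) / in_frame a (v m b))) = (\<theta> 0 a + Im k + pi) - (\<theta> m b - Im k + pi)"
    proof (rule log_turn_at_corner[OF h B_def c1 c2 cL e, symmetric])
      show "f1 (0,0) = in_frame a (v m b)" "f2 (0,0) = in_frame a (v 0 a)"
        by (auto simp: f1_def f2_def mean_frame_ends mean_velocity_diag)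
      show "in_frame a (v m b) \<noteq> 0" using mean_frame_nonzero[OF uab vp] by (simp add: mean_frame_ends)
      show "in_frame a (v 0 a) / in_frame a (v m b) \<notin> \<real>\<^sub>\<le>\<^sub>0"
        using no_cusp[OF m0(1)] by (simp add: turn_m)
      have ev: "\<forall>\<^sub>F \<alpha> in at_right 0. \<alpha> \<in> {0<..<b - a}"
        using a_less_b by (intro eventually_at_rightI[of 0 "b - a"]) auto
      have "((\<lambda>\<alpha>. Im (L (b - \<alpha>, b)) - Im k + pi) \<longlongrightarrow> \<theta> m b - Im k + pi) (at_right 0)"
        using lim_end[OF m0(1)] by (intro tendsto_intros) (simp add: bm)
      then show "((\<lambda>\<alpha>. Im (L (a + snd (\<alpha>, 0::real), b - fst (\<alpha>, 0::real)) + \<i> * pi)) \<longlongrightarrow> \<theta> m b - Im k + pi) (at_right 0)"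
        by (rule Lim_transform_eventually) (auto intro!: eventually_mono[OF ev] simp: k)
      have "((\<lambda>\<beta>. Im (L (a, a + \<beta>)) + Im k + pi) \<longlongrightarrow> \<theta> 0 a + Im k + pi) (at_right 0)"
        using lim_start[OF m0(2)] by (intro tendsto_intros) simp
      then show "((\<lambda>\<beta>. Im (L (a + snd (0::real, \<beta>), b - fst (0::real, \<beta>)) + \<i> * pi)) \<longlongrightarrow> \<theta> 0 a + Im k + pi) (at_right 0)"
        by (rule Lim_transform_eventually) (auto intro!: eventually_mono[OF ev] simp: k)
    qed
    then show ?thesis by (simp add: turn_m)
  qed
  \<comment> \<open>the angles telescope over the inner vertices, and the last vertex closes the sum\<close>
  have telescope: "j \<le> m \<Longrightarrow> (\<Sum>i<j. \<theta> i (\<tau> (Suc i)) - \<theta> i (\<tau> i)) + (\<Sum>i<j. Im (Ln (turn i))) = \<theta> j (\<tau> j) - \<theta> 0 a" for j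
  proof (induction j)
    case (Suc j)
    then show ?case using inner[of j] by (simp add: m)
  qed simp
  show thesis
  proof (rule that[OF \<theta>_cont \<theta>_cis])
    show "(\<Sum>i<n. \<theta> i (\<tau> (Suc i)) - \<theta> i (\<tau> i)) + (\<Sum>i<n. Im (Ln (turn i))) = 2 * Im k"
      using telescope[of m] outer by (simp add: m)
  qed auto
qed

end


section \<open>Hopf's Umlaufsatz\<close>

context cornered_loop
begin

definition loop :: "real \<Rightarrow> complex" where
  "loop x = z (a + x * (b - a))"

lemma loop_param: "x \<in> {0..1} \<Longrightarrow> a + x * (b - a) \<in> {a..b}"
  using between_param[of a a b b x] a_less_b by auto

lemma path_loop: "path loop"
  unfolding path_def loop_def
  by (intro continuous_on_compose2[OF cont_z] continuous_intros) (use loop_param in auto)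

lemma path_image_loop: "path_image loop = z ` {a..b}"
proof -
  have "t \<in> (\<lambda>x. a + x * (b - a)) ` {0..1}" if "t \<in> {a..b}" for t
    using that a_less_b by (intro image_eqI[of _ _ "(t - a) / (b - a)"]) (auto simp: field_simps)
  then have "(\<lambda>x. a + x * (b - a)) ` {0..1} = {a..b}" using loop_param by auto
  then show ?thesis unfolding path_image_def loop_def by (metis image_image)
qed

lemma loop_ends: "pathstart loop = z a" "pathfinish loop = z a"
  by (simp_all add: pathstart_def pathfinish_def loop_def closed)

lemma z_eqD:
  assumes "s \<in> {a..b}" "t \<in> {a..b}" "z s = z t" "s < t"
  shows "s = a \<and> t = b"
proof -
  have "(s, t) \<notin> secant_domain" using z_neq[of s t] assms by auto
  then have "\<not> t - s < b - a" using assms by (auto simp: secant_domain_def)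
  then show ?thesis using assms by auto
qed

lemma simple_loop: "simple_path loop"
proof -
  have "x = y \<or> x = 0 \<and> y = 1 \<or> x = 1 \<and> y = 0"
    if x: "x \<in> {0..1}" and y: "y \<in> {0..1}" and eq: "loop x = loop y" for x y
  proof -
    have *: "x' = 0 \<and> y' = 1" if "x' \<in> {0..1}" "y' \<in> {0..1}" "loop x' = loop y'" "x' < y'" for x' y'
    proof -
      have "a + x' * (b - a) < a + y' * (b - a)" using that a_less_b by simp
      then have "a + x' * (b - a) = a \<and> a + y' * (b - a) = b"
        using z_eqD[OF loop_param[OF that(1)] loop_param[OF that(2)]] that by (simp add: loop_def)
      then have "x' * (b - a) = 0" "(1 - y') * (b - a) = 0" by (auto simp: algebra_simps)
      then show ?thesis using a_less_b by simp
    qed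
    show ?thesis using *[OF x y eq] *[OF y x eq[symmetric]] by linarith
  qed
  then show ?thesis by (simp add: simple_path_def loop_free_def path_loop)
qed

lemma winding_number_via_log:
  assumes l: "continuous_on {a..b} l" "\<And>t. t \<in> {a..b} \<Longrightarrow> exp (l t) = z t - \<zeta>"
  shows "l b - l a = 2 * pi * \<i> * winding_number loop \<zeta>"
proof -
  define m where "m x = l (a + x * (b - a))" for x
  have "path m"
    unfolding path_def m_def
    by (intro continuous_on_compose2[OF l(1)] continuous_intros) (use loop_param in auto)
  then have "winding_number (exp \<circ> m) 0 = (pathfinish m - pathstart m) / (2 * of_real pi * \<i>)"
    by (rule winding_number_compose_exp)
  moreover have "winding_number loop \<zeta> = winding_number (\<lambda>x. loop x - \<zeta>) 0"
    by (rule winding_number_offset)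
  moreover have "winding_number (\<lambda>x. loop x - \<zeta>) 0 = winding_number (exp \<circ> m) 0"
    using l(2)[OF loop_param] by (intro winding_number_cong) (auto simp: loop_def m_def)
  ultimately show ?thesis by (simp add: pathfinish_def pathstart_def m_def)
qed

text \<open>Near \<open>u\<close> the mean velocities are not parallel to \<open>N\<close>, hence neither are the secants through
  \<open>z u\<close>; the rest of the loop has a positive distance from \<open>z u\<close>.\<close>
lemma transversal_avoids:
  assumes i: "i < n" and u: "u \<in> {\<tau> i<..<\<tau> (Suc i)}" and N: "Im (N / v i u) \<noteq> 0"
  obtains h0 where "0 < h0"
    "\<And>t h. t \<in> {a..b} \<Longrightarrow> h \<in> {0..h0} \<Longrightarrow> (t,h) \<noteq> (u,0) \<Longrightarrow> z t \<noteq> z u + of_real h * N"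
proof -
  have uT: "(u,u) \<in> triangle i" using u by (auto simp: triangle_def)
  have N0: "N \<noteq> 0" using N by auto
  have uab: "u \<in> {a<..<b}" using u \<tau>_mono[of 0 i] \<tau>_mono[of "Suc i" n] i by auto
  have "Im (v i u / N) \<noteq> 0" using N by (auto simp: Im_divide mult.commute)
  moreover have "continuous_on (triangle i) (\<lambda>x. Im (mean_velocity i x / N))"
    using N0 by (intro continuous_intros mean_velocity_continuous i) auto
  then have "((\<lambda>x. Im (mean_velocity i x / N)) \<longlongrightarrow> Im (v i u / N)) (at (u,u) within triangle i)"
    using uT by (auto simp: continuous_on_def mean_velocity_diag)
  ultimately have "\<forall>\<^sub>F x in at (u,u) within triangle i. Im (mean_velocity i x / N) \<noteq> 0"
    using tendsto_imp_eventually_ne by blast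
  then obtain d where d: "0 < d" "\<And>x. x \<in> triangle i \<Longrightarrow> x \<noteq> (u,u) \<Longrightarrow> dist x (u,u) < d \<Longrightarrow> Im (mean_velocity i x / N) \<noteq> 0"
    unfolding eventually_at by auto
  define e where "e = Min {d, u - \<tau> i, \<tau> (Suc i) - u}"
  have e: "0 < e" "e \<le> d" "e \<le> u - \<tau> i" "e \<le> \<tau> (Suc i) - u" using d u by (auto simp: e_def)
  have near: "z t \<noteq> z u + of_real h * N" if t: "\<bar>t - u\<bar> < e" "(t,h) \<noteq> (u,0)" for t h
  proof
    assume eq: "z t = z u + of_real h * N"
    have t0: "t \<noteq> u" using eq t N0 by auto
    have False if st: "(s', t') \<in> triangle i" "(s', t') \<noteq> (u,u)" "dist (s',t') (u,u) < d" "s' \<noteq> t'"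
      "z t' - z s' = of_real h' * N" for s' t' h'
    proof -
      have "of_real (t' - s') * mean_velocity i (s',t') = of_real h' * N" using secant_eq_mean_velocity[OF i st(1)] st(5) by simp
      then have "mean_velocity i (s',t') / N = of_real (h' / (t' - s'))"
        using st(4) N0 by (simp add: field_simps)
      then show False using d(2)[OF st(1,2,3)] by simp
    qed note * = this
    show False
    proof (cases "t < u")
      case True
      have "dist (t,u) (u,u) < d" using t(1) e by (simp add: dist_prod_def dist_real_def)
      moreover have "(t,u) \<in> triangle i" using True t(1) e u by (simp add: triangle_def)
      moreover have "z u - z t = of_real (-h) * N" by (simp add: eq)
      ultimately show False using True by (intro *[of t u "-h"]) simp_all
    next
      case False
      have "dist (u,t) (u,u) < d" using t(1) e by (simp add: dist_prod_def dist_real_def)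
      moreover have "(u,t) \<in> triangle i" using False t(1) e u by (simp add: triangle_def)
      moreover have "z t - z u = of_real h * N" by (simp add: eq)
      ultimately show False using False t0 by (intro *[of u t h]) simp_all
    qed
  qed
  define K where "K = z ` ({a..b} \<inter> {t. e \<le> \<bar>t - u\<bar>})"
  have "compact K" unfolding K_def
    by (intro compact_continuous_image continuous_on_subset[OF cont_z] compact_Int_closed closed_Collect_le continuous_intros) auto
  then have "closed K" by (rule compact_imp_closed)
  moreover have "z u \<notin> K"
  proof
    assume "z u \<in> K"
    then obtain t where t: "t \<in> {a..b}" "e \<le> \<bar>t - u\<bar>" "z u = z t" by (auto simp: K_def)
    then consider "t < u" | "u < t" using e by force
    then show False
    proof cases
      case 1
      then show False using z_eqD[of t u] t uab by simp
    next
      case 2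
      then show False using z_eqD[of u t] t uab by simp
    qed
  qed
  ultimately obtain D where D: "0 < D" "\<And>x. x \<in> K \<Longrightarrow> D \<le> dist (z u) x"
    using separate_point_closed[of K "z u"] by auto
  show thesis
  proof
    show "0 < D / (2 * cmod N)" using D N0 by simp
    fix t h assume t: "t \<in> {a..b}" and h: "h \<in> {0..D / (2 * cmod N)}" and ne: "(t,h) \<noteq> (u,0)"
    show "z t \<noteq> z u + of_real h * N"
    proof (cases "\<bar>t - u\<bar> < e")
      case True
      then show ?thesis using near ne by blast
    next
      case False
      then have "D \<le> dist (z u) (z t)" using t by (intro D) (auto simp: K_def)
      moreover have "cmod (of_real h * N) < D"
        using h N0 D by (auto simp: norm_mult field_simps)
      ultimately show ?thesis by (auto simp: dist_norm norm_minus_commute)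
    qed
  qed
qed

text \<open>The box is starlike about the point opposite to the one removed; hence continuous logarithms exist
  on it.\<close>
lemma starlike_box_minus_boundary_point:
  fixes c d u h0 :: real
  assumes u: "u \<in> {c..d}" and h0: "0 < h0"
  shows "starlike ({c..d} \<times> {0..h0} - {(u, 0)})"
proof -
  define Y where "Y = {c..d} \<times> {0..h0} - {(u, 0)}"
  have "starlike Y"
      unfolding starlike_def
    proof (intro bexI[of _ "(u,h0)"] ballI)
      show "(u,h0) \<in> Y" using u h0 by (auto simp: Y_def)
      fix x assume x: "x \<in> Y"
      have "convex ({c..d} \<times> {0..h0})" by (intro convex_Times) auto
      then have seg: "closed_segment (u,h0) x \<subseteq> {c..d} \<times> {0..h0}"
        using x \<open>(u,h0) \<in> Y\<close> by (intro closed_segment_subset) (auto simp: Y_def)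
      moreover have "(u,0) \<notin> closed_segment (u,h0) x"
      proof
        assume "(u,0) \<in> closed_segment (u,h0) x"
        then obtain w where w: "0 \<le> w" "w \<le> 1" "(u,0) = (1 - w) *\<^sub>R (u,h0) + w *\<^sub>R x"
          by (auto simp: closed_segment_def)
        obtain x1 x2 where xx: "x = (x1,x2)" by fastforce
        have x2: "0 \<le> x2" using x xx by (auto simp: Y_def)
        have eq: "u = (1 - w) * u + w * x1" "0 = (1 - w) * h0 + w * x2" using w(3) xx by auto
        have "0 \<le> (1 - w) * h0" "0 \<le> w * x2" using w h0 x2 by auto
        then have "(1 - w) * h0 = 0" "w * x2 = 0" using eq(2) by linarith+
        then have "w = 1" "x2 = 0" using h0 by auto
        then show False using eq(1) x xx by (auto simp: Y_def)
      qed
      ultimately show "closed_segment (u,h0) x \<subseteq> Y" by (auto simp: Y_def)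
    qed
  then show ?thesis by (simp add: Y_def)
qed

text \<open>The winding number about \<open>z u + h N\<close> is the change along the loop of a logarithm \<open>l\<close> of
  \<open>z t - (z u + h N)\<close>, where \<open>(t, h)\<close> ranges over a box without the point \<open>(u, 0)\<close>. On the edge
  \<open>h = 0\<close> this is a logarithm of secants, with different constants before and after \<open>u\<close>. The two
  constants are compared along the normal \<open>t = u\<close> by a corner computation on either side of it;
  the difference is \<open>\<pi>\<close> with the sign of the side to which \<open>N\<close> points.\<close>
lemma winding_number_beside_curve:
  assumes L0: "continuous_on secant_domain L0" "\<And>s t. (s,t) \<in> secant_domain \<Longrightarrow> exp (L0 (s,t)) = z t - z s"
    and k: "\<And>s. s \<in> {a<..<b} \<Longrightarrow> L0 (s,b) = L0 (a,s) + k"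
    and i: "i < n" and u: "u \<in> {\<tau> i<..<\<tau> (Suc i)}" and N: "Im (N / v i u) \<noteq> 0"
  shows "\<forall>\<^sub>F h in at_right 0. z u + of_real h * N \<notin> path_image loop \<and>
           2 * pi * Re (winding_number loop (z u + of_real h * N)) = Im k + pi * sgn (Im (N / v i u))"
proof -
  \<comment> \<open>with the constant standard frame, framed secants are secants\<close>
  interpret id: framed_loop z v n \<tau> "\<lambda>_. 1" "\<lambda>_. 0" "\<lambda>_. 1"
    by unfold_locales auto
  have idH: "id.framed_secant (s,t) = z t - z s" for s t
    by (simp add: id.framed_secant_def id.mean_frame_def shear_def complex_eq_iff)
  have L0H: "exp (L0 x) = id.framed_secant x" if "x \<in> secant_domain" for x
    using L0(2)[of "fst x" "snd x"] idH[of "fst x" "snd x"] that by simp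
  have uab: "u \<in> {a<..<b}" using u \<tau>_mono[of 0 i] \<tau>_mono[of "Suc i" n] i by auto
  have N0: "N \<noteq> 0" using N by auto
  have v0: "v i u \<noteq> 0" using N by auto
  obtain h0 where h0: "0 < h0"
    "\<And>t h. t \<in> {a..b} \<Longrightarrow> h \<in> {0..h0} \<Longrightarrow> (t,h) \<noteq> (u,0) \<Longrightarrow> z t \<noteq> z u + of_real h * N"
    by (rule transversal_avoids[OF i u N]) blast
  have "\<exists>\<psi>. continuous_on (id.proper_triangle i) \<psi> \<and> (\<forall>x\<in>id.proper_triangle i. exp (\<psi> x) = id.framed_mean i x) \<and>
      (\<forall>s t. (s,t) \<in> id.proper_triangle i \<and> s < t \<longrightarrow> Im (L0 (s,t)) = Im (\<psi> (s,t)))"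
    by (rule id.piece_log[OF L0(1) L0H i])
  then obtain \<psi> where \<psi>: "continuous_on (id.proper_triangle i) \<psi>"
    "\<And>s t. (s,t) \<in> id.proper_triangle i \<Longrightarrow> s < t \<Longrightarrow> Im (L0 (s,t)) = Im (\<psi> (s,t))"
    by blast
  have lim_up: "((\<lambda>\<beta>. Im (L0 (u, u + \<beta>))) \<longlongrightarrow> Im (\<psi> (u,u))) (at_right 0)"
    by (rule id.piece_limits(1)[OF i \<psi>]) (use u in auto)
  have lim_down: "((\<lambda>\<alpha>. Im (L0 (u - \<alpha>, u))) \<longlongrightarrow> Im (\<psi> (u,u))) (at_right 0)"
    by (rule id.piece_limits(2)[OF i \<psi>]) (use u in auto)
  define Y where "Y = {a..b} \<times> {0..h0} - {(u, 0)}"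
  define f where "f = (\<lambda>x::real \<times> real. z (fst x) - (z u + of_real (snd x) * N))"
  have f_nz: "f x \<noteq> 0" if "x \<in> Y" for x
    using h0(2)[of "fst x" "snd x"] that by (cases x) (auto simp: f_def Y_def)
  have f_cont: "continuous_on Y f" unfolding f_def
    by (intro continuous_intros continuous_on_compose2[OF cont_z]) (auto simp: Y_def)
  have "starlike Y" unfolding Y_def using uab h0(1) by (intro starlike_box_minus_boundary_point) auto
  then have contr: "contractible Y" by (rule starlike_imp_contractible)
  obtain l where l: "continuous_on Y l" "\<And>x. x \<in> Y \<Longrightarrow> f x = exp (l x)"
    by (rule continuous_logarithm_on_contractible[OF f_cont contr f_nz]) auto
  have l_comp: "continuous_on S (\<lambda>x. l (g1 x, g2 x))"
    if "continuous_on S g1" "continuous_on S g2" "\<And>x. x \<in> S \<Longrightarrow> (g1 x, g2 x) \<in> Y" for S :: "'x::topological_space set" and g1 g2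
    by (rule continuous_on_compose2[OF l(1)]) (use that in \<open>auto intro!: continuous_intros\<close>)
  have L0_comp: "continuous_on S (\<lambda>x. L0 (g1 x, g2 x))"
    if "continuous_on S g1" "continuous_on S g2" "\<And>x. x \<in> S \<Longrightarrow> (g1 x, g2 x) \<in> secant_domain" for S :: "'x::topological_space set" and g1 g2
    by (rule continuous_on_compose2[OF L0(1)]) (use that in \<open>auto intro!: continuous_intros\<close>)
  \<comment> \<open>on the edge \<open>h = 0\<close>, after and before \<open>u\<close>\<close>
  have c_up: "continuous_on {u<..b} (\<lambda>t. l (t,0))" "continuous_on {u<..b} (\<lambda>t. L0 (u,t))"
    by (intro l_comp L0_comp continuous_intros; use uab h0 in \<open>auto simp: Y_def secant_domain_def\<close>)+
  have e_up: "exp (l (t,0)) = 1 * exp (L0 (u,t))" if "t \<in> {u<..b}" for t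
    using L0(2)[of u t] l(2)[of "(t,0)"] that uab h0 by (auto simp: f_def secant_domain_def Y_def)
  obtain c1 where c1: "\<And>t. t \<in> {u<..b} \<Longrightarrow> l (t,0) = L0 (u,t) + c1"
    by (rule continuous_logs_differ_by_constant[OF _ c_up e_up]) auto
  have c_down: "continuous_on {a..<u} (\<lambda>t. l (t,0))" "continuous_on {a..<u} (\<lambda>t. L0 (t,u))"
    by (intro l_comp L0_comp continuous_intros; use uab h0 in \<open>auto simp: Y_def secant_domain_def\<close>)+
  have e_down: "exp (l (t,0)) = (-1) * exp (L0 (t,u))" if "t \<in> {a..<u}" for t
    using L0(2)[of t u] l(2)[of "(t,0)"] that uab h0 by (auto simp: f_def secant_domain_def Y_def)
  obtain c2 where c2: "\<And>t. t \<in> {a..<u} \<Longrightarrow> l (t,0) = L0 (t,u) + c2"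
    by (rule continuous_logs_differ_by_constant[OF _ c_down e_down]) auto
  \<comment> \<open>on the normal through \<open>z u\<close>\<close>
  have c_norm: "continuous_on {0<..h0} (\<lambda>h. l (u,h))" "continuous_on {0<..h0} (\<lambda>h. complex_of_real (ln h))"
    by (intro l_comp continuous_intros; use uab h0 in \<open>auto simp: Y_def\<close>)+
  have e_norm: "exp (l (u,h)) = (-N) * exp (complex_of_real (ln h))" if "h \<in> {0<..h0}" for h
  proof -
    have "exp (complex_of_real (ln h)) = of_real h" using that by (subst exp_of_real) auto
    then show ?thesis using l(2)[of "(u,h)"] that uab by (auto simp: f_def Y_def mult.commute)
  qed
  obtain c3 where c3: "\<And>h. h \<in> {0<..h0} \<Longrightarrow> l (u,h) = complex_of_real (ln h) + c3"
    by (rule continuous_logs_differ_by_constant[OF _ c_norm e_norm]) (use N0 in auto)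
  define e where "e = Min {h0, u - \<tau> i, \<tau> (Suc i) - u}"
  have e: "0 < e" "e \<le> h0" "e \<le> u - \<tau> i" "e \<le> \<tau> (Suc i) - u" using h0 u by (auto simp: e_def)
  have "a \<le> \<tau> i" "\<tau> (Suc i) \<le> b" using \<tau>_mono[of 0 i] \<tau>_mono[of "Suc i" n] i by auto
  then have e': "a \<le> u - e" "u + e \<le> b" using e by linarith+
  define B where "B = {0..e} \<times> {0..e}"
  have B0: "(0,0) \<in> B" using e by (auto simp: B_def)
  have ev: "\<forall>\<^sub>F x in at_right 0. x \<in> {0<..<e}" using e by (intro eventually_at_rightI[of 0 e]) auto
  have lim_norm: "((\<lambda>\<beta>. Im (l (u,\<beta>))) \<longlongrightarrow> Im c3) (at_right 0)"
    by (rule Lim_transform_eventually[OF tendsto_const]) (use e in \<open>auto intro!: eventually_mono[OF ev] simp: c3\<close>)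
  have quot: "- N / v i u = - (N / v i u)" "- N / - v i u = N / v i u" by simp_all
  \<comment> \<open>the corner between the curve after \<open>u\<close> and the normal\<close>
  have "Im (Ln ((-N) / v i u)) = Im c3 - (Im (\<psi> (u,u)) + Im c1)"
  proof (rule log_turn_at_corner[OF e(1) B_def, symmetric])
    have "continuous_on B (\<lambda>x. mean_velocity i (u, u + fst x))"
      by (intro continuous_on_compose2[OF mean_velocity_continuous[OF i]] continuous_intros)
        (use e u in \<open>auto simp: B_def triangle_def\<close>)
    then show "continuous (at (0,0) within B) (\<lambda>x. mean_velocity i (u, u + fst x))"
      using B0 by (simp add: continuous_on_eq_continuous_within)
    show "continuous (at (0,0) within B) (\<lambda>x. -N)" by auto
    show "continuous_on (B - {(0,0)}) (\<lambda>x. l (u + fst x, snd x))"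
      using e e' by (intro l_comp continuous_intros) (auto simp: B_def Y_def)
    show "exp (l (u + fst (\<alpha>,\<beta>), snd (\<alpha>,\<beta>))) = of_real \<alpha> * mean_velocity i (u, u + fst (\<alpha>,\<beta>)) + of_real \<beta> * (-N)"
      if "(\<alpha>,\<beta>) \<in> B" "(\<alpha>,\<beta>) \<noteq> (0,0)" for \<alpha> \<beta>
    proof -
      have "(u, u + \<alpha>) \<in> triangle i" "(u + \<alpha>, \<beta>) \<in> Y" using that e e' u by (auto simp: B_def triangle_def Y_def)
      then show ?thesis
        using l(2)[of "(u + \<alpha>, \<beta>)"] secant_eq_mean_velocity[OF i, of u "u + \<alpha>"]
        by (simp add: f_def diff_diff_eq[symmetric])
    qed
    show "((\<lambda>\<beta>. Im (l (u + fst (0::real,\<beta>), snd (0::real,\<beta>)))) \<longlongrightarrow> Im c3) (at_right 0)"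
      using lim_norm by simp
    have "((\<lambda>\<alpha>. Im (L0 (u, u + \<alpha>)) + Im c1) \<longlongrightarrow> Im (\<psi> (u,u)) + Im c1) (at_right 0)"
      by (intro tendsto_intros lim_up)
    then show "((\<lambda>\<alpha>. Im (l (u + fst (\<alpha>,0::real), snd (\<alpha>,0::real)))) \<longlongrightarrow> Im (\<psi> (u,u)) + Im c1) (at_right 0)"
      by (rule Lim_transform_eventually) (use e' in \<open>auto intro!: eventually_mono[OF ev] simp: c1\<close>)
    show "- N / v i u \<notin> \<real>\<^sub>\<le>\<^sub>0" using N by (auto simp: complex_nonpos_Reals_iff)
  qed (use v0 in \<open>auto simp: mean_velocity_diag\<close>)
  \<comment> \<open>the corner between the curve before \<open>u\<close>, traversed backwards, and the normal\<close>
  moreover have "Im (Ln ((-N) / (- v i u))) = Im c3 - (Im (\<psi> (u,u)) + Im c2)"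
  proof (rule log_turn_at_corner[OF e(1) B_def, symmetric])
    have "continuous_on B (\<lambda>x. - mean_velocity i (u - fst x, u))"
      by (intro continuous_intros continuous_on_compose2[OF mean_velocity_continuous[OF i]])
        (use e u in \<open>auto simp: B_def triangle_def\<close>)
    then show "continuous (at (0,0) within B) (\<lambda>x. - mean_velocity i (u - fst x, u))"
      using B0 by (simp add: continuous_on_eq_continuous_within)
    show "continuous (at (0,0) within B) (\<lambda>x. -N)" by auto
    show "continuous_on (B - {(0,0)}) (\<lambda>x. l (u - fst x, snd x))"
      using e e' by (intro l_comp continuous_intros) (auto simp: B_def Y_def)
    show "exp (l (u - fst (\<alpha>,\<beta>), snd (\<alpha>,\<beta>))) = of_real \<alpha> * (- mean_velocity i (u - fst (\<alpha>,\<beta>), u)) + of_real \<beta> * (-N)"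
      if "(\<alpha>,\<beta>) \<in> B" "(\<alpha>,\<beta>) \<noteq> (0,0)" for \<alpha> \<beta>
    proof -
      have "(u - \<alpha>, u) \<in> triangle i" "(u - \<alpha>, \<beta>) \<in> Y" using that e e' u by (auto simp: B_def triangle_def Y_def)
      then have e1: "exp (l (u - \<alpha>, \<beta>)) = z (u - \<alpha>) - (z u + of_real \<beta> * N)"
        and e2: "z u - z (u - \<alpha>) = of_real \<alpha> * mean_velocity i (u - \<alpha>, u)"
        using l(2)[of "(u - \<alpha>, \<beta>)"] secant_eq_mean_velocity[OF i, of "u - \<alpha>" u] by (auto simp: f_def)
      have "exp (l (u - \<alpha>, \<beta>)) = - (z u - z (u - \<alpha>)) + of_real \<beta> * (- N)"
        unfolding e1 by simp
      then show ?thesis unfolding e2 by simp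
    qed
    show "((\<lambda>\<beta>. Im (l (u - fst (0::real,\<beta>), snd (0::real,\<beta>)))) \<longlongrightarrow> Im c3) (at_right 0)"
      using lim_norm by simp
    have "((\<lambda>\<alpha>. Im (L0 (u - \<alpha>, u)) + Im c2) \<longlongrightarrow> Im (\<psi> (u,u)) + Im c2) (at_right 0)"
      by (intro tendsto_intros lim_down)
    then show "((\<lambda>\<alpha>. Im (l (u - fst (\<alpha>,0::real), snd (\<alpha>,0::real)))) \<longlongrightarrow> Im (\<psi> (u,u)) + Im c2) (at_right 0)"
      by (rule Lim_transform_eventually) (use e' in \<open>auto intro!: eventually_mono[OF ev] simp: c2\<close>)
    show "- N / - v i u \<notin> \<real>\<^sub>\<le>\<^sub>0" using N by (auto simp: complex_nonpos_Reals_iff)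
  qed (use v0 in \<open>auto simp: mean_velocity_diag\<close>)
  moreover have "Im (Ln (N / v i u)) - Im (Ln (- (N / v i u))) = pi * sgn (Im (N / v i u))"
    using N v0 N0 by (subst Ln_minus) (auto simp: sgn_if)
  ultimately have jump: "Im c1 - Im c2 = pi * sgn (Im (N / v i u))"
    unfolding quot by linarith
  have bottom: "l (b,0) - l (a,0) = k + c1 - c2"
    using c1[of b] c2[of a] k[of u] uab by simp
  have wn: "z u + of_real h * N \<notin> path_image loop \<and>
      2 * pi * Re (winding_number loop (z u + of_real h * N)) = Im k + pi * sgn (Im (N / v i u))"
    if h: "0 < h" "h < h0" for h
  proof
    have Yh: "(t,h) \<in> Y" if "t \<in> {a..b}" for t using that h by (auto simp: Y_def)
    show "z u + of_real h * N \<notin> path_image loop"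
      using h0(2)[of _ h] h unfolding path_image_loop by fastforce
    have c_side: "continuous_on {0..h0} (\<lambda>h. l (b,h))" "continuous_on {0..h0} (\<lambda>h. l (a,h))"
      by (intro l_comp continuous_intros; use uab h0 in \<open>auto simp: Y_def\<close>)+
    have e_side: "exp (l (b,h)) = 1 * exp (l (a,h))" if "h \<in> {0..h0}" for h
      using l(2)[of "(b,h)"] l(2)[of "(a,h)"] that uab by (auto simp: Y_def f_def closed)
    obtain c4 where c4: "\<And>h. h \<in> {0..h0} \<Longrightarrow> l (b,h) = l (a,h) + c4"
      by (rule continuous_logs_differ_by_constant[OF _ c_side e_side]) auto
    \<comment> \<open>the loop is closed, so \<open>l\<close> changes equally along the two sides of the box\<close>
    have "l (b,h) - l (a,h) = l (b,0) - l (a,0)" using c4[of h] c4[of 0] h by simp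
    moreover have "l (b,h) - l (a,h) = 2 * pi * \<i> * winding_number loop (z u + of_real h * N)"
    proof (rule winding_number_via_log)
      show "continuous_on {a..b} (\<lambda>t. l (t,h))" by (intro l_comp continuous_intros) (use Yh in auto)
      show "exp (l (t,h)) = z t - (z u + of_real h * N)" if "t \<in> {a..b}" for t
        using l(2)[OF Yh[OF that]] by (simp add: f_def)
    qed
    ultimately have "2 * pi * \<i> * winding_number loop (z u + of_real h * N) = k + c1 - c2"
      using bottom by simp
    then have "Im (2 * pi * \<i> * winding_number loop (z u + of_real h * N)) = Im (k + c1 - c2)" by simp
    then show "2 * pi * Re (winding_number loop (z u + of_real h * N)) = Im k + pi * sgn (Im (N / v i u))"
      using jump by simp
  qed
  show ?thesis using wn h0(1) by (intro eventually_at_rightI[of 0 h0]) auto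
qed

text \<open>By the preceding lemma the winding numbers on the two sides are \<open>(Im k \<plusminus> \<pi>) / 2\<pi>\<close>. The one
  inside is \<open>1\<close> or \<open>-1\<close>, and the other cannot be \<open>-2\<close>.\<close>
lemma inward_normal_orients:
  assumes L0: "continuous_on secant_domain L0" "\<And>s t. (s,t) \<in> secant_domain \<Longrightarrow> exp (L0 (s,t)) = z t - z s"
    and k: "\<And>s. s \<in> {a<..<b} \<Longrightarrow> L0 (s,b) = L0 (a,s) + k"
    and i: "i < n" and u: "u \<in> {\<tau> i<..<\<tau> (Suc i)}" and N: "Im (N / v i u) > 0"
    and inward: "\<forall>\<^sub>F h in at_right 0. z u + of_real h * N \<in> inside (z ` {a..b})"
  shows "Im k = pi" and "\<And>\<zeta>. \<zeta> \<in> inside (z ` {a..b}) \<Longrightarrow> winding_number loop \<zeta> = 1"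
proof -
  let ?w = "\<lambda>h N. winding_number loop (z u + of_real h * N)"
  have N1: "Im (N / v i u) \<noteq> 0" "Im ((-N) / v i u) \<noteq> 0" using N by auto
  have beside: "\<forall>\<^sub>F h in at_right 0. z u + of_real h * M \<notin> path_image loop \<and>
      2 * pi * Re (?w h M) = Im k + pi * sgn (Im (M / v i u))" if "Im (M / v i u) \<noteq> 0" for M
    by (rule winding_number_beside_curve[OF L0 k i u that])
  have "\<forall>\<^sub>F h in at_right 0. z u + of_real h * N \<in> inside (z ` {a..b}) \<and>
      2 * pi * Re (?w h N) = Im k + pi \<and> z u + of_real h * (-N) \<notin> path_image loop \<and>
      2 * pi * Re (?w h (-N)) = Im k - pi"
    using inward beside[OF N1(1)] beside[OF N1(2)]
    by eventually_elim (use N in auto)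
  then obtain h where h: "z u + of_real h * N \<in> inside (z ` {a..b})"
      "2 * pi * Re (?w h N) = Im k + pi" "z u + of_real h * (-N) \<notin> path_image loop"
      "2 * pi * Re (?w h (-N)) = Im k - pi"
    using eventually_happens'[OF trivial_limit_at_right_real] by blast
  have other: "?w h (-N) \<in> {-1,0,1}"
    by (rule simple_closed_path_winding_number_cases[OF simple_loop _ h(3)]) (simp add: loop_ends)
  show "Im k = pi" "\<And>\<zeta>. \<zeta> \<in> inside (z ` {a..b}) \<Longrightarrow> winding_number loop \<zeta> = 1"
  proof -
    consider "\<And>\<zeta>. \<zeta> \<in> inside (path_image loop) \<Longrightarrow> winding_number loop \<zeta> = 1"
      | "\<And>\<zeta>. \<zeta> \<in> inside (path_image loop) \<Longrightarrow> winding_number loop \<zeta> = -1"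
      by (rule simple_closed_path_winding_number_inside[OF simple_loop]) auto
    then have "Im k = pi \<and> (\<forall>\<zeta> \<in> inside (z ` {a..b}). winding_number loop \<zeta> = 1)"
    proof cases
      case 1
      then show ?thesis using h(1,2) by (simp add: path_image_loop)
    next
      case 2
      then have "Im k = - 3 * pi" using h(1,2) by (simp add: path_image_loop)
      then have "pi * Re (?w h (-N)) = pi * (-2)" using h(4) by simp
      then have "Re (?w h (-N)) = -2" by (simp only: mult_cancel_left) auto
      then show ?thesis using other by auto
    qed
    then show "Im k = pi" "\<And>\<zeta>. \<zeta> \<in> inside (z ` {a..b}) \<Longrightarrow> winding_number loop \<zeta> = 1" by auto
  qed
qed

end

context framed_loop
begin

text \<open>The conclusion also says that a loop whose normal on the left points inside has winding number one,
  because both facts come from the same monodromy \<open>k\<close>.\<close>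
theorem umlaufsatz:
  assumes no_cusp: "\<And>i. i < n \<Longrightarrow> turn i \<notin> \<real>\<^sub>\<le>\<^sub>0"
    and i: "i < n" and u: "u \<in> {\<tau> i<..<\<tau> (Suc i)}" and N: "Im (N / v i u) > 0"
    and inward: "\<forall>\<^sub>F h in at_right 0. z u + of_real h * N \<in> inside (z ` {a..b})"
  obtains \<theta> where "\<And>i. i < n \<Longrightarrow> continuous_on {\<tau> i..\<tau> (Suc i)} (\<theta> i)"
    and "\<And>i t. i < n \<Longrightarrow> t \<in> {\<tau> i..\<tau> (Suc i)} \<Longrightarrow> in_frame t (v i t) = of_real (cmod (in_frame t (v i t))) * cis (\<theta> i t)"
    and "(\<Sum>i<n. \<theta> i (\<tau> (Suc i)) - \<theta> i (\<tau> i)) + (\<Sum>i<n. Im (Ln (turn i))) = 2 * pi"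
    and "\<And>\<zeta>. \<zeta> \<in> inside (z ` {a..b}) \<Longrightarrow> winding_number loop \<zeta> = 1"
proof -
  obtain L0 where L0: "continuous_on secant_domain L0" "\<And>s t. (s,t) \<in> secant_domain \<Longrightarrow> exp (L0 (s,t)) = z t - z s"
    by (rule first_log_exists) auto
  have anti: "exp (L0 (s,b)) = - exp (L0 (a,s))" if "s \<in> {a<..<b}" for s
    using L0(2)[of s b] L0(2)[of a s] that by (auto simp: secant_domain_def closed)
  obtain k where k: "\<And>s. s \<in> {a<..<b} \<Longrightarrow> L0 (s,b) = L0 (a,s) + k"
    by (rule antisymmetric_log[OF L0(1) anti]) auto
  note orient = inward_normal_orients[OF L0 k i u N inward]
  obtain L where L: "continuous_on secant_domain L" "\<And>x. x \<in> secant_domain \<Longrightarrow> exp (L x) = framed_secant x"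
    and Ld: "\<And>s. s \<in> {a<..<b} \<Longrightarrow> L (s,b) - L (a,s) = L0 (s,b) - L0 (a,s)"
    by (rule framed_log[OF L0]) auto
  have k': "L (s,b) = L (a,s) + k" if "s \<in> {a<..<b}" for s
    using Ld[OF that] k[OF that] by (simp add: algebra_simps)
  show thesis
    by (rule rotation[OF L k' no_cusp]) (use that orient in auto)
qed

end


section \<open>The Cauchy kernel in the plane\<close>

definition radius2 :: "real \<times> real \<Rightarrow> real" where
  "radius2 u = (fst u)\<^sup>2 + (snd u)\<^sup>2"

lemma radius2_measurable [measurable]: "radius2 \<in> borel_measurable borel"
  unfolding radius2_def by (intro borel_measurable_continuous_onI continuous_intros)

lemma kernel_measurable:
  "(\<lambda>u. fst u / radius2 u) \<in> borel_measurable borel" "(\<lambda>u. snd u / radius2 u) \<in> borel_measurable borel"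
  by (intro borel_measurable_divide borel_measurable_continuous_onI continuous_intros radius2_measurable)+

lemma has_bochner_integral_cauchy:
  "has_bochner_integral lborel (\<lambda>s::real. 1 / (1 + s\<^sup>2)) pi"
proof -
  have "integrable lborel (\<lambda>s::real. 1 / (1 + s\<^sup>2))"
    using integrable_inverse_1_plus_square by (simp add: set_integrable_def inverse_eq_divide)
  moreover have "integral\<^sup>L lborel (\<lambda>s::real. 1 / (1 + s\<^sup>2)) = pi"
    using LBINT_inverse_1_plus_square
    by (simp add: interval_lebesgue_integral_def set_lebesgue_integral_def inverse_eq_divide)
  ultimately show ?thesis by (simp add: has_bochner_integral_iff)
qed

lemma has_bochner_integral_poisson:
  fixes x :: real
  assumes "x \<noteq> 0"
  shows "has_bochner_integral lborel (\<lambda>y. \<bar>x\<bar> / (x\<^sup>2 + y\<^sup>2)) pi"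
proof -
  have eq: "\<bar>x\<bar> * (\<bar>x\<bar> / (x\<^sup>2 + (0 + x * s)\<^sup>2)) = 1 / (1 + s\<^sup>2)" for s
  proof -
    have "\<bar>x\<bar> * (\<bar>x\<bar> / (x\<^sup>2 + (0 + x * s)\<^sup>2)) = x\<^sup>2 / (x\<^sup>2 * (1 + s\<^sup>2))"
      by (simp add: power2_eq_square algebra_simps abs_mult_self_eq)
    then show ?thesis using assms by simp
  qed
  have "has_bochner_integral lborel (\<lambda>s. \<bar>x\<bar> / (x\<^sup>2 + (0 + x * s)\<^sup>2)) (pi / \<bar>x\<bar>)"
  proof -
    have "(\<lambda>s. \<bar>x\<bar> / (x\<^sup>2 + (0 + x * s)\<^sup>2)) = (\<lambda>s. 1 / \<bar>x\<bar> * (1 / (1 + s\<^sup>2)))"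
    proof (rule ext)
      fix s
      have "B = 1 / c * C" if "c \<noteq> 0" "c * B = C" for B C c :: real using that by auto
      from this[OF _ eq[of s]] assms
      show "\<bar>x\<bar> / (x\<^sup>2 + (0 + x * s)\<^sup>2) = 1 / \<bar>x\<bar> * (1 / (1 + s\<^sup>2))" by simp
    qed
    then show ?thesis
      using has_bochner_integral_mult_right[OF has_bochner_integral_cauchy, of "1 / \<bar>x\<bar>"] by simp
  qed
  then show ?thesis
    using lborel_has_bochner_integral_real_affine_iff[of x "\<lambda>y. \<bar>x\<bar> / (x\<^sup>2 + y\<^sup>2)" pi 0] assms
    by (simp add: divide_inverse mult.commute)
qed

text \<open>For fixed nonzero \<open>x\<close>, the integral of \<open>x / (x\<^sup>2 + y\<^sup>2)\<close> over \<open>y\<close> is \<open>\<plusminus>\<pi>\<close>, whatever \<open>x\<close>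
  is; hence the kernel is integrable on vertical strips in spite of its singularity.\<close>
lemma integrable_kernel_fst:
  "integrable lborel (\<lambda>u. indicator {-R..R} (fst u) * (fst u / radius2 u))"
proof -
  have "integrable (lborel \<Otimes>\<^sub>M lborel) (\<lambda>u::real \<times> real. indicator {-R..R} (fst u) * (fst u / radius2 u))"
  proof (rule lborel_pair.Fubini_integrable)
    show "(\<lambda>u. indicator {-R..R} (fst u) * (fst u / radius2 u)) \<in> borel_measurable (lborel \<Otimes>\<^sub>M lborel)"
      unfolding radius2_def by measurable
    have b: "has_bochner_integral lborel (\<lambda>y. norm (indicator {-R..R} (fst (x,y)) * (fst (x,y) / radius2 (x,y))))
            (indicator ({-R..R} - {0}) x * pi)" for x
    proof (cases "x = 0")
      case False
      then show ?thesis
        using has_bochner_integral_mult_right[OF has_bochner_integral_poisson[OF False], of "indicator {-R..R} x"]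
        by (simp add: radius2_def abs_mult indicator_def)
    qed (auto simp: radius2_def intro: has_bochner_integral_zero)
    have "integrable lborel (\<lambda>x. indicator ({-R..R} - {0}) x * pi)"
      using emeasure_bounded_finite[of "{-R..R} - {0::real}"]
      by (intro integrable_mult_left integrable_real_indicator) (auto simp: bounded_diff)
    then show "integrable lborel (\<lambda>x. LINT y|lborel. norm (indicator {-R..R} (fst (x,y)) * (fst (x,y) / radius2 (x,y))))"
      using has_bochner_integral_integral_eq[OF b] by simp
    show "AE x in lborel. integrable lborel (\<lambda>y. indicator {-R..R} (fst (x,y)) * (fst (x,y) / radius2 (x,y)))"
    proof (rule AE_I2)
      fix x
      have "integrable lborel (\<lambda>y. norm (indicator {-R..R} (fst (x,y)) * (fst (x,y) / radius2 (x,y))))"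
        using b has_bochner_integral_iff by blast
      then show "integrable lborel (\<lambda>y. indicator {-R..R} (fst (x,y)) * (fst (x,y) / radius2 (x,y)))"
        by (subst (asm) integrable_norm_iff) (auto simp: radius2_def)
    qed
  qed
  then show ?thesis by (simp add: lborel_prod)
qed

lemma integrable_kernel_snd:
  "integrable lborel (\<lambda>u. indicator {-R..R} (snd u) * (snd u / radius2 u))"
proof -
  have "integrable (lborel \<Otimes>\<^sub>M lborel) (\<lambda>(x,y). (\<lambda>u::real \<times> real. indicator {-R..R} (fst u) * (fst u / radius2 u)) (y,x))"
    by (rule lborel_pair.integrable_product_swap) (use integrable_kernel_fst in \<open>simp add: lborel_prod\<close>)
  then show ?thesis by (simp add: lborel_prod split_def radius2_def add.commute)
qed

text \<open>A continuously differentiable function \<open>f\<close> with gradient \<open>G\<close> and support in a square.\<close>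
definition C1c :: "real \<Rightarrow> (real \<times> real \<Rightarrow> real) \<Rightarrow> (real \<times> real \<Rightarrow> real \<times> real) \<Rightarrow> bool" where
  "C1c R f G \<longleftrightarrow> continuous_on UNIV G \<and> (\<forall>u. (f has_derivative (\<lambda>h. h \<bullet> G u)) (at u)) \<and>
     (\<forall>u. u \<notin> {-R..R} \<times> {-R..R} \<longrightarrow> f u = 0 \<and> G u = 0)"

lemma C1cD:
  assumes "C1c R f G"
  shows "continuous_on UNIV G" "(f has_derivative (\<lambda>h. h \<bullet> G u)) (at u)"
    and "u \<notin> {-R..R} \<times> {-R..R} \<Longrightarrow> f u = 0" "u \<notin> {-R..R} \<times> {-R..R} \<Longrightarrow> G u = 0"
  using assms unfolding C1c_def by blast+

lemma C1c_bounded: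
  assumes "C1c R f G"
  obtains C where "0 \<le> C" "\<And>u. norm (G u) \<le> C"
proof -
  have "compact (G ` ({-R..R} \<times> {-R..R}))"
    using assms by (intro compact_continuous_image compact_Times)
      (auto simp: C1c_def intro: continuous_on_subset)
  then obtain C where C: "\<And>u. u \<in> {-R..R} \<times> {-R..R} \<Longrightarrow> norm (G u) \<le> C"
    by (meson bounded_iff compact_imp_bounded image_eqI)
  show ?thesis
  proof (rule that[of "max C 0"])
    show "norm (G u) \<le> max C 0" for u
    proof (cases "u \<in> {-R..R} \<times> {-R..R}")
      case True then show ?thesis using C[OF True] by simp
    next
      case False then show ?thesis using C1cD(4)[OF assms False] by simp
    qed
  qed simp
qed

lemma C1c_measurable:
  assumes "C1c R f G"
  shows "f \<in> borel_measurable borel" "G \<in> borel_measurable borel"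
    "(\<lambda>u. fst (G u)) \<in> borel_measurable borel" "(\<lambda>u. snd (G u)) \<in> borel_measurable borel"
proof -
  have "continuous_on UNIV f"
    by (metis C1cD(2)[OF assms] continuous_at_imp_continuous_on has_derivative_continuous)
  then show "f \<in> borel_measurable borel" by (rule borel_measurable_continuous_onI)
  have c: "continuous_on UNIV G" using assms by (simp add: C1c_def)
  then show "G \<in> borel_measurable borel" by (rule borel_measurable_continuous_onI)
  show "(\<lambda>u. fst (G u)) \<in> borel_measurable borel" "(\<lambda>u. snd (G u)) \<in> borel_measurable borel"
    by (intro borel_measurable_continuous_onI continuous_intros c)+
qed

lemma integrable_kernel_times:
  assumes \<kappa>: "integrable lborel (\<lambda>u. indicator {-R..R} (pr u) * \<kappa> u)"
    and m: "\<phi> \<in> borel_measurable borel" "\<kappa> \<in> borel_measurable borel"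
    and b: "\<And>u. \<bar>\<phi> u\<bar> \<le> C * indicator {-R..R} (pr u)"
  shows "integrable lborel (\<lambda>u::real \<times> real. \<kappa> u * \<phi> u :: real)"
proof (rule Bochner_Integration.integrable_bound)
  show "integrable lborel (\<lambda>u. C * (indicator {-R..R} (pr u) * \<kappa> u))"
    by (rule integrable_mult_right[OF \<kappa>])
  show "(\<lambda>u. \<kappa> u * \<phi> u) \<in> borel_measurable lborel" using m by simp
  show "AE u in lborel. norm (\<kappa> u * \<phi> u) \<le> norm (C * (indicator {-R..R} (pr u) * \<kappa> u))"
  proof (rule AE_I2)
    fix u :: "real \<times> real"
    have "\<bar>\<kappa> u\<bar> * \<bar>\<phi> u\<bar> \<le> \<bar>\<kappa> u\<bar> * \<bar>C * indicator {-R..R} (pr u)\<bar>"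
      using b[of u] by (intro mult_left_mono) auto
    then show "norm (\<kappa> u * \<phi> u) \<le> norm (C * (indicator {-R..R} (pr u) * \<kappa> u))"
      by (simp add: abs_mult mult_ac)
  qed
qed

lemma integrable_radial:
  assumes f: "C1c R f G"
  shows "integrable lborel (\<lambda>u. (u \<bullet> G u) / radius2 u)"
proof -
  obtain C where C: "0 \<le> C" "\<And>u. norm (G u) \<le> C" by (rule C1c_bounded[OF f]) blast
  note m = C1c_measurable[OF f]
  have c: "\<bar>fst (G u)\<bar> \<le> C" "\<bar>snd (G u)\<bar> \<le> C" for u
    using C(2)[of u] norm_fst_le[of "fst (G u)" "snd (G u)"] norm_snd_le[of "snd (G u)" "fst (G u)"]
    by (auto intro: order_trans)
  have z: "G u = 0" if "fst u \<notin> {-R..R} \<or> snd u \<notin> {-R..R}" for u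
    using C1cD(4)[OF f, of u] that by (auto simp: mem_Times_iff)
  have b: "\<bar>fst (G u)\<bar> \<le> C * indicator {-R..R} (fst u)" "\<bar>snd (G u)\<bar> \<le> C * indicator {-R..R} (snd u)" for u
    using c[of u] z[of u] by (auto simp only: indicator_def split: if_splits) auto
  have "integrable lborel (\<lambda>u. (fst u / radius2 u) * fst (G u))"
    by (rule integrable_kernel_times[OF integrable_kernel_fst[of R] m(3) kernel_measurable(1)])
      (rule b)
  moreover have "integrable lborel (\<lambda>u. (snd u / radius2 u) * snd (G u))"
    by (rule integrable_kernel_times[OF integrable_kernel_snd[of R] m(4) kernel_measurable(2)])
      (rule b)
  ultimately have "integrable lborel (\<lambda>u. (fst u / radius2 u) * fst (G u) + (snd u / radius2 u) * snd (G u))"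
    by (rule Bochner_Integration.integrable_add)
  then show ?thesis by (simp add: inner_prod_def add_divide_distrib)
qed

lemma integral_sgn_derivative:
  fixes F :: "real \<Rightarrow> real"
  assumes F: "\<And>y. (F has_vector_derivative F' y) (at y)" and c: "continuous_on UNIV F'"
    and R: "\<And>y. R \<le> \<bar>y\<bar> \<Longrightarrow> F y = 0 \<and> F' y = 0" "0 < R"
  shows "has_bochner_integral lborel (\<lambda>y. sgn y * F' y) (- 2 * F 0)"
proof -
  have up: "has_bochner_integral lborel (\<lambda>y. indicator {0..R} y *\<^sub>R F' y) (F R - F 0)"
    by (rule has_bochner_integral_FTC_Icc)
      (use R F c in \<open>auto intro: continuous_on_subset has_vector_derivative_at_within\<close>)
  have down: "has_bochner_integral lborel (\<lambda>y. indicator {-R..0} y *\<^sub>R F' y) (F 0 - F (-R))"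
    by (rule has_bochner_integral_FTC_Icc)
      (use R F c in \<open>auto intro: continuous_on_subset has_vector_derivative_at_within\<close>)
  have "(\<lambda>y. sgn y * F' y) = (\<lambda>y. indicator {0..R} y *\<^sub>R F' y - indicator {-R..0} y *\<^sub>R F' y)"
    using R by (auto simp: fun_eq_iff sgn_if indicator_def)
  then show ?thesis
    using has_bochner_integral_diff[OF up down] R by simp
qed

text \<open>Substituting \<open>x = y s\<close> for fixed \<open>y\<close> turns the integrand into \<open>sgn y / (1 + s\<^sup>2)\<close> times the derivative
  of \<open>f\<close> along the line of slope \<open>s\<close>. After exchanging the integrals, the integral over \<open>y\<close> is
  \<open>- 2 f(0,0)\<close> for every \<open>s\<close>, and the Cauchy density integrates to \<open>\<pi>\<close>.\<close>
proposition integral_radial_derivative: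
  assumes f: "C1c R f G" and R: "0 < R"
  shows "integral\<^sup>L lborel (\<lambda>u. (u \<bullet> G u) / radius2 u) = - 2 * pi * f (0,0)"
proof -
  define K where "K = (\<lambda>u. (u \<bullet> G u) / radius2 u)"
  define k where "k = (\<lambda>(y,s). sgn y * ((s,1) \<bullet> G (y * s, y)) / (1 + s\<^sup>2))"
  have cG: "continuous_on UNIV G" using f by (simp add: C1c_def)
  have K: "integrable (lborel \<Otimes>\<^sub>M lborel) K"
    using integrable_radial[OF f] by (simp add: lborel_prod K_def)
  then have Ksw: "integrable (lborel \<Otimes>\<^sub>M lborel) (\<lambda>(y,x). K (x,y))"
    by (rule lborel_pair.integrable_product_swap)
  have sub: "\<bar>y\<bar> * K (0 + y * s, y) = k (y,s)" if "y \<noteq> 0" for y s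
  proof -
    have r: "radius2 (0 + y * s, y) = y * y * (1 + s\<^sup>2)" by (simp add: radius2_def power2_eq_square algebra_simps)
    have i: "(0 + y * s, y) \<bullet> G (0 + y * s, y) = y * ((s,1) \<bullet> G (y * s, y))"
      by (simp add: inner_prod_def algebra_simps)
    have "\<bar>y\<bar> * (y * S / (y * y * D)) = sgn y * S / D" for S D
      using that by (auto simp: sgn_if abs_if)
    then show ?thesis unfolding K_def r i k_def by simp
  qed
  have k_meas: "k \<in> borel_measurable (lborel \<Otimes>\<^sub>M lborel)"
  proof -
    have "(\<lambda>p::real \<times> real. (snd p, 1) \<bullet> G (fst p * snd p, fst p)) \<in> borel_measurable borel"
      by (intro borel_measurable_continuous_onI continuous_intros continuous_on_compose2[OF cG]) auto
    moreover have "(\<lambda>p::real \<times> real. sgn (fst p)) \<in> borel_measurable borel"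
      by (rule measurable_compose[of fst borel borel sgn]) (auto intro!: borel_measurable_continuous_onI continuous_intros)
    moreover have "(\<lambda>p::real \<times> real. 1 + (snd p)\<^sup>2) \<in> borel_measurable borel"
      by (intro borel_measurable_continuous_onI continuous_intros)
    ultimately have "(\<lambda>p::real \<times> real. sgn (fst p) * ((snd p, 1) \<bullet> G (fst p * snd p, fst p)) / (1 + (snd p)\<^sup>2)) \<in> borel_measurable borel"
      by (intro borel_measurable_divide borel_measurable_times)
    then show ?thesis by (simp add: k_def split_def lborel_prod)
  qed
  have inner: "(LINT x|lborel. norm (K (x,y))) = (LINT s|lborel. norm (k (y,s)))"
     "(LINT x|lborel. K (x,y)) = (LINT s|lborel. k (y,s))" if "y \<noteq> 0" for y
    using lborel_integral_real_affine[OF that, of "\<lambda>x. norm (K (x,y))" 0]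
      lborel_integral_real_affine[OF that, of "\<lambda>x. K (x,y)" 0] that
    by (simp_all flip: integral_mult_right_zero sub add: abs_mult)
  have AE0: "AE y::real in lborel. y \<noteq> 0" by (rule AE_lborel_singleton)
  have k_int: "integrable (lborel \<Otimes>\<^sub>M lborel) k"
  proof (rule lborel_pair.Fubini_integrable[OF k_meas])
    have "integrable lborel (\<lambda>y. LINT x|lborel. norm ((\<lambda>(y,x). K (x,y)) (y,x)))"
      using lborel_pair.integrable_fst'[OF integrable_norm[OF Ksw]] by simp
    then show "integrable lborel (\<lambda>y. LINT s|lborel. norm (k (y,s)))"
      by (subst integrable_cong_AE[where g = "\<lambda>y. LINT x|lborel. norm (K (x,y))"])
        (use k_meas inner(1) in \<open>auto intro!: eventually_mono[OF AE0] simp: borel_measurable_integrable\<close>)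
    show "AE y in lborel. integrable lborel (\<lambda>s. k (y,s))"
      using lborel_pair.AE_integrable_fst'[OF Ksw] AE0
    proof eventually_elim
      case (elim y)
      then have "integrable lborel (\<lambda>s. K (0 + y * s, y))"
        using lborel_integrable_real_affine[of "\<lambda>x. K (x,y)" y 0] by simp
      then have "integrable lborel (\<lambda>s. \<bar>y\<bar> * K (0 + y * s, y))" by (rule integrable_mult_right)
      moreover have "(\<lambda>s. \<bar>y\<bar> * K (0 + y * s, y)) = (\<lambda>s. k (y,s))" using sub[OF elim(2)] by blast
      ultimately show ?case by (simp only:)
    qed
  qed
  \<comment> \<open>along the line of slope \<open>s\<close> the integrand is a total derivative\<close>
  have vert: "has_bochner_integral lborel (\<lambda>y. k (y,s)) (- 2 * f (0,0) / (1 + s\<^sup>2))" for s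
  proof -
    have "has_bochner_integral lborel (\<lambda>y. sgn y * ((s,1) \<bullet> G (y * s, y))) (- 2 * f (0 * s, 0))"
    proof (rule integral_sgn_derivative[where F = "\<lambda>y. f (y * s, y)" and R = "R + 1"])
      fix y
      have "((\<lambda>y. (y * s, y)) has_derivative (\<lambda>h. (h * s, h))) (at y)"
        by (auto intro!: derivative_eq_intros)
      moreover have "(f has_derivative (\<lambda>h. h \<bullet> G (y * s, y))) (at (y * s, y))"
        using f by (simp add: C1c_def)
      ultimately have "((\<lambda>y. f (y * s, y)) has_derivative (\<lambda>h. (h * s, h) \<bullet> G (y * s, y))) (at y)"
        by (rule has_derivative_compose)
      then show "((\<lambda>y. f (y * s, y)) has_vector_derivative ((s,1) \<bullet> G (y * s, y))) (at y)"
        by (simp add: has_vector_derivative_def inner_prod_def algebra_simps)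
    next
      show "continuous_on UNIV (\<lambda>y. (s, 1) \<bullet> G (y * s, y))"
        by (intro continuous_intros continuous_on_compose2[OF cG]) auto
      show "f (y * s, y) = 0 \<and> (s, 1) \<bullet> G (y * s, y) = 0" if "R + 1 \<le> \<bar>y\<bar>" for y
      proof -
        have "(y * s, y) \<notin> {-R..R} \<times> {-R..R}" using that by auto
        then show ?thesis using f by (auto simp: C1c_def)
      qed
    qed (use R in auto)
    from has_bochner_integral_divide_zero[OF this, of "1 + s\<^sup>2"]
    show ?thesis by (simp add: k_def)
  qed
  have "integral\<^sup>L (lborel \<Otimes>\<^sub>M lborel) K = (LINT y|lborel. LINT x|lborel. K (x,y))"
    using lborel_pair.integral_fst'[OF Ksw] lborel_pair.integral_product_swap[of K] K
    by simp
  also have "\<dots> = (LINT y|lborel. LINT s|lborel. k (y,s))"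
    using lborel_pair.integrable_fst'[OF Ksw] lborel_pair.integrable_fst'[OF k_int]
    by (intro integral_cong_AE) (auto intro!: eventually_mono[OF AE0] simp: inner(2) borel_measurable_integrable)
  also have "\<dots> = (LINT s|lborel. LINT y|lborel. k (y,s))"
    using lborel_pair.Fubini_integral[of "\<lambda>y s. k (y,s)"] k_int by simp
  also have "\<dots> = (LINT s|lborel. - 2 * f (0,0) * (1 / (1 + s\<^sup>2)))"
    using has_bochner_integral_integral_eq[OF vert] by simp
  also have "\<dots> = - 2 * f (0,0) * pi"
    using has_bochner_integral_integral_eq[OF has_bochner_integral_mult_right[OF has_bochner_integral_cauchy, of "- 2 * f (0,0)"]]
    by simp
  finally show ?thesis by (simp add: lborel_prod K_def)
qed


section \<open>Exchanging the kernel with a line integral\<close>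

lemma lborel_reflect:
  fixes h :: "real \<times> real \<Rightarrow> real"
  assumes [measurable]: "h \<in> borel_measurable borel"
  shows "(LINT \<zeta>|lborel. h (c - \<zeta>)) = (LINT u|lborel. h u)"
    and "integrable lborel (\<lambda>\<zeta>. h (c - \<zeta>)) \<longleftrightarrow> integrable lborel h"
proof -
  have "lborel = density (distr lborel borel (\<lambda>x. c + (-1) *\<^sub>R x)) (\<lambda>_. ennreal (\<bar>-1\<bar>^DIM(real \<times> real)))"
    by (rule lborel_affine) simp
  then have eq: "lborel = distr lborel borel (\<lambda>x. c - x)" by (simp add: density_1)
  show "(LINT \<zeta>|lborel. h (c - \<zeta>)) = (LINT u|lborel. h u)"
    by (subst (2) eq) (simp add: integral_distr)
  show "integrable lborel (\<lambda>\<zeta>. h (c - \<zeta>)) \<longleftrightarrow> integrable lborel h"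
    by (subst (2) eq) (simp add: integrable_distr_eq)
qed

lemma fubini_dominated:
  fixes h :: "real \<times> (real \<times> real) \<Rightarrow> real"
  assumes m: "h \<in> borel_measurable borel"
    and i: "\<And>t. integrable lborel (\<lambda>u. h (t,u))"
    and b: "\<And>t. (LINT u|lborel. \<bar>h (t,u)\<bar>) \<le> M * indicator {c..d} t"
  shows "integrable (lborel \<Otimes>\<^sub>M lborel) h"
proof (rule lborel_pair.Fubini_integrable)
  show hm: "h \<in> borel_measurable (lborel \<Otimes>\<^sub>M lborel)" using m by (simp add: lborel_prod)
  show "integrable lborel (\<lambda>t. LINT u|lborel. norm (h (t,u)))"
  proof (rule Bochner_Integration.integrable_bound)
    show "integrable lborel (\<lambda>t. M * indicator {c..d} t)"
      by (intro integrable_mult_right integrable_real_indicator) (auto simp: emeasure_lborel_Icc_eq)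
    show "(\<lambda>t. LINT u|lborel. norm (h (t,u))) \<in> borel_measurable lborel"
      using hm by measurable
    show "AE t in lborel. norm (LINT u|lborel. norm (h (t,u))) \<le> norm (M * indicator {c..d} t)"
    proof (rule AE_I2)
      fix t
      have "0 \<le> (LINT u|lborel. norm (h (t,u)))" by (intro integral_nonneg_AE) auto
      then show "norm (LINT u|lborel. norm (h (t,u))) \<le> norm (M * indicator {c..d} t)"
        using b[of t] by simp
    qed
  qed
  show "AE t in lborel. integrable lborel (\<lambda>u. h (t,u))" using i by simp
qed

definition cell :: "real \<Rightarrow> (real \<times> real) set" where
  "cell R = {-R..R} \<times> {-R..R}"

text \<open>Only local integrability of the two components of the Cauchy kernel enters the applications of
  Fubini's theorem.\<close>
locale kernel =
  fixes \<kappa> :: "real \<times> real \<Rightarrow> real"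
  assumes kernel_meas [measurable]: "\<kappa> \<in> borel_measurable borel"
    and kernel_int: "\<And>R. integrable lborel (\<lambda>u. indicator (cell R) u * \<kappa> u)"

lemma kernel_fst: "kernel (\<lambda>u. fst u / radius2 u)" and kernel_snd: "kernel (\<lambda>u. snd u / radius2 u)"
proof -
  have *: "integrable lborel (\<lambda>u. indicator (cell R) u * \<kappa> u)"
    if "integrable lborel (\<lambda>u. indicator {-R..R} (pr u) * \<kappa> u)" "\<kappa> \<in> borel_measurable borel"
      "\<And>u. u \<in> cell R \<Longrightarrow> pr u \<in> {-R..R}" for R and \<kappa> pr :: "real \<times> real \<Rightarrow> real"
  proof -
    have m: "indicator (cell R) \<in> borel_measurable borel"
      by (intro borel_measurable_indicator borel_closed) (auto simp: cell_def intro!: closed_Times)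
    have "integrable lborel (\<lambda>u. \<kappa> u * indicator (cell R) u)"
      by (rule integrable_kernel_times[OF that(1) m that(2), where C = 1]) (use that(3) in \<open>auto simp: indicator_def\<close>)
    then show ?thesis by (simp add: mult.commute)
  qed
  show "kernel (\<lambda>u. fst u / radius2 u)"
    by (rule kernel.intro[OF kernel_measurable(1) *[OF integrable_kernel_fst kernel_measurable(1)]]) (auto simp: cell_def)
  show "kernel (\<lambda>u. snd u / radius2 u)"
    by (rule kernel.intro[OF kernel_measurable(2) *[OF integrable_kernel_snd kernel_measurable(2)]]) (auto simp: cell_def)
qed

context kernel
begin

definition mass :: "real \<Rightarrow> real" where
  "mass R = (LINT u|lborel. \<bar>indicator (cell R) u * \<kappa> u\<bar>)"

lemma bounded_factor:
  assumes m: "\<phi> \<in> borel_measurable borel" and b: "\<And>u. \<bar>\<phi> u\<bar> \<le> C * indicator (cell R) u"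
  shows "integrable lborel (\<lambda>u. \<kappa> u * \<phi> u)"
    and "(LINT u|lborel. \<bar>\<kappa> u * \<phi> u\<bar>) \<le> C * mass R"
proof -
  have dom: "\<bar>\<kappa> u * \<phi> u\<bar> \<le> C * \<bar>indicator (cell R) u * \<kappa> u\<bar>" for u
    using mult_left_mono[OF b[of u], of "\<bar>\<kappa> u\<bar>"] by (simp add: abs_mult mult_ac)
  have i1: "integrable lborel (\<lambda>u. C * \<bar>indicator (cell R) u * \<kappa> u\<bar>)"
    by (intro integrable_mult_right integrable_abs kernel_int)
  show i2: "integrable lborel (\<lambda>u. \<kappa> u * \<phi> u)"
  proof (rule Bochner_Integration.integrable_bound[OF i1])
    show "(\<lambda>u. \<kappa> u * \<phi> u) \<in> borel_measurable lborel" using m by simp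
    show "AE u in lborel. norm (\<kappa> u * \<phi> u) \<le> norm (C * \<bar>indicator (cell R) u * \<kappa> u\<bar>)"
      using dom by (auto intro!: AE_I2 order_trans[OF dom])
  qed
  have "(LINT u|lborel. \<bar>\<kappa> u * \<phi> u\<bar>) \<le> (LINT u|lborel. C * \<bar>indicator (cell R) u * \<kappa> u\<bar>)"
    by (rule integral_mono[OF integrable_abs[OF i2] i1 dom])
  then show "(LINT u|lborel. \<bar>\<kappa> u * \<phi> u\<bar>) \<le> C * mass R" by (simp add: mass_def)
qed

lemma shifted_factor:
  assumes \<phi>: "\<phi> \<in> borel_measurable borel" "\<And>u. \<bar>\<phi> u\<bar> \<le> C * indicator (cell R) u" "0 \<le> C"
    and p: "p \<in> cell S"
  shows "integrable lborel (\<lambda>u. \<kappa> u * \<phi> (p - u))"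
    and "(LINT u|lborel. \<bar>\<kappa> u * \<phi> (p - u)\<bar>) \<le> C * mass (R + S)"
proof -
  note [measurable] = \<phi>(1)
  have m: "(\<lambda>u. \<phi> (p - u)) \<in> borel_measurable borel" by measurable
  have bd: "\<bar>\<phi> (p - u)\<bar> \<le> C * indicator (cell (R + S)) u" for u
  proof (cases "p - u \<in> cell R")
    case True
    then have "u \<in> cell (R + S)" using p by (cases p; cases u) (auto simp: cell_def)
    then show ?thesis using \<phi>(2)[of "p - u"] True by simp
  next
    case False
    then have "\<phi> (p - u) = 0" using \<phi>(2)[of "p - u"] by simp
    then show ?thesis using \<phi>(3) by simp
  qed
  show "integrable lborel (\<lambda>u. \<kappa> u * \<phi> (p - u))"
    "(LINT u|lborel. \<bar>\<kappa> u * \<phi> (p - u)\<bar>) \<le> C * mass (R + S)"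
    using bounded_factor[OF m bd] by auto
qed

text \<open>Fubini's theorem, followed by the substitution \<open>u = \<gamma> t - \<zeta>\<close> that moves the singularity of the
  kernel to the origin.\<close>
lemma exchange_first:
  fixes \<gamma> :: "real \<Rightarrow> real \<times> real" and w :: "real \<Rightarrow> real"
  assumes \<phi>: "\<phi> \<in> borel_measurable borel" "\<And>u. \<bar>\<phi> u\<bar> \<le> C * indicator (cell R) u" "0 \<le> C"
    and w: "w \<in> borel_measurable borel" "\<And>t. \<bar>w t\<bar> \<le> W * indicator {c..d} t"
    and \<gamma>: "\<gamma> \<in> borel_measurable borel" "\<gamma> ` {c..d} \<subseteq> cell S"
  shows "integrable lborel (\<lambda>\<zeta>. (LINT t|lborel. w t * \<kappa> (\<gamma> t - \<zeta>)) * \<phi> \<zeta>)"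
    and "integrable lborel (\<lambda>t. w t * (LINT u|lborel. \<kappa> u * \<phi> (\<gamma> t - u)))"
    and "(LINT \<zeta>|lborel. (LINT t|lborel. w t * \<kappa> (\<gamma> t - \<zeta>)) * \<phi> \<zeta>) =
         (LINT t|lborel. w t * (LINT u|lborel. \<kappa> u * \<phi> (\<gamma> t - u)))"
proof -
  note [measurable] = \<phi>(1) w(1) \<gamma>(1)
  have \<gamma>S: "\<gamma> t \<in> cell S" if "t \<in> {c..d}" for t using \<gamma>(2) that by auto
  define h where "h = (\<lambda>p::real \<times> (real \<times> real). w (fst p) * (\<kappa> (\<gamma> (fst p) - snd p) * \<phi> (snd p)))"
  have fm: "(fst :: real \<times> (real \<times> real) \<Rightarrow> real) \<in> borel_measurable borel"
    and sm: "(snd :: real \<times> (real \<times> real) \<Rightarrow> _) \<in> borel_measurable borel"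
    by (intro borel_measurable_continuous_onI continuous_intros)+
  have hm: "h \<in> borel_measurable borel" unfolding h_def
    by (intro borel_measurable_times measurable_compose[OF fm w(1)] measurable_compose[OF _ kernel_meas]
      measurable_compose[OF sm \<phi>(1)] borel_measurable_diff measurable_compose[OF fm \<gamma>(1)] sm)
  have shift: "(LINT \<zeta>|lborel. \<kappa> (\<gamma> t - \<zeta>) * \<phi> \<zeta>) = (LINT u|lborel. \<kappa> u * \<phi> (\<gamma> t - u))"
    "(LINT \<zeta>|lborel. \<bar>\<kappa> (\<gamma> t - \<zeta>) * \<phi> \<zeta>\<bar>) = (LINT u|lborel. \<bar>\<kappa> u * \<phi> (\<gamma> t - u)\<bar>)"
    "integrable lborel (\<lambda>\<zeta>. \<kappa> (\<gamma> t - \<zeta>) * \<phi> \<zeta>) \<longleftrightarrow> integrable lborel (\<lambda>u. \<kappa> u * \<phi> (\<gamma> t - u))" for t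
    using lborel_reflect[of "\<lambda>u. \<kappa> u * \<phi> (\<gamma> t - u)" "\<gamma> t"] lborel_reflect[of "\<lambda>u. \<bar>\<kappa> u * \<phi> (\<gamma> t - u)\<bar>" "\<gamma> t"]
    by simp_all
  have hi: "integrable lborel (\<lambda>\<zeta>. h (t,\<zeta>))" for t
  proof (cases "t \<in> {c..d}")
    case True
    have "integrable lborel (\<lambda>u. \<kappa> u * \<phi> (\<gamma> t - u))" by (rule shifted_factor(1)[OF \<phi> \<gamma>S[OF True]])
    then show ?thesis by (simp add: h_def shift)
  next
    case False
    then have "w t = 0" using w(2)[of t] by simp
    then show ?thesis by (simp add: h_def)
  qed
  have W0: "0 \<le> W" if "t \<in> {c..d}" for t using w(2)[of t] that by auto
  have hb: "(LINT \<zeta>|lborel. \<bar>h (t,\<zeta>)\<bar>) \<le> (W * (C * mass (R + S))) * indicator {c..d} t" for t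
  proof (cases "t \<in> {c..d}")
    case True
    have "(LINT \<zeta>|lborel. \<bar>h (t,\<zeta>)\<bar>) = \<bar>w t\<bar> * (LINT u|lborel. \<bar>\<kappa> u * \<phi> (\<gamma> t - u)\<bar>)"
      by (simp add: h_def abs_mult[of "w t"] shift(2))
    also have "\<dots> \<le> W * (C * mass (R + S))"
      using w(2)[of t] True W0[OF True] shifted_factor(2)[OF \<phi> \<gamma>S[OF True]]
      by (intro mult_mono) (auto intro!: integral_nonneg_AE)
    finally show ?thesis using True by simp
  next
    case False
    then have "w t = 0" using w(2)[of t] by simp
    then show ?thesis using False by (simp add: h_def)
  qed
  have H: "integrable (lborel \<Otimes>\<^sub>M lborel) h" by (rule fubini_dominated[OF hm hi hb])
  then have H': "integrable (lborel \<Otimes>\<^sub>M lborel) (\<lambda>(t,\<zeta>). h (t,\<zeta>))" by simp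
  have first: "(LINT t|lborel. h (t,\<zeta>)) = (LINT t|lborel. w t * \<kappa> (\<gamma> t - \<zeta>)) * \<phi> \<zeta>" for \<zeta>
    unfolding integral_mult_left_zero[symmetric] by (simp add: h_def mult_ac)
  have second: "(LINT \<zeta>|lborel. h (t,\<zeta>)) = w t * (LINT u|lborel. \<kappa> u * \<phi> (\<gamma> t - u))" for t
    by (simp add: h_def shift)
  show "integrable lborel (\<lambda>\<zeta>. (LINT t|lborel. w t * \<kappa> (\<gamma> t - \<zeta>)) * \<phi> \<zeta>)"
    using lborel_pair.integrable_snd[OF H'] by (simp add: first)
  show "integrable lborel (\<lambda>t. w t * (LINT u|lborel. \<kappa> u * \<phi> (\<gamma> t - u)))"
    using lborel_pair.integrable_fst'[OF H] by (simp add: second)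
  show "(LINT \<zeta>|lborel. (LINT t|lborel. w t * \<kappa> (\<gamma> t - \<zeta>)) * \<phi> \<zeta>) =
         (LINT t|lborel. w t * (LINT u|lborel. \<kappa> u * \<phi> (\<gamma> t - u)))"
    using lborel_pair.Fubini_integral[OF H'] by (simp add: first second)
qed

text \<open>A second exchange, after which the line integral of \<open>\<phi>\<close> along a translate of the curve can be
  evaluated for each \<open>u\<close> separately.\<close>
lemma exchange_second:
  fixes \<gamma> :: "real \<Rightarrow> real \<times> real" and w :: "real \<Rightarrow> real"
  assumes \<phi>: "\<phi> \<in> borel_measurable borel" "\<And>u. \<bar>\<phi> u\<bar> \<le> C * indicator (cell R) u" "0 \<le> C"
    and w: "w \<in> borel_measurable borel" "\<And>t. \<bar>w t\<bar> \<le> W * indicator {c..d} t"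
    and \<gamma>: "\<gamma> \<in> borel_measurable borel" "\<gamma> ` {c..d} \<subseteq> cell S"
  shows "integrable lborel (\<lambda>u. \<kappa> u * (LINT t|lborel. w t * \<phi> (\<gamma> t - u)))"
    and "(LINT t|lborel. w t * (LINT u|lborel. \<kappa> u * \<phi> (\<gamma> t - u))) =
         (LINT u|lborel. \<kappa> u * (LINT t|lborel. w t * \<phi> (\<gamma> t - u)))"
proof -
  note [measurable] = \<phi>(1) w(1) \<gamma>(1)
  have \<gamma>S: "\<gamma> t \<in> cell S" if "t \<in> {c..d}" for t using \<gamma>(2) that by auto
  define h where "h = (\<lambda>p::real \<times> (real \<times> real). w (fst p) * (\<kappa> (snd p) * \<phi> (\<gamma> (fst p) - snd p)))"
  have fm: "(fst :: real \<times> (real \<times> real) \<Rightarrow> real) \<in> borel_measurable borel"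
    and sm: "(snd :: real \<times> (real \<times> real) \<Rightarrow> _) \<in> borel_measurable borel"
    by (intro borel_measurable_continuous_onI continuous_intros)+
  have hm: "h \<in> borel_measurable borel" unfolding h_def
    by (intro borel_measurable_times measurable_compose[OF fm w(1)] measurable_compose[OF sm kernel_meas]
      measurable_compose[OF _ \<phi>(1)] borel_measurable_diff measurable_compose[OF fm \<gamma>(1)] sm)
  have hi: "integrable lborel (\<lambda>\<zeta>. h (t,\<zeta>))" for t
  proof (cases "t \<in> {c..d}")
    case True
    have "integrable lborel (\<lambda>u. \<kappa> u * \<phi> (\<gamma> t - u))" by (rule shifted_factor(1)[OF \<phi> \<gamma>S[OF True]])
    then show ?thesis by (simp add: h_def)
  next
    case False
    then have "w t = 0" using w(2)[of t] by simp
    then show ?thesis by (simp add: h_def)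
  qed
  have W0: "0 \<le> W" if "t \<in> {c..d}" for t using w(2)[of t] that by auto
  have hb: "(LINT \<zeta>|lborel. \<bar>h (t,\<zeta>)\<bar>) \<le> (W * (C * mass (R + S))) * indicator {c..d} t" for t
  proof (cases "t \<in> {c..d}")
    case True
    have "(LINT \<zeta>|lborel. \<bar>h (t,\<zeta>)\<bar>) = \<bar>w t\<bar> * (LINT u|lborel. \<bar>\<kappa> u * \<phi> (\<gamma> t - u)\<bar>)"
      by (simp add: h_def abs_mult[of "w t"])
    also have "\<dots> \<le> W * (C * mass (R + S))"
      using w(2)[of t] True W0[OF True] shifted_factor(2)[OF \<phi> \<gamma>S[OF True]]
      by (intro mult_mono) (auto intro!: integral_nonneg_AE)
    finally show ?thesis using True by simp
  next
    case False
    then have "w t = 0" using w(2)[of t] by simp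
    then show ?thesis using False by (simp add: h_def)
  qed
  have "integrable (lborel \<Otimes>\<^sub>M lborel) h" by (rule fubini_dominated[OF hm hi hb])
  then have H': "integrable (lborel \<Otimes>\<^sub>M lborel) (\<lambda>(t,\<zeta>). h (t,\<zeta>))" by simp
  have eq: "(LINT t|lborel. h (t,u)) = \<kappa> u * (LINT t|lborel. w t * \<phi> (\<gamma> t - u))" for u
    unfolding integral_mult_right_zero[symmetric] by (simp add: h_def mult_ac)
  show "integrable lborel (\<lambda>u. \<kappa> u * (LINT t|lborel. w t * \<phi> (\<gamma> t - u)))"
    using lborel_pair.integrable_snd[OF H'] by (simp add: eq)
  show "(LINT t|lborel. w t * (LINT u|lborel. \<kappa> u * \<phi> (\<gamma> t - u))) =
         (LINT u|lborel. \<kappa> u * (LINT t|lborel. w t * \<phi> (\<gamma> t - u)))"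
    using lborel_pair.Fubini_integral[OF H'] by (simp add: eq) (simp add: h_def)
qed

end


section \<open>The winding flux through an arc\<close>

lemma C1c_component_bounds:
  assumes f: "C1c R f G"
  obtains C where "0 \<le> C" "\<And>u. \<bar>fst (G u)\<bar> \<le> C * indicator (cell R) u" "\<And>u. \<bar>snd (G u)\<bar> \<le> C * indicator (cell R) u"
    "\<And>u. \<bar>f u\<bar> \<le> C * indicator (cell R) u"
proof -
  obtain C where C: "0 \<le> C" "\<And>u. norm (G u) \<le> C" by (rule C1c_bounded[OF f]) blast
  have "continuous_on UNIV f"
    by (metis C1cD(2)[OF f] continuous_at_imp_continuous_on has_derivative_continuous)
  then have "compact (f ` cell R)"
    by (intro compact_continuous_image) (auto simp: cell_def intro: continuous_on_subset compact_Times)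
  then obtain D where D: "\<And>u. u \<in> cell R \<Longrightarrow> \<bar>f u\<bar> \<le> D"
    by (metis bounded_iff compact_imp_bounded image_eqI real_norm_def)
  have c: "\<bar>fst (G u)\<bar> \<le> C" "\<bar>snd (G u)\<bar> \<le> C" for u
    using C(2)[of u] norm_fst_le[of "fst (G u)" "snd (G u)"] norm_snd_le[of "snd (G u)" "fst (G u)"]
    by (auto intro: order_trans)
  show thesis
  proof (rule that[of "max C D"])
    fix u :: "real \<times> real"
    show "\<bar>fst (G u)\<bar> \<le> max C D * indicator (cell R) u" "\<bar>snd (G u)\<bar> \<le> max C D * indicator (cell R) u"
      "\<bar>f u\<bar> \<le> max C D * indicator (cell R) u"
      using C1cD(3,4)[OF f, of u] c[of u] D[of u] by (auto simp flip: cell_def simp: indicator_def)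
  qed (use C in auto)
qed

lemma radial_derivative_reflected:
  assumes f: "C1c R f G" and p: "p \<in> cell S" and R: "0 < R" "0 \<le> S"
  shows "(LINT u|lborel. (u \<bullet> G (p - u)) / radius2 u) = 2 * pi * f p"
proof -
  have c: "C1c (R + S) (\<lambda>u. f (p - u)) (\<lambda>u. - G (p - u))"
    unfolding C1c_def
  proof (intro conjI allI impI)
    show "continuous_on UNIV (\<lambda>u. - G (p - u))"
      by (intro continuous_intros continuous_on_compose2[OF C1cD(1)[OF f]]) auto
    fix u
    have "((\<lambda>u. p - u) has_derivative (\<lambda>h. - h)) (at u)" by (auto intro!: derivative_eq_intros)
    from has_derivative_compose[OF this C1cD(2)[OF f]]
    show "((\<lambda>u. f (p - u)) has_derivative (\<lambda>h. h \<bullet> - G (p - u))) (at u)" by simp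
    assume "u \<notin> {-(R + S)..R + S} \<times> {-(R + S)..R + S}"
    then have "p - u \<notin> {-R..R} \<times> {-R..R}" using p by (cases p; cases u) (auto simp: cell_def)
    then show "f (p - u) = 0" "- G (p - u) = 0" using C1cD(3,4)[OF f] by auto
  qed
  have "(LINT u|lborel. (u \<bullet> - G (p - u)) / radius2 u) = - 2 * pi * f (p - (0,0))"
    using integral_radial_derivative[OF c] R by simp
  then show ?thesis by (simp add: zero_prod_def[symmetric])
qed

lemma borel_measurable_on_Icc:
  fixes g :: "real \<Rightarrow> 'b::euclidean_space"
  assumes "continuous_on {c..d} g"
  shows "(\<lambda>t. indicator {c..d} t *\<^sub>R g t) \<in> borel_measurable borel"
  by (rule borel_measurable_continuous_on_indicator[OF _ assms]) auto

text \<open>\<open>W \<zeta>\<close> is the change of the angle under which the arc is seen from a point \<open>\<zeta>\<close> off the arc. Write \<open>\<gamma> = (x, y)\<close> and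
  \<open>(X, Y) = \<gamma> - \<zeta>\<close>. The numerator of \<open>W f\<^sub>y\<close> is
  \<open>f\<^sub>y (y' X - x' Y) = - x' (X f\<^sub>x + Y f\<^sub>y) + X (x' f\<^sub>x + y' f\<^sub>y)\<close>.
  After the substitution \<open>\<zeta> = \<gamma> - u\<close>, the first term is a radial derivative and integrates to
  \<open>- 2\<pi> x' f(\<gamma>)\<close>; the second is a derivative with respect to the parameter of the arc and contributes
  only at its ends. The case of \<open>W f\<^sub>x\<close> is the same with the roles of \<open>x\<close> and \<open>y\<close> exchanged.\<close>
proposition winding_flux_arc:
  fixes \<gamma> \<gamma>' :: "real \<Rightarrow> real \<times> real"
  assumes f: "C1c R f G" and R: "0 < R" and cd: "c \<le> d"
    and d\<gamma>: "\<And>t. t \<in> {c..d} \<Longrightarrow> (\<gamma> has_vector_derivative \<gamma>' t) (at t within {c..d})"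
    and c\<gamma>': "continuous_on {c..d} \<gamma>'"
  defines "wx \<equiv> \<lambda>t. indicator {c..d} t * fst (\<gamma>' t)" and "wy \<equiv> \<lambda>t. indicator {c..d} t * snd (\<gamma>' t)"
    and "K1 \<equiv> \<lambda>u. fst u / radius2 u" and "K2 \<equiv> \<lambda>u. snd u / radius2 u"
  defines "W \<equiv> \<lambda>\<zeta>. (LINT t|lborel. wy t * K1 (\<gamma> t - \<zeta>)) - (LINT t|lborel. wx t * K2 (\<gamma> t - \<zeta>))"
  shows "integrable lborel (\<lambda>\<zeta>. W \<zeta> * snd (G \<zeta>))" "integrable lborel (\<lambda>\<zeta>. W \<zeta> * fst (G \<zeta>))"
    and "(LINT \<zeta>|lborel. W \<zeta> * snd (G \<zeta>)) = - 2 * pi * (LINT t|lborel. wx t * f (\<gamma> t)) +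
           ((LINT u|lborel. K1 u * f (\<gamma> d - u)) - (LINT u|lborel. K1 u * f (\<gamma> c - u)))"
    and "(LINT \<zeta>|lborel. W \<zeta> * fst (G \<zeta>)) = 2 * pi * (LINT t|lborel. wy t * f (\<gamma> t)) -
           ((LINT u|lborel. K2 u * f (\<gamma> d - u)) - (LINT u|lborel. K2 u * f (\<gamma> c - u)))"
proof -
  interpret k1: kernel K1 unfolding K1_def by (rule kernel_fst)
  interpret k2: kernel K2 unfolding K2_def by (rule kernel_snd)
  obtain C where C: "0 \<le> C" "\<And>u. \<bar>fst (G u)\<bar> \<le> C * indicator (cell R) u" "\<And>u. \<bar>snd (G u)\<bar> \<le> C * indicator (cell R) u"
    "\<And>u. \<bar>f u\<bar> \<le> C * indicator (cell R) u" by (rule C1c_component_bounds[OF f]) blast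
  note m = C1c_measurable[OF f]
  have c\<gamma>: "continuous_on {c..d} \<gamma>" by (rule continuous_on_vector_derivative[OF d\<gamma>])
  have f_cont: "continuous_on UNIV f"
    by (metis C1cD(2)[OF f] continuous_at_imp_continuous_on has_derivative_continuous)
  \<comment> \<open>the curve, extended by zero to a Borel function on the real line\<close>
  define \<delta> where "\<delta> = (\<lambda>t. indicator {c..d} t *\<^sub>R \<gamma> t)"
  have \<delta>: "\<delta> t = \<gamma> t" if "t \<in> {c..d}" for t using that by (simp add: \<delta>_def)
  have \<delta>m: "\<delta> \<in> borel_measurable borel" unfolding \<delta>_def by (rule borel_measurable_on_Icc[OF c\<gamma>])
  have "compact (\<gamma> ` {c..d})" by (intro compact_continuous_image c\<gamma>) auto
  then obtain S where S: "\<And>t. t \<in> {c..d} \<Longrightarrow> norm (\<gamma> t) \<le> S" "0 \<le> S"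
    by (metis bounded_pos compact_imp_bounded image_eqI less_imp_le)
  have \<delta>S: "\<delta> t \<in> cell S" if "t \<in> {c..d}" for t
    using S(1)[OF that] norm_fst_le[of "fst (\<gamma> t)" "snd (\<gamma> t)"] norm_snd_le[of "snd (\<gamma> t)" "fst (\<gamma> t)"]
    unfolding \<delta>[OF that] cell_def mem_Times_iff by (auto simp: abs_le_iff)
  have "compact (\<gamma>' ` {c..d})" by (intro compact_continuous_image c\<gamma>') auto
  then obtain V where V: "\<And>t. t \<in> {c..d} \<Longrightarrow> norm (\<gamma>' t) \<le> V"
    by (metis bounded_pos compact_imp_bounded image_eqI)
  have wxb: "\<bar>wx t\<bar> \<le> V * indicator {c..d} t" and wyb: "\<bar>wy t\<bar> \<le> V * indicator {c..d} t" for t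
    using V[of t] norm_fst_le[of "fst (\<gamma>' t)" "snd (\<gamma>' t)"] norm_snd_le[of "snd (\<gamma>' t)" "fst (\<gamma>' t)"]
    by (auto simp: wx_def wy_def indicator_def intro: order_trans)
  have wxm: "wx \<in> borel_measurable borel" and wym: "wy \<in> borel_measurable borel"
    using borel_measurable_on_Icc[of c d "\<lambda>t. fst (\<gamma>' t)"] borel_measurable_on_Icc[of c d "\<lambda>t. snd (\<gamma>' t)"] c\<gamma>'
    by (auto simp: wx_def wy_def intro: continuous_intros)
  have to\<delta>: "wx t * h (\<gamma> t) = wx t * h (\<delta> t)" "wy t * h (\<gamma> t) = wy t * h (\<delta> t)" for t and h :: "real \<times> real \<Rightarrow> real"
    by (auto simp: wx_def wy_def \<delta>_def indicator_def)
  define I where "I \<kappa> \<phi> t = (LINT u|lborel. \<kappa> u * \<phi> (\<delta> t - u))" for \<kappa> \<phi> :: "real \<times> real \<Rightarrow> real" and t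
  let ?G1 = "\<lambda>u. fst (G u)" and ?G2 = "\<lambda>u. snd (G u)"
  have \<delta>cell: "\<delta> ` {c..d} \<subseteq> cell S" using \<delta>S by auto
  note ex1 = k1.exchange_first[OF _ _ C(1) _ _ \<delta>m \<delta>cell]
  note ex2 = k2.exchange_first[OF _ _ C(1) _ _ \<delta>m \<delta>cell]
  note y12 = ex1[OF m(4) C(3) wym wyb] and x22 = ex2[OF m(4) C(3) wxm wxb]
  note y11 = ex1[OF m(3) C(2) wym wyb] and x21 = ex2[OF m(3) C(2) wxm wxb]
  note x11 = ex1[OF m(3) C(2) wxm wxb] and y22 = ex2[OF m(4) C(3) wym wyb]
  have W: "W \<zeta> * \<phi> = (LINT t|lborel. wy t * K1 (\<delta> t - \<zeta>)) * \<phi> - (LINT t|lborel. wx t * K2 (\<delta> t - \<zeta>)) * \<phi>" for \<zeta> \<phi>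
    unfolding W_def to\<delta>(1)[of _ "\<lambda>p. K2 (p - \<zeta>)"] to\<delta>(2)[of _ "\<lambda>p. K1 (p - \<zeta>)"]
    by (simp add: left_diff_distrib)
  show "integrable lborel (\<lambda>\<zeta>. W \<zeta> * snd (G \<zeta>))" "integrable lborel (\<lambda>\<zeta>. W \<zeta> * fst (G \<zeta>))"
    unfolding W by (intro Bochner_Integration.integrable_diff y12(1) x22(1) y11(1) x21(1))+
  \<comment> \<open>the radial derivative\<close>
  have rad: "I K1 ?G1 t + I K2 ?G2 t = 2 * pi * f (\<delta> t)" if t: "t \<in> {c..d}" for t
  proof -
    note s1 = k1.shifted_factor(1)[OF m(3) C(2) C(1) \<delta>S[OF t]]
    note s2 = k2.shifted_factor(1)[OF m(4) C(3) C(1) \<delta>S[OF t]]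
    have "I K1 ?G1 t + I K2 ?G2 t = (LINT u|lborel. (u \<bullet> G (\<delta> t - u)) / radius2 u)"
      unfolding I_def Bochner_Integration.integral_add[OF s1 s2, symmetric]
      by (intro Bochner_Integration.integral_cong) (auto simp: inner_prod_def K1_def K2_def add_divide_distrib)
    also have "\<dots> = 2 * pi * f (\<delta> t)" by (rule radial_derivative_reflected[OF f \<delta>S[OF t] R S(2)])
    finally show ?thesis .
  qed
  have radx: "wx t * I K2 ?G2 t = 2 * pi * (wx t * f (\<delta> t)) - wx t * I K1 ?G1 t"
    and rady: "wy t * I K1 ?G1 t = 2 * pi * (wy t * f (\<delta> t)) - wy t * I K2 ?G2 t" for t
  proof -
    have "wx t * (I K1 ?G1 t + I K2 ?G2 t) = wx t * (2 * pi * f (\<delta> t))"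
      "wy t * (I K1 ?G1 t + I K2 ?G2 t) = wy t * (2 * pi * f (\<delta> t))"
      using rad[of t] by (auto simp: wx_def wy_def indicator_def)
    then show "wx t * I K2 ?G2 t = 2 * pi * (wx t * f (\<delta> t)) - wx t * I K1 ?G1 t"
      "wy t * I K1 ?G1 t = 2 * pi * (wy t * f (\<delta> t)) - wy t * I K2 ?G2 t"
      by (auto simp: algebra_simps)
  qed
  have fint: "integrable lborel (\<lambda>t. wx t * f (\<delta> t))" "integrable lborel (\<lambda>t. wy t * f (\<delta> t))"
  proof -
    have "(\<lambda>t. wx t * f (\<delta> t)) = (\<lambda>t. indicator {c..d} t *\<^sub>R (fst (\<gamma>' t) * f (\<gamma> t)))"
      "(\<lambda>t. wy t * f (\<delta> t)) = (\<lambda>t. indicator {c..d} t *\<^sub>R (snd (\<gamma>' t) * f (\<gamma> t)))"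
      by (auto simp: fun_eq_iff wx_def wy_def \<delta>_def indicator_def)
    moreover have "set_integrable lborel {c..d} (\<lambda>t. fst (\<gamma>' t) * f (\<gamma> t))" "set_integrable lborel {c..d} (\<lambda>t. snd (\<gamma>' t) * f (\<gamma> t))"
      by (intro borel_integrable_atLeastAtMost' continuous_intros c\<gamma>' continuous_on_compose2[OF f_cont c\<gamma>]; simp)+
    ultimately show "integrable lborel (\<lambda>t. wx t * f (\<delta> t))" "integrable lborel (\<lambda>t. wy t * f (\<delta> t))"
      by (simp_all only: set_integrable_def)
  qed
  \<comment> \<open>the derivative along the translated arc\<close>
  have tan: "(LINT t|lborel. wx t * ?G1 (\<delta> t - u) + wy t * ?G2 (\<delta> t - u)) = f (\<gamma> d - u) - f (\<gamma> c - u)"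
    and tan_int: "integrable lborel (\<lambda>t. wx t * ?G1 (\<delta> t - u))" "integrable lborel (\<lambda>t. wy t * ?G2 (\<delta> t - u))" for u
  proof -
    have cg: "continuous_on {c..d} (\<lambda>t. G (\<gamma> t - u))"
      by (intro continuous_on_compose2[OF C1cD(1)[OF f]] continuous_intros c\<gamma>) auto
    have "has_bochner_integral lborel (\<lambda>t. indicator {c..d} t *\<^sub>R (\<gamma>' t \<bullet> G (\<gamma> t - u))) (f (\<gamma> d - u) - f (\<gamma> c - u))"
    proof (rule has_bochner_integral_FTC_Icc[OF cd])
      fix t assume t: "c \<le> t" "t \<le> d"
      have "((\<lambda>t. \<gamma> t - u) has_derivative (\<lambda>h. h *\<^sub>R \<gamma>' t)) (at t within {c..d})"
        using d\<gamma>[of t] t by (auto simp: has_vector_derivative_def intro!: derivative_eq_intros)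
      from has_derivative_compose[OF this C1cD(2)[OF f]]
      show "((\<lambda>t. f (\<gamma> t - u)) has_vector_derivative (\<gamma>' t \<bullet> G (\<gamma> t - u))) (at t within {c..d})"
        by (simp add: has_vector_derivative_def)
    qed (intro continuous_intros c\<gamma>' cg)
    moreover have "indicator {c..d} t *\<^sub>R (\<gamma>' t \<bullet> G (\<gamma> t - u)) = wx t * ?G1 (\<delta> t - u) + wy t * ?G2 (\<delta> t - u)" for t
      by (auto simp: inner_prod_def wx_def wy_def \<delta>_def indicator_def)
    ultimately show "(LINT t|lborel. wx t * ?G1 (\<delta> t - u) + wy t * ?G2 (\<delta> t - u)) = f (\<gamma> d - u) - f (\<gamma> c - u)"
      by (simp add: has_bochner_integral_iff)
    have "(\<lambda>t. wx t * ?G1 (\<delta> t - u)) = (\<lambda>t. indicator {c..d} t *\<^sub>R (fst (\<gamma>' t) * ?G1 (\<gamma> t - u)))"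
      "(\<lambda>t. wy t * ?G2 (\<delta> t - u)) = (\<lambda>t. indicator {c..d} t *\<^sub>R (snd (\<gamma>' t) * ?G2 (\<gamma> t - u)))"
      by (auto simp: fun_eq_iff wx_def wy_def \<delta>_def indicator_def)
    moreover have "set_integrable lborel {c..d} (\<lambda>t. fst (\<gamma>' t) * ?G1 (\<gamma> t - u))" "set_integrable lborel {c..d} (\<lambda>t. snd (\<gamma>' t) * ?G2 (\<gamma> t - u))"
      by (intro borel_integrable_atLeastAtMost' continuous_intros c\<gamma>' cg)+
    ultimately show "integrable lborel (\<lambda>t. wx t * ?G1 (\<delta> t - u))" "integrable lborel (\<lambda>t. wy t * ?G2 (\<delta> t - u))"
      by (simp_all only: set_integrable_def)
  qed
  \<comment> \<open>the contributions of the end points\<close>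
  have closing: "(LINT t|lborel. wx t * I \<kappa> ?G1 t + wy t * I \<kappa> ?G2 t) =
       (LINT u|lborel. \<kappa> u * f (\<gamma> d - u)) - (LINT u|lborel. \<kappa> u * f (\<gamma> c - u))" if "kernel \<kappa>" for \<kappa>
  proof -
    interpret k: kernel \<kappa> by fact
    note a = k.exchange_second[OF m(3) C(2) C(1) wxm wxb \<delta>m \<delta>cell] k.exchange_second[OF m(4) C(3) C(1) wym wyb \<delta>m \<delta>cell]
    note b = k.exchange_first(2)[OF m(3) C(2) C(1) wxm wxb \<delta>m \<delta>cell] k.exchange_first(2)[OF m(4) C(3) C(1) wym wyb \<delta>m \<delta>cell]
    have "(LINT t|lborel. wx t * I \<kappa> ?G1 t + wy t * I \<kappa> ?G2 t) =
       (LINT t|lborel. wx t * I \<kappa> ?G1 t) + (LINT t|lborel. wy t * I \<kappa> ?G2 t)"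
      unfolding I_def by (rule Bochner_Integration.integral_add[OF b])
    also have "\<dots> = (LINT u|lborel. \<kappa> u * (LINT t|lborel. wx t * ?G1 (\<delta> t - u))) + (LINT u|lborel. \<kappa> u * (LINT t|lborel. wy t * ?G2 (\<delta> t - u)))"
      unfolding I_def a(2) a(4) ..
    also have "\<dots> = (LINT u|lborel. \<kappa> u * (LINT t|lborel. wx t * ?G1 (\<delta> t - u)) + \<kappa> u * (LINT t|lborel. wy t * ?G2 (\<delta> t - u)))"
      by (rule Bochner_Integration.integral_add[OF a(1) a(3), symmetric])
    also have "\<dots> = (LINT u|lborel. \<kappa> u * f (\<gamma> d - u) - \<kappa> u * f (\<gamma> c - u))"
    proof (intro Bochner_Integration.integral_cong refl)
      fix u
      have "(LINT t|lborel. wx t * ?G1 (\<delta> t - u)) + (LINT t|lborel. wy t * ?G2 (\<delta> t - u)) = f (\<gamma> d - u) - f (\<gamma> c - u)"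
        using tan[of u] Bochner_Integration.integral_add[OF tan_int[of u]] by simp
      then show "\<kappa> u * (LINT t|lborel. wx t * ?G1 (\<delta> t - u)) + \<kappa> u * (LINT t|lborel. wy t * ?G2 (\<delta> t - u)) =
          \<kappa> u * f (\<gamma> d - u) - \<kappa> u * f (\<gamma> c - u)" by (simp flip: distrib_left right_diff_distrib)
    qed
    also have "\<dots> = (LINT u|lborel. \<kappa> u * f (\<gamma> d - u)) - (LINT u|lborel. \<kappa> u * f (\<gamma> c - u))"
      using cd \<delta>[of c] \<delta>[of d] \<delta>S[of c] \<delta>S[of d]
      by (intro Bochner_Integration.integral_diff k.shifted_factor(1)[OF m(1) C(4) C(1)]) auto
    finally show ?thesis .
  qed
  have "(LINT \<zeta>|lborel. W \<zeta> * ?G2 \<zeta>) = (LINT t|lborel. wy t * I K1 ?G2 t) - (LINT t|lborel. wx t * I K2 ?G2 t)"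
    unfolding W I_def Bochner_Integration.integral_diff[OF y12(1) x22(1)] y12(3) x22(3) ..
  also have "(LINT t|lborel. wx t * I K2 ?G2 t) = 2 * pi * (LINT t|lborel. wx t * f (\<delta> t)) - (LINT t|lborel. wx t * I K1 ?G1 t)"
    unfolding radx using fint x11(2) by (subst Bochner_Integration.integral_diff) (auto simp: I_def)
  also have "(LINT t|lborel. wy t * I K1 ?G2 t) - \<dots> = - 2 * pi * (LINT t|lborel. wx t * f (\<delta> t)) + (LINT t|lborel. wx t * I K1 ?G1 t + wy t * I K1 ?G2 t)"
    using x11(2) y12(2) by (subst Bochner_Integration.integral_add) (auto simp: I_def)
  finally show "(LINT \<zeta>|lborel. W \<zeta> * snd (G \<zeta>)) = - 2 * pi * (LINT t|lborel. wx t * f (\<gamma> t)) +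
           ((LINT u|lborel. K1 u * f (\<gamma> d - u)) - (LINT u|lborel. K1 u * f (\<gamma> c - u)))"
    unfolding closing[OF k1.kernel_axioms] to\<delta>(1)[of _ f] .
  have "(LINT \<zeta>|lborel. W \<zeta> * ?G1 \<zeta>) = (LINT t|lborel. wy t * I K1 ?G1 t) - (LINT t|lborel. wx t * I K2 ?G1 t)"
    unfolding W I_def Bochner_Integration.integral_diff[OF y11(1) x21(1)] y11(3) x21(3) ..
  also have "(LINT t|lborel. wy t * I K1 ?G1 t) = 2 * pi * (LINT t|lborel. wy t * f (\<delta> t)) - (LINT t|lborel. wy t * I K2 ?G2 t)"
    unfolding rady using fint y22(2) by (subst Bochner_Integration.integral_diff) (auto simp: I_def)
  also have "\<dots> - (LINT t|lborel. wx t * I K2 ?G1 t) = 2 * pi * (LINT t|lborel. wy t * f (\<delta> t)) - (LINT t|lborel. wx t * I K2 ?G1 t + wy t * I K2 ?G2 t)"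
    using x21(2) y22(2) by (subst Bochner_Integration.integral_add) (auto simp: I_def)
  finally show "(LINT \<zeta>|lborel. W \<zeta> * fst (G \<zeta>)) = 2 * pi * (LINT t|lborel. wy t * f (\<gamma> t)) -
           ((LINT u|lborel. K2 u * f (\<gamma> d - u)) - (LINT u|lborel. K2 u * f (\<gamma> c - u)))"
    unfolding closing[OF k2.kernel_axioms] to\<delta>(2)[of _ f] .
qed


section \<open>Green's formula for compact support\<close>

text \<open>The primitive \<open>m\<close> of \<open>F' / F\<close> satisfies \<open>F = F c \<cdot> exp m\<close>, so \<open>l\<close> and \<open>m\<close> differ by a constant.\<close>
lemma has_integral_log_derivative:
  fixes F F' l :: "real \<Rightarrow> complex"
  assumes cd: "c \<le> d" and F: "\<And>t. t \<in> {c..d} \<Longrightarrow> (F has_vector_derivative F' t) (at t within {c..d})"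
    and F': "continuous_on {c..d} F'" and nz: "\<And>t. t \<in> {c..d} \<Longrightarrow> F t \<noteq> 0"
    and l: "continuous_on {c..d} l" "\<And>t. t \<in> {c..d} \<Longrightarrow> exp (l t) = F t"
  shows "((\<lambda>t. F' t / F t) has_integral (l d - l c)) {c..d}"
proof -
  have cF: "continuous_on {c..d} F" by (rule continuous_on_vector_derivative[OF F])
  have cq: "continuous_on {c..d} (\<lambda>t. F' t / F t)"
    by (intro continuous_intros F' cF) (use nz in auto)
  define m where "m t = integral {c..t} (\<lambda>t. F' t / F t)" for t
  have dm: "(m has_vector_derivative F' t / F t) (at t within {c..d})" if "t \<in> {c..d}" for t
    unfolding m_def by (rule integral_has_vector_derivative[OF cq that])
  have cm: "continuous_on {c..d} m" by (rule continuous_on_vector_derivative[OF dm])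
  have "((\<lambda>t. exp (- m t) * F t) has_vector_derivative 0) (at t within {c..d})" if t: "t \<in> {c..d}" for t
  proof -
    have "((\<lambda>t. exp (- m t)) has_vector_derivative - (F' t / F t) * exp (- m t)) (at t within {c..d})"
    proof -
      have "((\<lambda>t. - m t) has_vector_derivative - (F' t / F t)) (at t within {c..d})"
        by (intro derivative_intros dm t)
      from field_vector_diff_chain_within[OF this DERIV_subset[OF DERIV_exp subset_UNIV]]
      show ?thesis by (simp add: o_def)
    qed
    from has_vector_derivative_mult[OF this F[OF t]]
    show ?thesis using nz[OF t] by (simp add: field_simps)
  qed
  then have "\<exists>k. \<forall>t\<in>{c..d}. exp (- m t) * F t = k"
    by (intro has_derivative_zero_constant) (auto simp: has_vector_derivative_def)
  then obtain k where k: "\<And>t. t \<in> {c..d} \<Longrightarrow> exp (- m t) * F t = k" by blast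
  have "m c = 0" by (simp add: m_def)
  then have kF: "k = F c" using k[of c] cd by simp
  have e: "exp (l t) = F c * exp (m t)" if "t \<in> {c..d}" for t
    using k[OF that] l(2)[OF that] unfolding kF by (simp add: exp_minus field_simps)
  have "F c \<noteq> 0" using nz cd by simp
  then obtain c0 where "\<And>t. t \<in> {c..d} \<Longrightarrow> l t = m t + c0"
    by (rule continuous_logs_differ_by_constant[OF _ l(1) cm e, rotated 2]) auto
  then have "l d - l c = m d" using \<open>m c = 0\<close> cd by simp
  then show ?thesis using integrable_integral[OF integrable_continuous_interval[OF cq]] by (simp add: m_def)
qed

definition pt :: "complex \<Rightarrow> real \<times> real" where
  "pt w = (Re w, Im w)"

lemma pt_simps [simp]: "fst (pt w) = Re w" "snd (pt w) = Im w" "pt w - pt w' = pt (w - w')"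
  by (simp_all add: pt_def)

lemma inj_pt: "inj pt" by (auto simp: inj_def pt_def complex_eq_iff)

lemma continuous_on_pt [continuous_intros]: "continuous_on S f \<Longrightarrow> continuous_on S (\<lambda>x. pt (f x))"
  unfolding pt_def by (intro continuous_intros)

lemma pt_Complex: "pt (Complex (fst u) (snd u)) = u" by (simp add: pt_def)

lemma open_pt_image: "open S \<Longrightarrow> open (pt ` S)"
proof -
  assume S: "open S"
  have eq: "pt ` S = (\<lambda>u. of_real (fst u) + \<i> * of_real (snd u)) -` S"
  proof (intro equalityI subsetI)
    fix u assume "u \<in> (\<lambda>u. of_real (fst u) + \<i> * of_real (snd u)) -` S"
    then have "of_real (fst u) + \<i> * of_real (snd u) \<in> S" by simp
    then show "u \<in> pt ` S" by (rule rev_image_eqI) (simp add: pt_def)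
  next
    fix u assume "u \<in> pt ` S"
    then obtain w where "u = pt w" "w \<in> S" by auto
    then show "u \<in> (\<lambda>u. of_real (fst u) + \<i> * of_real (snd u)) -` S"
      by (simp add: complex_eq[symmetric])
  qed
  show ?thesis unfolding eq using S by (intro open_vimage continuous_intros)
qed

context cornered_loop
begin

text \<open>The velocity components are extended by zero, so that integrals along a piece are integrals over the
  real line.\<close>
definition wx :: "nat \<Rightarrow> real \<Rightarrow> real" where "wx i t = indicator {\<tau> i..\<tau> (Suc i)} t * Re (v i t)"
definition wy :: "nat \<Rightarrow> real \<Rightarrow> real" where "wy i t = indicator {\<tau> i..\<tau> (Suc i)} t * Im (v i t)"

text \<open>The contribution of the \<open>i\<close>-th piece to \<open>2\<pi>\<close> times the winding number about \<open>\<zeta>\<close>.\<close>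
definition flux :: "nat \<Rightarrow> real \<times> real \<Rightarrow> real" where
  "flux i \<zeta> = (LINT t|lborel. wy i t * (fst (pt (z t) - \<zeta>) / radius2 (pt (z t) - \<zeta>)))
            - (LINT t|lborel. wx i t * (snd (pt (z t) - \<zeta>) / radius2 (pt (z t) - \<zeta>)))"

lemma LINT_piece:
  assumes i: "i < n" and h: "continuous_on {\<tau> i..\<tau> (Suc i)} h"
  shows "(LINT t|lborel. wx i t * h t) = integral {\<tau> i..\<tau> (Suc i)} (\<lambda>t. Re (v i t) * h t)"
    and "(LINT t|lborel. wy i t * h t) = integral {\<tau> i..\<tau> (Suc i)} (\<lambda>t. Im (v i t) * h t)"
proof -
  have "set_integrable lborel {\<tau> i..\<tau> (Suc i)} (\<lambda>t. Re (v i t) * h t)" "set_integrable lborel {\<tau> i..\<tau> (Suc i)} (\<lambda>t. Im (v i t) * h t)"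
    by (intro borel_integrable_atLeastAtMost' continuous_intros cont_v i h)+
  from this[THEN set_borel_integral_eq_integral(2)]
  show "(LINT t|lborel. wx i t * h t) = integral {\<tau> i..\<tau> (Suc i)} (\<lambda>t. Re (v i t) * h t)"
    "(LINT t|lborel. wy i t * h t) = integral {\<tau> i..\<tau> (Suc i)} (\<lambda>t. Im (v i t) * h t)"
    by (simp_all add: set_lebesgue_integral_def wx_def wy_def mult.assoc)
qed

lemma winding_number_flux:
  assumes \<zeta>: "\<zeta> \<notin> z ` {a..b}"
  shows "(\<Sum>i<n. flux i (pt \<zeta>)) = 2 * pi * Re (winding_number loop \<zeta>)"
proof -
  have nz: "z t - \<zeta> \<noteq> 0" if "t \<in> {a..b}" for t using \<zeta> that by auto
  have cz: "continuous_on {a..b} (\<lambda>t. z t - \<zeta>)" by (intro continuous_intros cont_z)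
  obtain l where l: "continuous_on {a..b} l" "\<And>t. t \<in> {a..b} \<Longrightarrow> z t - \<zeta> = exp (l t)"
    by (rule continuous_logarithm_on_contractible[OF cz convex_imp_contractible nz]) auto
  have flux: "flux i (pt \<zeta>) = Im (l (\<tau> (Suc i))) - Im (l (\<tau> i))" if i: "i < n" for i
  proof -
    have sub: "{\<tau> i..\<tau> (Suc i)} \<subseteq> {a..b}" by (rule piece_subset[OF i])
    have nz': "z t - \<zeta> \<noteq> 0" if "t \<in> {\<tau> i..\<tau> (Suc i)}" for t using nz sub that by auto
    have r: "radius2 (pt w) \<noteq> 0" if "w \<noteq> 0" for w
      using that by (auto simp: radius2_def sum_power2_eq_zero_iff complex_eq_iff)
    have czi: "continuous_on {\<tau> i..\<tau> (Suc i)} z" using cont_z sub continuous_on_subset by blast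
    have "((\<lambda>t. v i t / (z t - \<zeta>)) has_integral (l (\<tau> (Suc i)) - l (\<tau> i))) {\<tau> i..\<tau> (Suc i)}"
    proof (rule has_integral_log_derivative)
      show "((\<lambda>t. z t - \<zeta>) has_vector_derivative v i t) (at t within {\<tau> i..\<tau> (Suc i)})"
        if "t \<in> {\<tau> i..\<tau> (Suc i)}" for t
        using deriv[OF i that] by (auto intro!: derivative_eq_intros)
    qed (use \<tau>_less[OF i] cont_v[OF i] nz' l sub in \<open>auto intro: continuous_on_subset\<close>)
    from has_integral_Im[OF this]
    have I: "integral {\<tau> i..\<tau> (Suc i)} (\<lambda>t. Im (v i t / (z t - \<zeta>))) = Im (l (\<tau> (Suc i))) - Im (l (\<tau> i))"
      by (simp add: integral_unique)
    have c1: "continuous_on {\<tau> i..\<tau> (Suc i)} (\<lambda>t. fst (pt (z t) - pt \<zeta>) / radius2 (pt (z t) - pt \<zeta>))"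
      and c2: "continuous_on {\<tau> i..\<tau> (Suc i)} (\<lambda>t. snd (pt (z t) - pt \<zeta>) / radius2 (pt (z t) - pt \<zeta>))"
      using r[OF nz'] unfolding pt_simps radius2_def by (intro continuous_intros czi; simp)+
    have split: "Im (v i t / (z t - \<zeta>)) = Im (v i t) * (fst (pt (z t) - pt \<zeta>) / radius2 (pt (z t) - pt \<zeta>))
        - Re (v i t) * (snd (pt (z t) - pt \<zeta>) / radius2 (pt (z t) - pt \<zeta>))" for t
    proof -
      have "(c * X - d * Y) / r = c * (X / r) - d * (Y / r)" for c d X Y r :: real
        by (simp add: diff_divide_distrib)
      then show ?thesis unfolding Im_divide radius2_def pt_simps minus_complex.sel .
    qed
    show ?thesis
      unfolding flux_def LINT_piece(2)[OF i c1] LINT_piece(1)[OF i c2] I[symmetric] split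
      by (rule integral_diff[symmetric]) (intro integrable_continuous_interval continuous_intros cont_v i c1 c2)+
  qed
  have "(\<Sum>i<n. flux i (pt \<zeta>)) = (\<Sum>i<n. Im (l (\<tau> (Suc i))) - Im (l (\<tau> i)))"
    by (rule sum.cong) (auto simp: flux)
  also have "\<dots> = Im (l b) - Im (l a)" by (rule sum_lessThan_telescope)
  also have "\<dots> = Im (l b - l a)" by simp
  also have "l b - l a = 2 * pi * \<i> * winding_number loop \<zeta>"
    by (rule winding_number_via_log) (use l in auto)
  finally show ?thesis by simp
qed

lemma curve_null: "AE \<zeta> in lborel. \<zeta> \<notin> pt ` z ` {a..b}"
proof -
  have cl: "closed (pt ` z ` {a..b})"
    by (intro compact_imp_closed compact_continuous_image continuous_intros cont_z) auto
  have cover: "{a..b} \<subseteq> (\<Union>i<n. {\<tau> i..\<tau> (Suc i)})"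
  proof -
    have "m \<le> n \<Longrightarrow> {a..\<tau> m} \<subseteq> (\<Union>i<m. {\<tau> i..\<tau> (Suc i)}) \<union> {a}" for m
      by (induction m) (fastforce simp: lessThan_Suc)+
    from this[of n] show ?thesis using \<tau>_less[of 0] n_pos by fastforce
  qed
  have "negligible (\<Union>i<n. (\<lambda>t. pt (z t)) ` {\<tau> i..\<tau> (Suc i)})"
  proof (rule negligible_Union, simp, clarify)
    fix i assume i: "i < n"
    show "negligible ((\<lambda>t. pt (z t)) ` {\<tau> i..\<tau> (Suc i)})"
    proof (rule negligible_differentiable_image_lowdim)
      show "(\<lambda>t. pt (z t)) differentiable_on {\<tau> i..\<tau> (Suc i)}"
        unfolding differentiable_on_def pt_def
      proof (intro ballI differentiable_Pair)
        fix t assume t: "t \<in> {\<tau> i..\<tau> (Suc i)}"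
        have "(z has_derivative (\<lambda>h. h *\<^sub>R v i t)) (at t within {\<tau> i..\<tau> (Suc i)})"
          using deriv[OF i t] by (simp add: has_vector_derivative_def)
        then show "(\<lambda>t. Re (z t)) differentiable at t within {\<tau> i..\<tau> (Suc i)}"
          "(\<lambda>t. Im (z t)) differentiable at t within {\<tau> i..\<tau> (Suc i)}"
          unfolding differentiable_def by (auto intro!: derivative_eq_intros)
      qed
    qed simp
  qed
  moreover have "pt ` z ` {a..b} \<subseteq> (\<Union>i<n. (\<lambda>t. pt (z t)) ` {\<tau> i..\<tau> (Suc i)})" using cover by fastforce
  ultimately have "negligible (pt ` z ` {a..b})" by (rule negligible_subset)
  then have "pt ` z ` {a..b} \<in> null_sets lborel"
    using cl by (simp add: negligible_iff_null_sets null_sets_completion_iff borel_closed)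
  then show ?thesis by (rule AE_not_in)
qed

definition region :: "(real \<times> real) set" where
  "region = pt ` inside (z ` {a..b})"

lemma compact_curve: "compact (z ` {a..b})"
  by (intro compact_continuous_image cont_z) auto

lemma open_region: "open region"
  unfolding region_def by (intro open_pt_image open_inside compact_imp_closed compact_curve)

lemma flux_region:
  assumes ccw: "\<And>\<zeta>. \<zeta> \<in> inside (z ` {a..b}) \<Longrightarrow> winding_number loop \<zeta> = 1"
    and u: "u \<notin> pt ` z ` {a..b}"
  shows "(\<Sum>i<n. flux i u) = 2 * pi * indicator region u"
proof -
  define \<zeta> where "\<zeta> = Complex (fst u) (snd u)"
  have pt: "pt \<zeta> = u" by (simp add: \<zeta>_def pt_Complex)
  then have out: "\<zeta> \<notin> z ` {a..b}" using u by auto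
  have "Re (winding_number loop \<zeta>) = indicator region u"
  proof (cases "\<zeta> \<in> inside (z ` {a..b})")
    case True
    then show ?thesis using ccw pt by (auto simp: region_def)
  next
    case False
    have "\<zeta> \<in> inside (z ` {a..b}) \<union> outside (z ` {a..b})"
      unfolding inside_Un_outside using out by simp
    with False have "\<zeta> \<in> outside (z ` {a..b})" by blast
    then have "\<zeta> \<in> outside (path_image loop)" by (simp add: path_image_loop)
    then have "winding_number loop \<zeta> = 0"
      by (intro winding_number_zero_in_outside path_loop) (simp_all add: loop_ends)
    moreover have "u \<notin> region" using False pt inj_pt unfolding region_def by (metis inj_image_mem_iff)
    ultimately show ?thesis by simp
  qed
  then show ?thesis using winding_number_flux[OF out] pt by simp
qed

text \<open>Summing \<open>winding_flux_arc\<close> over the pieces, the contributions at the vertices cancel cyclically. The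
  total flux is \<open>2\<pi>\<close> inside and \<open>0\<close> outside, and the curve itself is a null set.\<close>
lemma green_compact_support:
  assumes ccw: "\<And>\<zeta>. \<zeta> \<in> inside (z ` {a..b}) \<Longrightarrow> winding_number loop \<zeta> = 1"
    and f: "C1c R f G" and R: "0 < R"
  shows "has_bochner_integral lborel (\<lambda>u. indicator region u * snd (G u))
           (- (\<Sum>i<n. integral {\<tau> i..\<tau> (Suc i)} (\<lambda>t. Re (v i t) * f (pt (z t)))))"
    and "has_bochner_integral lborel (\<lambda>u. indicator region u * fst (G u))
           (\<Sum>i<n. integral {\<tau> i..\<tau> (Suc i)} (\<lambda>t. Im (v i t) * f (pt (z t))))"
proof -
  have f_cont: "continuous_on UNIV f"
    by (metis C1cD(2)[OF f] continuous_at_imp_continuous_on has_derivative_continuous)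
  have cf: "continuous_on {\<tau> i..\<tau> (Suc i)} (\<lambda>t. f (pt (z t)))" if "i < n" for i
    using cont_z piece_subset[OF that]
    by (intro continuous_on_compose2[OF f_cont] continuous_intros) (auto intro: continuous_on_subset)
  have arc: "integrable lborel (\<lambda>u. flux i u * snd (G u))" "integrable lborel (\<lambda>u. flux i u * fst (G u))"
    "(LINT u|lborel. flux i u * snd (G u)) = - 2 * pi * integral {\<tau> i..\<tau> (Suc i)} (\<lambda>t. Re (v i t) * f (pt (z t))) +
       ((LINT u|lborel. fst u / radius2 u * f (pt (z (\<tau> (Suc i))) - u)) - (LINT u|lborel. fst u / radius2 u * f (pt (z (\<tau> i)) - u)))"
    "(LINT u|lborel. flux i u * fst (G u)) = 2 * pi * integral {\<tau> i..\<tau> (Suc i)} (\<lambda>t. Im (v i t) * f (pt (z t))) -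
       ((LINT u|lborel. snd u / radius2 u * f (pt (z (\<tau> (Suc i))) - u)) - (LINT u|lborel. snd u / radius2 u * f (pt (z (\<tau> i)) - u)))"
    if i: "i < n" for i
  proof -
    have d: "((\<lambda>t. pt (z t)) has_vector_derivative pt (v i t)) (at t within {\<tau> i..\<tau> (Suc i)})"
      if "t \<in> {\<tau> i..\<tau> (Suc i)}" for t
    proof -
      have "(z has_derivative (\<lambda>h. h *\<^sub>R v i t)) (at t within {\<tau> i..\<tau> (Suc i)})"
        using deriv[OF i that] by (simp add: has_vector_derivative_def)
      then show ?thesis unfolding has_vector_derivative_def pt_def
        by (auto intro!: derivative_eq_intros)
    qed
    have c: "continuous_on {\<tau> i..\<tau> (Suc i)} (\<lambda>t. pt (v i t))" by (intro continuous_intros cont_v i)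
    have le: "\<tau> i \<le> \<tau> (Suc i)" using \<tau>_less[OF i] by simp
    note A = winding_flux_arc[OF f R le d c, unfolded pt_simps(1,2), folded wx_def wy_def, folded flux_def]
    show "integrable lborel (\<lambda>u. flux i u * snd (G u))" "integrable lborel (\<lambda>u. flux i u * fst (G u))"
      using A(1,2) by auto
    show "(LINT u|lborel. flux i u * snd (G u)) = - 2 * pi * integral {\<tau> i..\<tau> (Suc i)} (\<lambda>t. Re (v i t) * f (pt (z t))) +
       ((LINT u|lborel. fst u / radius2 u * f (pt (z (\<tau> (Suc i))) - u)) - (LINT u|lborel. fst u / radius2 u * f (pt (z (\<tau> i)) - u)))"
      using A(3) LINT_piece(1)[OF i cf[OF i]] by simp
    show "(LINT u|lborel. flux i u * fst (G u)) = 2 * pi * integral {\<tau> i..\<tau> (Suc i)} (\<lambda>t. Im (v i t) * f (pt (z t))) -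
       ((LINT u|lborel. snd u / radius2 u * f (pt (z (\<tau> (Suc i))) - u)) - (LINT u|lborel. snd u / radius2 u * f (pt (z (\<tau> i)) - u)))"
      using A(4) LINT_piece(2)[OF i cf[OF i]] by simp
  qed
  have ind_m: "(indicator region :: _ \<Rightarrow> real) \<in> borel_measurable borel"
    using open_region by (intro borel_measurable_indicator borel_open)
  have AE: "AE u in lborel. (\<Sum>i<n. flux i u * h u) = 2 * pi * (indicator region u * h u)" for h :: "real \<times> real \<Rightarrow> real"
    using curve_null by eventually_elim (simp add: flux_region[OF ccw] flip: sum_distrib_right)
  have main: "has_bochner_integral lborel (\<lambda>u. indicator region u * h u) (S / (2 * pi))"
    if m: "h \<in> borel_measurable borel" and i: "\<And>i. i < n \<Longrightarrow> integrable lborel (\<lambda>u. flux i u * h u)"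
      and S: "(\<Sum>i<n. LINT u|lborel. flux i u * h u) = S" for h S
  proof -
    have "has_bochner_integral lborel (\<lambda>u. \<Sum>i<n. flux i u * h u) (\<Sum>i<n. LINT u|lborel. flux i u * h u)"
      using i by (intro has_bochner_integral_sum) (auto simp: has_bochner_integral_iff)
    then have H: "has_bochner_integral lborel (\<lambda>u. \<Sum>i<n. flux i u * h u) S" by (simp add: S)
    have "has_bochner_integral lborel (\<lambda>u. 2 * pi * (indicator region u * h u)) S"
    proof (rule has_bochner_integralI_AE[OF H])
      show "(\<lambda>u. 2 * pi * (indicator region u * h u)) \<in> borel_measurable lborel" using m ind_m by simp
    qed (use AE in auto)
    from has_bochner_integral_divide_zero[OF this, of "2 * pi"]
    show ?thesis by simp
  qed
  note m = C1c_measurable[OF f]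
  have zero: "(\<Sum>i<n. (E (z (\<tau> (Suc i))) - E (z (\<tau> i)) :: real)) = 0" for E
    using sum_lessThan_telescope[of "\<lambda>i. E (z (\<tau> i))" n] closed by simp
  have "(\<Sum>i<n. LINT u|lborel. flux i u * snd (G u)) =
      (\<Sum>i<n. - 2 * pi * integral {\<tau> i..\<tau> (Suc i)} (\<lambda>t. Re (v i t) * f (pt (z t))) +
       ((LINT u|lborel. fst u / radius2 u * f (pt (z (\<tau> (Suc i))) - u)) - (LINT u|lborel. fst u / radius2 u * f (pt (z (\<tau> i)) - u))))"
    by (intro sum.cong refl arc(3)) auto
  also have "\<dots> = - 2 * pi * (\<Sum>i<n. integral {\<tau> i..\<tau> (Suc i)} (\<lambda>t. Re (v i t) * f (pt (z t))))"
    unfolding sum.distrib zero[of "\<lambda>w. LINT u|lborel. fst u / radius2 u * f (pt w - u)"] by (simp add: sum_distrib_left sum_negf)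
  finally show "has_bochner_integral lborel (\<lambda>u. indicator region u * snd (G u))
           (- (\<Sum>i<n. integral {\<tau> i..\<tau> (Suc i)} (\<lambda>t. Re (v i t) * f (pt (z t)))))"
    using main[OF m(4) arc(1)] by simp
  have "(\<Sum>i<n. LINT u|lborel. flux i u * fst (G u)) =
      (\<Sum>i<n. 2 * pi * integral {\<tau> i..\<tau> (Suc i)} (\<lambda>t. Im (v i t) * f (pt (z t))) -
       ((LINT u|lborel. snd u / radius2 u * f (pt (z (\<tau> (Suc i))) - u)) - (LINT u|lborel. snd u / radius2 u * f (pt (z (\<tau> i)) - u))))"
    by (intro sum.cong refl arc(4)) auto
  also have "\<dots> = 2 * pi * (\<Sum>i<n. integral {\<tau> i..\<tau> (Suc i)} (\<lambda>t. Im (v i t) * f (pt (z t))))"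
    unfolding sum_subtractf[of _ "\<lambda>i. (LINT u|lborel. snd u / radius2 u * f (pt (z (\<tau> (Suc i))) - u)) - (LINT u|lborel. snd u / radius2 u * f (pt (z (\<tau> i)) - u))"]
      zero[of "\<lambda>w. LINT u|lborel. snd u / radius2 u * f (pt w - u)"] by (simp add: sum_distrib_left)
  finally show "has_bochner_integral lborel (\<lambda>u. indicator region u * fst (G u))
           (\<Sum>i<n. integral {\<tau> i..\<tau> (Suc i)} (\<lambda>t. Im (v i t) * f (pt (z t))))"
    using main[OF m(3) arc(2)] by simp
qed

end


section \<open>Cut-off functions\<close>

text \<open>\<open>G\<close> is the gradient of \<open>f\<close>.\<close>
definition C1_on :: "'a::real_inner set \<Rightarrow> ('a \<Rightarrow> real) \<Rightarrow> ('a \<Rightarrow> 'a) \<Rightarrow> bool" where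
  "C1_on U f G \<longleftrightarrow> continuous_on U G \<and> (\<forall>u\<in>U. (f has_derivative (\<lambda>h. h \<bullet> G u)) (at u))"

lemma C1_on_continuous: "C1_on U f G \<Longrightarrow> continuous_on U f"
  unfolding C1_on_def by (meson continuous_at_imp_continuous_on has_derivative_continuous)

lemma has_derivative_pos_part_square:
  "((\<lambda>x::real. (max 0 x)\<^sup>2) has_real_derivative 2 * max 0 x) (at x)"
proof (cases "x = 0")
  case False
  show ?thesis
  proof (cases "0 < x")
    case True
    have "((\<lambda>y. y\<^sup>2) has_real_derivative 2 * max 0 x) (at x)" using True by (auto intro!: derivative_eq_intros)
    then show ?thesis
      by (rule has_field_derivative_transform_within_open[where S = "{0<..}"]) (use True in auto)
  next
    case neg: False
    have "((\<lambda>y. 0) has_real_derivative 2 * max 0 x) (at x)" using neg by simp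
    then show ?thesis
      by (rule has_field_derivative_transform_within_open[where S = "{..<0}"]) (use neg False in auto)
  qed
next
  case True
  have "((\<lambda>h. ((max 0 (0 + h))\<^sup>2 - (max 0 0)\<^sup>2) / h) \<longlongrightarrow> 0) (at (0::real))"
  proof (rule Lim_null_comparison[where g = "\<lambda>h. \<bar>h\<bar>"])
    have "norm (((max 0 (0 + h))\<^sup>2 - (max 0 0)\<^sup>2) / h) \<le> \<bar>h\<bar>" for h :: real
      by (auto simp: max_def power2_eq_square)
    then show "\<forall>\<^sub>F h in at 0. norm (((max 0 (0 + h))\<^sup>2 - (max 0 0)\<^sup>2) / h) \<le> \<bar>h\<bar>" for h :: real
      by simp
    show "((\<lambda>h. \<bar>h\<bar>) \<longlongrightarrow> 0) (at (0::real))" by (auto intro!: tendsto_eq_intros)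
  qed
  then show ?thesis using True by (simp add: DERIV_def)
qed

text \<open>Squares of positive parts are continuously differentiable. A finite sum \<open>\<Phi>\<close> of such bumps, one for each
  ball of a cover of \<open>K\<close>, is at least some \<open>c > 0\<close> on \<open>K\<close>, and \<open>1 - (max 0 (1 - \<Phi> / c))\<^sup>2\<close> is the
  cut-off function.\<close>
lemma cutoff_exists:
  fixes K U :: "'a::euclidean_space set"
  assumes K: "compact K" and U: "open U" and KU: "K \<subseteq> U"
  obtains \<phi> G S where "C1_on UNIV \<phi> G" "compact S" "S \<subseteq> U" "K \<subseteq> S" "\<And>x. x \<in> K \<Longrightarrow> \<phi> x = 1" "\<And>x. x \<notin> S \<Longrightarrow> \<phi> x = 0"
proof -
  have "\<exists>r>0. cball x r \<subseteq> U" if "x \<in> K" for x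
    using open_contains_cball U KU that by blast
  then obtain r where r: "\<And>x. x \<in> K \<Longrightarrow> 0 < r x \<and> cball x (r x) \<subseteq> U" by metis
  have cover: "K \<subseteq> (\<Union>x\<in>K. ball x (r x))" using r by (auto intro!: bexI)
  obtain F where F: "F \<subseteq> K" "finite F" "K \<subseteq> (\<Union>x\<in>F. ball x (r x))"
    by (rule compactE_image[OF K open_ball cover]) blast
  define B where "B x z = (max 0 ((r x)\<^sup>2 - (z - x) \<bullet> (z - x)))\<^sup>2" for x z
  define GB where "GB x z = (- 4 * max 0 ((r x)\<^sup>2 - (z - x) \<bullet> (z - x))) *\<^sub>R (z - x)" for x z
  have dB: "(B x has_derivative (\<lambda>h. h \<bullet> GB x z)) (at z)" for x z
  proof -
    have "((\<lambda>z. (r x)\<^sup>2 - (z - x) \<bullet> (z - x)) has_derivative (\<lambda>h. - 2 * (h \<bullet> (z - x)))) (at z)"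
      by (auto intro!: derivative_eq_intros simp: inner_commute)
    from DERIV_compose_FDERIV[OF has_derivative_pos_part_square this]
    show ?thesis by (simp add: B_def[abs_def] GB_def algebra_simps)
  qed
  have cGB: "continuous_on UNIV (GB x)" for x
    unfolding GB_def by (intro continuous_intros)
  define \<Phi> where "\<Phi> z = (\<Sum>x\<in>F. B x z)" for z
  define G\<Phi> where "G\<Phi> z = (\<Sum>x\<in>F. GB x z)" for z
  have d\<Phi>: "(\<Phi> has_derivative (\<lambda>h. h \<bullet> G\<Phi> z)) (at z)" for z
    unfolding \<Phi>_def[abs_def] G\<Phi>_def inner_sum_right by (intro has_derivative_sum dB)
  have cG\<Phi>: "continuous_on UNIV G\<Phi>" unfolding G\<Phi>_def by (intro continuous_intros cGB)
  have c\<Phi>: "continuous_on UNIV \<Phi>"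
    by (metis d\<Phi> continuous_at_imp_continuous_on has_derivative_continuous)
  \<comment> \<open>every point of \<open>K\<close> lies in one of the balls\<close>
  have pos: "0 < \<Phi> z" if zK: "z \<in> K" for z
  proof -
    obtain x where x: "x \<in> F" "z \<in> ball x (r x)" using subsetD[OF F(3) zK] by blast
    have "(z - x) \<bullet> (z - x) < (r x)\<^sup>2"
    proof -
      have "norm (z - x) < r x" using x by (simp add: dist_norm norm_minus_commute)
      then have "(norm (z - x))\<^sup>2 < (r x)\<^sup>2" by (intro power_strict_mono) auto
      then show ?thesis by (simp add: power2_norm_eq_inner)
    qed
    then have "0 < B x z" by (simp add: B_def)
    moreover have "0 \<le> B y z" for y by (simp add: B_def)
    ultimately show ?thesis unfolding \<Phi>_def using x F(2) by (intro sum_pos2) auto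
  qed
  obtain c where c: "0 < c" "\<And>z. z \<in> K \<Longrightarrow> c \<le> \<Phi> z"
  proof (cases "K = {}")
    case True
    then show ?thesis using that[of 1] by auto
  next
    case False
    obtain y where "y \<in> K" "\<And>z. z \<in> K \<Longrightarrow> \<Phi> y \<le> \<Phi> z"
      using continuous_attains_inf[OF K False continuous_on_subset[OF c\<Phi> subset_UNIV]] by blast
    then show ?thesis using that[of "\<Phi> y"] pos by auto
  qed
  define \<phi> where "\<phi> z = 1 - (max 0 (1 - \<Phi> z / c))\<^sup>2" for z
  define G where "G z = (2 * max 0 (1 - \<Phi> z / c) / c) *\<^sub>R G\<Phi> z" for z
  have "(\<phi> has_derivative (\<lambda>h. h \<bullet> G z)) (at z)" for z
  proof -
    have "((\<lambda>z. 1 - \<Phi> z / c) has_derivative (\<lambda>h. - (h \<bullet> G\<Phi> z) / c)) (at z)"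
      using c by (auto intro!: derivative_eq_intros d\<Phi>)
    from DERIV_compose_FDERIV[OF has_derivative_pos_part_square this]
    have "((\<lambda>z. 1 - (max 0 (1 - \<Phi> z / c))\<^sup>2) has_derivative (\<lambda>h. 0 - - (h \<bullet> G\<Phi> z) / c * (2 * max 0 (1 - \<Phi> z / c)))) (at z)"
      by (intro has_derivative_diff has_derivative_const)
    then show ?thesis by (simp add: \<phi>_def[abs_def] G_def algebra_simps)
  qed
  moreover have "continuous_on UNIV G" unfolding G_def
    by (intro continuous_intros cG\<Phi> c\<Phi>) (use c in auto)
  ultimately have "C1_on UNIV \<phi> G" by (simp add: C1_on_def)
  moreover define S where "S = K \<union> (\<Union>x\<in>F. cball x (r x))"
  have "compact S" unfolding S_def using F(2) K by (intro compact_Un compact_UN) auto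
  moreover have "S \<subseteq> U" unfolding S_def using r F(1) KU by fastforce
  moreover have "\<phi> z = 1" if "z \<in> K" for z
    using c(2)[OF that] c(1) by (simp add: \<phi>_def max_def)
  moreover have "\<phi> z = 0" if "z \<notin> S" for z
  proof -
    have "B x z = 0" if "x \<in> F" for x
    proof -
      have "r x < norm (z - x)" using \<open>z \<notin> S\<close> that by (auto simp: S_def dist_norm norm_minus_commute)
      moreover have "0 < r x" using r F(1) that by blast
      ultimately have "(r x)\<^sup>2 \<le> (norm (z - x))\<^sup>2" by (intro power_mono) auto
      then show ?thesis by (simp add: B_def power2_norm_eq_inner)
    qed
    then show ?thesis by (simp add: \<phi>_def \<Phi>_def)
  qed
  ultimately show thesis by (intro that[of \<phi> G S]) (auto simp: S_def)
qed

lemma C1_on_extend: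
  fixes K U :: "'a::euclidean_space set"
  assumes f: "C1_on U f G" and K: "compact K" and U: "open U" and KU: "K \<subseteq> U"
  obtains f' G' S where "C1_on UNIV f' G'" "compact S" "\<And>x. x \<in> K \<Longrightarrow> f' x = f x"
    "\<And>x. x \<in> interior K \<Longrightarrow> G' x = G x" "\<And>x. x \<notin> S \<Longrightarrow> f' x = 0 \<and> G' x = 0"
proof -
  obtain \<phi> X S where X: "C1_on UNIV \<phi> X" "compact S" "S \<subseteq> U" "K \<subseteq> S" "\<And>x. x \<in> K \<Longrightarrow> \<phi> x = 1" "\<And>x. x \<notin> S \<Longrightarrow> \<phi> x = 0"
    by (rule cutoff_exists[OF K U KU]) blast
  define f' where "f' x = (if x \<in> U then \<phi> x * f x else 0)" for x
  define G' where "G' x = (if x \<in> U then \<phi> x *\<^sub>R G x + f x *\<^sub>R X x else 0)" for x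
  have oS: "open (- S)" using X(2) compact_imp_closed by blast
  have cov: "U \<union> - S = UNIV" using X(3) by auto
  have zero: "f' x = 0" if "x \<notin> S" for x using X(6)[OF that] by (simp add: f'_def)
  have dU: "(f' has_derivative (\<lambda>h. h \<bullet> G' x)) (at x)" if x: "x \<in> U" for x
  proof -
    have "((\<lambda>x. \<phi> x * f x) has_derivative (\<lambda>h. \<phi> x * (h \<bullet> G x) + (h \<bullet> X x) * f x)) (at x)"
      using f X(1) x by (intro has_derivative_mult) (auto simp: C1_on_def)
    then have "((\<lambda>x. \<phi> x * f x) has_derivative (\<lambda>h. h \<bullet> G' x)) (at x)"
      using x by (simp add: G'_def inner_add_right mult.commute)
    then show ?thesis
      by (rule has_derivative_transform_within_open[OF _ U x]) (simp add: f'_def)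
  qed
  have dS: "(f' has_derivative (\<lambda>h. 0)) (at x)" if x: "x \<in> - S" for x
    by (rule has_derivative_transform_within_open[OF has_derivative_const oS x]) (simp add: zero)
  have G0: "G' x = 0" if "x \<notin> S" for x
  proof (cases "x \<in> U")
    case True
    have "(\<lambda>h. h \<bullet> G' x) = (\<lambda>h. 0)"
      using has_derivative_unique[OF dU[OF True] dS] that by simp
    from fun_cong[OF this, of "G' x"] show ?thesis by simp
  qed (simp add: G'_def)
  have "(f' has_derivative (\<lambda>h. h \<bullet> G' x)) (at x)" for x
  proof (cases "x \<in> U")
    case True
    then show ?thesis by (rule dU)
  next
    case False
    then have "x \<notin> S" using X(3) by blast
    then show ?thesis using dS[of x] by (simp add: G0)
  qed
  moreover have cont: "continuous_on UNIV G'"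
  proof -
    have fc: "continuous_on U f" using C1_on_continuous[OF f] .
    have \<phi>c: "continuous_on U \<phi>" using C1_on_continuous[OF X(1)] continuous_on_subset by blast
    have "continuous_on U (\<lambda>x. \<phi> x *\<^sub>R G x + f x *\<^sub>R X x)"
      using f X(1) by (intro continuous_intros fc \<phi>c) (auto simp: C1_on_def intro: continuous_on_subset)
    then have "continuous_on U G'" by (rule continuous_on_eq) (simp add: G'_def)
    moreover have "continuous_on (- S) G'"
      by (rule continuous_on_eq[of _ "\<lambda>_. 0"]) (auto simp: G0)
    ultimately have "continuous_on (U \<union> - S) G'" by (intro continuous_on_open_Un U oS)
    then show ?thesis by (simp add: cov)
  qed
  ultimately have "C1_on UNIV f' G'" by (simp add: C1_on_def)
  moreover have fK: "f' x = f x" if "x \<in> K" for x using that X(5) KU by (auto simp: f'_def)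
  moreover have "G' x = G x" if x: "x \<in> interior K" for x
  proof -
    have xU: "x \<in> U" using x KU interior_subset by blast
    have "(f has_derivative (\<lambda>h. h \<bullet> G' x)) (at x)"
      by (rule has_derivative_transform_within_open[OF dU[OF xU] open_interior x]) (use fK interior_subset in blast)
    moreover have "(f has_derivative (\<lambda>h. h \<bullet> G x)) (at x)" using f xU by (simp add: C1_on_def)
    ultimately have "(\<lambda>h. h \<bullet> G' x) = (\<lambda>h. h \<bullet> G x)" by (rule has_derivative_unique)
    from fun_cong[OF this, of "G' x - G x"]
    have "(G' x - G x) \<bullet> (G' x - G x) = 0" by (simp add: inner_diff_right)
    then show ?thesis by simp
  qed
  ultimately show thesis using X(2) zero G0 by (intro that[of f' G' S]) auto
qed


section \<open>Green's formula\<close>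

context cornered_loop
begin

lemma compact_closed_region: "compact (pt ` (z ` {a..b} \<union> inside (z ` {a..b})))"
proof (intro compact_continuous_image continuous_intros)
  have "bounded (inside (z ` {a..b}))"
    using compact_curve by (intro bounded_inside compact_imp_bounded)
  then have "bounded (z ` {a..b} \<union> inside (z ` {a..b}))"
    using compact_curve compact_imp_bounded by auto
  moreover have "closed (z ` {a..b} \<union> inside (z ` {a..b}))"
    using closed_path_image_Un_inside[OF path_loop] by (simp add: path_image_loop)
  ultimately show "compact (z ` {a..b} \<union> inside (z ` {a..b}))" by (simp add: compact_eq_bounded_closed)
qed

text \<open>A cut-off function that is \<open>1\<close> on the closed domain reduces the statement to compact support.\<close>
theorem green:
  assumes ccw: "\<And>\<zeta>. \<zeta> \<in> inside (z ` {a..b}) \<Longrightarrow> winding_number loop \<zeta> = 1"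
    and f: "C1_on U f G" and U: "open U" "pt ` (z ` {a..b} \<union> inside (z ` {a..b})) \<subseteq> U"
  shows "has_bochner_integral lborel (\<lambda>u. indicator region u * snd (G u))
           (- (\<Sum>i<n. integral {\<tau> i..\<tau> (Suc i)} (\<lambda>t. Re (v i t) * f (pt (z t)))))"
    and "has_bochner_integral lborel (\<lambda>u. indicator region u * fst (G u))
           (\<Sum>i<n. integral {\<tau> i..\<tau> (Suc i)} (\<lambda>t. Im (v i t) * f (pt (z t))))"
proof -
  define K where "K = pt ` (z ` {a..b} \<union> inside (z ` {a..b}))"
  have K: "compact K" unfolding K_def by (rule compact_closed_region)
  obtain f' G' S where f': "C1_on UNIV f' G'" "compact S" "\<And>x. x \<in> K \<Longrightarrow> f' x = f x"
    "\<And>x. x \<in> interior K \<Longrightarrow> G' x = G x" "\<And>x. x \<notin> S \<Longrightarrow> f' x = 0 \<and> G' x = 0"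
    by (rule C1_on_extend[OF f K U(1) U(2)[folded K_def]]) blast
  obtain R where R: "0 < R" "\<And>x. x \<in> S \<Longrightarrow> norm x \<le> R"
    using compact_imp_bounded[OF f'(2)] bounded_pos by metis
  have "x \<in> {-R..R} \<times> {-R..R}" if "x \<in> S" for x
    using R(2)[OF that] norm_fst_le[of "fst x" "snd x"] norm_snd_le[of "snd x" "fst x"]
    by (auto simp: mem_Times_iff abs_le_iff)
  then have c: "C1c R f' G'" using f'(1,5) unfolding C1c_def C1_on_def by blast
  have reg: "region \<subseteq> interior K"
    by (rule interior_maximal[OF _ open_region]) (auto simp: region_def K_def)
  have eqG: "indicator region u * snd (G' u) = indicator region u * snd (G u)"
    "indicator region u * fst (G' u) = indicator region u * fst (G u)" for u
    using f'(4)[of u] reg by (auto simp: indicator_def)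
  have eqf: "integral {\<tau> i..\<tau> (Suc i)} (\<lambda>t. q t * f' (pt (z t))) = integral {\<tau> i..\<tau> (Suc i)} (\<lambda>t. q t * f (pt (z t)))"
    if "i < n" for i q
    using piece_subset[OF that] by (intro integral_cong) (auto simp: K_def intro!: f'(3))
  show "has_bochner_integral lborel (\<lambda>u. indicator region u * snd (G u))
           (- (\<Sum>i<n. integral {\<tau> i..\<tau> (Suc i)} (\<lambda>t. Re (v i t) * f (pt (z t)))))"
    using green_compact_support(1)[OF ccw c R(1)] by (simp add: eqG eqf)
  show "has_bochner_integral lborel (\<lambda>u. indicator region u * fst (G u))
           (\<Sum>i<n. integral {\<tau> i..\<tau> (Suc i)} (\<lambda>t. Im (v i t) * f (pt (z t))))"
    using green_compact_support(2)[OF ccw c R(1)] by (simp add: eqG eqf)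
qed

end


section \<open>Smooth functions and partial derivatives\<close>

lemma has_derivative_cong_open:
  assumes "open S" "x \<in> S" "\<And>y. y \<in> S \<Longrightarrow> f y = g y"
  shows "(f has_derivative F) (at x) \<longleftrightarrow> (g has_derivative F) (at x)"
  using has_derivative_transform_within_open[of f F x UNIV S g] has_derivative_transform_within_open[of g F x UNIV S f] assms
  by auto

lemma frechet_derivative_cong_open:
  assumes "open S" "x \<in> S" "\<And>y. y \<in> S \<Longrightarrow> f y = g y"
  shows "frechet_derivative f (at x) = frechet_derivative g (at x)"
  unfolding frechet_derivative_def by (simp add: has_derivative_cong_open[OF assms])

lemma Ck_on_cong:
  assumes S: "open S"
  shows "(\<And>x. x \<in> S \<Longrightarrow> f x = g x) \<Longrightarrow> Ck_on n S f \<Longrightarrow> Ck_on n S g"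
proof (induction n arbitrary: f g)
  case 0
  then show ?case using continuous_on_cong[of S S f g] by simp
next
  case (Suc n)
  have "g differentiable (at x)" if "x \<in> S" for x
  proof -
    have "(f has_derivative F) (at x) \<longleftrightarrow> (g has_derivative F) (at x)" for F
      by (rule has_derivative_cong_open[OF S that Suc.prems(1)])
    then show ?thesis using Suc.prems(2) that by (metis Ck_on.simps(2) differentiable_def)
  qed
  moreover have "Ck_on n S (\<lambda>x. frechet_derivative g (at x) v)" for v
    by (rule Suc.IH[of "\<lambda>x. frechet_derivative f (at x) v"])
      (use Suc.prems(2) frechet_derivative_cong_open[OF S _ Suc.prems(1)] in auto)
  ultimately show ?case by simp
qed

lemma Ck_on_SucI:
  assumes S: "open S" and d: "\<And>x. x \<in> S \<Longrightarrow> (f has_derivative F x) (at x)" and F: "\<And>v. Ck_on n S (\<lambda>x. F x v)"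
  shows "Ck_on (Suc n) S f"
proof -
  have "frechet_derivative f (at x) = F x" if "x \<in> S" for x
    using frechet_derivative_at[OF d[OF that]] by simp
  then have "Ck_on n S (\<lambda>x. frechet_derivative f (at x) v)" for v
    by (intro Ck_on_cong[OF S _ F[of v]]) simp
  then show ?thesis using d by (auto simp: differentiable_def)
qed

lemma Ck_on_SucD:
  assumes "Ck_on (Suc n) S f"
  shows "x \<in> S \<Longrightarrow> (f has_derivative frechet_derivative f (at x)) (at x)"
    and "Ck_on n S (\<lambda>x. frechet_derivative f (at x) v)"
  using assms by (auto simp: frechet_derivative_works)

lemma Ck_on_continuous: "open S \<Longrightarrow> Ck_on n S f \<Longrightarrow> continuous_on S f"
proof (induction n arbitrary: f)
  case (Suc n)
  then show ?case
    by (auto intro!: continuous_at_imp_continuous_on simp: differentiable_imp_continuous_within)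
qed simp

lemma Ck_on_Suc_imp: "open S \<Longrightarrow> Ck_on (Suc n) S f \<Longrightarrow> Ck_on n S f"
proof (induction n arbitrary: f)
  case 0
  then show ?case using Ck_on_continuous[of S "Suc 0" f] by simp
next
  case (Suc n)
  then show ?case by (meson Ck_on.simps(2))
qed

lemma Ck_on_const: "open S \<Longrightarrow> Ck_on n S (\<lambda>x. c)"
proof (induction n arbitrary: c)
  case (Suc n)
  show ?case by (rule Ck_on_SucI[OF Suc.prems has_derivative_const Suc.IH[OF Suc.prems]])
qed simp

lemma Ck_on_add: "open S \<Longrightarrow> Ck_on n S f \<Longrightarrow> Ck_on n S g \<Longrightarrow> Ck_on n S (\<lambda>x. f x + g x)"
proof (induction n arbitrary: f g)
  case 0
  then show ?case by (auto intro: continuous_intros)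
next
  case (Suc n)
  show ?case
    by (rule Ck_on_SucI[OF Suc.prems(1) has_derivative_add[OF Ck_on_SucD(1)[OF Suc.prems(2)] Ck_on_SucD(1)[OF Suc.prems(3)]]])
      (auto intro!: Suc.IH Suc.prems(1) Ck_on_SucD(2)[OF Suc.prems(2)] Ck_on_SucD(2)[OF Suc.prems(3)])
qed

lemma Ck_on_linear: "bounded_linear L \<Longrightarrow> open S \<Longrightarrow> Ck_on n S f \<Longrightarrow> Ck_on n S (\<lambda>x. L (f x))"
proof (induction n arbitrary: f)
  case 0
  then show ?case by (auto intro: bounded_linear.continuous_on)
next
  case (Suc n)
  show ?case
    by (rule Ck_on_SucI[OF Suc.prems(2) bounded_linear.has_derivative[OF Suc.prems(1) Ck_on_SucD(1)[OF Suc.prems(3)]]])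
      (auto intro!: Suc.IH Suc.prems(1,2) Ck_on_SucD(2)[OF Suc.prems(3)])
qed

lemma Ck_on_bilinear:
  fixes f :: "'a::real_normed_vector \<Rightarrow> 'b::real_normed_vector" and g :: "'a \<Rightarrow> 'c::real_normed_vector"
  assumes p: "bounded_bilinear p"
  shows "open S \<Longrightarrow> Ck_on n S f \<Longrightarrow> Ck_on n S g \<Longrightarrow> Ck_on n S (\<lambda>x. p (f x) (g x))"
proof (induction n arbitrary: f g)
  case 0
  then show ?case using p by (auto intro: bounded_bilinear.continuous_on)
next
  case (Suc n)
  note S = Suc.prems(1)
  have f: "Ck_on n S f" and g: "Ck_on n S g"
    using Ck_on_Suc_imp[OF S Suc.prems(2)] Ck_on_Suc_imp[OF S Suc.prems(3)] by auto
  show ?case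
    by (rule Ck_on_SucI[OF S bounded_bilinear.FDERIV[OF p Ck_on_SucD(1)[OF Suc.prems(2)] Ck_on_SucD(1)[OF Suc.prems(3)]]])
      (auto intro!: Ck_on_add S Suc.IH f g Ck_on_SucD(2)[OF Suc.prems(2)] Ck_on_SucD(2)[OF Suc.prems(3)])
qed

lemmas Ck_on_mult = Ck_on_bilinear[OF bounded_bilinear_mult]

lemma Ck_on_inverse:
  fixes f :: "'a::real_normed_vector \<Rightarrow> real"
  shows "open S \<Longrightarrow> (\<And>x. x \<in> S \<Longrightarrow> f x \<noteq> 0) \<Longrightarrow> Ck_on n S f \<Longrightarrow> Ck_on n S (\<lambda>x. inverse (f x))"
proof (induction n)
  case 0
  then show ?case by (auto intro!: continuous_intros)
next
  case (Suc n)
  note S = Suc.prems(1)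
  have IH: "Ck_on n S (\<lambda>x. inverse (f x))" by (rule Suc.IH[OF S Suc.prems(2) Ck_on_Suc_imp[OF S Suc.prems(3)]])
  have D: "Ck_on n S (\<lambda>x. - (inverse (f x) * frechet_derivative f (at x) v * inverse (f x)))" for v
    by (intro Ck_on_linear[OF bounded_linear_minus[OF bounded_linear_ident]] Ck_on_mult S IH Ck_on_SucD(2)[OF Suc.prems(3)])
  show ?case
    by (rule Ck_on_SucI[OF S Deriv.has_derivative_inverse[OF Suc.prems(2) Ck_on_SucD(1)[OF Suc.prems(3)]] D])
qed

lemma Ck_on_sqrt:
  fixes f :: "'a::real_normed_vector \<Rightarrow> real"
  shows "open S \<Longrightarrow> (\<And>x. x \<in> S \<Longrightarrow> 0 < f x) \<Longrightarrow> Ck_on n S f \<Longrightarrow> Ck_on n S (\<lambda>x. sqrt (f x))"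
proof (induction n)
  case 0
  then show ?case by (auto intro!: continuous_intros)
next
  case (Suc n)
  note S = Suc.prems(1)
  have IH: "Ck_on n S (\<lambda>x. sqrt (f x))" by (rule Suc.IH[OF S Suc.prems(2) Ck_on_Suc_imp[OF S Suc.prems(3)]])
  have d: "((\<lambda>x. sqrt (f x)) has_derivative (\<lambda>v. frechet_derivative f (at x) v * (inverse (sqrt (f x)) / 2))) (at x)"
    if "x \<in> S" for x
    by (rule DERIV_compose_FDERIV[OF DERIV_real_sqrt[OF Suc.prems(2)[OF that]] Ck_on_SucD(1)[OF Suc.prems(3) that]])
  have "sqrt (f x) \<noteq> 0" if "x \<in> S" for x using Suc.prems(2)[OF that] by simp
  then have D: "Ck_on n S (\<lambda>x. frechet_derivative f (at x) v * (inverse (sqrt (f x)) / 2))" for v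
    by (intro Ck_on_mult S Ck_on_SucD(2)[OF Suc.prems(3)] Ck_on_linear[OF bounded_linear_divide] Ck_on_inverse IH)
  show ?case by (rule Ck_on_SucI[OF S d D])
qed

lemma smooth_on_cong: "open S \<Longrightarrow> (\<And>x. x \<in> S \<Longrightarrow> f x = g x) \<Longrightarrow> smooth_on S f \<Longrightarrow> smooth_on S g"
  unfolding smooth_on_def using Ck_on_cong by blast

lemma smooth_on_subset:
  assumes "smooth_on S f" "T \<subseteq> S" shows "smooth_on T f"
proof -
  have "Ck_on n S f \<Longrightarrow> Ck_on n T f" for n and f :: "'a \<Rightarrow> 'b"
    using assms(2) by (induction n arbitrary: f) (auto intro: continuous_on_subset)
  then show ?thesis using assms(1) by (auto simp: smooth_on_def)
qed

lemma smooth_on_const [intro]: "open S \<Longrightarrow> smooth_on S (\<lambda>x. c)"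
  by (simp add: smooth_on_def Ck_on_const)

lemma smooth_on_add: "open S \<Longrightarrow> smooth_on S f \<Longrightarrow> smooth_on S g \<Longrightarrow> smooth_on S (\<lambda>x. f x + g x)"
  by (simp add: smooth_on_def Ck_on_add)

lemma smooth_on_linear: "bounded_linear L \<Longrightarrow> open S \<Longrightarrow> smooth_on S f \<Longrightarrow> smooth_on S (\<lambda>x. L (f x))"
  by (simp add: smooth_on_def Ck_on_linear)

lemma smooth_on_minus: "open S \<Longrightarrow> smooth_on S f \<Longrightarrow> smooth_on S (\<lambda>x. - f x)"
  by (rule smooth_on_linear[OF bounded_linear_minus[OF bounded_linear_ident]])

lemma smooth_on_diff: "open S \<Longrightarrow> smooth_on S f \<Longrightarrow> smooth_on S g \<Longrightarrow> smooth_on S (\<lambda>x. f x - g x)"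
  using smooth_on_add[OF _ _ smooth_on_minus, of S f g] by simp

lemma smooth_on_mult:
  fixes f g :: "'a::real_normed_vector \<Rightarrow> real"
  shows "open S \<Longrightarrow> smooth_on S f \<Longrightarrow> smooth_on S g \<Longrightarrow> smooth_on S (\<lambda>x. f x * g x)"
  by (simp add: smooth_on_def Ck_on_mult)

lemma smooth_on_inverse:
  fixes f :: "'a::real_normed_vector \<Rightarrow> real"
  shows "open S \<Longrightarrow> (\<And>x. x \<in> S \<Longrightarrow> f x \<noteq> 0) \<Longrightarrow> smooth_on S f \<Longrightarrow> smooth_on S (\<lambda>x. inverse (f x))"
  by (simp add: smooth_on_def Ck_on_inverse)

lemma smooth_on_divide:
  fixes f g :: "'a::real_normed_vector \<Rightarrow> real"
  shows "open S \<Longrightarrow> (\<And>x. x \<in> S \<Longrightarrow> g x \<noteq> 0) \<Longrightarrow> smooth_on S f \<Longrightarrow> smooth_on S g \<Longrightarrow> smooth_on S (\<lambda>x. f x / g x)"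
  unfolding divide_inverse by (intro smooth_on_mult smooth_on_inverse)

lemma smooth_on_sqrt:
  fixes f :: "'a::real_normed_vector \<Rightarrow> real"
  shows "open S \<Longrightarrow> (\<And>x. x \<in> S \<Longrightarrow> 0 < f x) \<Longrightarrow> smooth_on S f \<Longrightarrow> smooth_on S (\<lambda>x. sqrt (f x))"
  by (simp add: smooth_on_def Ck_on_sqrt)

lemma smooth_on_sum:
  assumes S: "open S" shows "(\<And>i. i \<in> I \<Longrightarrow> smooth_on S (f i)) \<Longrightarrow> smooth_on S (\<lambda>x. \<Sum>i\<in>I. f i x)"
  by (induction I rule: infinite_finite_induct) (auto intro: smooth_on_add S)

lemma smooth_on_nth: "open S \<Longrightarrow> smooth_on S f \<Longrightarrow> smooth_on S (\<lambda>x. f x $ i)"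
  by (rule smooth_on_linear[OF bounded_linear_vec_nth])

lemma smooth_on_vec:
  fixes f :: "'n::finite \<Rightarrow> 'a::real_normed_vector \<Rightarrow> 'b::real_normed_vector"
  assumes S: "open S" and f: "\<And>i. smooth_on S (f i)"
  shows "smooth_on S (\<lambda>x. \<chi> i. f i x)"
proof -
  have "bounded_linear (\<lambda>y. \<chi> j. if j = i then y else (0::'b))" for i :: 'n
    by (rule bounded_linear_intro[where K = 1])
      (auto simp: vec_eq_iff norm_vec_def L2_set_def if_distrib[of norm] if_distrib[of "\<lambda>x. x ^ 2"] sum.delta cong: if_cong)
  then have "smooth_on S (\<lambda>x. \<Sum>i\<in>UNIV. (\<chi> j. if j = i then f i x else 0))"
    by (intro smooth_on_sum S) (rule smooth_on_linear[OF _ S f], simp)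
  moreover have "(\<Sum>i\<in>UNIV. (\<chi> j. if j = i then f i x else 0)) = (\<chi> i. f i x)" for x
    by (simp add: vec_eq_iff sum.delta)
  ultimately show ?thesis by simp
qed

lemma smooth_on_pd: "smooth_on S f \<Longrightarrow> smooth_on S (pd i f)"
  unfolding smooth_on_def pd_def[abs_def] using Ck_on_SucD(2) by blast

lemma smooth_on_differentiable: "smooth_on S f \<Longrightarrow> x \<in> S \<Longrightarrow> f differentiable (at x)"
  unfolding smooth_on_def by (metis Ck_on.simps(2))

lemma smooth_on_continuous: "smooth_on S f \<Longrightarrow> continuous_on S f"
  unfolding smooth_on_def by (metis Ck_on.simps(1))

lemma pd_has_derivative: "(f has_derivative F) (at x) \<Longrightarrow> pd i f x = F (axis i 1)"
  unfolding pd_def by (metis frechet_derivative_at)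

lemma has_derivative_pd:
  assumes "f differentiable (at x)"
  shows "(f has_derivative (\<lambda>h. h $ 1 * pd 1 f x + h $ 2 * pd 2 f x)) (at x)"
proof -
  have d: "(f has_derivative frechet_derivative f (at x)) (at x)"
    using assms by (simp add: frechet_derivative_works)
  have lin: "linear (frechet_derivative f (at x))" using assms by (rule linear_frechet_derivative)
  have "frechet_derivative f (at x) h = h $ 1 * pd 1 f x + h $ 2 * pd 2 f x" for h :: "real^2"
  proof -
    have "h = h $ 1 *\<^sub>R axis 1 1 + h $ 2 *\<^sub>R axis 2 1"
      by (simp add: vec_eq_iff axis_def forall_2)
    then have "frechet_derivative f (at x) h = frechet_derivative f (at x) (h $ 1 *\<^sub>R axis 1 1 + h $ 2 *\<^sub>R axis 2 1)"
      by simp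
    then show ?thesis using lin by (simp add: linear_add linear_scale pd_def)
  qed
  then show ?thesis using d by (metis (no_types, lifting) ext)
qed

lemma pd_cong:
  assumes "open S" "x \<in> S" "\<And>y. y \<in> S \<Longrightarrow> f y = g y"
  shows "pd i f x = pd i g x"
  by (simp add: pd_def frechet_derivative_cong_open[OF assms])

lemma pd_add: "f differentiable (at x) \<Longrightarrow> g differentiable (at x) \<Longrightarrow> pd i (\<lambda>y. f y + g y) x = pd i f x + pd i g x"
  unfolding pd_def frechet_derivative_works
  by (subst frechet_derivative_at[OF has_derivative_add, symmetric]) auto

lemma pd_diff: "f differentiable (at x) \<Longrightarrow> g differentiable (at x) \<Longrightarrow> pd i (\<lambda>y. f y - g y) x = pd i f x - pd i g x"
  unfolding pd_def frechet_derivative_works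
  by (subst frechet_derivative_at[OF has_derivative_diff, symmetric]) auto

lemma pd_minus: "f differentiable (at x) \<Longrightarrow> pd i (\<lambda>y. - f y) x = - pd i f x"
  unfolding pd_def frechet_derivative_works
  by (subst frechet_derivative_at[OF has_derivative_minus, symmetric]) auto

lemma pd_mult: "f differentiable (at x) \<Longrightarrow> g differentiable (at x) \<Longrightarrow> pd i (\<lambda>y. f y * g y) x = pd i f x * g x + f x * pd i g x"
  unfolding pd_def frechet_derivative_works
  by (subst frechet_derivative_at[OF has_derivative_mult, symmetric]) (auto simp: mult.commute)

lemma pd_const [simp]: "pd i (\<lambda>y. c) x = 0"
  using pd_has_derivative[OF has_derivative_const[of c "at x"], of i] by simp

lemma has_real_derivative_along_axis:
  assumes "f differentiable (at (x + s *\<^sub>R axis i 1))"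
  shows "((\<lambda>s. f (x + s *\<^sub>R axis i 1)) has_real_derivative pd i f (x + s *\<^sub>R axis i 1)) (at s)"
proof -
  have "((\<lambda>s. x + s *\<^sub>R axis i 1) has_derivative (\<lambda>h. h *\<^sub>R axis i 1)) (at s)"
    by (auto intro!: derivative_eq_intros)
  from has_derivative_compose[OF this assms[unfolded frechet_derivative_works]]
  have "((\<lambda>s. f (x + s *\<^sub>R axis i 1)) has_derivative
      (\<lambda>h. frechet_derivative f (at (x + s *\<^sub>R axis i 1)) (h *\<^sub>R axis i 1))) (at s)" .
  moreover have "frechet_derivative f (at (x + s *\<^sub>R axis i 1)) (h *\<^sub>R axis i 1) = h * pd i f (x + s *\<^sub>R axis i 1)" for h
    using linear_scale[OF linear_frechet_derivative[OF assms]] by (simp add: pd_def)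
  ultimately show ?thesis by (simp add: has_field_derivative_def mult_commute_abs)
qed

text \<open>The mean value theorem, applied in both directions.\<close>
lemma second_difference:
  assumes e: "0 < e" and f: "\<And>s t. s \<in> {0..e} \<Longrightarrow> t \<in> {0..e} \<Longrightarrow>
      f differentiable (at (x + s *\<^sub>R axis i 1 + t *\<^sub>R axis j 1)) \<and> pd i f differentiable (at (x + s *\<^sub>R axis i 1 + t *\<^sub>R axis j 1))"
  obtains s t where "0 < s" "s < e" "0 < t" "t < e"
    "f (x + e *\<^sub>R axis i 1 + e *\<^sub>R axis j 1) - f (x + e *\<^sub>R axis i 1) - f (x + e *\<^sub>R axis j 1) + f x
      = e * e * pd j (pd i f) (x + s *\<^sub>R axis i 1 + t *\<^sub>R axis j 1)"
proof -
  define u where "u s = f (x + s *\<^sub>R axis i 1 + e *\<^sub>R axis j 1) - f (x + s *\<^sub>R axis i 1)" for s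
  have d: "(u has_real_derivative pd i f (x + s *\<^sub>R axis i 1 + e *\<^sub>R axis j 1) - pd i f (x + s *\<^sub>R axis i 1)) (at s)"
    if s: "0 \<le> s" "s \<le> e" for s
  proof -
    have "((\<lambda>s. f ((x + e *\<^sub>R axis j 1) + s *\<^sub>R axis i 1)) has_real_derivative pd i f ((x + e *\<^sub>R axis j 1) + s *\<^sub>R axis i 1)) (at s)"
      by (rule has_real_derivative_along_axis) (use f[of s e] s e in \<open>auto simp: add_ac\<close>)
    moreover have "((\<lambda>s. f (x + s *\<^sub>R axis i 1)) has_real_derivative pd i f (x + s *\<^sub>R axis i 1)) (at s)"
      by (rule has_real_derivative_along_axis) (use f[of s 0] s e in auto)
    ultimately show ?thesis unfolding u_def[abs_def]
      by (intro DERIV_diff) (simp_all add: add_ac)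
  qed
  obtain s where s: "0 < s" "s < e" "u e - u 0 = (e - 0) * (pd i f (x + s *\<^sub>R axis i 1 + e *\<^sub>R axis j 1) - pd i f (x + s *\<^sub>R axis i 1))"
    using MVT2[OF e d] by auto
  have d2: "((\<lambda>t. pd i f (x + s *\<^sub>R axis i 1 + t *\<^sub>R axis j 1)) has_real_derivative pd j (pd i f) (x + s *\<^sub>R axis i 1 + t *\<^sub>R axis j 1)) (at t)"
    if t: "0 \<le> t" "t \<le> e" for t
    by (rule has_real_derivative_along_axis) (use f[of s t] s t in auto)
  obtain t where t: "0 < t" "t < e" "pd i f (x + s *\<^sub>R axis i 1 + e *\<^sub>R axis j 1) - pd i f (x + s *\<^sub>R axis i 1 + 0 *\<^sub>R axis j 1)
      = (e - 0) * pd j (pd i f) (x + s *\<^sub>R axis i 1 + t *\<^sub>R axis j 1)"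
    using MVT2[OF e d2] by auto
  show thesis
    by (rule that[OF s(1,2) t(1,2)]) (use s(3) t(3) in \<open>simp add: u_def algebra_simps\<close>)
qed

text \<open>Both mixed derivatives are limits of the same second difference.\<close>
lemma pd_commute:
  assumes S: "open S" "x \<in> S" and f: "smooth_on S f"
  shows "pd 1 (pd 2 f) x = pd 2 (pd 1 f) x"
proof (rule ccontr)
  assume ne: "pd 1 (pd 2 f) x \<noteq> pd 2 (pd 1 f) x"
  define d where "d = \<bar>pd 1 (pd 2 f) x - pd 2 (pd 1 f) x\<bar> / 2"
  have d: "0 < d" using ne by (simp add: d_def)
  have c: "isCont (pd 1 (pd 2 f)) x" "isCont (pd 2 (pd 1 f)) x"
    using smooth_on_continuous[OF smooth_on_pd[OF smooth_on_pd[OF f]]] S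
    by (simp_all add: continuous_on_eq_continuous_at)
  obtain r1 where r1: "0 < r1" "\<And>y. dist y x < r1 \<Longrightarrow> dist (pd 1 (pd 2 f) y) (pd 1 (pd 2 f) x) < d"
    using c(1) d unfolding continuous_at_eps_delta by (metis dist_commute)
  obtain r2 where r2: "0 < r2" "\<And>y. dist y x < r2 \<Longrightarrow> dist (pd 2 (pd 1 f) y) (pd 2 (pd 1 f) x) < d"
    using c(2) d unfolding continuous_at_eps_delta by (metis dist_commute)
  obtain r3 where r3: "0 < r3" "\<And>y. dist y x < r3 \<Longrightarrow> y \<in> S"
    using S unfolding open_dist by metis
  define e where "e = Min {r1, r2, r3} / 3"
  have e: "0 < e" "3 * e \<le> r1" "3 * e \<le> r2" "3 * e \<le> r3" using r1 r2 r3 by (auto simp: e_def)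
  have near: "dist (x + s *\<^sub>R axis i 1 + t *\<^sub>R axis j 1) x < 3 * e" if "s \<in> {0..e}" "t \<in> {0..e}" for s t and i j :: 2
  proof -
    have "dist (x + s *\<^sub>R axis i 1 + t *\<^sub>R axis j 1) x \<le> norm (s *\<^sub>R axis i (1::real)) + norm (t *\<^sub>R axis j (1::real))"
    proof -
      have "x + s *\<^sub>R axis i 1 + t *\<^sub>R axis j 1 - x = s *\<^sub>R axis i 1 + t *\<^sub>R axis j 1" by simp
      then show ?thesis unfolding dist_norm by (simp only: norm_triangle_ineq)
    qed
    also have "\<dots> < 3 * e" using that e by simp
    finally show ?thesis .
  qed
  have df: "f differentiable (at (x + s *\<^sub>R axis i 1 + t *\<^sub>R axis j 1)) \<and> pd i f differentiable (at (x + s *\<^sub>R axis i 1 + t *\<^sub>R axis j 1))"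
    if "s \<in> {0..e}" "t \<in> {0..e}" for s t i j
    using r3(2)[of "x + s *\<^sub>R axis i 1 + t *\<^sub>R axis j 1"] near[OF that, of i j] e f
    by (auto intro!: smooth_on_differentiable smooth_on_pd)
  obtain s t where st: "0 < s" "s < e" "0 < t" "t < e"
    "f (x + e *\<^sub>R axis 1 1 + e *\<^sub>R axis 2 1) - f (x + e *\<^sub>R axis 1 1) - f (x + e *\<^sub>R axis 2 1) + f x
      = e * e * pd 2 (pd 1 f) (x + s *\<^sub>R axis 1 1 + t *\<^sub>R axis 2 1)"
    by (rule second_difference[OF e(1) df]) 
  obtain s' t' where st': "0 < s'" "s' < e" "0 < t'" "t' < e"
    "f (x + e *\<^sub>R axis 2 1 + e *\<^sub>R axis 1 1) - f (x + e *\<^sub>R axis 2 1) - f (x + e *\<^sub>R axis 1 1) + f x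
      = e * e * pd 1 (pd 2 f) (x + s' *\<^sub>R axis 2 1 + t' *\<^sub>R axis 1 1)"
    by (rule second_difference[OF e(1) df])
  have "e * e * pd 2 (pd 1 f) (x + s *\<^sub>R axis 1 1 + t *\<^sub>R axis 2 1) = e * e * pd 1 (pd 2 f) (x + s' *\<^sub>R axis 2 1 + t' *\<^sub>R axis 1 1)"
    unfolding st(5)[symmetric] st'(5)[symmetric] by (simp add: add_ac)
  then have eq: "pd 2 (pd 1 f) (x + s *\<^sub>R axis 1 1 + t *\<^sub>R axis 2 1) = pd 1 (pd 2 f) (x + s' *\<^sub>R axis 2 1 + t' *\<^sub>R axis 1 1)"
    using e by simp
  have "dist (pd 2 (pd 1 f) (x + s *\<^sub>R axis 1 1 + t *\<^sub>R axis 2 1)) (pd 2 (pd 1 f) x) < d"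
    by (rule r2(2), rule less_le_trans[OF near e(3)]) (use st in auto)
  moreover have "dist (pd 1 (pd 2 f) (x + s' *\<^sub>R axis 2 1 + t' *\<^sub>R axis 1 1)) (pd 1 (pd 2 f) x) < d"
    by (rule r1(2), rule less_le_trans[OF near e(2)]) (use st' in auto)
  ultimately have "\<bar>pd 1 (pd 2 f) x - pd 2 (pd 1 f) x\<bar> < d + d"
    using eq unfolding dist_real_def by linarith
  then show False by (simp add: d_def)
qed


section \<open>Orthonormal frames on a chart\<close>

lemma ginner_expand:
  "ginner g c x v w = v $ 1 * (g c x $ 1 $ 1 * w $ 1 + g c x $ 1 $ 2 * w $ 2) + v $ 2 * (g c x $ 2 $ 1 * w $ 1 + g c x $ 2 $ 2 * w $ 2)"
  by (simp add: ginner_def inner_vec_def matrix_vector_mult_def sum_2)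

lemma det_frame: "det (vector [v, w] :: real^2^2) = v $ 1 * w $ 2 - v $ 2 * w $ 1"
  by (simp add: det_2 vector_2)

text \<open>If \<open>M\<close> has the rows \<open>v\<close> and \<open>w\<close>, orthonormality says \<open>M A M\<^sup>T = 1\<close>; for square matrices the factors may
  be rotated cyclically.\<close>
lemma orthonormal_complete:
  fixes A :: "real^2^2" and v w :: "real^2"
  assumes "v \<bullet> (A *v v) = 1" "w \<bullet> (A *v w) = 1" "v \<bullet> (A *v w) = 0" "w \<bullet> (A *v v) = 0"
  shows "v $ k * (\<Sum>l\<in>UNIV. v $ l * A $ l $ m) + w $ k * (\<Sum>l\<in>UNIV. w $ l * A $ l $ m) = (if k = m then 1 else 0)"
proof -
  define M :: "real^2^2" where "M = vector [v, w]"
  have M: "M $ 1 = v" "M $ 2 = w" by (simp_all add: M_def vector_2)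
  have "(M ** A) ** transpose M = mat 1"
    using assms
    by (simp add: vec_eq_iff forall_2 matrix_matrix_mult_def transpose_def sum_2 M mat_def
        inner_vec_def matrix_vector_mult_def algebra_simps)
  then have "transpose M ** (M ** A) = mat 1" by (rule matrix_left_right_inverse[THEN iffD1])
  then have "(transpose M ** (M ** A)) $ k $ m = (mat 1 :: real^2^2) $ k $ m" by simp
  then show ?thesis by (simp add: matrix_matrix_mult_def transpose_def sum_2 M mat_def)
qed

lemma positive_definite_2:
  fixes A :: "real^2^2"
  assumes sym: "transpose A = A" and pos: "\<And>v. v \<noteq> 0 \<Longrightarrow> v \<bullet> (A *v v) > 0"
  shows "A $ 2 $ 1 = A $ 1 $ 2" "0 < A $ 1 $ 1" "0 < det A"
proof -
  show s: "A $ 2 $ 1 = A $ 1 $ 2" using arg_cong[OF sym, of "\<lambda>M. M $ 1 $ 2"] by (simp add: transpose_def)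
  have "vector [1, 0] \<noteq> (0 :: real^2)" by (simp add: vec_eq_iff forall_2 vector_2)
  from pos[OF this] show p: "0 < A $ 1 $ 1"
    by (simp add: inner_vec_def matrix_vector_mult_def sum_2 vector_2)
  define u :: "real^2" where "u = vector [- A $ 1 $ 2, A $ 1 $ 1]"
  have u: "u $ 1 = - A $ 1 $ 2" "u $ 2 = A $ 1 $ 1" by (simp_all add: u_def vector_2)
  have "u \<noteq> 0" using p u by (auto simp: vec_eq_iff forall_2)
  from pos[OF this] have "0 < A $ 1 $ 1 * det A"
    by (simp add: inner_vec_def matrix_vector_mult_def sum_2 u det_2 s algebra_simps)
  then show "0 < det A" using p by (simp add: zero_less_mult_iff)
qed

lemma matrix_inv_2:
  fixes A :: "real^2^2"
  assumes "det A \<noteq> 0"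
  shows "matrix_inv A $ 1 $ 1 = A $ 2 $ 2 / det A" "matrix_inv A $ 1 $ 2 = - A $ 1 $ 2 / det A"
    "matrix_inv A $ 2 $ 1 = - A $ 2 $ 1 / det A" "matrix_inv A $ 2 $ 2 = A $ 1 $ 1 / det A"
proof -
  define B :: "real^2^2" where "B = vector [vector [A $ 2 $ 2 / det A, - A $ 1 $ 2 / det A], vector [- A $ 2 $ 1 / det A, A $ 1 $ 1 / det A]]"
  have B: "B $ 1 $ 1 = A $ 2 $ 2 / det A" "B $ 1 $ 2 = - A $ 1 $ 2 / det A"
    "B $ 2 $ 1 = - A $ 2 $ 1 / det A" "B $ 2 $ 2 = A $ 1 $ 1 / det A"
    by (simp_all add: B_def vector_2)
  have "A ** B = mat 1"
    using assms by (simp add: vec_eq_iff forall_2 matrix_matrix_mult_def sum_2 B mat_def flip: diff_divide_distrib)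
      (simp add: det_2 algebra_simps)
  then have AB: "A ** B = mat 1 \<and> B ** A = mat 1" using matrix_left_right_inverse by blast
  then have "A ** matrix_inv A = mat 1 \<and> matrix_inv A ** A = mat 1"
    unfolding matrix_inv_def by (rule someI)
  then have "matrix_inv A = B"
    using AB by (metis matrix_mul_assoc matrix_mul_lid matrix_mul_rid)
  then show "matrix_inv A $ 1 $ 1 = A $ 2 $ 2 / det A" "matrix_inv A $ 1 $ 2 = - A $ 1 $ 2 / det A"
    "matrix_inv A $ 2 $ 1 = - A $ 2 $ 1 / det A" "matrix_inv A $ 2 $ 2 = A $ 1 $ 1 / det A"
    by (simp_all add: B)
qed

text \<open>An open set of coordinates on which \<open>\<Gamma>\<close> is compatible with the metric; \<open>\<Gamma>\<close> may have torsion, so that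
  the results apply to the Levi-Civita connection and to other metric connections.\<close>
locale metric_patch =
  fixes g :: "'a metric_field" and \<Gamma> :: "'a connection_field" and c :: "'a chart" and V :: "(real^2) set"
  assumes open_V: "open V" and smooth_g: "smooth_on V (g c)" and smooth_\<Gamma>: "smooth_on V (\<Gamma> c)"
    and sym: "\<And>x. x \<in> V \<Longrightarrow> transpose (g c x) = g c x"
    and pos: "\<And>x v. x \<in> V \<Longrightarrow> v \<noteq> 0 \<Longrightarrow> v \<bullet> (g c x *v v) > 0"
    and metric: "\<And>x i l j. x \<in> V \<Longrightarrow> cov_metric g \<Gamma> c x i l j = 0"
begin

lemma g21: "x \<in> V \<Longrightarrow> g c x $ 2 $ 1 = g c x $ 1 $ 2"
  and g11_pos: "x \<in> V \<Longrightarrow> 0 < g c x $ 1 $ 1"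
  and det_pos: "x \<in> V \<Longrightarrow> 0 < det (g c x)"
  using positive_definite_2[OF sym pos] by auto

lemma pd_g: "x \<in> V \<Longrightarrow> pd i (\<lambda>y. g c y $ l $ j) x =
    \<Gamma> c x $ i $ 1 $ l * g c x $ 1 $ j + \<Gamma> c x $ i $ 2 $ l * g c x $ 2 $ j
    + \<Gamma> c x $ i $ 1 $ j * g c x $ l $ 1 + \<Gamma> c x $ i $ 2 $ j * g c x $ l $ 2"
  using metric[of x i l j] by (simp add: cov_metric_def sum_2)

lemma smooth_g_nth: "smooth_on V (\<lambda>y. g c y $ l $ j)"
  by (intro smooth_on_nth open_V smooth_g)

lemma smooth_\<Gamma>_nth: "smooth_on V (\<lambda>y. \<Gamma> c y $ i $ k $ j)"
  by (intro smooth_on_nth open_V smooth_\<Gamma>)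

lemma differentiable_g: "x \<in> V \<Longrightarrow> (\<lambda>y. g c y $ l $ j) differentiable (at x)"
  by (rule smooth_on_differentiable[OF smooth_g_nth])

lemma differentiable_\<Gamma>: "x \<in> V \<Longrightarrow> (\<lambda>y. \<Gamma> c y $ i $ k $ j) differentiable (at x)"
  by (rule smooth_on_differentiable[OF smooth_\<Gamma>_nth])

lemma cov_deriv_nth: "cov_deriv \<Gamma> c i Y x $ k =
    pd i (\<lambda>y. Y y $ k) x + \<Gamma> c x $ i $ k $ 1 * Y x $ 1 + \<Gamma> c x $ i $ k $ 2 * Y x $ 2"
  by (simp add: cov_deriv_def sum_2)

lemma pd_ginner:
  assumes x: "x \<in> V" and Y: "smooth_on V Y" and Z: "smooth_on V Z"
  shows "pd i (\<lambda>y. ginner g c y (Y y) (Z y)) x =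
    ginner g c x (cov_deriv \<Gamma> c i Y x) (Z x) + ginner g c x (Y x) (cov_deriv \<Gamma> c i Z x)"
proof -
  have d: "(\<lambda>y. Y y $ k) differentiable (at x)" "(\<lambda>y. Z y $ k) differentiable (at x)" for k
    using smooth_on_differentiable[OF smooth_on_nth[OF open_V Y] x] smooth_on_differentiable[OF smooth_on_nth[OF open_V Z] x] by auto
  show ?thesis
    unfolding ginner_expand
    by (simp add: pd_add pd_mult d differentiable_g[OF x] pd_g[OF x] cov_deriv_nth g21[OF x])
      (simp add: algebra_simps)
qed

lemma smooth_cov_deriv:
  assumes "smooth_on V Y"
  shows "smooth_on V (\<lambda>x. cov_deriv \<Gamma> c i Y x $ k)"
  unfolding cov_deriv_nth using assms
  by (intro smooth_on_add smooth_on_mult smooth_on_pd smooth_on_nth smooth_\<Gamma> open_V)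

lemma smooth_ginner:
  assumes "\<And>k. smooth_on V (\<lambda>x. Y x $ k)" "\<And>k. smooth_on V (\<lambda>x. Z x $ k)"
  shows "smooth_on V (\<lambda>x. ginner g c x (Y x) (Z x))"
  unfolding ginner_expand using assms
  by (intro smooth_on_add smooth_on_mult smooth_g_nth open_V)

end

locale frame_patch = metric_patch g \<Gamma> c V for g :: "'a metric_field" and \<Gamma> c V +
  fixes \<sigma> :: "'a chart \<Rightarrow> real^2 \<Rightarrow> real" and E :: "real^2 \<Rightarrow> real^2^2"
  assumes smooth_E: "smooth_on V E"
    and orthonormal: "\<And>x. x \<in> V \<Longrightarrow> oriented_orthonormal \<sigma> g c x (E x $ 1) (E x $ 2)"
    and sign: "\<And>x. x \<in> V \<Longrightarrow> \<sigma> c x = 1 \<or> \<sigma> c x = -1"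
begin

lemma smooth_E_nth: "smooth_on V (\<lambda>x. E x $ \<alpha>)" "smooth_on V (\<lambda>x. E x $ \<alpha> $ k)"
  by (intro smooth_on_nth open_V smooth_E)+

lemma differentiable_E: "x \<in> V \<Longrightarrow> (\<lambda>y. E y $ \<alpha> $ k) differentiable (at x)"
  by (rule smooth_on_differentiable[OF smooth_E_nth(2)])

lemma on: "x \<in> V \<Longrightarrow> ginner g c x (E x $ 1) (E x $ 1) = 1"
  "x \<in> V \<Longrightarrow> ginner g c x (E x $ 2) (E x $ 2) = 1"
  "x \<in> V \<Longrightarrow> ginner g c x (E x $ 1) (E x $ 2) = 0"
  "x \<in> V \<Longrightarrow> ginner g c x (E x $ 2) (E x $ 1) = 0"
  using orthonormal[of x] g21[of x] by (auto simp: oriented_orthonormal_def ginner_expand algebra_simps)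

lemma complete:
  assumes "x \<in> V"
  shows "E x $ 1 $ k * (E x $ 1 $ 1 * g c x $ 1 $ m + E x $ 1 $ 2 * g c x $ 2 $ m) +
     E x $ 2 $ k * (E x $ 2 $ 1 * g c x $ 1 $ m + E x $ 2 $ 2 * g c x $ 2 $ m) = (if k = m then 1 else 0)"
  using orthonormal_complete[of "E x $ 1" "g c x" "E x $ 2" k m] on[OF assms]
  by (simp add: ginner_def sum_2)

lemma expand:
  assumes "x \<in> V"
  shows "u = ginner g c x u (E x $ 1) *\<^sub>R E x $ 1 + ginner g c x u (E x $ 2) *\<^sub>R E x $ 2"
proof -
  have "u $ k = ginner g c x u (E x $ 1) * E x $ 1 $ k + ginner g c x u (E x $ 2) * E x $ 2 $ k" for k
  proof -
    have "u $ k = u $ 1 * (if k = 1 then 1 else 0) + u $ 2 * (if k = 2 then 1 else 0)"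
      using exhaust_2[of k] by auto
    also have "\<dots> = ginner g c x u (E x $ 1) * E x $ 1 $ k + ginner g c x u (E x $ 2) * E x $ 2 $ k"
      unfolding complete[OF assms, symmetric] ginner_expand by (simp add: g21[OF assms] algebra_simps)
    finally show ?thesis .
  qed
  then show ?thesis by (simp add: vec_eq_iff)
qed

text \<open>The determinant of the frame, which is the reciprocal of the component of the area form.\<close>
definition \<rho> :: "real^2 \<Rightarrow> real" where
  "\<rho> x = E x $ 1 $ 1 * E x $ 2 $ 2 - E x $ 1 $ 2 * E x $ 2 $ 1"

lemma smooth_\<rho>: "smooth_on V \<rho>"
  unfolding \<rho>_def[abs_def] by (intro smooth_on_diff smooth_on_mult smooth_E_nth open_V)

lemma det_\<rho>: "x \<in> V \<Longrightarrow> det (g c x) * (\<rho> x)\<^sup>2 = 1"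
proof -
  assume x: "x \<in> V"
  have "det (g c x) * (\<rho> x)\<^sup>2 = ginner g c x (E x $ 1) (E x $ 1) * ginner g c x (E x $ 2) (E x $ 2)
      - ginner g c x (E x $ 1) (E x $ 2) * ginner g c x (E x $ 2) (E x $ 1)"
    unfolding ginner_expand det_2 \<rho>_def by (simp add: g21[OF x] power2_eq_square algebra_simps)
  then show ?thesis using on[OF x] by simp
qed

lemma \<rho>_nz: "x \<in> V \<Longrightarrow> \<rho> x \<noteq> 0"
  using det_\<rho>[of x] by auto

lemma area_form_\<rho>: "x \<in> V \<Longrightarrow> area_form \<sigma> g c x = 1 / \<rho> x"
proof -
  assume x: "x \<in> V"
  have p: "0 < \<sigma> c x * \<rho> x"
    using orthonormal[OF x] by (simp add: oriented_orthonormal_def oriented_det_def det_frame \<rho>_def)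
  have "det (g c x) = (1 / \<rho> x)\<^sup>2" using det_\<rho>[OF x] \<rho>_nz[OF x] by (simp add: field_simps power2_eq_square)
  then have "sqrt (det (g c x)) = \<bar>1 / \<rho> x\<bar>" by simp
  then show ?thesis using sign[OF x] p by (auto simp: area_form_def abs_if)
qed

text \<open>The component \<open>\<omega>\<^sup>1\<^sub>2\<close> of the connection form, which determines the others because the frame is
  orthonormal.\<close>
definition w :: "2 \<Rightarrow> real^2 \<Rightarrow> real" where
  "w i x = ginner g c x (cov_deriv \<Gamma> c i (\<lambda>y. E y $ 2) x) (E x $ 1)"

lemma smooth_w: "smooth_on V (w i)"
  unfolding w_def[abs_def] by (intro smooth_ginner smooth_cov_deriv smooth_E_nth)

lemma cov_skew:
  assumes x: "x \<in> V"
  shows "ginner g c x (cov_deriv \<Gamma> c i (\<lambda>y. E y $ \<alpha>) x) (E x $ \<beta>) + ginner g c x (E x $ \<alpha>) (cov_deriv \<Gamma> c i (\<lambda>y. E y $ \<beta>) x) = 0"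
proof -
  have "pd i (\<lambda>y. ginner g c y (E y $ \<alpha>) (E y $ \<beta>)) x = pd i (\<lambda>y. if \<alpha> = \<beta> then 1 else 0) x"
    by (rule pd_cong[OF open_V x]) (use on exhaust_2[of \<alpha>] exhaust_2[of \<beta>] in auto)
  then show ?thesis using pd_ginner[OF x smooth_E_nth(1) smooth_E_nth(1), of i \<alpha> \<beta>] by simp
qed

lemma ginner_commute: "x \<in> V \<Longrightarrow> ginner g c x u v = ginner g c x v u"
  by (simp add: ginner_expand g21 algebra_simps)

lemma cov_E:
  assumes x: "x \<in> V"
  shows "cov_deriv \<Gamma> c i (\<lambda>y. E y $ 2) x = w i x *\<^sub>R E x $ 1"
    and "cov_deriv \<Gamma> c i (\<lambda>y. E y $ 1) x = - w i x *\<^sub>R E x $ 2"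
proof -
  have s: "ginner g c x (cov_deriv \<Gamma> c i (\<lambda>y. E y $ \<alpha>) x) (E x $ \<alpha>) = 0" for \<alpha>
    using cov_skew[OF x, of i \<alpha> \<alpha>] ginner_commute[OF x, of "E x $ \<alpha>"] by simp
  have t: "ginner g c x (cov_deriv \<Gamma> c i (\<lambda>y. E y $ 1) x) (E x $ 2) = - w i x"
    using cov_skew[OF x, of i 1 2] ginner_commute[OF x, of "E x $ 1"] by (simp add: w_def)
  show "cov_deriv \<Gamma> c i (\<lambda>y. E y $ 2) x = w i x *\<^sub>R E x $ 1"
    using expand[OF x, of "cov_deriv \<Gamma> c i (\<lambda>y. E y $ 2) x"] by (simp add: s w_def)
  show "cov_deriv \<Gamma> c i (\<lambda>y. E y $ 1) x = - w i x *\<^sub>R E x $ 2"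
    using expand[OF x, of "cov_deriv \<Gamma> c i (\<lambda>y. E y $ 1) x"] by (simp add: s t)
qed

lemma pd_E:
  assumes x: "x \<in> V"
  shows "pd i (\<lambda>y. E y $ 2 $ k) x = w i x * E x $ 1 $ k - (\<Gamma> c x $ i $ k $ 1 * E x $ 2 $ 1 + \<Gamma> c x $ i $ k $ 2 * E x $ 2 $ 2)"
    and "pd i (\<lambda>y. E y $ 1 $ k) x = - w i x * E x $ 2 $ k - (\<Gamma> c x $ i $ k $ 1 * E x $ 1 $ 1 + \<Gamma> c x $ i $ k $ 2 * E x $ 1 $ 2)"
  using arg_cong[OF cov_E(1)[OF x, of i], of "\<lambda>u. u $ k"] arg_cong[OF cov_E(2)[OF x, of i], of "\<lambda>u. u $ k"]
  by (simp_all add: cov_deriv_nth)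

lemma pd_\<rho>: "x \<in> V \<Longrightarrow> pd i \<rho> x = - \<rho> x * (\<Gamma> c x $ i $ 1 $ 1 + \<Gamma> c x $ i $ 2 $ 2)"
  unfolding \<rho>_def[abs_def]
  by (simp add: pd_diff pd_mult differentiable_E pd_E) (simp add: algebra_simps)

text \<open>The second partial derivatives of the frame commute; expressing them by \<open>w\<close> and the Christoffel
  symbols gives \<open>R(\<partial>\<^sub>1, \<partial>\<^sub>2) E\<^sub>2 = dw E\<^sub>1\<close> and \<open>R(\<partial>\<^sub>1, \<partial>\<^sub>2) E\<^sub>1 = - dw E\<^sub>2\<close>.\<close>
lemma curvature_on_frame:
  assumes x: "x \<in> V"
  shows "riemann \<Gamma> c x 1 2 1 k * E x $ 2 $ 1 + riemann \<Gamma> c x 1 2 2 k * E x $ 2 $ 2 = (pd 1 (w 2) x - pd 2 (w 1) x) * E x $ 1 $ k"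
    and "riemann \<Gamma> c x 1 2 1 k * E x $ 1 $ 1 + riemann \<Gamma> c x 1 2 2 k * E x $ 1 $ 2 = - (pd 1 (w 2) x - pd 2 (w 1) x) * E x $ 2 $ k"
proof -
  have dw: "w i differentiable (at x)" for i by (rule smooth_on_differentiable[OF smooth_w x])
  note D = dw differentiable_E[OF x] differentiable_\<Gamma>[OF x]
  have "pd 1 (\<lambda>x. w 2 x * E x $ 1 $ k - (\<Gamma> c x $ 2 $ k $ 1 * E x $ 2 $ 1 + \<Gamma> c x $ 2 $ k $ 2 * E x $ 2 $ 2)) x = pd 1 (pd 2 (\<lambda>y. E y $ 2 $ k)) x"
    by (rule pd_cong[OF open_V x]) (simp add: pd_E)
  also have "\<dots> = pd 2 (pd 1 (\<lambda>y. E y $ 2 $ k)) x" by (rule pd_commute[OF open_V x smooth_E_nth(2)])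
  also have "\<dots> = pd 2 (\<lambda>x. w 1 x * E x $ 1 $ k - (\<Gamma> c x $ 1 $ k $ 1 * E x $ 2 $ 1 + \<Gamma> c x $ 1 $ k $ 2 * E x $ 2 $ 2)) x"
    by (rule pd_cong[OF open_V x]) (simp add: pd_E)
  finally show "riemann \<Gamma> c x 1 2 1 k * E x $ 2 $ 1 + riemann \<Gamma> c x 1 2 2 k * E x $ 2 $ 2 = (pd 1 (w 2) x - pd 2 (w 1) x) * E x $ 1 $ k"
    by (simp add: pd_diff pd_add pd_mult D pd_E[OF x] riemann_def sum_2) (simp add: algebra_simps)
  have "pd 1 (\<lambda>x. - w 2 x * E x $ 2 $ k - (\<Gamma> c x $ 2 $ k $ 1 * E x $ 1 $ 1 + \<Gamma> c x $ 2 $ k $ 2 * E x $ 1 $ 2)) x = pd 1 (pd 2 (\<lambda>y. E y $ 1 $ k)) x"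
    by (rule pd_cong[OF open_V x]) (simp add: pd_E)
  also have "\<dots> = pd 2 (pd 1 (\<lambda>y. E y $ 1 $ k)) x" by (rule pd_commute[OF open_V x smooth_E_nth(2)])
  also have "\<dots> = pd 2 (\<lambda>x. - w 1 x * E x $ 2 $ k - (\<Gamma> c x $ 1 $ k $ 1 * E x $ 1 $ 1 + \<Gamma> c x $ 1 $ k $ 2 * E x $ 1 $ 2)) x"
    by (rule pd_cong[OF open_V x]) (simp add: pd_E)
  finally show "riemann \<Gamma> c x 1 2 1 k * E x $ 1 $ 1 + riemann \<Gamma> c x 1 2 2 k * E x $ 1 $ 2 = - (pd 1 (w 2) x - pd 2 (w 1) x) * E x $ 2 $ k"
    by (simp add: pd_diff pd_add pd_mult pd_minus D pd_E[OF x] riemann_def sum_2) (simp add: algebra_simps)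
qed

text \<open>\<open>R(\<partial>\<^sub>1, \<partial>\<^sub>2) \<partial>\<^sub>2\<close> is recovered from the action of the curvature on the frame by Cramer's rule.\<close>
lemma gauss_curvature_frame:
  assumes x: "x \<in> V"
  shows "gauss_curvature g \<Gamma> c x * area_form \<sigma> g c x = pd 1 (w 2) x - pd 2 (w 1) x"
proof -
  define dw where "dw = pd 1 (w 2) x - pd 2 (w 1) x"
  have R: "riemann \<Gamma> c x 1 2 2 k * \<rho> x = dw * (E x $ 1 $ 1 * E x $ 1 $ k + E x $ 2 $ 1 * E x $ 2 $ k)" for k
  proof -
    have "riemann \<Gamma> c x 1 2 2 k * \<rho> x =
       E x $ 1 $ 1 * (riemann \<Gamma> c x 1 2 1 k * E x $ 2 $ 1 + riemann \<Gamma> c x 1 2 2 k * E x $ 2 $ 2)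
       - E x $ 2 $ 1 * (riemann \<Gamma> c x 1 2 1 k * E x $ 1 $ 1 + riemann \<Gamma> c x 1 2 2 k * E x $ 1 $ 2)"
      by (simp add: \<rho>_def algebra_simps)
    then show ?thesis unfolding curvature_on_frame[OF x] dw_def[symmetric] by (simp add: algebra_simps)
  qed
  have "(riemann \<Gamma> c x 1 2 2 1 * g c x $ 1 $ 1 + riemann \<Gamma> c x 1 2 2 2 * g c x $ 2 $ 1) * \<rho> x =
      (riemann \<Gamma> c x 1 2 2 1 * \<rho> x) * g c x $ 1 $ 1 + (riemann \<Gamma> c x 1 2 2 2 * \<rho> x) * g c x $ 2 $ 1"
    by (simp add: algebra_simps)
  also have "\<dots> = dw * (E x $ 1 $ 1 * (E x $ 1 $ 1 * g c x $ 1 $ 1 + E x $ 1 $ 2 * g c x $ 2 $ 1) +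
     E x $ 2 $ 1 * (E x $ 2 $ 1 * g c x $ 1 $ 1 + E x $ 2 $ 2 * g c x $ 2 $ 1))"
    unfolding R by (simp add: algebra_simps)
  also have "\<dots> = dw" using complete[OF x, of 1 1] by simp
  finally have *: "(riemann \<Gamma> c x 1 2 2 1 * g c x $ 1 $ 1 + riemann \<Gamma> c x 1 2 2 2 * g c x $ 2 $ 1) * \<rho> x = dw" .
  have d: "det (g c x) = 1 / (\<rho> x)\<^sup>2" using det_\<rho>[OF x] \<rho>_nz[OF x] by (simp add: field_simps)
  show ?thesis
    using *[symmetric] \<rho>_nz[OF x]
    by (simp add: gauss_curvature_def sum_2 d area_form_\<rho>[OF x] dw_def[symmetric] power2_eq_square)
qed

text \<open>Minus the Hodge star of the 1-form \<open>B\<close>, characterised by \<open>\<beta>(v) = B(N)\<close> for oriented orthonormal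
  \<open>v, N\<close> (\<open>normal_component_\<beta>\<close>).\<close>
definition \<beta> :: "(real^2 \<Rightarrow> real^2) \<Rightarrow> 2 \<Rightarrow> real^2 \<Rightarrow> real" where
  "\<beta> B i x = (if i = 1 then g c x $ 1 $ 1 * B x $ 2 - g c x $ 1 $ 2 * B x $ 1
                       else g c x $ 1 $ 2 * B x $ 2 - g c x $ 2 $ 2 * B x $ 1) * \<rho> x"

lemma smooth_\<beta>: "smooth_on V B \<Longrightarrow> smooth_on V (\<beta> B i)"
  unfolding \<beta>_def[abs_def]
  by (cases "i = 1") (auto intro!: smooth_on_mult smooth_on_diff smooth_g_nth smooth_on_nth smooth_\<rho> open_V)

text \<open>Metric compatibility expresses the derivatives of \<open>g\<close> and of \<open>\<rho>\<close> by Christoffel symbols. With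
  vanishing torsion, what remains on the right is the divergence of \<open>B\<close>.\<close>
lemma codiff_frame:
  assumes x: "x \<in> V" and B: "smooth_on V (\<psi> c)"
    and torsion: "\<And>i k j. \<Gamma> c x $ i $ k $ j = \<Gamma> c x $ j $ k $ i"
  shows "codiff g \<Gamma> \<psi> c x * area_form \<sigma> g c x = pd 1 (\<beta> (\<psi> c) 2) x - pd 2 (\<beta> (\<psi> c) 1) x"
proof -
  have dB: "(\<lambda>y. \<psi> c y $ k) differentiable (at x)" for k
    by (rule smooth_on_differentiable[OF smooth_on_nth[OF open_V B] x])
  have d\<rho>: "\<rho> differentiable (at x)" by (rule smooth_on_differentiable[OF smooth_\<rho> x])
  have d: "det (g c x) = 1 / (\<rho> x)\<^sup>2" using det_\<rho>[OF x] \<rho>_nz[OF x] by (simp add: field_simps)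
  have t: "\<Gamma> c x $ 2 $ k $ 1 = \<Gamma> c x $ 1 $ k $ 2" for k by (rule torsion)
  have dnz: "det (g c x) \<noteq> 0" using det_pos[OF x] by simp
  note D = dB differentiable_g[OF x] d\<rho>
  have one: "pd 1 (\<beta> (\<psi> c) 2) x = pd 1 (\<lambda>x. (g c x $ 1 $ 2 * \<psi> c x $ 2 - g c x $ 2 $ 2 * \<psi> c x $ 1) * \<rho> x) x"
    "pd 2 (\<beta> (\<psi> c) 1) x = pd 2 (\<lambda>x. (g c x $ 1 $ 1 * \<psi> c x $ 2 - g c x $ 1 $ 2 * \<psi> c x $ 1) * \<rho> x) x"
    by (simp_all add: \<beta>_def[abs_def])
  have inv: "matrix_inv (g c x) $ 1 $ 1 = g c x $ 2 $ 2 * (\<rho> x * \<rho> x)"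
    "matrix_inv (g c x) $ 1 $ 2 = - g c x $ 1 $ 2 * (\<rho> x * \<rho> x)"
    "matrix_inv (g c x) $ 2 $ 1 = - g c x $ 1 $ 2 * (\<rho> x * \<rho> x)"
    "matrix_inv (g c x) $ 2 $ 2 = g c x $ 1 $ 1 * (\<rho> x * \<rho> x)"
    by (simp_all add: matrix_inv_2[OF dnz] d g21[OF x] power2_eq_square)
  have "codiff g \<Gamma> \<psi> c x = (pd 1 (\<beta> (\<psi> c) 2) x - pd 2 (\<beta> (\<psi> c) 1) x) * \<rho> x"
    unfolding one codiff_def sum_2 inv
    by (simp add: pd_mult pd_diff D pd_g[OF x] pd_\<rho>[OF x] g21[OF x] t) (simp add: algebra_simps)
  then show ?thesis unfolding area_form_\<rho>[OF x] using \<rho>_nz[OF x] by simp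
qed

end


section \<open>Metric connections with torsion\<close>

context frame_patch
begin

lemma connection_form_w:
  assumes \<omega>: "connection_form \<Gamma> c V E \<omega>" and x: "x \<in> V"
  shows "\<omega> x $ i $ 1 $ 2 = w i x" "\<omega> x $ i $ 2 $ 1 = - w i x" "\<omega> x $ i $ 1 $ 1 = 0" "\<omega> x $ i $ 2 $ 2 = 0"
proof -
  have eq: "cov_deriv \<Gamma> c i (\<lambda>y. E y $ \<beta>) x = \<omega> x $ i $ 1 $ \<beta> *\<^sub>R E x $ 1 + \<omega> x $ i $ 2 $ \<beta> *\<^sub>R E x $ 2" for \<beta>
    using \<omega> x by (simp add: connection_form_def sum_2)
  have lin: "ginner g c x (a *\<^sub>R u + b *\<^sub>R v) y = a * ginner g c x u y + b * ginner g c x v y" for a b u v y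
    by (simp add: ginner_expand algebra_simps)
  have lin1: "ginner g c x (a *\<^sub>R u) y = a * ginner g c x u y" for a u y
    by (simp add: ginner_expand algebra_simps)
  have "ginner g c x (w i x *\<^sub>R E x $ 1) (E x $ \<alpha>) = ginner g c x (\<omega> x $ i $ 1 $ 2 *\<^sub>R E x $ 1 + \<omega> x $ i $ 2 $ 2 *\<^sub>R E x $ 2) (E x $ \<alpha>)" for \<alpha>
    using eq[of 2] cov_E(1)[OF x, of i] by simp
  from this[of 1] this[of 2] show "\<omega> x $ i $ 1 $ 2 = w i x" "\<omega> x $ i $ 2 $ 2 = 0"
    by (simp_all add: lin lin1 on[OF x])
  have "ginner g c x (- w i x *\<^sub>R E x $ 2) (E x $ \<alpha>) = ginner g c x (\<omega> x $ i $ 1 $ 1 *\<^sub>R E x $ 1 + \<omega> x $ i $ 2 $ 1 *\<^sub>R E x $ 2) (E x $ \<alpha>)" for \<alpha>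
    using eq[of 1] cov_E(2)[OF x, of i] by simp
  from this[of 1] this[of 2] show "\<omega> x $ i $ 1 $ 1 = 0" "\<omega> x $ i $ 2 $ 1 = - w i x"
    unfolding lin lin1 by (simp_all add: on[OF x])
qed

lemma Pf_curvature_form:
  assumes \<omega>: "connection_form \<Gamma> c V E \<omega>" and x: "x \<in> V"
  shows "Pf (curvature_form \<omega> x) = pd 1 (w 2) x - pd 2 (w 1) x"
proof -
  note W = connection_form_w[OF \<omega>]
  have dw: "w i differentiable (at x)" for i by (rule smooth_on_differentiable[OF smooth_w x])
  have p: "pd i (\<lambda>y. \<omega> y $ j $ 1 $ 2) x = pd i (w j) x" "pd i (\<lambda>y. \<omega> y $ j $ 2 $ 1) x = - pd i (w j) x" for i j
    unfolding pd_minus[OF dw, symmetric] by (rule pd_cong[OF open_V x]; simp add: W)+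
  show ?thesis
    unfolding Pf_def curvature_form_def by (simp add: sum_2 p W[OF x])
qed

end

text \<open>The normal is the velocity with its index lowered, rotated and scaled by the determinant of the pair.\<close>
lemma normal_flat:
  assumes "ginner g c x v v = 1" "ginner g c x v N = 0" "g c x $ 2 $ 1 = g c x $ 1 $ 2"
  shows "N $ 1 = - (v $ 1 * N $ 2 - v $ 2 * N $ 1) * (g c x $ 1 $ 2 * v $ 1 + g c x $ 2 $ 2 * v $ 2)"
    and "N $ 2 = (v $ 1 * N $ 2 - v $ 2 * N $ 1) * (g c x $ 1 $ 1 * v $ 1 + g c x $ 1 $ 2 * v $ 2)"
proof -
  define a where "a = g c x $ 1 $ 1 * v $ 1 + g c x $ 1 $ 2 * v $ 2"
  define b where "b = g c x $ 1 $ 2 * v $ 1 + g c x $ 2 $ 2 * v $ 2"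
  have 1: "v $ 1 * a + v $ 2 * b = 1" using assms by (simp add: ginner_expand a_def b_def)
  have 2: "a * N $ 1 + b * N $ 2 = 0" using assms by (simp add: ginner_expand a_def b_def algebra_simps)
  have "N $ 1 * (v $ 1 * a + v $ 2 * b) = v $ 1 * (a * N $ 1 + b * N $ 2) - (v $ 1 * N $ 2 - v $ 2 * N $ 1) * b"
    "N $ 2 * (v $ 1 * a + v $ 2 * b) = v $ 2 * (a * N $ 1 + b * N $ 2) + (v $ 1 * N $ 2 - v $ 2 * N $ 1) * a"
    by (simp_all add: algebra_simps)
  then have "N $ 1 = - (v $ 1 * N $ 2 - v $ 2 * N $ 1) * b" "N $ 2 = (v $ 1 * N $ 2 - v $ 2 * N $ 1) * a"
    unfolding 1 2 by (simp_all add: algebra_simps)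
  then show "N $ 1 = - (v $ 1 * N $ 2 - v $ 2 * N $ 1) * (g c x $ 1 $ 2 * v $ 1 + g c x $ 2 $ 2 * v $ 2)"
    "N $ 2 = (v $ 1 * N $ 2 - v $ 2 * N $ 1) * (g c x $ 1 $ 1 * v $ 1 + g c x $ 1 $ 2 * v $ 2)"
    by (simp_all only: a_def b_def)
qed

lemma lower_nth: "lower g T c x $ i $ k $ j = g c x $ k $ 1 * T c x $ i $ 1 $ j + g c x $ k $ 2 * T c x $ i $ 2 $ j"
  by (simp add: lower_def sum_2)

lemma contraction_nth: "contraction T c x $ i = T c x $ 1 $ 1 $ i + T c x $ 2 $ 2 $ i"
  by (simp add: contraction_def sum_2)

text \<open>A tensor that is skew in the last two of three indices has two independent components in dimension
  two, as many as a 1-form has. The endomorphism \<open>T\<^sub>i\<close> has trace zero because its lowered form is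
  skew.\<close>
lemma skew_contraction:
  assumes skew: "\<And>i k j. lower g T c x $ i $ k $ j = - lower g T c x $ i $ j $ k"
    and s: "g c x $ 2 $ 1 = g c x $ 1 $ 2" and d: "det (g c x) \<noteq> 0"
  shows "lower g T c x $ 1 $ 1 $ 2 = g c x $ 1 $ 1 * contraction T c x $ 2 - g c x $ 1 $ 2 * contraction T c x $ 1"
    and "lower g T c x $ 2 $ 1 $ 2 = g c x $ 1 $ 2 * contraction T c x $ 2 - g c x $ 2 $ 2 * contraction T c x $ 1"
proof -
  have e: "g c x $ 1 $ 1 * T c x $ i $ 1 $ 1 + g c x $ 1 $ 2 * T c x $ i $ 2 $ 1 = 0"
    "g c x $ 1 $ 2 * T c x $ i $ 1 $ 2 + g c x $ 2 $ 2 * T c x $ i $ 2 $ 2 = 0"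
    "g c x $ 1 $ 1 * T c x $ i $ 1 $ 2 + g c x $ 1 $ 2 * T c x $ i $ 2 $ 2 = - (g c x $ 1 $ 2 * T c x $ i $ 1 $ 1 + g c x $ 2 $ 2 * T c x $ i $ 2 $ 1)" for i
    using skew[of i 1 1] skew[of i 2 2] skew[of i 1 2] by (simp_all add: lower_nth s)
  have tr: "T c x $ i $ 2 $ 2 = - T c x $ i $ 1 $ 1" for i
  proof -
    have "det (g c x) * (T c x $ i $ 1 $ 1 + T c x $ i $ 2 $ 2) =
       g c x $ 2 $ 2 * (g c x $ 1 $ 1 * T c x $ i $ 1 $ 1 + g c x $ 1 $ 2 * T c x $ i $ 2 $ 1)
      + g c x $ 1 $ 1 * (g c x $ 1 $ 2 * T c x $ i $ 1 $ 2 + g c x $ 2 $ 2 * T c x $ i $ 2 $ 2)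
      - g c x $ 1 $ 2 * ((g c x $ 1 $ 1 * T c x $ i $ 1 $ 2 + g c x $ 1 $ 2 * T c x $ i $ 2 $ 2)
          + (g c x $ 1 $ 2 * T c x $ i $ 1 $ 1 + g c x $ 2 $ 2 * T c x $ i $ 2 $ 1))"
      by (simp add: det_2 s algebra_simps)
    then have "det (g c x) * (T c x $ i $ 1 $ 1 + T c x $ i $ 2 $ 2) = 0" unfolding e by simp
    then show ?thesis using d by simp
  qed
  show "lower g T c x $ 1 $ 1 $ 2 = g c x $ 1 $ 1 * contraction T c x $ 2 - g c x $ 1 $ 2 * contraction T c x $ 1"
    using e(1)[of 2] by (simp add: lower_nth contraction_nth tr algebra_simps)
  show "lower g T c x $ 2 $ 1 $ 2 = g c x $ 1 $ 2 * contraction T c x $ 2 - g c x $ 2 $ 2 * contraction T c x $ 1"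
    using e(2)[of 1] e(3)[of 2] by (simp add: lower_nth contraction_nth tr s algebra_simps)
qed

text \<open>The component of \<open>T\<^sub>v v\<close> along \<open>N\<close> involves only the skew components \<open>T\<^sub>i\<^sub>1\<^sub>2\<close>, which
  \<open>skew_contraction\<close> expresses by the contraction.\<close>
lemma skew_normal_component:
  assumes skew: "\<And>i k j. lower g T c x $ i $ k $ j = - lower g T c x $ i $ j $ k"
    and s: "g c x $ 2 $ 1 = g c x $ 1 $ 2" and d: "det (g c x) \<noteq> 0"
    and on: "ginner g c x v v = 1" "ginner g c x v N = 0"
  shows "contraction T c x \<bullet> N = - ginner g c x (\<chi> k. \<Sum>p\<in>UNIV. \<Sum>q\<in>UNIV. T c x $ p $ k $ q * v $ p * v $ q) N"
proof -
  define \<delta> where "\<delta> = v $ 1 * N $ 2 - v $ 2 * N $ 1"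
  define B where "B = contraction T c x"
  have l0: "lower g T c x $ i $ 1 $ 1 = 0" "lower g T c x $ i $ 2 $ 2 = 0" "lower g T c x $ i $ 2 $ 1 = - lower g T c x $ i $ 1 $ 2" for i
    using skew[of i 1 1] skew[of i 2 2] skew[of i 2 1] by simp_all
  have "ginner g c x (\<chi> k. \<Sum>p\<in>UNIV. \<Sum>q\<in>UNIV. T c x $ p $ k $ q * v $ p * v $ q) N =
     (\<Sum>p\<in>UNIV. v $ p * (\<Sum>k\<in>UNIV. \<Sum>q\<in>UNIV. lower g T c x $ p $ k $ q * N $ k * v $ q))"
    by (simp add: ginner_expand sum_2 lower_nth s algebra_simps)
  also have "\<dots> = - \<delta> * (v $ 1 * lower g T c x $ 1 $ 1 $ 2 + v $ 2 * lower g T c x $ 2 $ 1 $ 2)"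
    by (simp add: sum_2 l0 \<delta>_def algebra_simps)
  also have "\<dots> = - (B $ 1 * (- \<delta> * (g c x $ 1 $ 2 * v $ 1 + g c x $ 2 $ 2 * v $ 2)) + B $ 2 * (\<delta> * (g c x $ 1 $ 1 * v $ 1 + g c x $ 1 $ 2 * v $ 2)))"
    unfolding skew_contraction[OF skew s d] B_def by (simp add: algebra_simps)
  also have "\<dots> = - (B $ 1 * N $ 1 + B $ 2 * N $ 2)"
    using normal_flat[of g c x v N, OF on s] by (simp only: \<delta>_def)
  finally show ?thesis by (simp add: B_def inner_vec_def sum_2)
qed

lemma cov_metric_minus:
  assumes "\<Gamma>' c x = \<Gamma> c x - T c x" "cov_metric g \<Gamma> c x i l j = 0" "transpose (g c x) = g c x"
  shows "cov_metric g \<Gamma>' c x i l j = lower g T c x $ i $ l $ j + lower g T c x $ i $ j $ l"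
proof -
  have s: "g c x $ 2 $ 1 = g c x $ 1 $ 2"
    using arg_cong[OF assms(3), of "\<lambda>M. M $ 1 $ 2"] by (simp add: transpose_def)
  have s': "g c x $ k $ m = g c x $ m $ k" for k m
    using s exhaust_2[of k] exhaust_2[of m] by auto
  show ?thesis
    using assms(2) unfolding cov_metric_def sum_2 lower_nth assms(1) s'[of 1 j] s'[of 2 j]
    by (simp add: algebra_simps)
qed

locale torsion_patch = frame_patch g \<Gamma> c V \<sigma> E for g :: "'a metric_field" and \<Gamma> c V \<sigma> E +
  fixes \<Gamma>' T :: "'a connection_field"
  assumes smooth_\<Gamma>': "smooth_on V (\<Gamma>' c)"
    and minus: "\<And>x. x \<in> V \<Longrightarrow> \<Gamma>' c x = \<Gamma> c x - T c x"
    and metric': "\<And>x i l j. x \<in> V \<Longrightarrow> cov_metric g \<Gamma>' c x i l j = 0"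
    and torsion_free: "\<And>x i k j. x \<in> V \<Longrightarrow> \<Gamma> c x $ i $ k $ j = \<Gamma> c x $ j $ k $ i"
begin

sublocale conn': frame_patch g \<Gamma>' c V \<sigma> E
  by unfold_locales (use open_V smooth_g smooth_\<Gamma>' sym pos metric' smooth_E orthonormal sign in auto)

lemma skew_T: "x \<in> V \<Longrightarrow> lower g T c x $ i $ k $ j = - lower g T c x $ i $ j $ k"
  using cov_metric_minus[of \<Gamma>' c x \<Gamma> T g i k j, OF minus metric sym] metric'[of x i k j] by simp

text \<open>Subtracting \<open>T\<close> from the connection subtracts \<open>T\<^sub>i\<^sub>1\<^sub>2\<close>, taken in the frame, from \<open>w\<close>; this is
  \<open>\<beta>\<close> of the contraction of \<open>T\<close>.\<close>
lemma w'_eq: "x \<in> V \<Longrightarrow> conn'.w i x = w i x - \<beta> (contraction T c) i x"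
proof -
  assume x: "x \<in> V"
  have l0: "lower g T c x $ i $ 1 $ 1 = 0" "lower g T c x $ i $ 2 $ 2 = 0" "lower g T c x $ i $ 2 $ 1 = - lower g T c x $ i $ 1 $ 2" for i
    using skew_T[OF x, of i 1 1] skew_T[OF x, of i 2 2] skew_T[OF x, of i 2 1] by simp_all
  have "w i x - conn'.w i x = (\<Sum>k\<in>UNIV. \<Sum>j\<in>UNIV. lower g T c x $ i $ k $ j * E x $ 1 $ k * E x $ 2 $ j)"
    unfolding w_def conn'.w_def ginner_expand cov_deriv_nth conn'.cov_deriv_nth minus[OF x]
    by (simp add: sum_2 lower_nth g21[OF x] algebra_simps)
  also have "\<dots> = lower g T c x $ i $ 1 $ 2 * \<rho> x"
    by (simp add: sum_2 l0 \<rho>_def algebra_simps)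
  also have "\<dots> = \<beta> (contraction T c) i x"
  proof -
    have d: "det (g c x) \<noteq> 0" using det_pos[OF x] by simp
    have "i = 1 \<or> i = 2" by (rule exhaust_2)
    then show ?thesis
      using skew_contraction[of g T c x, OF skew_T[OF x] g21[OF x] d] by (auto simp: \<beta>_def)
  qed
  finally show ?thesis by simp
qed

lemma smooth_contraction: "smooth_on V (contraction T c)"
proof -
  have "smooth_on V (T c)"
    by (rule smooth_on_cong[OF open_V _ smooth_on_diff[OF open_V smooth_\<Gamma> smooth_\<Gamma>']]) (simp add: minus)
  then show ?thesis
    unfolding contraction_def[abs_def] by (intro smooth_on_vec smooth_on_sum smooth_on_nth open_V)
qed

lemma Pf_torsion:
  assumes \<omega>: "connection_form \<Gamma>' c V E \<omega>" and x: "x \<in> V"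
  shows "interior_form \<sigma> g \<Gamma> (contraction T) c x = Pf (curvature_form \<omega> x)"
proof -
  have d: "w i differentiable (at x)" "\<beta> (contraction T c) i differentiable (at x)" for i
    using smooth_on_differentiable[OF smooth_w x] smooth_on_differentiable[OF smooth_\<beta>[OF smooth_contraction] x] by auto
  have "pd j (conn'.w i) x = pd j (w i) x - pd j (\<beta> (contraction T c) i) x" for i j
  proof -
    have "pd j (conn'.w i) x = pd j (\<lambda>x. w i x - \<beta> (contraction T c) i x) x"
      by (rule pd_cong[OF open_V x]) (rule w'_eq)
    then show ?thesis by (simp add: pd_diff d)
  qed
  then show ?thesis
    unfolding conn'.Pf_curvature_form[OF \<omega> x] interior_form_def
    using gauss_curvature_frame[OF x] codiff_frame[where \<psi> = "contraction T", OF x smooth_contraction torsion_free[OF x]]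
    by (simp add: left_diff_distrib)
qed

end


section \<open>The metric connection associated with a connection\<close>

lemma matrix_mult_nth2: "(A ** B) $ i $ j = A $ i $ 1 * B $ 1 $ j + A $ i $ 2 * B $ 2 $ j" for A B :: "real^2^2"
  by (simp add: matrix_matrix_mult_def sum_2)

lemma invertible_matrix_inv:
  fixes A :: "real^2^2"
  assumes "invertible A"
  shows "A ** matrix_inv A = mat 1" "matrix_inv A ** A = mat 1"
proof -
  obtain B where "A ** B = mat 1 \<and> B ** A = mat 1" using assms unfolding invertible_def by auto
  then have "A ** matrix_inv A = mat 1 \<and> matrix_inv A ** A = mat 1"
    unfolding matrix_inv_def by (rule someI)
  then show "A ** matrix_inv A = mat 1" "matrix_inv A ** A = mat 1" by auto
qed

lemma metric_at:
  assumes "riemannian_metric A g" "c \<in> A" "x \<in> coords c"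
  shows "transpose (g c x) = g c x" "v \<noteq> 0 \<Longrightarrow> v \<bullet> (g c x *v v) > 0"
  using assms by (auto simp: riemannian_metric_def)

lemma skew_part_matrix:
  "skew_part g D c x $ i = (1/2) *\<^sub>R (D c x $ i - matrix_inv (g c x) ** transpose (D c x $ i) ** g c x)"
  by (simp add: skew_part_def vec_eq_iff matrix_mult_nth2 sum_2 transpose_def algebra_simps)

text \<open>Lowering the index turns \<open>D\<^sub>i - g\<^sup>-\<^sup>1 D\<^sub>i\<^sup>T g\<close> into \<open>g D\<^sub>i - (g D\<^sub>i)\<^sup>T\<close>.\<close>
lemma skew_part_skew:
  assumes s: "transpose (g c x) = g c x" and inv: "invertible (g c x)"
  shows "lower g (skew_part g D) c x $ i $ k $ j = - lower g (skew_part g D) c x $ i $ j $ k"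
proof -
  define G where "G = g c x"
  define M where "M = D c x $ i"
  have sG: "transpose G = G" using s by (simp add: G_def)
  have "lower g (skew_part g D) c x $ i $ k $ j = (G ** skew_part g D c x $ i) $ k $ j" for k j
    by (simp add: lower_nth matrix_mult_nth2 G_def)
  moreover have "G ** skew_part g D c x $ i = (1/2) *\<^sub>R (G ** M - transpose (G ** M))"
  proof -
    have "G ** skew_part g D c x $ i = (1/2) *\<^sub>R (G ** M - (G ** matrix_inv G) ** transpose M ** G)"
      unfolding skew_part_matrix by (simp add: G_def M_def vec_eq_iff matrix_mult_nth2 algebra_simps)
    also have "\<dots> = (1/2) *\<^sub>R (G ** M - transpose (G ** M))"
      using invertible_matrix_inv(1)[OF inv] sG by (simp add: G_def[symmetric] matrix_transpose_mul)
    finally show ?thesis .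
  qed
  ultimately have "lower g (skew_part g D) c x $ i $ k $ j = ((G ** M) $ k $ j - (G ** M) $ j $ k) / 2" for k j
    by (simp add: transpose_def)
  from this[of k j] this[of j k] show ?thesis by simp
qed

text \<open>\<open>\<nabla>g\<close> is twice the symmetric part of the lowered \<open>S\<close>, so half of \<open>g\<^sup>-\<^sup>1 \<nabla>g\<close> removes the symmetric part
  from \<open>- S\<close>.\<close>
lemma assoc_connection_minus:
  assumes m: "nabla c x = \<Gamma> c x - S c x" "\<And>i l j. cov_metric g \<Gamma> c x i l j = 0"
    and s: "transpose (g c x) = g c x" and inv: "invertible (g c x)"
  shows "assoc_connection g nabla c x = \<Gamma> c x - skew_part g S c x"
proof -
  have "assoc_connection g nabla c x $ i $ k $ j = (\<Gamma> c x - skew_part g S c x) $ i $ k $ j" for i k j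
  proof -
    have sg: "g c x $ k $ m = g c x $ m $ k" for k m
      using arg_cong[OF s, of "\<lambda>M. M $ m $ k"] by (simp add: transpose_def)
    have cm: "cov_metric g nabla c x i l j = (g c x ** S c x $ i) $ l $ j + (transpose (S c x $ i) ** g c x) $ l $ j" for l
      using cov_metric_minus[of nabla c x \<Gamma> S g i l j, OF m s]
      by (simp add: lower_nth matrix_mult_nth2 transpose_def sg[of j] mult.commute)
    have "(\<Sum>l\<in>UNIV. matrix_inv (g c x) $ k $ l * cov_metric g nabla c x i l j) =
        (matrix_inv (g c x) ** (g c x ** S c x $ i) + matrix_inv (g c x) ** (transpose (S c x $ i) ** g c x)) $ k $ j"
      unfolding cm by (simp add: sum_2 matrix_mult_nth2[of "matrix_inv (g c x)"] algebra_simps)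
    also have "\<dots> = (S c x $ i + matrix_inv (g c x) ** transpose (S c x $ i) ** g c x) $ k $ j"
      using invertible_matrix_inv(2)[OF inv] by (simp add: matrix_mul_assoc)
    finally show ?thesis
      using m(1) by (simp add: assoc_connection_def skew_part_matrix diff_divide_distrib)
  qed
  then show ?thesis by (simp add: vec_eq_iff)
qed

text \<open>In matrix form the transformation law says how the endomorphisms \<open>\<Gamma>\<^sub>i\<close> are intertwined by the
  Jacobian, up to the second derivatives of the transition map.\<close>
lemma connection_law:
  assumes "is_connection A \<Gamma>" "c \<in> A" "c' \<in> A" "x \<in> overlap c c'"
  shows "jacobian c c' x ** \<Gamma> c x $ i = (\<chi> m j. pd i (\<lambda>y. jacobian c c' y $ m $ j) x)
      + (\<Sum>a\<in>UNIV. jacobian c c' x $ a $ i *\<^sub>R (\<Gamma> c' (transition c c' x) $ a ** jacobian c c' x))"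
proof -
  have "(\<Sum>k\<in>UNIV. jacobian c c' x $ m $ k * \<Gamma> c x $ i $ k $ j) =
          pd i (\<lambda>y. jacobian c c' y $ m $ j) x +
          (\<Sum>a\<in>UNIV. \<Sum>b\<in>UNIV. jacobian c c' x $ a $ i * jacobian c c' x $ b $ j
              * \<Gamma> c' (transition c c' x) $ a $ m $ b)" for m j
    using assms unfolding is_connection_def by blast
  then show ?thesis
    by (simp add: vec_eq_iff matrix_mult_nth2 sum_2 algebra_simps)
qed

lemma connection_lawI:
  assumes "\<And>c. c \<in> A \<Longrightarrow> smooth_on (coords c) (\<Gamma> c)"
    and "\<And>c c' x i. c \<in> A \<Longrightarrow> c' \<in> A \<Longrightarrow> x \<in> overlap c c' \<Longrightarrow>
      jacobian c c' x ** \<Gamma> c x $ i = (\<chi> m j. pd i (\<lambda>y. jacobian c c' y $ m $ j) x)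
      + (\<Sum>a\<in>UNIV. jacobian c c' x $ a $ i *\<^sub>R (\<Gamma> c' (transition c c' x) $ a ** jacobian c c' x))"
  shows "is_connection A \<Gamma>"
  unfolding is_connection_def
proof (intro conjI ballI allI assms(1))
  fix c c' x and i j m :: 2
  assume c: "c \<in> A" "c' \<in> A" "x \<in> overlap c c'"
  show "(\<Sum>k\<in>UNIV. jacobian c c' x $ m $ k * \<Gamma> c x $ i $ k $ j) =
          pd i (\<lambda>y. jacobian c c' y $ m $ j) x +
          (\<Sum>a\<in>UNIV. \<Sum>b\<in>UNIV. jacobian c c' x $ a $ i * jacobian c c' x $ b $ j
              * \<Gamma> c' (transition c c' x) $ a $ m $ b)"
    using arg_cong[OF assms(2)[OF c, of i], of "\<lambda>M. M $ m $ j"]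
    by (simp add: matrix_mult_nth2 sum_2 algebra_simps)
qed

lemma overlap_coords: "x \<in> overlap c c' \<Longrightarrow> x \<in> coords c"
  by (auto simp: overlap_def coords_def)

lemma transition_coords:
  assumes "is_chart c" "x \<in> overlap c c'" shows "transition c c' x \<in> coords c'"
proof -
  obtain p where p: "p \<in> cdom c" "p \<in> cdom c'" "x = cmap c p" using assms(2) by (auto simp: overlap_def)
  have "inv_into (cdom c) (cmap c) x = p"
    using assms(1) p unfolding is_chart_def homeomorphism_def by auto
  then show ?thesis using p by (auto simp: transition_def coords_def)
qed

text \<open>If \<open>J\<close> intertwines endomorphisms and is an isometry, it also intertwines their adjoints.\<close>
lemma skew_part_tensor:
  fixes J G G' :: "real^2^2" and M :: "real^2^2" and M' :: "real^2^2^2"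
  assumes JM: "J ** M = (\<Sum>a\<in>UNIV. k a *\<^sub>R (M' $ a ** J))"
    and G: "G = transpose J ** G' ** J" and inv: "invertible G" "invertible G'"
  shows "J ** (M - matrix_inv G ** transpose M ** G) =
     (\<Sum>a\<in>UNIV. k a *\<^sub>R ((M' $ a - matrix_inv G' ** transpose (M' $ a) ** G') ** J))"
proof -
  have "det G = det J * det G' * det J" by (simp add: G det_mul)
  moreover have "det G \<noteq> 0" using inv by (simp add: invertible_det_nz)
  ultimately have J: "invertible J" by (auto simp: invertible_det_nz)
  define K where "K = matrix_inv J"
  have K: "J ** K = mat 1" "K ** J = mat 1" unfolding K_def using invertible_matrix_inv[OF J] by auto
  have tK: "transpose K ** transpose J = mat 1" "transpose J ** transpose K = mat 1"
    using K by (metis matrix_transpose_mul transpose_mat)+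
  note I = invertible_matrix_inv[OF inv(1)] invertible_matrix_inv[OF inv(2)]
  have "G ** (K ** matrix_inv G' ** transpose K) = transpose J ** (G' ** ((J ** K) ** matrix_inv G')) ** transpose K"
    unfolding G by (simp only: matrix_mul_assoc)
  also have "\<dots> = mat 1" using I(3) tK(2) by (simp add: K(1) matrix_mul_lid matrix_mul_rid)
  finally have GB: "G ** (K ** matrix_inv G' ** transpose K) = mat 1" .
  have "matrix_inv G = matrix_inv G ** (G ** (K ** matrix_inv G' ** transpose K))"
    unfolding GB by (simp only: matrix_mul_rid)
  also have "\<dots> = K ** matrix_inv G' ** transpose K"
    unfolding matrix_mul_assoc I(2) by (simp only: matrix_mul_lid)
  finally have "matrix_inv G = K ** matrix_inv G' ** transpose K" .
  then have JG: "J ** matrix_inv G = matrix_inv G' ** transpose K"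
    using K(1) by (simp add: matrix_mul_assoc matrix_mul_lid)
  have M: "M = K ** (\<Sum>a\<in>UNIV. k a *\<^sub>R (M' $ a ** J))"
    unfolding JM[symmetric] by (simp add: matrix_mul_assoc K(2) matrix_mul_lid)
  have tM: "transpose M = (\<Sum>a\<in>UNIV. k a *\<^sub>R (transpose J ** transpose (M' $ a))) ** transpose K"
  proof -
    have "transpose M = transpose (\<Sum>a\<in>UNIV. k a *\<^sub>R (M' $ a ** J)) ** transpose K"
      by (subst (1) M) (simp only: matrix_transpose_mul)
    also have "transpose (\<Sum>a\<in>UNIV. k a *\<^sub>R (M' $ a ** J)) = (\<Sum>a\<in>UNIV. k a *\<^sub>R (transpose J ** transpose (M' $ a)))"
      by (simp add: vec_eq_iff matrix_mult_nth2 transpose_def sum_2 mult.commute)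
    finally show ?thesis .
  qed
  have "J ** (matrix_inv G ** transpose M ** G) = (J ** matrix_inv G) ** (transpose M ** G)"
    by (simp only: matrix_mul_assoc)
  also have "\<dots> = matrix_inv G' ** (transpose K ** ((\<Sum>a\<in>UNIV. k a *\<^sub>R (transpose J ** transpose (M' $ a))) ** ((transpose K ** transpose J) ** (G' ** J))))"
    unfolding JG tM unfolding G by (simp only: matrix_mul_assoc)
  also have "\<dots> = matrix_inv G' ** (transpose K ** ((\<Sum>a\<in>UNIV. k a *\<^sub>R (transpose J ** transpose (M' $ a))) ** (G' ** J)))"
    unfolding tK(1) by (simp add: matrix_mul_lid)
  also have "(\<Sum>a\<in>UNIV. k a *\<^sub>R (transpose J ** transpose (M' $ a))) = transpose J ** (\<Sum>a\<in>UNIV. k a *\<^sub>R transpose (M' $ a))"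
    by (simp add: vec_eq_iff matrix_mult_nth2 sum_2 algebra_simps)
  also have "matrix_inv G' ** (transpose K ** (transpose J ** (\<Sum>a\<in>UNIV. k a *\<^sub>R transpose (M' $ a)) ** (G' ** J))) =
     matrix_inv G' ** ((transpose K ** transpose J) ** ((\<Sum>a\<in>UNIV. k a *\<^sub>R transpose (M' $ a)) ** (G' ** J)))"
    by (simp only: matrix_mul_assoc)
  also have "\<dots> = (\<Sum>a\<in>UNIV. k a *\<^sub>R (matrix_inv G' ** transpose (M' $ a) ** G' ** J))"
    unfolding tK(1) by (simp add: vec_eq_iff matrix_mult_nth2 sum_2 algebra_simps)
  finally have two: "J ** (matrix_inv G ** transpose M ** G) = (\<Sum>a\<in>UNIV. k a *\<^sub>R (matrix_inv G' ** transpose (M' $ a) ** G' ** J))" .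
  have "J ** (M - matrix_inv G ** transpose M ** G) = J ** M - J ** (matrix_inv G ** transpose M ** G)"
    by (simp add: vec_eq_iff matrix_mult_nth2 algebra_simps)
  also have "\<dots> = (\<Sum>a\<in>UNIV. k a *\<^sub>R ((M' $ a - matrix_inv G' ** transpose (M' $ a) ** G') ** J))"
    unfolding JM two by (simp add: vec_eq_iff matrix_mult_nth2 sum_2 algebra_simps)
  finally show ?thesis .
qed

lemma smooth_matrix_inv_nth:
  fixes h :: "real^2 \<Rightarrow> real^2^2"
  assumes S: "open S" and h: "smooth_on S h" and d: "\<And>x. x \<in> S \<Longrightarrow> det (h x) \<noteq> 0"
  shows "smooth_on S (\<lambda>x. matrix_inv (h x) $ i $ j)"
proof -
  have n: "smooth_on S (\<lambda>x. h x $ k $ l)" for k l by (intro smooth_on_nth S h)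
  have D: "smooth_on S (\<lambda>x. det (h x))" unfolding det_2 by (intro smooth_on_diff smooth_on_mult S n)
  have q1: "smooth_on S (\<lambda>x. h x $ k $ l / det (h x))" for k l
    by (rule smooth_on_divide[OF S d n D])
  have q: "smooth_on S (\<lambda>x. h x $ k $ l / det (h x))" "smooth_on S (\<lambda>x. - h x $ k $ l / det (h x))" for k l
    using q1[of k l] smooth_on_minus[OF S q1[of k l]] by simp_all
  have e: "smooth_on S (\<lambda>x. matrix_inv (h x) $ 1 $ 1)" "smooth_on S (\<lambda>x. matrix_inv (h x) $ 1 $ 2)"
    "smooth_on S (\<lambda>x. matrix_inv (h x) $ 2 $ 1)" "smooth_on S (\<lambda>x. matrix_inv (h x) $ 2 $ 2)"
    by (rule smooth_on_cong[OF S _ q(1)[of 2 2]], simp add: matrix_inv_2 d)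
      (rule smooth_on_cong[OF S _ q(2)[of 1 2]], simp add: matrix_inv_2 d,
       rule smooth_on_cong[OF S _ q(2)[of 2 1]], simp add: matrix_inv_2 d,
       rule smooth_on_cong[OF S _ q(1)[of 1 1]], simp add: matrix_inv_2 d)
  have "i = 1 \<or> i = 2" "j = 1 \<or> j = 2" by (rule exhaust_2)+
  then show ?thesis using e by auto
qed

lemma smooth_skew_part:
  assumes S: "open S" and h: "smooth_on S (g c)" and d: "\<And>x. x \<in> S \<Longrightarrow> det (g c x) \<noteq> 0" and D: "smooth_on S (D c)"
  shows "smooth_on S (skew_part g D c)"
  unfolding skew_part_def[abs_def]
  by (intro smooth_on_vec smooth_on_mult smooth_on_const smooth_on_diff smooth_on_sum smooth_on_nth
      smooth_matrix_inv_nth S h d D)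

text \<open>The inhomogeneous terms of two connections cancel in their difference \<open>S\<close>, so \<open>S\<close> and its skew part
  are tensors.\<close>
proposition assoc_connection_is_connection:
  assumes surf: "smooth_structure A" and met: "riemannian_metric A g"
    and lc: "is_connection A \<Gamma>" "\<And>c x i l j. c \<in> A \<Longrightarrow> x \<in> coords c \<Longrightarrow> cov_metric g \<Gamma> c x i l j = 0"
    and nab: "is_connection A nabla" and S: "connection_minus A \<Gamma> nabla S"
  shows "connection_minus A \<Gamma> (assoc_connection g nabla) (skew_part g S)"
    and "is_connection A (assoc_connection g nabla)"
    and "\<And>c. c \<in> A \<Longrightarrow> smooth_on (coords c) (S c)"
proof -
  have inv: "invertible (g c x)" and det: "det (g c x) \<noteq> 0" if "c \<in> A" "x \<in> coords c" for c x
    using positive_definite_2(3)[of "g c x"] metric_at[OF met that] by (auto simp: invertible_det_nz)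
  have ch: "is_chart c" if "c \<in> A" for c
    using surf that unfolding smooth_structure_def by blast
  then have op: "open (coords c)" if "c \<in> A" for c
    using that unfolding is_chart_def by blast
  have sub: "nabla c x = \<Gamma> c x - S c x" if "c \<in> A" "x \<in> coords c" for c x
    using S that by (simp add: connection_minus_def)
  have eq: "assoc_connection g nabla c x = \<Gamma> c x - skew_part g S c x" if "c \<in> A" "x \<in> coords c" for c x
    by (rule assoc_connection_minus[where nabla = nabla]) (use sub[OF that] lc(2)[OF that] metric_at(1)[OF met that] inv[OF that] in auto)
  then show "connection_minus A \<Gamma> (assoc_connection g nabla) (skew_part g S)"
    by (simp add: connection_minus_def)
  have sm: "smooth_on (coords c) (\<Gamma> c)" "smooth_on (coords c) (nabla c)" "smooth_on (coords c) (g c)" if "c \<in> A" for c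
    using lc(1) nab met that by (auto simp: is_connection_def riemannian_metric_def)
  show smS: "smooth_on (coords c) (S c)" if "c \<in> A" for c
    by (rule smooth_on_cong[OF op[OF that] _ smooth_on_diff[OF op[OF that] sm(1,2)[OF that]]]) (simp add: sub that)
  show "is_connection A (assoc_connection g nabla)"
  proof (rule connection_lawI)
    fix c assume c: "c \<in> A"
    have sm': "smooth_on (coords c) (\<lambda>x. \<Gamma> c x - skew_part g S c x)"
      by (rule smooth_on_diff[OF op[OF c] sm(1)[OF c] smooth_skew_part[of "coords c" g c S, OF op[OF c] sm(3)[OF c] det[OF c] smS[OF c]]])
    show "smooth_on (coords c) (assoc_connection g nabla c)"
      by (rule smooth_on_cong[OF op[OF c] eq[OF c, symmetric] sm'])
  next
    fix c c' x and i :: 2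
    assume c: "c \<in> A" "c' \<in> A" and x: "x \<in> overlap c c'"
    have xc: "x \<in> coords c" by (rule overlap_coords[OF x])
    have xc': "transition c c' x \<in> coords c'"
      by (rule transition_coords[OF ch[OF c(1)] x])
    define J where "J = jacobian c c' x"
    define P :: "real^2^2" where "P = (\<chi> m j. pd i (\<lambda>y. jacobian c c' y $ m $ j) x)"
    define x' where "x' = transition c c' x"
    have LG: "J ** \<Gamma> c x $ i = P + (\<Sum>a\<in>UNIV. J $ a $ i *\<^sub>R (\<Gamma> c' x' $ a ** J))"
      unfolding J_def P_def x'_def by (rule connection_law[OF lc(1) c x])
    have LN: "J ** nabla c x $ i = P + (\<Sum>a\<in>UNIV. J $ a $ i *\<^sub>R (nabla c' x' $ a ** J))"
      unfolding J_def P_def x'_def by (rule connection_law[OF nab c x])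
    have S: "S c x = \<Gamma> c x - nabla c x" "S c' x' = \<Gamma> c' x' - nabla c' x'"
      using sub[OF c(1) xc] sub[OF c(2) xc'] by (simp_all add: x'_def)
    have "J ** S c x $ i = J ** \<Gamma> c x $ i - J ** nabla c x $ i"
      unfolding S by (simp add: vec_eq_iff matrix_mult_nth2 algebra_simps)
    also have "\<dots> = (\<Sum>a\<in>UNIV. J $ a $ i *\<^sub>R (S c' x' $ a ** J))"
      unfolding LG LN S by (simp add: vec_eq_iff matrix_mult_nth2 sum_2 algebra_simps)
    finally have LS: "J ** S c x $ i = (\<Sum>a\<in>UNIV. J $ a $ i *\<^sub>R (S c' x' $ a ** J))" .
    have G: "g c x = transpose J ** g c' x' ** J"
    proof -
      have "g c x $ k $ l = (\<Sum>a\<in>UNIV. \<Sum>b\<in>UNIV. J $ a $ k * J $ b $ l * g c' x' $ a $ b)" for k l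
        using met c x unfolding riemannian_metric_def J_def x'_def by blast
      then show ?thesis by (simp add: vec_eq_iff matrix_mult_nth2 transpose_def sum_2 algebra_simps)
    qed
    have "J ** skew_part g S c x $ i = (1/2) *\<^sub>R (J ** (S c x $ i - matrix_inv (g c x) ** transpose (S c x $ i) ** g c x))"
      unfolding skew_part_matrix by (simp add: vec_eq_iff matrix_mult_nth2 algebra_simps)
    also have "\<dots> = (\<Sum>a\<in>UNIV. J $ a $ i *\<^sub>R (skew_part g S c' x' $ a ** J))"
      unfolding skew_part_tensor[of J "S c x $ i" "\<lambda>a. J $ a $ i" "S c' x'", OF LS G inv[OF c(1) xc] inv[OF c(2) xc', folded x'_def]]
      unfolding skew_part_matrix by (simp add: vec_eq_iff matrix_mult_nth2 sum_2 algebra_simps)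
    finally have LX: "J ** skew_part g S c x $ i = (\<Sum>a\<in>UNIV. J $ a $ i *\<^sub>R (skew_part g S c' x' $ a ** J))" .
    have "J ** (\<Gamma> c x - skew_part g S c x) $ i = J ** \<Gamma> c x $ i - J ** skew_part g S c x $ i"
      by (simp add: vec_eq_iff matrix_mult_nth2 algebra_simps)
    also have "\<dots> = P + (\<Sum>a\<in>UNIV. J $ a $ i *\<^sub>R ((\<Gamma> c' x' - skew_part g S c' x') $ a ** J))"
      unfolding LG LX by (simp add: vec_eq_iff matrix_mult_nth2 sum_2 algebra_simps)
    finally show "jacobian c c' x ** assoc_connection g nabla c x $ i = (\<chi> m j. pd i (\<lambda>y. jacobian c c' y $ m $ j) x)
      + (\<Sum>a\<in>UNIV. jacobian c c' x $ a $ i *\<^sub>R (assoc_connection g nabla c' (transition c c' x) $ a ** jacobian c c' x))"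
      unfolding eq[OF c(1) xc] eq[OF c(2) xc'] J_def P_def x'_def .
  qed
qed


section \<open>Curves seen from a frame\<close>

context frame_patch
begin

lemma along_curve:
  assumes z: "(\<zeta> has_vector_derivative u) (at t within S)" and f: "f differentiable (at (\<zeta> t))"
  shows "((\<lambda>t. f (\<zeta> t)) has_real_derivative u $ 1 * pd 1 f (\<zeta> t) + u $ 2 * pd 2 f (\<zeta> t)) (at t within S)"
proof -
  have "((\<lambda>t. f (\<zeta> t)) has_derivative (\<lambda>h. (h *\<^sub>R u) $ 1 * pd 1 f (\<zeta> t) + (h *\<^sub>R u) $ 2 * pd 2 f (\<zeta> t))) (at t within S)"
    by (rule has_derivative_compose[OF z[unfolded has_vector_derivative_def] has_derivative_pd[OF f]])
  moreover have "(\<lambda>h. (h *\<^sub>R u) $ 1 * pd 1 f (\<zeta> t) + (h *\<^sub>R u) $ 2 * pd 2 f (\<zeta> t)) = (*) (u $ 1 * pd 1 f (\<zeta> t) + u $ 2 * pd 2 f (\<zeta> t))"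
    by (auto simp: algebra_simps)
  ultimately show ?thesis by (simp add: has_field_derivative_def)
qed

text \<open>The product rule for the metric, along a curve with velocity \<open>u\<close>: one term is the covariant
  acceleration, the other the covariant derivative of the frame.\<close>
lemma component_derivative:
  assumes z: "(\<zeta> has_vector_derivative u t) (at t within S)" and x: "\<zeta> t \<in> V"
    and u: "(u has_vector_derivative a) (at t within S)"
  shows "((\<lambda>t. ginner g c (\<zeta> t) (u t) (E (\<zeta> t) $ \<alpha>)) has_real_derivative
     ginner g c (\<zeta> t) (\<chi> k. a $ k + (\<Sum>p\<in>UNIV. \<Sum>q\<in>UNIV. \<Gamma> c (\<zeta> t) $ p $ k $ q * u t $ p * u t $ q)) (E (\<zeta> t) $ \<alpha>)
     + (u t $ 1 * ginner g c (\<zeta> t) (u t) (cov_deriv \<Gamma> c 1 (\<lambda>y. E y $ \<alpha>) (\<zeta> t))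
        + u t $ 2 * ginner g c (\<zeta> t) (u t) (cov_deriv \<Gamma> c 2 (\<lambda>y. E y $ \<alpha>) (\<zeta> t)))) (at t within S)"
proof -
  have du: "((\<lambda>t. u t $ k) has_real_derivative a $ k) (at t within S)" for k
    using bounded_linear.has_vector_derivative[OF bounded_linear_vec_nth u]
    by (simp add: has_real_derivative_iff_has_vector_derivative)
  note dg = along_curve[OF z differentiable_g[OF x]] and dE = along_curve[OF z differentiable_E[OF x]]
  show ?thesis
    unfolding ginner_expand
    by (rule DERIV_cong, (rule derivative_intros du dg dE)+)
      (simp add: pd_g[OF x] g21[OF x] cov_deriv_nth sum_2, simp add: algebra_simps)
qed

text \<open>In the frame, \<open>N\<close> is \<open>v\<close> turned by a right angle; the orientation excludes the opposite vector.\<close>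
lemma frame_coordinates:
  assumes x: "x \<in> V" and vN: "oriented_orthonormal \<sigma> g c x v N"
  defines "e1 \<equiv> ginner g c x v (E x $ 1)" and "e2 \<equiv> ginner g c x v (E x $ 2)"
  shows "e1\<^sup>2 + e2\<^sup>2 = 1" "N = e1 *\<^sub>R E x $ 2 - e2 *\<^sub>R E x $ 1" "v $ 1 * N $ 2 - v $ 2 * N $ 1 = \<rho> x"
proof -
  define n1 where "n1 = ginner g c x N (E x $ 1)"
  define n2 where "n2 = ginner g c x N (E x $ 2)"
  have v: "v = e1 *\<^sub>R E x $ 1 + e2 *\<^sub>R E x $ 2" and N: "N = n1 *\<^sub>R E x $ 1 + n2 *\<^sub>R E x $ 2"
    unfolding e1_def e2_def n1_def n2_def by (rule expand[OF x])+
  have bil: "ginner g c x (a1 *\<^sub>R E x $ 1 + a2 *\<^sub>R E x $ 2) (b1 *\<^sub>R E x $ 1 + b2 *\<^sub>R E x $ 2) = a1 * b1 + a2 * b2" for a1 a2 b1 b2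
  proof -
    have "ginner g c x (a1 *\<^sub>R E x $ 1 + a2 *\<^sub>R E x $ 2) (b1 *\<^sub>R E x $ 1 + b2 *\<^sub>R E x $ 2) =
        a1 * b1 * ginner g c x (E x $ 1) (E x $ 1) + a1 * b2 * ginner g c x (E x $ 1) (E x $ 2)
        + a2 * b1 * ginner g c x (E x $ 2) (E x $ 1) + a2 * b2 * ginner g c x (E x $ 2) (E x $ 2)"
      by (simp add: ginner_expand algebra_simps)
    then show ?thesis by (simp add: on[OF x])
  qed
  have 1: "e1 * e1 + e2 * e2 = 1" and 2: "n1 * n1 + n2 * n2 = 1" and 3: "e1 * n1 + e2 * n2 = 0"
    using assms(2) unfolding oriented_orthonormal_def by (metis bil v N)+
  show "e1\<^sup>2 + e2\<^sup>2 = 1" using 1 by (simp add: power2_eq_square)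
  have det: "v $ 1 * N $ 2 - v $ 2 * N $ 1 = (e1 * n2 - e2 * n1) * \<rho> x"
    unfolding arg_cong[OF v, of "\<lambda>u. u $ 1"] arg_cong[OF v, of "\<lambda>u. u $ 2"]
      arg_cong[OF N, of "\<lambda>u. u $ 1"] arg_cong[OF N, of "\<lambda>u. u $ 2"] \<rho>_def by (simp add: algebra_simps)
  have "0 < \<sigma> c x * ((e1 * n2 - e2 * n1) * \<rho> x)"
    using assms(2) by (simp add: oriented_orthonormal_def oriented_det_def det_frame det)
  moreover have "0 < \<sigma> c x * \<rho> x"
    using orthonormal[OF x] by (simp add: oriented_orthonormal_def oriented_det_def det_frame \<rho>_def)
  ultimately have "0 < e1 * n2 - e2 * n1"
    using mult.left_commute[of "\<sigma> c x" "e1 * n2 - e2 * n1" "\<rho> x"] by (metis zero_less_mult_pos2)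
  moreover have "(e1 * n2 - e2 * n1)\<^sup>2 = (e1 * e1 + e2 * e2) * (n1 * n1 + n2 * n2) - (e1 * n1 + e2 * n2)\<^sup>2"
    by (simp add: power2_eq_square algebra_simps)
  then have "(e1 * n2 - e2 * n1)\<^sup>2 = 1" unfolding 1 2 3 by simp
  ultimately have d1: "e1 * n2 - e2 * n1 = 1" by (simp add: power2_eq_1_iff)
  show "v $ 1 * N $ 2 - v $ 2 * N $ 1 = \<rho> x" using det d1 by simp
  have "n2 * (e1 * e1 + e2 * e2) = e1 * (e1 * n2 - e2 * n1) + e2 * (e1 * n1 + e2 * n2)"
    "n1 * (e1 * e1 + e2 * e2) = e1 * (e1 * n1 + e2 * n2) - e2 * (e1 * n2 - e2 * n1)"
    by (simp_all add: algebra_simps)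
  then have "n2 = e1" "n1 = - e2" unfolding 1 3 d1 by simp_all
  then show "N = e1 *\<^sub>R E x $ 2 - e2 *\<^sub>R E x $ 1" using N by simp
qed

text \<open>For a unit vector with components \<open>e\<^sub>1, e\<^sub>2\<close>, the derivative of its angle is \<open>e\<^sub>1 e\<^sub>2' - e\<^sub>2 e\<^sub>1'\<close>. The left-hand side
  is this expression, by \<open>component_derivative\<close>.\<close>
lemma angular_speed:
  assumes x: "x \<in> V" and on: "oriented_orthonormal \<sigma> g c x v N"
  defines "e1 \<equiv> ginner g c x v (E x $ 1)" and "e2 \<equiv> ginner g c x v (E x $ 2)"
  shows "e1 * (ginner g c x a (E x $ 2) + (v $ 1 * ginner g c x v (cov_deriv \<Gamma> c 1 (\<lambda>y. E y $ 2) x) + v $ 2 * ginner g c x v (cov_deriv \<Gamma> c 2 (\<lambda>y. E y $ 2) x)))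
       - e2 * (ginner g c x a (E x $ 1) + (v $ 1 * ginner g c x v (cov_deriv \<Gamma> c 1 (\<lambda>y. E y $ 1) x) + v $ 2 * ginner g c x v (cov_deriv \<Gamma> c 2 (\<lambda>y. E y $ 1) x)))
       = ginner g c x a N + (v $ 1 * w 1 x + v $ 2 * w 2 x)"
proof -
  note F = frame_coordinates[OF x on, folded e1_def e2_def]
  have sc: "ginner g c x v (k *\<^sub>R y) = k * ginner g c x v y" for k y by (simp add: ginner_expand algebra_simps)
  have aN: "ginner g c x a N = e1 * ginner g c x a (E x $ 2) - e2 * ginner g c x a (E x $ 1)"
    unfolding F(2) by (simp add: ginner_expand algebra_simps)
  have "e1 * (e1 * W) - e2 * (- (e2 * W)) = W" for W
  proof -
    have "e1 * (e1 * W) - e2 * (- (e2 * W)) = (e1\<^sup>2 + e2\<^sup>2) * W" by (simp add: power2_eq_square algebra_simps)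
    then show ?thesis using F(1) by simp
  qed
  from this[of "v $ 1 * w 1 x + v $ 2 * w 2 x"]
  show ?thesis
    unfolding aN cov_E[OF x] sc e1_def[symmetric] e2_def[symmetric]
    by (simp add: algebra_simps)
qed

lemma normal_component_\<beta>:
  assumes x: "x \<in> V" and on: "oriented_orthonormal \<sigma> g c x v N"
  shows "B x \<bullet> N = v $ 1 * \<beta> B 1 x + v $ 2 * \<beta> B 2 x"
proof -
  have vN: "ginner g c x v v = 1" "ginner g c x v N = 0" using on by (auto simp: oriented_orthonormal_def)
  note nf = normal_flat[OF vN g21[OF x], unfolded frame_coordinates(3)[OF x on]]
  show ?thesis
    by (simp add: inner_vec_def sum_2 nf \<beta>_def algebra_simps)
qed

end

text \<open>Gram-Schmidt applied to the coordinate basis; the sign \<open>s\<close> of the orientation is put into the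
  second vector.\<close>
definition gram_schmidt :: "real \<Rightarrow> 'a metric_field \<Rightarrow> 'a chart \<Rightarrow> real^2 \<Rightarrow> real^2^2" where
  "gram_schmidt s g c x = (\<chi> \<alpha> k.
     if \<alpha> = 1 then (if k = 1 then 1 / sqrt (g c x $ 1 $ 1) else 0)
     else (if k = 1 then - s * g c x $ 1 $ 2 else s * g c x $ 1 $ 1) / sqrt (g c x $ 1 $ 1 * det (g c x)))"

lemma gram_schmidt_nth:
  "gram_schmidt s g c x $ 1 $ 1 = 1 / sqrt (g c x $ 1 $ 1)" "gram_schmidt s g c x $ 1 $ 2 = 0"
  "gram_schmidt s g c x $ 2 $ 1 = - s * g c x $ 1 $ 2 / sqrt (g c x $ 1 $ 1 * det (g c x))"
  "gram_schmidt s g c x $ 2 $ 2 = s * g c x $ 1 $ 1 / sqrt (g c x $ 1 $ 1 * det (g c x))"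
  by (simp_all add: gram_schmidt_def)

context metric_patch
begin

lemma gram_schmidt_components:
  assumes x: "x \<in> V"
  shows "ginner g c x u (gram_schmidt s g c x $ 1) = sqrt (g c x $ 1 $ 1) * u $ 1 + g c x $ 1 $ 2 / sqrt (g c x $ 1 $ 1) * u $ 2"
    and "ginner g c x u (gram_schmidt s g c x $ 2) = s * sqrt (det (g c x) / g c x $ 1 $ 1) * u $ 2"
proof -
  note p = g11_pos[OF x] det_pos[OF x]
  show "ginner g c x u (gram_schmidt s g c x $ 1) = sqrt (g c x $ 1 $ 1) * u $ 1 + g c x $ 1 $ 2 / sqrt (g c x $ 1 $ 1) * u $ 2"
    using p by (simp add: ginner_expand gram_schmidt_nth g21[OF x] field_simps real_sqrt_mult_self)
  define q where "q = sqrt (g c x $ 1 $ 1 * det (g c x))"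
  have q: "q * q = g c x $ 1 $ 1 * det (g c x)" "q > 0" using p by (simp_all add: q_def)
  have sq: "sqrt (det (g c x) / g c x $ 1 $ 1) = det (g c x) / q"
  proof (rule real_sqrt_unique)
    show "(det (g c x) / q)\<^sup>2 = det (g c x) / g c x $ 1 $ 1"
      using q p by (simp add: power2_eq_square field_simps)
  qed (use p q in simp)
  have "ginner g c x u (gram_schmidt s g c x $ 2) = s * (det (g c x) / q) * u $ 2"
  proof -
    have e: "gram_schmidt s g c x $ 2 $ 1 = - s * g c x $ 1 $ 2 / q" "gram_schmidt s g c x $ 2 $ 2 = s * g c x $ 1 $ 1 / q"
      by (simp_all add: gram_schmidt_nth q_def)
    show ?thesis using q(2) by (simp add: ginner_expand e g21[OF x] det_2[of "g c x"]) (simp add: field_simps)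
  qed
  then show "ginner g c x u (gram_schmidt s g c x $ 2) = s * sqrt (det (g c x) / g c x $ 1 $ 1) * u $ 2"
    by (simp add: sq)
qed

lemma gram_schmidt_frame:
  assumes s: "s = 1 \<or> s = -1" and \<sigma>: "\<And>x. x \<in> V \<Longrightarrow> \<sigma> c x = s"
  shows "frame_patch g \<Gamma> c V \<sigma> (gram_schmidt s g c)"
proof unfold_locales
  have n: "smooth_on V (\<lambda>x. g c x $ k $ l)" for k l by (rule smooth_g_nth)
  have D: "smooth_on V (\<lambda>x. det (g c x))" unfolding det_2 by (intro smooth_on_diff smooth_on_mult open_V n)
  have q1: "smooth_on V (\<lambda>x. sqrt (g c x $ 1 $ 1))" by (rule smooth_on_sqrt[OF open_V g11_pos n])
  have q2: "smooth_on V (\<lambda>x. sqrt (g c x $ 1 $ 1 * det (g c x)))"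
    by (rule smooth_on_sqrt[OF open_V _ smooth_on_mult[OF open_V n D]]) (simp add: g11_pos det_pos)
  have nz: "sqrt (g c x $ 1 $ 1) \<noteq> 0" "sqrt (g c x $ 1 $ 1 * det (g c x)) \<noteq> 0" if "x \<in> V" for x
    using g11_pos[OF that] det_pos[OF that] by simp_all
  show "smooth_on V (gram_schmidt s g c)"
    unfolding gram_schmidt_def[abs_def]
  proof (intro smooth_on_vec open_V)
    fix \<alpha> k :: 2
    have "smooth_on V (\<lambda>x. 1 / sqrt (g c x $ 1 $ 1))"
      "smooth_on V (\<lambda>x. (if k = 1 then - s * g c x $ 1 $ 2 else s * g c x $ 1 $ 1) / sqrt (g c x $ 1 $ 1 * det (g c x)))"
      using n by (cases "k = 1"; auto intro!: smooth_on_divide smooth_on_const smooth_on_mult smooth_on_minus open_V nz q1 q2)+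
    then show "smooth_on V (\<lambda>x. if \<alpha> = 1 then (if k = 1 then 1 / sqrt (g c x $ 1 $ 1) else 0)
     else (if k = 1 then - s * g c x $ 1 $ 2 else s * g c x $ 1 $ 1) / sqrt (g c x $ 1 $ 1 * det (g c x)))"
      by (cases "\<alpha> = 1"; cases "k = 1") (auto intro: smooth_on_const open_V)
  qed
  fix x assume x: "x \<in> V"
  note p = g11_pos[OF x] det_pos[OF x]
  have ss: "s * s = 1" using s by auto
  define q where "q = sqrt (g c x $ 1 $ 1 * det (g c x))"
  have q: "q * q = g c x $ 1 $ 1 * det (g c x)" "q > 0" using p by (simp_all add: q_def)
  have sq: "sqrt (det (g c x) / g c x $ 1 $ 1) * g c x $ 1 $ 1 = q"
  proof -
    have "sqrt (det (g c x) / g c x $ 1 $ 1) * sqrt (g c x $ 1 $ 1 * g c x $ 1 $ 1) = q"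
      unfolding q_def real_sqrt_mult[symmetric] using p by simp
    then show ?thesis using p by (simp add: real_sqrt_mult_self)
  qed
  show "oriented_orthonormal \<sigma> g c x (gram_schmidt s g c x $ 1) (gram_schmidt s g c x $ 2)"
    unfolding oriented_orthonormal_def oriented_det_def det_frame \<sigma>[OF x]
    unfolding gram_schmidt_components[OF x] gram_schmidt_nth q_def[symmetric]
  proof (intro conjI)
    show "sqrt (g c x $ 1 $ 1) * (1 / sqrt (g c x $ 1 $ 1)) + g c x $ 1 $ 2 / sqrt (g c x $ 1 $ 1) * 0 = 1"
      using p by simp
    have "s * sqrt (det (g c x) / g c x $ 1 $ 1) * (s * g c x $ 1 $ 1 / q) = (s * s) * (sqrt (det (g c x) / g c x $ 1 $ 1) * g c x $ 1 $ 1) / q"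
      by simp
    also have "\<dots> = 1" unfolding sq ss using q by simp
    finally show "s * sqrt (det (g c x) / g c x $ 1 $ 1) * (s * g c x $ 1 $ 1 / q) = 1" .
    show "s * sqrt (det (g c x) / g c x $ 1 $ 1) * 0 = 0" by simp
    have "s * (1 / sqrt (g c x $ 1 $ 1) * (s * g c x $ 1 $ 1 / q) - 0 * (- s * g c x $ 1 $ 2 / q)) = (s * s) * (g c x $ 1 $ 1 / (sqrt (g c x $ 1 $ 1) * q))"
      by simp
    also have "\<dots> > 0" unfolding ss using p q by simp
    finally show "0 < s * (1 / sqrt (g c x $ 1 $ 1) * (s * g c x $ 1 $ 1 / q) - 0 * (- s * g c x $ 1 $ 2 / q))" .
  qed
  show "\<sigma> c x = 1 \<or> \<sigma> c x = -1" using s \<sigma>[OF x] by simp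
qed

end


section \<open>Passing to the complex plane\<close>

lemma inside_linear_image_subset:
  assumes T: "bounded_linear T" "bounded_linear T'" "\<And>x. T' (T x) = x" "\<And>y. T (T' y) = y" and x: "x \<in> inside S"
  shows "T x \<in> inside (T ` S)"
proof -
  let ?C = "connected_component_set (- (T ` S)) (T x)"
  have xS: "x \<notin> S" "bounded (connected_component_set (- S) x)" using x by (auto simp: inside_def)
  have inj: "T a = T b \<Longrightarrow> a = b" for a b using T(3) by metis
  have Tx: "T x \<notin> T ` S" using xS inj by auto
  have conn: "connected (T' ` ?C)"
    by (intro connected_continuous_image linear_continuous_on T connected_connected_component)
  have sub: "T' ` ?C \<subseteq> - S"
  proof
    fix y assume "y \<in> T' ` ?C"
    then obtain u where u: "u \<in> ?C" "y = T' u" by auto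
    then have "u \<notin> T ` S" using connected_component_subset[of "- (T ` S)" "T x"] by auto
    then show "y \<in> - S" using u T(4) by (metis ComplI image_eqI)
  qed
  have "x \<in> T' ` ?C"
    using Tx T(3)[of x] by (intro image_eqI[of _ _ "T x"]) (auto simp: connected_component_refl)
  then have "T' ` ?C \<subseteq> connected_component_set (- S) x"
    by (intro connected_component_maximal conn sub)
  then have "bounded (T' ` ?C)" using xS(2) bounded_subset by blast
  then have "bounded (T ` T' ` ?C)" by (rule bounded_linear_image[OF _ T(1)])
  moreover have "T ` T' ` ?C = ?C" using T(4) by (simp add: image_image)
  ultimately show ?thesis using Tx by (simp add: inside_def)
qed

lemma inside_linear_image:
  assumes T: "bounded_linear T" "bounded_linear T'" "\<And>x. T' (T x) = x" "\<And>y. T (T' y) = y"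
  shows "inside (T ` S) = T ` inside S"
proof (intro equalityI subsetI)
  fix y assume y: "y \<in> inside (T ` S)"
  have "T' y \<in> inside (T' ` T ` S)" by (rule inside_linear_image_subset[OF T(2,1,4,3) y])
  moreover have "T' ` T ` S = S" using T(3) by (simp add: image_image)
  ultimately show "y \<in> T ` inside S" using T(4) by (metis image_eqI)
next
  fix y assume "y \<in> T ` inside S"
  then show "y \<in> inside (T ` S)" using inside_linear_image_subset[OF T] by auto
qed

text \<open>For a chart that reverses the orientation, the sign \<open>s = -1\<close> reflects the picture, so that positively
  oriented curves become counterclockwise.\<close>
definition toC :: "real \<Rightarrow> real^2 \<Rightarrow> complex" where
  "toC s x = Complex (x $ 1) (s * x $ 2)"

definition ofC :: "real \<Rightarrow> complex \<Rightarrow> real^2" where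
  "ofC s w = (\<chi> k. if k = 1 then Re w else s * Im w)"

definition vec2 :: "real \<Rightarrow> real \<times> real \<Rightarrow> real^2" where
  "vec2 s u = (\<chi> k. if k = 1 then fst u else s * snd u)"

lemma toC_sel [simp]: "Re (toC s x) = x $ 1" "Im (toC s x) = s * x $ 2"
  by (simp_all add: toC_def)

lemma ofC_nth [simp]: "ofC s w $ 1 = Re w" "ofC s w $ 2 = s * Im w"
  by (simp_all add: ofC_def)

lemma vec2_nth [simp]: "vec2 s u $ 1 = fst u" "vec2 s u $ 2 = s * snd u"
  by (simp_all add: vec2_def)

lemma bounded_linear_toC: "bounded_linear (toC s)"
proof -
  have "linear (toC s)" by (intro linearI) (simp_all add: complex_eq_iff algebra_simps)
  then show ?thesis by (simp add: linear_conv_bounded_linear)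
qed

lemma bounded_linear_ofC: "bounded_linear (ofC s)"
proof -
  have "linear (ofC s)" by (intro linearI) (simp_all add: vec_eq_iff forall_2 algebra_simps)
  then show ?thesis by (simp add: linear_conv_bounded_linear)
qed

lemma bounded_linear_vec2: "bounded_linear (vec2 s)"
proof -
  have "linear (vec2 s)" by (intro linearI) (simp_all add: vec_eq_iff forall_2 algebra_simps)
  then show ?thesis by (simp add: linear_conv_bounded_linear)
qed

lemma sign_inverse:
  assumes "s = 1 \<or> s = -1"
  shows "ofC s (toC s x) = x" "toC s (ofC s w) = w" "vec2 s (pt (toC s x)) = x" "pt (toC s (vec2 s u)) = u"
  using assms by (auto simp: vec_eq_iff forall_2 complex_eq_iff pt_def)

text \<open>The reflection preserves areas.\<close>
lemma lborel_vec2: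
  assumes s: "s = 1 \<or> s = -1"
  shows "lborel = distr lborel borel (vec2 s)"
proof (rule lborel_eqI)
  have m: "vec2 s \<in> lborel \<rightarrow>\<^sub>M borel"
    using borel_measurable_continuous_onI[OF linear_continuous_on[OF bounded_linear_vec2]] by simp
  fix l u :: "real^2" assume lu: "\<And>b. b \<in> Basis \<Longrightarrow> l \<bullet> b \<le> u \<bullet> b"
  have lu': "l $ k \<le> u $ k" for k 
  proof -
    have "axis k (1::real) \<in> Basis" by (auto simp: Basis_vec_def)
    from lu[OF this] show ?thesis by (simp add: inner_axis)
  qed
  define l2 where "l2 = (if s = 1 then l $ 2 else - u $ 2)"
  define u2 where "u2 = (if s = 1 then u $ 2 else - l $ 2)"
  have pre: "vec2 s -` box l u = box (l $ 1, l2) (u $ 1, u2)"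
    using s by (auto simp: mem_box_cart forall_2 box_prod l2_def u2_def)
  have P: "(\<Prod>b\<in>Basis. (u - l) \<bullet> b) = (u $ 1 - l $ 1) * (u $ 2 - l $ 2)"
  proof -
    have B: "(Basis :: (real^2) set) = {axis 1 1, axis 2 1}"
      by (auto simp: Basis_vec_def UNIV_2)
    show ?thesis unfolding B by (simp add: axis_eq_axis inner_axis)
  qed
  have "emeasure (distr lborel borel (vec2 s)) (box l u) = emeasure lborel (vec2 s -` box l u)"
    by (subst emeasure_distr[OF m]) auto
  also have "\<dots> = ennreal ((u $ 1 - l $ 1) * (u2 - l2))"
    unfolding pre using lu'[of 1] lu'[of 2]
    by (subst emeasure_lborel_box) (auto simp: Basis_prod_def l2_def u2_def zero_prod_def sum.distrib prod.union_disjoint)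
  also have "\<dots> = ennreal (\<Prod>b\<in>Basis. (u - l) \<bullet> b)" unfolding P using s by (auto simp: l2_def u2_def)
  finally show "emeasure (distr lborel borel (vec2 s)) (box l u) = ennreal (\<Prod>b\<in>Basis. (u - l) \<bullet> b)" .
qed simp

lemma integral_vec2:
  assumes s: "s = 1 \<or> s = -1" and D: "open D" and F: "continuous_on D F"
    and int: "has_bochner_integral lborel (\<lambda>u. indicator {u. vec2 s u \<in> D} u * F (vec2 s u)) I"
  shows "integral D F = (I :: real)"
proof -
  define h where "h = (\<lambda>x. indicator D x *\<^sub>R F x)"
  have m: "vec2 s \<in> lborel \<rightarrow>\<^sub>M borel"
    using borel_measurable_continuous_onI[OF linear_continuous_on[OF bounded_linear_vec2]] by simp
  have hm: "h \<in> borel_measurable borel"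
    unfolding h_def by (rule borel_measurable_continuous_on_indicator[OF _ F]) (use D in auto)
  have "(\<lambda>u. h (vec2 s u)) = (\<lambda>u. indicator {u. vec2 s u \<in> D} u * F (vec2 s u))"
    by (auto simp: h_def indicator_def fun_eq_iff)
  then have "integrable lborel (\<lambda>u. h (vec2 s u))" "(LINT u|lborel. h (vec2 s u)) = I"
    using int by (simp_all add: has_bochner_integral_iff)
  then have "integrable lborel h" "(LINT x|lborel. h x) = I"
    by (subst lborel_vec2[OF s], simp add: integrable_distr_eq[OF m hm], subst lborel_vec2[OF s], simp add: integral_distr[OF m hm])
  then show ?thesis
    using set_borel_integral_eq_integral(2)[of D F] by (simp add: set_integrable_def set_lebesgue_integral_def h_def)
qed

lemma smooth_on_real_derivative:
  fixes h :: "real \<Rightarrow> 'b::real_normed_vector"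
  assumes "smooth_on J h"
  shows "t \<in> J \<Longrightarrow> (h has_vector_derivative frechet_derivative h (at t) 1) (at t)"
    and "smooth_on J (\<lambda>t. frechet_derivative h (at t) 1)"
proof -
  show "smooth_on J (\<lambda>t. frechet_derivative h (at t) 1)"
    using assms unfolding smooth_on_def using Ck_on_SucD(2) by blast
  assume "t \<in> J"
  then have d: "h differentiable (at t)" by (rule smooth_on_differentiable[OF assms])
  have "frechet_derivative h (at t) x = x *\<^sub>R frechet_derivative h (at t) 1" for x
    using linear_scale[OF linear_frechet_derivative[OF d], of x 1] by simp
  then have "frechet_derivative h (at t) = (\<lambda>x. x *\<^sub>R frechet_derivative h (at t) 1)" by (rule ext)
  then show "(h has_vector_derivative frechet_derivative h (at t) 1) (at t)"
    using d unfolding has_vector_derivative_def frechet_derivative_works by metis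
qed

text \<open>The one-sided derivatives at the ends agree with those of a smooth extension.\<close>
lemma smooth_on_interval_derivatives:
  fixes f :: "real \<Rightarrow> real^2"
  assumes f: "smooth_on_interval a b f" and ab: "a < b"
  defines "f' \<equiv> \<lambda>t. vector_derivative f (at t within {a..b})"
  defines "f'' \<equiv> \<lambda>t. vector_derivative f' (at t within {a..b})"
  shows "\<And>t. t \<in> {a..b} \<Longrightarrow> (f has_vector_derivative f' t) (at t within {a..b})"
    and "\<And>t. t \<in> {a..b} \<Longrightarrow> (f' has_vector_derivative f'' t) (at t within {a..b})"
    and "continuous_on {a..b} f'" "continuous_on {a..b} f''"
proof -
  obtain J h where J: "open J" "{a..b} \<subseteq> J" "smooth_on J h" "\<And>t. t \<in> {a..b} \<Longrightarrow> h t = f t"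
    using f unfolding smooth_on_interval_def by blast
  define h' where "h' t = frechet_derivative h (at t) 1" for t
  define h'' where "h'' t = frechet_derivative h' (at t) 1" for t
  have sh': "smooth_on J h'" unfolding h'_def[abs_def] by (rule smooth_on_real_derivative(2)[OF J(3)])
  have sh'': "smooth_on J h''" unfolding h''_def[abs_def] by (rule smooth_on_real_derivative(2)[OF sh'])
  have dh: "(h has_vector_derivative h' t) (at t within {a..b})" "(h' has_vector_derivative h'' t) (at t within {a..b})"
    if "t \<in> {a..b}" for t
  proof -
    have tJ: "t \<in> J" using that J(2) by auto
    show "(h has_vector_derivative h' t) (at t within {a..b})"
      unfolding h'_def by (rule has_vector_derivative_at_within[OF smooth_on_real_derivative(1)[OF J(3) tJ]])
    show "(h' has_vector_derivative h'' t) (at t within {a..b})"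
      unfolding h''_def by (rule has_vector_derivative_at_within[OF smooth_on_real_derivative(1)[OF sh' tJ]])
  qed
  have df: "(f has_vector_derivative h' t) (at t within {a..b})" if t: "t \<in> {a..b}" for t
    by (rule has_vector_derivative_transform[OF t J(4)[symmetric] dh(1)[OF t]])
  have f': "f' t = h' t" if "t \<in> {a..b}" for t
    unfolding f'_def using vector_derivative_within_cbox[of a b t f "h' t"] df[OF that] ab that by simp
  have df': "(f' has_vector_derivative h'' t) (at t within {a..b})" if t: "t \<in> {a..b}" for t
    by (rule has_vector_derivative_transform[OF t f' dh(2)[OF t]])
  have f'': "f'' t = h'' t" if "t \<in> {a..b}" for t
    unfolding f''_def using vector_derivative_within_cbox[of a b t f' "h'' t"] df'[OF that] ab that by simp
  show "(f has_vector_derivative f' t) (at t within {a..b})" if "t \<in> {a..b}" for t using df[OF that] f'[OF that] by simp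
  show "(f' has_vector_derivative f'' t) (at t within {a..b})" if "t \<in> {a..b}" for t using df'[OF that] f''[OF that] by simp
  show "continuous_on {a..b} f'"
    by (rule continuous_on_eq[OF continuous_on_subset[OF smooth_on_continuous[OF sh'] J(2)] f'[symmetric]])
  show "continuous_on {a..b} f''"
    by (rule continuous_on_eq[OF continuous_on_subset[OF smooth_on_continuous[OF sh''] J(2)] f''[symmetric]])
qed

lemma Im_Ln_unit:
  assumes "cmod u = 1"
  shows "Im (Ln u) = (if 0 \<le> Im u then 1 else -1) * arccos (Re u)"
proof -
  have u0: "u \<noteq> 0" using assms by auto
  define \<theta> where "\<theta> = Im (Ln u)"
  have b: "- pi < \<theta>" "\<theta> \<le> pi" using u0 mpi_less_Im_Ln Im_Ln_le_pi by (auto simp: \<theta>_def)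
  have "Ln u = Complex 0 \<theta>" using assms u0 by (simp add: complex_eq_iff \<theta>_def)
  then have u: "u = exp (Complex 0 \<theta>)" using exp_Ln[OF u0] by simp
  have re: "Re u = cos \<theta>" and im: "Im u = sin \<theta>"
    using arg_cong[OF u, of Re] arg_cong[OF u, of Im] by (simp_all only: Re_exp Im_exp complex.sel exp_zero mult_1_left)
  show ?thesis
  proof (cases "0 \<le> \<theta>")
    case True
    then show ?thesis using b unfolding re im \<theta>_def[symmetric] by (simp add: sin_ge_zero arccos_cos)
  next
    case False
    then have "sin \<theta> < 0" using sin_gt_zero[of "- \<theta>"] b by simp
    moreover have "arccos (cos \<theta>) = - \<theta>" using arccos_cos[of "- \<theta>"] False b by simp
    ultimately show ?thesis unfolding re im \<theta>_def[symmetric] by simp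
  qed
qed

context frame_patch
begin

text \<open>A tangent vector as a complex number, with the frame as real and imaginary axis.\<close>
definition coord :: "real^2 \<Rightarrow> real^2 \<Rightarrow> complex" where
  "coord x u = Complex (ginner g c x u (E x $ 1)) (ginner g c x u (E x $ 2))"

lemma ginner_coord:
  assumes x: "x \<in> V"
  shows "ginner g c x u v = Re (coord x u) * Re (coord x v) + Im (coord x u) * Im (coord x v)"
proof -
  have "ginner g c x u v = ginner g c x (ginner g c x u (E x $ 1) *\<^sub>R E x $ 1 + ginner g c x u (E x $ 2) *\<^sub>R E x $ 2) v"
    using expand[OF x, of u] by simp
  also have "\<dots> = ginner g c x u (E x $ 1) * ginner g c x (E x $ 1) v + ginner g c x u (E x $ 2) * ginner g c x (E x $ 2) v"
    by (simp add: ginner_expand[of g c x "_ + _"] ginner_expand[of g c x "E x $ _" v] algebra_simps)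
  finally show ?thesis using ginner_commute[OF x, of _ v] by (simp add: coord_def)
qed

lemma det_coord:
  assumes x: "x \<in> V"
  shows "u $ 1 * v $ 2 - u $ 2 * v $ 1 = (Re (coord x u) * Im (coord x v) - Im (coord x u) * Re (coord x v)) * \<rho> x"
proof -
  have u: "u $ k = Re (coord x u) * E x $ 1 $ k + Im (coord x u) * E x $ 2 $ k" for u k
    using arg_cong[OF expand[OF x, of u], of "\<lambda>y. y $ k"] by (simp add: coord_def)
  show ?thesis
    unfolding u[of u 1] u[of u 2] u[of v 1] u[of v 2] \<rho>_def by (simp add: algebra_simps)
qed

lemma cmod_coord: "x \<in> V \<Longrightarrow> ginner g c x u u = 1 \<Longrightarrow> cmod (coord x u) = 1"
  using ginner_coord[of x u u] by (simp add: cmod_def power2_eq_square)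

text \<open>\<open>coord\<close> is an oriented isometry, so the oriented angle is the principal argument of the quotient.\<close>
lemma oriented_angle_coord:
  assumes x: "x \<in> V" and 1: "ginner g c x u u = 1" "ginner g c x v v = 1"
  shows "oriented_angle \<sigma> g c x u v = Im (Ln (coord x v / coord x u))"
proof -
  define w where "w = coord x v / coord x u"
  have cu: "cmod (coord x u) = 1" and cv: "cmod (coord x v) = 1" using cmod_coord[OF x] 1 by auto
  have w: "w = coord x v * cnj (coord x u)"
    using cu unfolding w_def by (subst complex_div_cnj) simp
  have re: "Re w = ginner g c x u v" unfolding w ginner_coord[OF x] by (simp add: algebra_simps)
  have im: "u $ 1 * v $ 2 - u $ 2 * v $ 1 = Im w * \<rho> x"
    unfolding det_coord[OF x] w by (simp add: algebra_simps)
  have p: "0 < \<sigma> c x * \<rho> x"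
    using orthonormal[OF x] by (simp add: oriented_orthonormal_def oriented_det_def det_frame \<rho>_def)
  have "oriented_det \<sigma> c x u v = (\<sigma> c x * \<rho> x) * Im w"
    unfolding oriented_det_def det_frame im by simp
  moreover have "0 \<le> k * y \<longleftrightarrow> 0 \<le> y" if "0 < k" for k y :: real
    using that by (simp add: zero_le_mult_iff)
  ultimately have "0 \<le> oriented_det \<sigma> c x u v \<longleftrightarrow> 0 \<le> Im w" using p by simp
  moreover have "cmod w = 1" using cu cv by (simp add: w_def norm_divide)
  ultimately show ?thesis
    unfolding oriented_angle_def w_def[symmetric] using 1 re by (simp add: Im_Ln_unit)
qed

end


section \<open>The Gauss-Bonnet formula\<close>

text \<open>The hypotheses of the theorem, fixed for the proof of the Gauss-Bonnet formula. The loop \<open>z\<close> is the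
  curve in the chart, seen in the complex plane; \<open>E\<close> is the Gram-Schmidt frame.\<close>
locale polygon =
  fixes A :: "'a::{t2_space,second_countable_topology} chart set"
    and \<sigma> :: "'a chart \<Rightarrow> real^2 \<Rightarrow> real"
    and g :: "'a metric_field" and LC :: "'a connection_field"
    and c :: "'a chart" and \<gamma> :: "real \<Rightarrow> 'a" and n :: nat and \<tau> :: "nat \<Rightarrow> real"
    and D :: "'a set" and N :: "nat \<Rightarrow> real \<Rightarrow> real^2"
  assumes surface: "oriented_surface A \<sigma>"
    and metric: "riemannian_metric A g"
    and LC: "levi_civita A g LC"
    and polygon: "positively_oriented_polygon A \<sigma> g c \<gamma> n \<tau> D N"
begin

lemma curved: "curved_polygon A \<sigma> g c \<gamma> n \<tau> D"
  and normal: "unit_normal \<sigma> g c \<gamma> n \<tau> N"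
  and inward: "inward_pointing c \<gamma> n \<tau> D N"
  using polygon by (auto simp: positively_oriented_polygon_def)

lemma c_in: "c \<in> A" and n_pos: "0 < n" and \<tau>_less: "i < n \<Longrightarrow> \<tau> i < \<tau> (Suc i)"
  and closed_up: "\<gamma> (\<tau> n) = \<gamma> (\<tau> 0)" and inj_\<gamma>: "inj_on \<gamma> {\<tau> 0..<\<tau> n}"
  and \<gamma>_dom: "\<gamma> ` {\<tau> 0..\<tau> n} \<subseteq> cdom c" and D_dom: "D \<subseteq> cdom c"
  and pieces: "i < n \<Longrightarrow> smooth_on_interval (\<tau> i) (\<tau> (Suc i)) (\<lambda>t. cmap c (\<gamma> t))"
  and unit_speed: "i < n \<Longrightarrow> t \<in> {\<tau> i..\<tau> (Suc i)} \<Longrightarrow> ginner g c (cmap c (\<gamma> t)) (vel c \<gamma> \<tau> i t) (vel c \<gamma> \<tau> i t) = 1"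
  and no_cusps: "i < n \<Longrightarrow> exterior_angle \<sigma> g c \<gamma> n \<tau> i \<noteq> pi"
  and D_inside: "cmap c ` D = inside (cmap c ` \<gamma> ` {\<tau> 0..\<tau> n})"
  using curved by (simp_all add: curved_polygon_def)

definition x where "x t = cmap c (\<gamma> t)"
abbreviation "u \<equiv> vel c \<gamma> \<tau>"
definition acc where "acc i t = vector_derivative (u i) (at t within {\<tau> i..\<tau> (Suc i)})"

lemma x_deriv: "i < n \<Longrightarrow> t \<in> {\<tau> i..\<tau> (Suc i)} \<Longrightarrow> (x has_vector_derivative u i t) (at t within {\<tau> i..\<tau> (Suc i)})"
  and u_deriv: "i < n \<Longrightarrow> t \<in> {\<tau> i..\<tau> (Suc i)} \<Longrightarrow> (u i has_vector_derivative acc i t) (at t within {\<tau> i..\<tau> (Suc i)})"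
  and u_cont: "i < n \<Longrightarrow> continuous_on {\<tau> i..\<tau> (Suc i)} (u i)"
  and acc_cont: "i < n \<Longrightarrow> continuous_on {\<tau> i..\<tau> (Suc i)} (acc i)"
  using smooth_on_interval_derivatives[OF pieces \<tau>_less, of i]
  unfolding vel_def[abs_def] x_def[abs_def] acc_def[abs_def] by auto

lemma chart_c: "is_chart c" and open_coords: "open (coords c)"
  using surface c_in unfolding oriented_surface_def smooth_structure_def is_chart_def by blast+

lemma inj_x: "inj_on x {\<tau> 0..<\<tau> n}"
proof -
  have "inj_on (cmap c) (cdom c)"
    using chart_c unfolding is_chart_def homeomorphism_def by (metis inj_on_inverseI)
  then have "inj_on (cmap c \<circ> \<gamma>) {\<tau> 0..<\<tau> n}"
    using \<gamma>_dom by (intro comp_inj_on inj_\<gamma>) (rule inj_on_subset, auto)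
  then show ?thesis by (simp add: x_def[abs_def] comp_def)
qed

lemma sign_cases: "y \<in> coords c \<Longrightarrow> \<sigma> c y = 1 \<or> \<sigma> c y = -1" and cont_sign: "continuous_on (coords c) (\<sigma> c)"
  using surface c_in by (auto simp: oriented_surface_def orientation_def)

lemma image_x: "cmap c ` \<gamma> ` {\<tau> 0..\<tau> n} = x ` {\<tau> 0..\<tau> n}"
  by (simp add: x_def[abs_def] image_image)

lemma x_coords: "t \<in> {\<tau> 0..\<tau> n} \<Longrightarrow> x t \<in> coords c"
  using \<gamma>_dom unfolding x_def coords_def by blast

lemma inside_coords: "inside (x ` {\<tau> 0..\<tau> n}) \<subseteq> coords c"
  using D_dom unfolding coords_def image_x[symmetric] D_inside[symmetric] by blast

definition s where "s = \<sigma> c (x (\<tau> 0))"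
definition z where "z t = toC s (x t)"
definition v where "v i t = toC s (u i t)"

lemma cornered: "cornered_loop z v n \<tau>"
  and s_cases: "s = 1 \<or> s = -1"
proof -
  have "\<tau> i \<le> \<tau> j" if "i \<le> j" "j \<le> n" for i j
    using that(2,1)
  proof (induction j)
    case (Suc j)
    then show ?case using \<tau>_less[of j] by (cases "i = Suc j") (auto simp: le_Suc_eq)
  qed simp
  from this[of 0 n] have "\<tau> 0 \<in> {\<tau> 0..\<tau> n}" by simp
  then show s: "s = 1 \<or> s = -1" unfolding s_def by (intro sign_cases x_coords)
  show "cornered_loop z v n \<tau>"
  proof
    show "inj_on z {\<tau> 0..<\<tau> n}"
      using inj_x sign_inverse(1)[OF s] unfolding inj_on_def z_def by metis
    show "z (\<tau> n) = z (\<tau> 0)" by (simp add: z_def x_def closed_up)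
    fix i t assume i: "i < n" and t: "t \<in> {\<tau> i..\<tau> (Suc i)}"
    show "(z has_vector_derivative v i t) (at t within {\<tau> i..\<tau> (Suc i)})"
      unfolding z_def[abs_def] v_def by (rule bounded_linear.has_vector_derivative[OF bounded_linear_toC x_deriv[OF i t]])
    have "u i t \<noteq> 0" using unit_speed[OF i t] by (auto simp: ginner_def)
    then show "v i t \<noteq> 0" unfolding v_def using sign_inverse(1)[OF s, of "u i t"] sign_inverse(1)[OF s, of 0]
      by (metis bounded_linear.linear bounded_linear_toC linear_0)
  next
    fix i assume "i < n"
    then show "continuous_on {\<tau> i..\<tau> (Suc i)} (v i)"
      unfolding v_def[abs_def] by (intro bounded_linear.continuous_on[OF bounded_linear_toC] u_cont)
  qed (use n_pos \<tau>_less in auto)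
qed

sublocale loop: cornered_loop z v n \<tau> by (rule cornered)

lemma image_z: "z ` {\<tau> 0..\<tau> n} = toC s ` x ` {\<tau> 0..\<tau> n}"
  by (simp add: z_def[abs_def] image_image)

lemma inside_z: "inside (z ` {\<tau> 0..\<tau> n}) = toC s ` inside (x ` {\<tau> 0..\<tau> n})"
  unfolding image_z by (rule inside_linear_image[OF bounded_linear_toC bounded_linear_ofC sign_inverse(1,2)[OF s_cases]])

text \<open>The part of the chart where the orientation has the same sign as at the start of the curve.\<close>
definition V where "V = {y \<in> coords c. \<sigma> c y = s}"

lemma open_V: "open V"
proof -
  have "V = coords c \<inter> (\<lambda>y. s * \<sigma> c y) -` {0<..}"
    using s_cases sign_cases by (fastforce simp: V_def)
  moreover have "open (coords c \<inter> (\<lambda>y. s * \<sigma> c y) -` {0<..})"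
    by (intro continuous_open_preimage continuous_intros cont_sign open_coords open_greaterThan)
  ultimately show ?thesis by simp
qed

text \<open>The closed domain is connected, being the closure of the interior of a Jordan curve, and the sign is
  locally constant.\<close>
lemma closed_domain_V: "x ` {\<tau> 0..\<tau> n} \<union> inside (x ` {\<tau> 0..\<tau> n}) \<subseteq> V"
proof -
  let ?K = "x ` {\<tau> 0..\<tau> n} \<union> inside (x ` {\<tau> 0..\<tau> n})"
  let ?I = "inside (path_image loop.loop)"
  have J: "connected ?I" "frontier ?I = path_image loop.loop"
    using Jordan_inside_outside[OF loop.simple_loop] by (simp_all add: loop.loop_ends)
  have "closure ?I = ?I \<union> path_image loop.loop" using closure_Un_frontier[of ?I] J(2) by simp
  moreover have "connected (closure ?I)" by (rule connected_imp_connected_closure[OF J(1)])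
  ultimately have "connected (?I \<union> path_image loop.loop)" by simp
  then have "connected (ofC s ` (?I \<union> path_image loop.loop))"
    by (intro connected_continuous_image linear_continuous_on bounded_linear_ofC)
  moreover have "ofC s ` (?I \<union> path_image loop.loop) = ?K"
    unfolding loop.path_image_loop inside_z image_Un unfolding image_z
    by (auto simp: image_image sign_inverse[OF s_cases])
  ultimately have K: "connected ?K" by simp
  have sub: "?K \<subseteq> coords c" using x_coords inside_coords by auto
  have c: "continuous_on ?K (\<sigma> c)" by (rule continuous_on_subset[OF cont_sign sub])
  have "\<sigma> c ` ?K \<subseteq> {1, -1}" using sign_cases sub by blast
  then have fin: "finite (\<sigma> c ` ?K)" by (rule finite_subset) simp
  obtain k where k: "\<And>y. y \<in> ?K \<Longrightarrow> \<sigma> c y = k"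
    using continuous_finite_range_constant[OF K c fin] unfolding constant_on_def by blast
  have "x (\<tau> 0) \<in> ?K" using loop.a_less_b by auto
  then have "k = s" using k unfolding s_def by metis
  then show ?thesis using k sub unfolding V_def by blast
qed

lemma x_V: "t \<in> {\<tau> 0..\<tau> n} \<Longrightarrow> x t \<in> V" using closed_domain_V by auto

lemma x_V_piece: "i < n \<Longrightarrow> t \<in> {\<tau> i..\<tau> (Suc i)} \<Longrightarrow> x t \<in> V"
  using x_V loop.piece_subset by blast

sublocale patch: metric_patch g LC c V
proof
  show "open V" by (rule open_V)
  have sub: "V \<subseteq> coords c" by (auto simp: V_def)
  show "smooth_on V (g c)" "smooth_on V (LC c)"
    using metric LC c_in sub
    by (auto simp: riemannian_metric_def levi_civita_def metric_connection_def is_connection_def intro: smooth_on_subset)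
  fix y assume y: "y \<in> V"
  then have yc: "y \<in> coords c" by (simp add: V_def)
  show "transpose (g c y) = g c y" by (rule metric_at(1)[OF metric c_in yc])
  show "0 < w \<bullet> (g c y *v w)" if "w \<noteq> 0" for w by (rule metric_at(2)[OF metric c_in yc that])
  show "cov_metric g LC c y i l j = 0" for i l j
    using LC c_in yc by (auto simp: levi_civita_def metric_connection_def)
qed

definition E where "E = gram_schmidt s g c"

sublocale frame: frame_patch g LC c V \<sigma> E
  unfolding E_def by (rule patch.gram_schmidt_frame[OF s_cases]) (simp add: V_def)

definition p where "p t = sqrt (g c (x t) $ 1 $ 1)"
definition q where "q t = s * (g c (x t) $ 1 $ 2 / sqrt (g c (x t) $ 1 $ 1))"
definition r where "r t = sqrt (det (g c (x t)) / g c (x t) $ 1 $ 1)"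

lemma x_cont: "continuous_on {\<tau> 0..\<tau> n} x"
proof -
  have "continuous_on {\<tau> 0..\<tau> n} (\<lambda>t. ofC s (z t))"
    by (intro bounded_linear.continuous_on[OF bounded_linear_ofC] loop.cont_z)
  moreover have e: "ofC s (z t) = x t" for t by (simp add: z_def sign_inverse(1)[OF s_cases])
  ultimately show ?thesis unfolding e by simp
qed

lemma along_cont: "smooth_on V f \<Longrightarrow> continuous_on {\<tau> 0..\<tau> n} (\<lambda>t. f (x t))"
  by (rule continuous_on_compose2[OF smooth_on_continuous x_cont]) (use x_V in auto)

sublocale framed: framed_loop z v n \<tau> p q r
proof
  have pos: "0 < g c (x t) $ 1 $ 1" "0 < det (g c (x t))" if "t \<in> {\<tau> 0..\<tau> n}" for t
    using patch.g11_pos patch.det_pos x_V[OF that] by auto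
  have nz: "sqrt (g c (x t) $ 1 $ 1) \<noteq> 0" "g c (x t) $ 1 $ 1 \<noteq> 0" if "t \<in> {\<tau> 0..\<tau> n}" for t
    using pos[OF that] by auto
  show "continuous_on {\<tau> 0..\<tau> n} p" "continuous_on {\<tau> 0..\<tau> n} q" "continuous_on {\<tau> 0..\<tau> n} r"
    unfolding p_def q_def r_def det_2
    by (intro continuous_on_real_sqrt continuous_on_divide continuous_on_mult continuous_on_diff continuous_on_const
        along_cont[OF patch.smooth_g_nth] ballI nz; assumption)+
  show "0 < p t" "0 < r t" if "t \<in> {\<tau> 0..\<tau> n}" for t
    using pos[OF that] by (auto simp: p_def r_def)
  have "x (\<tau> n) = x (\<tau> 0)" by (simp add: x_def closed_up)
  then show "p (\<tau> n) = p (\<tau> 0)" "q (\<tau> n) = q (\<tau> 0)" "r (\<tau> n) = r (\<tau> 0)"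
    by (simp_all add: p_def q_def r_def)
qed

lemma in_frame_toC:
  assumes "t \<in> {\<tau> 0..\<tau> n}"
  shows "framed.in_frame t (toC s w) = frame.coord (x t) w"
proof -
  have ss: "s * s = 1" using s_cases by auto
  have "s * (g c (x t) $ 1 $ 2 / sqrt (g c (x t) $ 1 $ 1)) * (s * w $ 2) = (s * s) * (g c (x t) $ 1 $ 2 / sqrt (g c (x t) $ 1 $ 1) * w $ 2)"
    by simp
  then show ?thesis
    unfolding framed.in_frame_def shear_def frame.coord_def unfolding E_def patch.gram_schmidt_components[OF x_V[OF assms]] toC_sel ss
      p_def q_def r_def by (simp add: mult_ac)
qed

lemma end_in: "i < n \<Longrightarrow> \<tau> (Suc i) \<in> {\<tau> 0..\<tau> n}" "i < n \<Longrightarrow> \<tau> i \<in> {\<tau> 0..\<tau> n}"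
  using loop.piece_subset[of i] \<tau>_less[of i] by auto

text \<open>In the orthonormal frame both velocities are complex units, and the exterior angle is the argument of
  their quotient.\<close>
lemma turn_angle:
  assumes i: "i < n"
  shows "cmod (framed.turn i) = 1" "Im (Ln (framed.turn i)) = exterior_angle \<sigma> g c \<gamma> n \<tau> i"
proof -
  define j where "j = Suc i mod n"
  have j: "j < n" using n_pos by (simp add: j_def)
  have same: "x (\<tau> j) = x (\<tau> (Suc i))"
    using i closed_up by (cases "Suc i = n") (auto simp: j_def x_def)
  have un: "ginner g c (x (\<tau> (Suc i))) (u i (\<tau> (Suc i))) (u i (\<tau> (Suc i))) = 1"
      "ginner g c (x (\<tau> (Suc i))) (u j (\<tau> j)) (u j (\<tau> j)) = 1"
    using unit_speed[OF i, of "\<tau> (Suc i)"] unit_speed[OF j, of "\<tau> j"] \<tau>_less[OF i] \<tau>_less[OF j] same[symmetric]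
    unfolding x_def[symmetric] by auto
  have xV: "x (\<tau> (Suc i)) \<in> V" by (rule x_V[OF end_in(1)[OF i]])
  \<comment> \<open>both velocities are measured in the frame at the same point, because the curve is closed\<close>
  have t: "framed.turn i = frame.coord (x (\<tau> (Suc i))) (u j (\<tau> j)) / frame.coord (x (\<tau> (Suc i))) (u i (\<tau> (Suc i)))"
    unfolding framed.turn_def v_def in_frame_toC[OF end_in(1)[OF i]] j_def ..
  show "cmod (framed.turn i) = 1" unfolding t using frame.cmod_coord[OF xV] un by (simp add: norm_divide)
  show "Im (Ln (framed.turn i)) = exterior_angle \<sigma> g c \<gamma> n \<tau> i"
    unfolding t exterior_angle_def Let_def j_def[symmetric] x_def[symmetric]
    by (rule frame.oriented_angle_coord[OF xV un, symmetric])
qed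

lemma turn_not_nonpos: "i < n \<Longrightarrow> framed.turn i \<notin> \<real>\<^sub>\<le>\<^sub>0"
proof
  assume i: "i < n" and "framed.turn i \<in> \<real>\<^sub>\<le>\<^sub>0"
  then obtain k where k: "k \<le> 0" "framed.turn i = of_real k" by (auto elim: nonpos_Reals_cases)
  then have "k = -1" using turn_angle(1)[OF i] by simp
  then have "framed.turn i = -1" using k by simp
  then have "exterior_angle \<sigma> g c \<gamma> n \<tau> i = pi" using turn_angle(2)[OF i] by simp
  then show False using no_cusps[OF i] by simp
qed

lemma on: "i < n \<Longrightarrow> t \<in> {\<tau> i..\<tau> (Suc i)} \<Longrightarrow> oriented_orthonormal \<sigma> g c (x t) (u i t) (N i t)"
  using normal unfolding unit_normal_def x_def by blast

text \<open>The Umlaufsatz for the loop in the Gram-Schmidt frame; the inward normal at the middle of the first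
  piece gives the orientation.\<close>
lemma rotation_index:
  obtains \<theta> where "\<And>i. i < n \<Longrightarrow> continuous_on {\<tau> i..\<tau> (Suc i)} (\<theta> i)"
    and "\<And>i t. i < n \<Longrightarrow> t \<in> {\<tau> i..\<tau> (Suc i)} \<Longrightarrow> frame.coord (x t) (u i t) = cis (\<theta> i t)"
    and "(\<Sum>i<n. \<theta> i (\<tau> (Suc i)) - \<theta> i (\<tau> i)) + (\<Sum>i<n. exterior_angle \<sigma> g c \<gamma> n \<tau> i) = 2 * pi"
    and "\<And>\<zeta>. \<zeta> \<in> inside (z ` {\<tau> 0..\<tau> n}) \<Longrightarrow> winding_number loop.loop \<zeta> = 1"
proof -
  define t0 where "t0 = (\<tau> 0 + \<tau> 1) / 2"
  have t0: "t0 \<in> {\<tau> 0<..<\<tau> (Suc 0)}" using \<tau>_less[OF n_pos] by (auto simp: t0_def)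
  then have t0': "t0 \<in> {\<tau> 0..\<tau> (Suc 0)}" by auto
  define M where "M = toC s (N 0 t0)"
  have quot: "Im (M / v 0 t0) > 0"
  proof -
    have "0 < \<sigma> c (x t0) * (u 0 t0 $ 1 * N 0 t0 $ 2 - u 0 t0 $ 2 * N 0 t0 $ 1)"
      using on[OF n_pos t0'] by (simp add: oriented_orthonormal_def oriented_det_def det_frame)
    moreover have "\<sigma> c (x t0) = s" using x_V_piece[OF n_pos t0'] by (simp add: V_def)
    ultimately have "0 < Im M * Re (v 0 t0) - Re M * Im (v 0 t0)"
      by (simp add: M_def v_def algebra_simps)
    moreover have "0 < (Re (v 0 t0))\<^sup>2 + (Im (v 0 t0))\<^sup>2"
      using loop.v_nz[OF n_pos t0'] by (auto simp: complex_eq_iff sum_power2_gt_zero_iff)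
    ultimately show ?thesis by (simp add: Im_divide)
  qed
  have "\<forall>\<^sub>F h in at_right 0. x t0 + h *\<^sub>R N 0 t0 \<in> inside (x ` {\<tau> 0..\<tau> n})"
    using inward n_pos t0 unfolding inward_pointing_def D_inside image_x x_def[symmetric] by blast
  then have inw: "\<forall>\<^sub>F h in at_right 0. z t0 + of_real h * M \<in> inside (z ` {\<tau> 0..\<tau> n})"
  proof eventually_elim
    case (elim h)
    have "z t0 + of_real h * M = toC s (x t0 + h *\<^sub>R N 0 t0)"
      by (simp add: z_def M_def complex_eq_iff algebra_simps)
    then show ?case using elim unfolding inside_z by simp
  qed
  obtain \<theta> where \<theta>: "\<And>i. i < n \<Longrightarrow> continuous_on {\<tau> i..\<tau> (Suc i)} (\<theta> i)"
    "\<And>i t. i < n \<Longrightarrow> t \<in> {\<tau> i..\<tau> (Suc i)} \<Longrightarrow> framed.in_frame t (v i t) = of_real (cmod (framed.in_frame t (v i t))) * cis (\<theta> i t)"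
    "(\<Sum>i<n. \<theta> i (\<tau> (Suc i)) - \<theta> i (\<tau> i)) + (\<Sum>i<n. Im (Ln (framed.turn i))) = 2 * pi"
    "\<And>\<zeta>. \<zeta> \<in> inside (z ` {\<tau> 0..\<tau> n}) \<Longrightarrow> winding_number loop.loop \<zeta> = 1"
    by (rule framed.umlaufsatz[OF turn_not_nonpos n_pos t0 quot inw]) auto
  show thesis
  proof (rule that[OF \<theta>(1) _ _ \<theta>(4)])
    fix i t assume i: "i < n" and t: "t \<in> {\<tau> i..\<tau> (Suc i)}"
    have t': "t \<in> {\<tau> 0..\<tau> n}" using loop.piece_subset[OF i] t by auto
    have "framed.in_frame t (v i t) = frame.coord (x t) (u i t)" unfolding v_def by (rule in_frame_toC[OF t'])
    moreover have "cmod (frame.coord (x t) (u i t)) = 1"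
      by (rule frame.cmod_coord[OF x_V[OF t']]) (use unit_speed[OF i t] in \<open>simp add: x_def\<close>)
    ultimately show "frame.coord (x t) (u i t) = cis (\<theta> i t)" using \<theta>(2)[OF i t] by simp
  next
    show "(\<Sum>i<n. \<theta> i (\<tau> (Suc i)) - \<theta> i (\<tau> i)) + (\<Sum>i<n. exterior_angle \<sigma> g c \<gamma> n \<tau> i) = 2 * pi"
      using \<theta>(3) turn_angle(2) by simp
  qed auto
qed

lemma piece_cont: "i < n \<Longrightarrow> smooth_on V f \<Longrightarrow> continuous_on {\<tau> i..\<tau> (Suc i)} (\<lambda>t. f (x t))"
  using along_cont loop.piece_subset continuous_on_subset by blast

text \<open>The imaginary part of the logarithmic derivative of the framed velocity is the angular speed.\<close>
lemma angle_change:
  assumes i: "i < n" and \<theta>: "continuous_on {\<tau> i..\<tau> (Suc i)} \<theta>"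
    and cis: "\<And>t. t \<in> {\<tau> i..\<tau> (Suc i)} \<Longrightarrow> frame.coord (x t) (u i t) = cis (\<theta> t)"
  shows "((\<lambda>t. normal_accel g LC c \<gamma> \<tau> N i t + (u i t $ 1 * frame.w 1 (x t) + u i t $ 2 * frame.w 2 (x t)))
      has_integral (\<theta> (\<tau> (Suc i)) - \<theta> (\<tau> i))) {\<tau> i..\<tau> (Suc i)}"
proof -
  let ?I = "{\<tau> i..\<tau> (Suc i)}"
  define a where "a t = (\<chi> k. acc i t $ k + (\<Sum>p\<in>UNIV. \<Sum>q\<in>UNIV. LC c (x t) $ p $ k $ q * u i t $ p * u i t $ q))" for t
  define d where "d \<alpha> t = ginner g c (x t) (a t) (E (x t) $ \<alpha>)
     + (u i t $ 1 * ginner g c (x t) (u i t) (cov_deriv LC c 1 (\<lambda>y. E y $ \<alpha>) (x t))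
        + u i t $ 2 * ginner g c (x t) (u i t) (cov_deriv LC c 2 (\<lambda>y. E y $ \<alpha>) (x t)))" for \<alpha> t
  have dE: "((\<lambda>t. ginner g c (x t) (u i t) (E (x t) $ \<alpha>)) has_real_derivative d \<alpha> t) (at t within ?I)" if "t \<in> ?I" for \<alpha> t
    unfolding d_def a_def by (rule frame.component_derivative[OF x_deriv[OF i that] x_V_piece[OF i that] u_deriv[OF i that]])
  have dF: "((\<lambda>t. frame.coord (x t) (u i t)) has_vector_derivative Complex (d 1 t) (d 2 t)) (at t within ?I)" if t: "t \<in> ?I" for t
  proof -
    have "((\<lambda>t. of_real (ginner g c (x t) (u i t) (E (x t) $ 1)) + \<i> * of_real (ginner g c (x t) (u i t) (E (x t) $ 2)))
        has_vector_derivative of_real (d 1 t) + \<i> * of_real (d 2 t)) (at t within ?I)"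
      using dE[OF t] by (auto intro!: has_vector_derivative_add has_vector_derivative_mult_right has_vector_derivative_of_real
          simp: has_real_derivative_iff_has_vector_derivative)
    then show ?thesis by (simp add: frame.coord_def Complex_eq)
  qed
  have uc: "continuous_on ?I (\<lambda>t. u i t $ k)" "continuous_on ?I (\<lambda>t. acc i t $ k)" for k
    by (intro continuous_intros u_cont acc_cont i)+
  note smooth = patch.smooth_g_nth patch.smooth_\<Gamma>_nth frame.smooth_E_nth(2) patch.smooth_cov_deriv[OF frame.smooth_E_nth(1)]
  have dc: "continuous_on ?I (d \<alpha>)" for \<alpha>
    unfolding d_def[abs_def] ginner_expand a_def sum_2 vec_lambda_beta
    by (intro continuous_on_add continuous_on_mult uc piece_cont[OF i] smooth)
  have Fc: "continuous_on ?I (\<lambda>t. Complex (d 1 t) (d 2 t))"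
    unfolding Complex_eq by (intro continuous_intros dc)
  have F_nz: "frame.coord (x t) (u i t) \<noteq> 0" if "t \<in> ?I" for t unfolding cis[OF that] by simp
  have H: "((\<lambda>t. Complex (d 1 t) (d 2 t) / frame.coord (x t) (u i t)) has_integral (\<i> * of_real (\<theta> (\<tau> (Suc i))) - \<i> * of_real (\<theta> (\<tau> i)))) ?I"
  proof (rule has_integral_log_derivative[OF _ dF Fc F_nz])
    show "continuous_on ?I (\<lambda>t. \<i> * complex_of_real (\<theta> t))" by (intro continuous_intros \<theta>)
    show "exp (\<i> * complex_of_real (\<theta> t)) = frame.coord (x t) (u i t)" if "t \<in> ?I" for t
      unfolding cis[OF that] by (simp add: cis_conv_exp)
  qed (use \<tau>_less[OF i] in auto)
  have "((\<lambda>t. Im (Complex (d 1 t) (d 2 t) / frame.coord (x t) (u i t))) has_integral (\<theta> (\<tau> (Suc i)) - \<theta> (\<tau> i))) ?I"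
    using has_integral_Im[OF H] by simp
  moreover have "Im (Complex (d 1 t) (d 2 t) / frame.coord (x t) (u i t)) =
      normal_accel g LC c \<gamma> \<tau> N i t + (u i t $ 1 * frame.w 1 (x t) + u i t $ 2 * frame.w 2 (x t))" if t: "t \<in> ?I" for t
  proof -
    have xV: "x t \<in> V" by (rule x_V_piece[OF i t])
    have 1: "(Re (frame.coord (x t) (u i t)))\<^sup>2 + (Im (frame.coord (x t) (u i t)))\<^sup>2 = 1"
      unfolding cis[OF t] by simp
    have "Im (Complex (d 1 t) (d 2 t) / frame.coord (x t) (u i t)) =
       ginner g c (x t) (u i t) (E (x t) $ 1) * d 2 t - ginner g c (x t) (u i t) (E (x t) $ 2) * d 1 t"
      unfolding Im_divide 1 by (simp add: frame.coord_def mult.commute)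
    also have "\<dots> = ginner g c (x t) (a t) (N i t) + (u i t $ 1 * frame.w 1 (x t) + u i t $ 2 * frame.w 2 (x t))"
      unfolding d_def by (rule frame.angular_speed[OF xV on[OF i t]])
    also have "ginner g c (x t) (a t) (N i t) = normal_accel g LC c \<gamma> \<tau> N i t"
      unfolding normal_accel_def cov_accel_def a_def acc_def x_def ..
    finally show ?thesis .
  qed
  ultimately show ?thesis by (rule has_integral_eq[rotated])
qed

text \<open>The form whose exterior derivative is the integrand over \<open>D\<close>. When \<open>B\<close> is the contraction of a
  skew \<open>T\<close>, it is the connection form of the Levi-Civita connection minus \<open>T\<close>.\<close>
definition \<eta> where "\<eta> B j y = frame.w j y - frame.\<beta> (B c) j y"

lemma smooth_\<eta>: "smooth_on V (B c) \<Longrightarrow> smooth_on V (\<eta> B j)"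
  unfolding \<eta>_def[abs_def] by (intro smooth_on_diff open_V frame.smooth_w frame.smooth_\<beta>)

lemma arclength_boundary_term:
  assumes B: "smooth_on V (B c)"
    and \<theta>: "\<And>i. i < n \<Longrightarrow> continuous_on {\<tau> i..\<tau> (Suc i)} (\<theta> i)"
    and cis: "\<And>i t. i < n \<Longrightarrow> t \<in> {\<tau> i..\<tau> (Suc i)} \<Longrightarrow> frame.coord (x t) (u i t) = cis (\<theta> i t)"
  shows "arclength_integral n \<tau> (boundary_term g LC B c \<gamma> \<tau> N) =
     (\<Sum>i<n. \<theta> i (\<tau> (Suc i)) - \<theta> i (\<tau> i))
     - (\<Sum>i<n. integral {\<tau> i..\<tau> (Suc i)} (\<lambda>t. u i t $ 1 * \<eta> B 1 (x t)) + integral {\<tau> i..\<tau> (Suc i)} (\<lambda>t. u i t $ 2 * \<eta> B 2 (x t)))"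
proof -
  have "integral {\<tau> i..\<tau> (Suc i)} (boundary_term g LC B c \<gamma> \<tau> N i) = (\<theta> i (\<tau> (Suc i)) - \<theta> i (\<tau> i)) -
     (integral {\<tau> i..\<tau> (Suc i)} (\<lambda>t. u i t $ 1 * \<eta> B 1 (x t)) + integral {\<tau> i..\<tau> (Suc i)} (\<lambda>t. u i t $ 2 * \<eta> B 2 (x t)))"
    if i: "i < n" for i
  proof -
    let ?I = "{\<tau> i..\<tau> (Suc i)}"
    have int: "(\<lambda>t. u i t $ j * \<eta> B k (x t)) integrable_on ?I" for j k
      by (intro integrable_continuous_interval continuous_intros u_cont piece_cont i smooth_\<eta> B)
    have "((\<lambda>t. (normal_accel g LC c \<gamma> \<tau> N i t + (u i t $ 1 * frame.w 1 (x t) + u i t $ 2 * frame.w 2 (x t)))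
         - (u i t $ 1 * \<eta> B 1 (x t) + u i t $ 2 * \<eta> B 2 (x t))) has_integral (\<theta> i (\<tau> (Suc i)) - \<theta> i (\<tau> i)) -
     (integral ?I (\<lambda>t. u i t $ 1 * \<eta> B 1 (x t)) + integral ?I (\<lambda>t. u i t $ 2 * \<eta> B 2 (x t)))) ?I"
      by (intro has_integral_diff has_integral_add angle_change \<theta> cis i integrable_integral int)
    moreover have "(normal_accel g LC c \<gamma> \<tau> N i t + (u i t $ 1 * frame.w 1 (x t) + u i t $ 2 * frame.w 2 (x t)))
         - (u i t $ 1 * \<eta> B 1 (x t) + u i t $ 2 * \<eta> B 2 (x t)) = boundary_term g LC B c \<gamma> \<tau> N i t" if t: "t \<in> ?I" for t
      unfolding boundary_term_def x_def[symmetric] frame.normal_component_\<beta>[OF x_V_piece[OF i t] on[OF i t]]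
      by (simp add: \<eta>_def algebra_simps)
    ultimately have "((boundary_term g LC B c \<gamma> \<tau> N i) has_integral (\<theta> i (\<tau> (Suc i)) - \<theta> i (\<tau> i)) -
     (integral ?I (\<lambda>t. u i t $ 1 * \<eta> B 1 (x t)) + integral ?I (\<lambda>t. u i t $ 2 * \<eta> B 2 (x t)))) ?I"
      by (rule has_integral_eq[rotated])
    then show ?thesis by (rule integral_unique)
  qed
  then show ?thesis by (simp add: arclength_integral_def sum_subtractf)
qed

lemma interior_form_\<eta>:
  assumes B: "smooth_on V (B c)" and y: "y \<in> V"
  shows "interior_form \<sigma> g LC B c y = pd 1 (\<eta> B 2) y - pd 2 (\<eta> B 1) y"
proof -
  have d: "frame.w i differentiable (at y)" "frame.\<beta> (B c) i differentiable (at y)" for i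
    using smooth_on_differentiable[OF frame.smooth_w y] smooth_on_differentiable[OF frame.smooth_\<beta>[OF B] y] by auto
  have tf: "LC c y $ i $ k $ j = LC c y $ j $ k $ i" for i k j
    using LC c_in y by (auto simp: levi_civita_def V_def)
  show ?thesis
    unfolding interior_form_def left_diff_distrib frame.gauss_curvature_frame[OF y] frame.codiff_frame[of y B, OF y B tf]
      \<eta>_def[abs_def] by (simp add: pd_diff d)
qed

lemma C1_on_pullback:
  assumes f: "smooth_on V f"
  shows "C1_on {a. vec2 s a \<in> V} (\<lambda>a. f (vec2 s a)) (\<lambda>a. (pd 1 f (vec2 s a), s * pd 2 f (vec2 s a)))"
  unfolding C1_on_def
proof (intro conjI ballI)
  have c: "continuous_on X (vec2 s)" for X by (rule linear_continuous_on[OF bounded_linear_vec2])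
  show "continuous_on {a. vec2 s a \<in> V} (\<lambda>a. (pd 1 f (vec2 s a), s * pd 2 f (vec2 s a)))"
    by (intro continuous_intros continuous_on_compose2[OF smooth_on_continuous[OF smooth_on_pd[OF f]] c]) auto
  fix a assume "a \<in> {a. vec2 s a \<in> V}"
  then have "f differentiable (at (vec2 s a))" by (intro smooth_on_differentiable[OF f]) simp
  from has_derivative_compose[OF bounded_linear_imp_has_derivative[OF bounded_linear_vec2] has_derivative_pd[OF this]]
  show "((\<lambda>a. f (vec2 s a)) has_derivative (\<lambda>h. h \<bullet> (pd 1 f (vec2 s a), s * pd 2 f (vec2 s a)))) (at a)"
    by (simp add: inner_prod_def mult_ac)
qed

lemma region_vec2: "a \<in> loop.region \<longleftrightarrow> vec2 s a \<in> inside (x ` {\<tau> 0..\<tau> n})"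
proof -
  have "loop.region = (\<lambda>y. pt (toC s y)) ` inside (x ` {\<tau> 0..\<tau> n})"
    unfolding loop.region_def inside_z by (simp add: image_image)
  then show ?thesis using sign_inverse(3,4)[OF s_cases] by (metis (no_types, lifting) image_iff)
qed

text \<open>Green's formula for each component of \<open>\<eta>\<close>, in coordinates reflected by \<open>s\<close>. The reflection multiplies
  \<open>d\<eta>\<close> by \<open>s\<close>, which is the sign that \<open>form_integral\<close> supplies.\<close>
lemma stokes:
  assumes B: "smooth_on V (B c)"
    and ccw: "\<And>\<zeta>. \<zeta> \<in> inside (z ` {\<tau> 0..\<tau> n}) \<Longrightarrow> winding_number loop.loop \<zeta> = 1"
  shows "form_integral \<sigma> c D (interior_form \<sigma> g LC B) =
     (\<Sum>i<n. integral {\<tau> i..\<tau> (Suc i)} (\<lambda>t. u i t $ 1 * \<eta> B 1 (x t)) + integral {\<tau> i..\<tau> (Suc i)} (\<lambda>t. u i t $ 2 * \<eta> B 2 (x t)))"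
proof -
  let ?U = "{a. vec2 s a \<in> V}" and ?D = "inside (x ` {\<tau> 0..\<tau> n})"
  have ss: "s * s = 1" using s_cases by auto
  have U: "open ?U"
  proof -
    have "?U = vec2 s -` V" by auto
    then show ?thesis using open_V linear_continuous_on[OF bounded_linear_vec2] open_vimage by metis
  qed
  have subU: "pt ` (z ` {\<tau> 0..\<tau> n} \<union> inside (z ` {\<tau> 0..\<tau> n})) \<subseteq> ?U"
    using closed_domain_V unfolding inside_z unfolding image_z by (auto simp: sign_inverse[OF s_cases])
  have along: "vec2 s (pt (z t)) = x t" for t unfolding z_def by (rule sign_inverse(3)[OF s_cases])
  note G1 = loop.green(1)[OF ccw C1_on_pullback[OF smooth_\<eta>[of B, OF B, of 1]] U subU]
  note G2 = loop.green(2)[OF ccw C1_on_pullback[OF smooth_\<eta>[of B, OF B, of 2]] U subU]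
  have "has_bochner_integral lborel (\<lambda>a. s * (indicator loop.region a * pd 1 (\<eta> B 2) (vec2 s a)) - indicator loop.region a * (s * pd 2 (\<eta> B 1) (vec2 s a)))
     (s * (\<Sum>i<n. integral {\<tau> i..\<tau> (Suc i)} (\<lambda>t. s * u i t $ 2 * \<eta> B 2 (x t))) - - (\<Sum>i<n. integral {\<tau> i..\<tau> (Suc i)} (\<lambda>t. u i t $ 1 * \<eta> B 1 (x t))))"
    using has_bochner_integral_diff[OF has_bochner_integral_mult_right[OF G2, of s] G1]
    unfolding along v_def toC_sel by simp
  moreover have "(\<lambda>a. s * (indicator loop.region a * pd 1 (\<eta> B 2) (vec2 s a)) - indicator loop.region a * (s * pd 2 (\<eta> B 1) (vec2 s a)))
     = (\<lambda>a. indicator {a. vec2 s a \<in> ?D} a * (s * (pd 1 (\<eta> B 2) (vec2 s a) - pd 2 (\<eta> B 1) (vec2 s a))))"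
    using region_vec2 by (auto simp: fun_eq_iff indicator_def algebra_simps)
  moreover have "s * (\<Sum>i<n. integral {\<tau> i..\<tau> (Suc i)} (\<lambda>t. s * u i t $ 2 * \<eta> B 2 (x t))) - - (\<Sum>i<n. integral {\<tau> i..\<tau> (Suc i)} (\<lambda>t. u i t $ 1 * \<eta> B 1 (x t)))
      = (\<Sum>i<n. integral {\<tau> i..\<tau> (Suc i)} (\<lambda>t. u i t $ 1 * \<eta> B 1 (x t)) + integral {\<tau> i..\<tau> (Suc i)} (\<lambda>t. u i t $ 2 * \<eta> B 2 (x t)))"
    by (simp add: sum_distrib_left sum.distrib mult.assoc ss mult.assoc[symmetric, of s s] flip: integral_mult_right)
  ultimately have I: "has_bochner_integral lborel (\<lambda>a. indicator {a. vec2 s a \<in> ?D} a * (s * (pd 1 (\<eta> B 2) (vec2 s a) - pd 2 (\<eta> B 1) (vec2 s a))))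
      (\<Sum>i<n. integral {\<tau> i..\<tau> (Suc i)} (\<lambda>t. u i t $ 1 * \<eta> B 1 (x t)) + integral {\<tau> i..\<tau> (Suc i)} (\<lambda>t. u i t $ 2 * \<eta> B 2 (x t)))"
    by simp
  have oD: "open ?D" by (intro open_inside compact_imp_closed compact_continuous_image x_cont) auto
  have DV: "?D \<subseteq> V" using closed_domain_V by auto
  have "integral ?D (\<lambda>y. s * (pd 1 (\<eta> B 2) y - pd 2 (\<eta> B 1) y)) =
      (\<Sum>i<n. integral {\<tau> i..\<tau> (Suc i)} (\<lambda>t. u i t $ 1 * \<eta> B 1 (x t)) + integral {\<tau> i..\<tau> (Suc i)} (\<lambda>t. u i t $ 2 * \<eta> B 2 (x t)))"
  proof (rule integral_vec2[OF s_cases oD _ I])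
    show "continuous_on ?D (\<lambda>y. s * (pd 1 (\<eta> B 2) y - pd 2 (\<eta> B 1) y))"
      by (intro continuous_intros continuous_on_subset[OF smooth_on_continuous DV] smooth_on_pd smooth_\<eta> B)
  qed
  moreover have "form_integral \<sigma> c D (interior_form \<sigma> g LC B) = integral ?D (\<lambda>y. s * (pd 1 (\<eta> B 2) y - pd 2 (\<eta> B 1) y))"
    unfolding form_integral_def D_inside image_x
  proof (rule integral_cong)
    fix y assume "y \<in> ?D"
    then have y: "y \<in> V" using DV by auto
    then show "\<sigma> c y * interior_form \<sigma> g LC B c y = s * (pd 1 (\<eta> B 2) y - pd 2 (\<eta> B 1) y)"
      unfolding interior_form_\<eta>[of B, OF B y] by (simp add: V_def)
  qed
  ultimately show ?thesis by simp
qed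

theorem gauss_bonnet:
  assumes B: "smooth_on (coords c) (B c)"
  shows "form_integral \<sigma> c D (interior_form \<sigma> g LC B)
        + arclength_integral n \<tau> (boundary_term g LC B c \<gamma> \<tau> N)
        + (\<Sum>i<n. exterior_angle \<sigma> g c \<gamma> n \<tau> i) = 2 * pi"
proof -
  have BV: "smooth_on V (B c)" by (rule smooth_on_subset[OF B]) (auto simp: V_def)
  obtain \<theta> where \<theta>: "\<And>i. i < n \<Longrightarrow> continuous_on {\<tau> i..\<tau> (Suc i)} (\<theta> i)"
    "\<And>i t. i < n \<Longrightarrow> t \<in> {\<tau> i..\<tau> (Suc i)} \<Longrightarrow> frame.coord (x t) (u i t) = cis (\<theta> i t)"
    "(\<Sum>i<n. \<theta> i (\<tau> (Suc i)) - \<theta> i (\<tau> i)) + (\<Sum>i<n. exterior_angle \<sigma> g c \<gamma> n \<tau> i) = 2 * pi"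
    "\<And>\<zeta>. \<zeta> \<in> inside (z ` {\<tau> 0..\<tau> n}) \<Longrightarrow> winding_number loop.loop \<zeta> = 1"
    by (rule rotation_index) blast
  show ?thesis
    using stokes[of B, OF BV \<theta>(4)] arclength_boundary_term[of B \<theta>, OF BV \<theta>(1,2)] \<theta>(3) by simp
qed

end


section \<open>The boundary and curvature of metric connections\<close>

text \<open>The covariant derivative of the metric under \<open>\<nabla>'\<close> is the symmetrization of the lowered \<open>T\<close>.\<close>
lemma metric_connection_iff_skew:
  assumes metric: "riemannian_metric A g" and LC: "metric_connection A g \<Gamma>"
    and nabla': "is_connection A nabla'" and T: "connection_minus A \<Gamma> nabla' T"
  shows "metric_connection A g nabla' \<longleftrightarrow> skew A g T"
proof -
  have "cov_metric g nabla' c x i l j = lower g T c x $ i $ l $ j + lower g T c x $ i $ j $ l"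
    if "c \<in> A" "x \<in> coords c" for c x i l j
    by (rule cov_metric_minus[where \<Gamma> = \<Gamma>])
      (use T LC metric_at(1)[OF metric that] that in \<open>simp_all add: connection_minus_def metric_connection_def\<close>)
  then show ?thesis
    using nabla' by (simp add: metric_connection_def skew_def add_eq_0_iff2)
qed

text \<open>The claim is local and holds for every frame, in every chart, as an instance of \<open>Pf_torsion\<close>.\<close>
lemma interior_form_is_pfaffian:
  assumes surface: "oriented_surface A \<sigma>" and metric: "riemannian_metric A g" and LC: "levi_civita A g LC"
    and nabla': "metric_connection A g nabla'" and T: "connection_minus A LC nabla' T"
  shows "is_pfaffian_curvature A \<sigma> g nabla' (interior_form \<sigma> g LC (contraction T))"
  unfolding is_pfaffian_curvature_def
proof (intro ballI allI impI)
  fix c V E \<omega> x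
  assume c: "c \<in> A" and "oriented_frame \<sigma> g c V E \<and> connection_form nabla' c V E \<omega>" and x: "x \<in> V"
  then have V: "open V" "V \<subseteq> coords c" and E: "smooth_on V E"
    "\<And>x. x \<in> V \<Longrightarrow> oriented_orthonormal \<sigma> g c x (E x $ 1) (E x $ 2)" and \<omega>: "connection_form nabla' c V E \<omega>"
    by (auto simp: oriented_frame_def)
  have con: "is_connection A LC" "is_connection A nabla'"
    using LC nabla' by (auto simp: levi_civita_def metric_connection_def)
  have cov: "cov_metric g LC c x i l j = 0" "cov_metric g nabla' c x i l j = 0"
      "LC c x $ i $ k $ j = LC c x $ j $ k $ i" if "x \<in> coords c" for x i k l j
    using LC nabla' c that by (auto simp: levi_civita_def metric_connection_def)
  interpret torsion_patch g LC c V \<sigma> E nabla' T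
  proof
    show "smooth_on V (g c)" "smooth_on V (LC c)" "smooth_on V (nabla' c)"
      using metric con c V(2) by (auto simp: riemannian_metric_def is_connection_def intro: smooth_on_subset)
    fix x assume "x \<in> V"
    then have xc: "x \<in> coords c" using V(2) by auto
    show "transpose (g c x) = g c x" by (rule metric_at(1)[OF metric c xc])
    show "0 < v \<bullet> (g c x *v v)" if "v \<noteq> 0" for v by (rule metric_at(2)[OF metric c xc that])
    show "\<sigma> c x = 1 \<or> \<sigma> c x = -1"
      using surface c xc by (auto simp: oriented_surface_def orientation_def)
    show "nabla' c x = LC c x - T c x" using T c xc by (simp add: connection_minus_def)
    show "LC c x $ i $ k $ j = LC c x $ j $ k $ i" for i k j by (rule cov(3)[OF xc])
  qed (use V E cov in auto)
  show "interior_form \<sigma> g LC (contraction T) c x = Pf (curvature_form \<omega> x)"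
    by (rule Pf_torsion[OF \<omega> x])
qed

lemma (in polygon) boundary_term_eq_normal_accel:
  assumes T: "connection_minus A LC nabla' T" and skew: "skew A g T" and i: "i < n" and t: "t \<in> {\<tau> i..\<tau> (Suc i)}"
  shows "boundary_term g LC (contraction T) c \<gamma> \<tau> N i t = normal_accel g nabla' c \<gamma> \<tau> N i t"
proof -
  let ?x = "cmap c (\<gamma> t)"
  have V: "?x \<in> V" and xc: "?x \<in> coords c"
    using x_V_piece[OF i t] unfolding x_def V_def by auto
  have N: "contraction T c ?x \<bullet> N i t = - ginner g c ?x (\<chi> k. \<Sum>p\<in>UNIV. \<Sum>q\<in>UNIV. T c ?x $ p $ k $ q * u i t $ p * u i t $ q) (N i t)"
  proof (rule skew_normal_component)
    show "lower g T c ?x $ i $ k $ j = - lower g T c ?x $ i $ j $ k" for i k j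
      using skew c_in xc unfolding skew_def by blast
    show "g c ?x $ 2 $ 1 = g c ?x $ 1 $ 2" "det (g c ?x) \<noteq> 0"
      using patch.g21[OF V] patch.det_pos[OF V] by simp_all
    show "ginner g c ?x (u i t) (u i t) = 1" "ginner g c ?x (u i t) (N i t) = 0"
      using on[OF i t] unfolding x_def oriented_orthonormal_def by auto
  qed
  have "cov_accel nabla' c \<gamma> \<tau> i t = cov_accel LC c \<gamma> \<tau> i t - (\<chi> k. \<Sum>p\<in>UNIV. \<Sum>q\<in>UNIV. T c ?x $ p $ k $ q * u i t $ p * u i t $ q)"
    using T c_in xc by (simp add: connection_minus_def cov_accel_def vec_eq_iff sum_subtractf left_diff_distrib)
  then show ?thesis
    unfolding boundary_term_def normal_accel_def N by (simp add: ginner_def inner_diff_left)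
qed

theorem proposition5p2:
  fixes A :: "'a::{t2_space,second_countable_topology} chart set"
    and \<sigma> :: "'a chart \<Rightarrow> real^2 \<Rightarrow> real"
    and g :: "'a metric_field" and LC :: "'a connection_field"
    and c :: "'a chart" and \<gamma> :: "real \<Rightarrow> 'a" and n :: nat and \<tau> :: "nat \<Rightarrow> real"
    and D :: "'a set" and N :: "nat \<Rightarrow> real \<Rightarrow> real^2"
  assumes surface: "oriented_surface A \<sigma>"
    and metric: "riemannian_metric A g"
    and LC: "levi_civita A g LC"
    and polygon: "positively_oriented_polygon A \<sigma> g c \<gamma> n \<tau> D N"
  shows
    "(\<forall>B. one_form A B \<longrightarrow>
        form_integral \<sigma> c D (interior_form \<sigma> g LC B)
        + arclength_integral n \<tau> (boundary_term g LC B c \<gamma> \<tau> N)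
        + (\<Sum>i<n. exterior_angle \<sigma> g c \<gamma> n \<tau> i) = 2 * pi) \<and>
     (\<forall>nabla' T. is_connection A nabla' \<and> connection_minus A LC nabla' T \<longrightarrow>
        (metric_connection A g nabla' \<longleftrightarrow> skew A g T) \<and>
        (metric_connection A g nabla' \<longrightarrow>
           is_pfaffian_curvature A \<sigma> g nabla' (interior_form \<sigma> g LC (contraction T)) \<and>
           (\<forall>i<n. \<forall>t\<in>{\<tau> i..\<tau> (Suc i)}.
              boundary_term g LC (contraction T) c \<gamma> \<tau> N i t = normal_accel g nabla' c \<gamma> \<tau> N i t))) \<and>
     (\<forall>nabla S. is_connection A nabla \<and> connection_minus A LC nabla S \<longrightarrow>
        connection_minus A LC (assoc_connection g nabla) (skew_part g S) \<and>
        metric_connection A g (assoc_connection g nabla) \<and>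
        form_integral \<sigma> c D (interior_form \<sigma> g LC (contraction (skew_part g S)))
        + arclength_integral n \<tau> (boundary_term g LC (contraction (skew_part g S)) c \<gamma> \<tau> N)
        + (\<Sum>i<n. exterior_angle \<sigma> g c \<gamma> n \<tau> i) = 2 * pi \<and>
        is_pfaffian_curvature A \<sigma> g (assoc_connection g nabla)
          (interior_form \<sigma> g LC (contraction (skew_part g S))) \<and>
        (\<forall>i<n. \<forall>t\<in>{\<tau> i..\<tau> (Suc i)}.
           boundary_term g LC (contraction (skew_part g S)) c \<gamma> \<tau> N i t
           = normal_accel g (assoc_connection g nabla) c \<gamma> \<tau> N i t))"
proof -
  interpret P: polygon A \<sigma> g LC c \<gamma> n \<tau> D N
    by (rule polygon.intro[OF surface metric LC polygon])
  have LC': "metric_connection A g LC" using LC by (simp add: levi_civita_def)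
  show ?thesis
  proof (intro conjI allI impI ballI)
    fix B assume "one_form A B"
    then show "form_integral \<sigma> c D (interior_form \<sigma> g LC B)
        + arclength_integral n \<tau> (boundary_term g LC B c \<gamma> \<tau> N)
        + (\<Sum>i<n. exterior_angle \<sigma> g c \<gamma> n \<tau> i) = 2 * pi"
      by (intro P.gauss_bonnet) (simp add: one_form_def P.c_in)
  next
    fix nabla' T assume *: "is_connection A nabla' \<and> connection_minus A LC nabla' T"
    note iff = metric_connection_iff_skew[OF metric LC' conjunct1[OF *] conjunct2[OF *]]
    show "metric_connection A g nabla' \<longleftrightarrow> skew A g T" by (rule iff)
    assume m: "metric_connection A g nabla'"
    show "is_pfaffian_curvature A \<sigma> g nabla' (interior_form \<sigma> g LC (contraction T))"
      by (rule interior_form_is_pfaffian[OF surface metric LC m conjunct2[OF *]])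
    show "boundary_term g LC (contraction T) c \<gamma> \<tau> N i t = normal_accel g nabla' c \<gamma> \<tau> N i t"
      if "i < n" "t \<in> {\<tau> i..\<tau> (Suc i)}" for i t
      by (rule P.boundary_term_eq_normal_accel[OF conjunct2[OF *] iffD1[OF iff m] that])
  next
    fix nabla S assume *: "is_connection A nabla \<and> connection_minus A LC nabla S"
    have con: "is_connection A LC" and cov: "\<And>c x i l j. c \<in> A \<Longrightarrow> x \<in> coords c \<Longrightarrow> cov_metric g LC c x i l j = 0"
      using LC' by (auto simp: metric_connection_def)
    have struct: "smooth_structure A" using surface by (simp add: oriented_surface_def)
    note assoc = assoc_connection_is_connection[OF struct metric con cov conjunct1[OF *] conjunct2[OF *]]
    show minus: "connection_minus A LC (assoc_connection g nabla) (skew_part g S)"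
      by (rule assoc(1))
    have inv: "det (g c x) \<noteq> 0" if "c \<in> A" "x \<in> coords c" for c x
      using positive_definite_2(3)[of "g c x"] metric_at[OF metric that] by auto
    have skew: "skew A g (skew_part g S)"
      unfolding skew_def
      by (intro ballI allI skew_part_skew) (auto simp: metric_at(1)[OF metric] invertible_det_nz inv)
    show m: "metric_connection A g (assoc_connection g nabla)"
      using metric_connection_iff_skew[OF metric LC' assoc(2) minus] skew by simp
    have "smooth_on (coords c) (skew_part g S c)"
    proof (rule smooth_skew_part[OF P.open_coords])
      show "smooth_on (coords c) (g c)" using metric P.c_in by (simp add: riemannian_metric_def)
    qed (use assoc(3) inv P.c_in in auto)
    then have "smooth_on (coords c) (contraction (skew_part g S) c)"
      unfolding contraction_def[abs_def]
      by (intro smooth_on_vec smooth_on_sum smooth_on_nth P.open_coords)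
    then show "form_integral \<sigma> c D (interior_form \<sigma> g LC (contraction (skew_part g S)))
        + arclength_integral n \<tau> (boundary_term g LC (contraction (skew_part g S)) c \<gamma> \<tau> N)
        + (\<Sum>i<n. exterior_angle \<sigma> g c \<gamma> n \<tau> i) = 2 * pi"
      by (rule P.gauss_bonnet)
    show "is_pfaffian_curvature A \<sigma> g (assoc_connection g nabla) (interior_form \<sigma> g LC (contraction (skew_part g S)))"
      by (rule interior_form_is_pfaffian[OF surface metric LC m minus])
    show "boundary_term g LC (contraction (skew_part g S)) c \<gamma> \<tau> N i t
           = normal_accel g (assoc_connection g nabla) c \<gamma> \<tau> N i t"
      if "i < n" "t \<in> {\<tau> i..\<tau> (Suc i)}" for i t
      by (rule P.boundary_term_eq_normal_accel[OF minus skew that])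
  qed
qed

end
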